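(* Let $n > 1$ be an integer and let $M = (m_{j,k})$ be an $n \times n$ quartic sign matrix, i.e. a complex matrix with $0$'s along the diagonal and fourth roots of unity off the diagonal. Then the following are equivalent: (a) There exists an integer $s$ with $1 \le s \le n$ such that $M$ can be conjugated by a permutation matrix into a block matrix of the form $$\begin{pmatrix} A & B \\ B^t & S \end{pmatrix}$$ where $A$ is an $s \times s$ skew-symmetric quartic sign matrix, $S$ is an $(n-s)\times(n-s)$ symmetric quartic sign matrix, and $B$ is an $s \times (n-s)$ matrix all of whose entries are $\pm 1$ or $\pm i$; here $B^t$ denotes the transpose of $B$. (b) There exist distinct prime ideals $\mathfrak{p}_1, \mathfrak{p}_2, \dots, \mathfrak{p}_n$ of $\mathbb{Q}(i)$, none dividing $2$, such that $M$ is the quartic residue matrix associated to $\mathfrak{p}_1, \dots, \mathfrak{p}_n$. (c) We have $m_{j,k} = \pm m_{k,j}$ for all $j,k$ with $1 \le j,k \le n$, and there exists an integer $s$ with $1 \le s \le n$ such that the diagonal entries of $M\overline{M}$ consist of $s$ occurrences of $n+1-2s$ and $n-s$ occurrences of $n-1$, where $\overline{M}$ is the entrywise complex conjugate of $M$.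
   Context: Here $i = \sqrt{-1}$, and "fourth root of unity" means any of $\pm 1, \pm i$. A quartic sign matrix is a square complex matrix whose diagonal entries are all $0$ and whose off-diagonal entries are all fourth roots of unity. Skew-symmetric means $A^t = -A$ (transpose without conjugation), and symmetric means $S^t = S$. Prime ideals of $\mathbb{Q}(i)$ means nonzero prime ideals of its ring of integers $\mathbb{Z}[i]$. Every prime ideal $\mathfrak{p}$ of $\mathbb{Q}(i)$ not dividing $2$ has a unique generator $\pi$ with $\pi \equiv 1 \pmod{2(1+i)}$, called its 2-primary generator. For distinct prime ideals $\mathfrak{p}_j, \mathfrak{p}_k$ not dividing $2$ with 2-primary generators $\pi_j, \pi_k$, the quartic residue symbol $\left(\frac{\pi_j}{\pi_k}\right)_4$ is the unique fourth root of unity with $$\left(\frac{\pi_j}{\pi_k}\right)_4 \equiv \pi_j^{(N\pi_k - 1)/4} \pmod{(\pi_k)},$$ where $N$ denotes the norm from $\mathbb{Q}(i)$ to $\mathbb{Q}$; also $\left(\frac{\pi_j}{\pi_j}\right)_4 = 0$. The quartic residue matrix associated to distinct prime ideals $\mathfrak{p}_1, \dots, \mathfrak{p}_n$ of $\mathbb{Q}(i)$ not dividing $2$ is the $n \times n$ matrix whose $(j,k)$-entry is $\left(\frac{\pi_j}{\pi_k}\right)_4$, where $\pi_l$ is the 2-primary generator of $\mathfrak{p}_l$ for $1 \le l \le n$. When $s = n$, the blocks $B$, $B^t$ and $S$ are empty. In (c), the sign in $m_{j,k} = \pm m_{k,j}$ may depend on $(j,k)$, and the diagonal entries are counted with multiplicity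 (as a multiset of size $n$); the two values $n+1-2s$ and $n-1$ coincide when $s=1$, in which case the condition says that all $n$ diagonal entries equal $n-1$. *)

theory Defs
  imports
    Complex_Main
    "HOL-Combinatorics.Permutations"
    "HOL-Library.Multiset"
    "HOL-Algebra.Ideal_Product"
    "Jordan_Normal_Form.Matrix"
begin

section \<open>Quartic sign matrices\<close>

definition fourth_roots :: "complex set" where
  "fourth_roots = {1, -1, \<i>, -\<i>}"

definition quartic_sign_mat :: "nat \<Rightarrow> complex mat \<Rightarrow> bool" where
  "quartic_sign_mat n A \<longleftrightarrow> A \<in> carrier_mat n n \<and>
     (\<forall>j<n. A $$ (j, j) = 0) \<and>
     (\<forall>j<n. \<forall>k<n. j \<noteq> k \<longrightarrow> A $$ (j, k) \<in> fourth_roots)"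

definition skew_symmetric_mat :: "complex mat \<Rightarrow> bool" where
  "skew_symmetric_mat A \<longleftrightarrow> transpose_mat A = - A"

definition symmetric_mat :: "complex mat \<Rightarrow> bool" where
  "symmetric_mat A \<longleftrightarrow> transpose_mat A = A"

definition permutation_mat :: "nat \<Rightarrow> complex mat \<Rightarrow> bool" where
  "permutation_mat n P \<longleftrightarrow>
     (\<exists>\<sigma>. \<sigma> permutes {..<n} \<and> P = mat n n (\<lambda>(j, k). if k = \<sigma> j then 1 else 0))"

text \<open>\<^term>\<open>similar_mat_wit N M P Q\<close> says that \<^term>\<open>N = P * M * Q\<close>, where
  \<^term>\<open>Q\<close> is the two-sided inverse of \<^term>\<open>P\<close>.\<close>

definition perm_conjugate :: "nat \<Rightarrow> complex mat \<Rightarrow> complex mat \<Rightarrow> bool" where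
  "perm_conjugate n M N \<longleftrightarrow> (\<exists>P Q. permutation_mat n P \<and> similar_mat_wit N M P Q)"

definition skew_symmetric_block_form :: "nat \<Rightarrow> complex mat \<Rightarrow> bool" where
  "skew_symmetric_block_form n M \<longleftrightarrow>
     (\<exists>s A B S. 1 \<le> s \<and> s \<le> n \<and>
        quartic_sign_mat s A \<and> skew_symmetric_mat A \<and>
        quartic_sign_mat (n - s) S \<and> symmetric_mat S \<and>
        B \<in> carrier_mat s (n - s) \<and> elements_mat B \<subseteq> fourth_roots \<and>
        perm_conjugate n M (four_block_mat A B (transpose_mat B) S))"

text \<open>The prescribed diagonal values are computed in the integers because
  \<^term>\<open>n + 1 - 2 * s\<close> may be negative.\<close>

definition diagonal_condition :: "nat \<Rightarrow> complex mat \<Rightarrow> bool" where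
  "diagonal_condition n M \<longleftrightarrow>
     (\<forall>j<n. \<forall>k<n. M $$ (j, k) = M $$ (k, j) \<or> M $$ (j, k) = - (M $$ (k, j))) \<and>
     (\<exists>s. 1 \<le> s \<and> s \<le> n \<and>
        mset (diag_mat (M * map_mat cnj M)) =
          replicate_mset s (of_int (int n + 1 - 2 * int s)) +
          replicate_mset (n - s) (of_int (int n - 1)))"


section \<open>The ring of Gaussian integers and its prime ideals\<close>

definition gauss_int_ring :: "complex ring" where
  "gauss_int_ring =
     \<lparr>carrier = {z. Re z \<in> \<int> \<and> Im z \<in> \<int>}, monoid.mult = (*), one = 1, zero = 0, add = (+)\<rparr>"

lemma cring_gauss_int_ring: "cring gauss_int_ring"
proof (intro cringI abelian_groupI comm_monoidI)
  fix x assume "x \<in> carrier gauss_int_ring"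
  then show "\<exists>y\<in>carrier gauss_int_ring. y \<oplus>\<^bsub>gauss_int_ring\<^esub> x = \<zero>\<^bsub>gauss_int_ring\<^esub>"
    by (intro bexI[of _ "- x"]) (auto simp: gauss_int_ring_def)
qed (auto simp: gauss_int_ring_def algebra_simps)

definition ideal_divides :: "complex set \<Rightarrow> complex set \<Rightarrow> bool" where
  "ideal_divides I J \<longleftrightarrow>
     (\<exists>K. ideal K gauss_int_ring \<and> J = ideal_prod gauss_int_ring I K)"

definition gauss_prime_ideal :: "complex set \<Rightarrow> bool" where
  "gauss_prime_ideal \<pp> \<longleftrightarrow> primeideal \<pp> gauss_int_ring \<and> \<pp> \<noteq> {0}"

definition odd_prime_ideal :: "complex set \<Rightarrow> bool" where
  "odd_prime_ideal \<pp> \<longleftrightarrow>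
     gauss_prime_ideal \<pp> \<and> \<not> ideal_divides \<pp> (PIdl\<^bsub>gauss_int_ring\<^esub> 2)"

definition gauss_cong :: "complex \<Rightarrow> complex \<Rightarrow> complex \<Rightarrow> bool" where
  "gauss_cong \<alpha> \<beta> \<gamma> \<longleftrightarrow> \<alpha> - \<beta> \<in> PIdl\<^bsub>gauss_int_ring\<^esub> \<gamma>"

definition primary_generator :: "complex set \<Rightarrow> complex" where
  "primary_generator \<pp> =
     (THE \<pi>. \<pi> \<in> carrier gauss_int_ring \<and> PIdl\<^bsub>gauss_int_ring\<^esub> \<pi> = \<pp> \<and>
             gauss_cong \<pi> 1 (2 * (1 + \<i>)))"


section \<open>Quartic residue symbols and matrices\<close>

text \<open>On Gaussian integers the norm is a natural number, so \<^const>\<open>floor\<close> and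
  \<^const>\<open>nat\<close> only convert its type.\<close>

definition gauss_norm :: "complex \<Rightarrow> nat" where
  "gauss_norm z = nat \<lfloor>Re (z * cnj z)\<rfloor>"

text \<open>The symbol is meaningful for 2-primary generators \<^term>\<open>\<alpha>\<close>, \<^term>\<open>\<beta>\<close> of
  prime ideals not dividing 2; then \<^term>\<open>gauss_norm \<beta> - 1\<close> is divisible by 4.\<close>

definition quartic_symbol :: "complex \<Rightarrow> complex \<Rightarrow> complex" where
  "quartic_symbol \<alpha> \<beta> =
     (if \<alpha> = \<beta> then 0
      else (THE \<zeta>. \<zeta> \<in> fourth_roots \<and> gauss_cong \<zeta> (\<alpha> ^ ((gauss_norm \<beta> - 1) div 4)) \<beta>))"

definition quartic_residue_mat :: "nat \<Rightarrow> (nat \<Rightarrow> complex set) \<Rightarrow> complex mat" where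
  "quartic_residue_mat n \<pp> =
     mat n n (\<lambda>(j, k). quartic_symbol (primary_generator (\<pp> j)) (primary_generator (\<pp> k)))"

definition is_quartic_residue_mat :: "nat \<Rightarrow> complex mat \<Rightarrow> bool" where
  "is_quartic_residue_mat n M \<longleftrightarrow>
     (\<exists>\<pp>. inj_on \<pp> {..<n} \<and> (\<forall>j<n. odd_prime_ideal (\<pp> j)) \<and> M = quartic_residue_mat n \<pp>)"

end

theory Submission
  imports Defs "HOL-Complex_Analysis.Complex_Analysis" "HOL-Number_Theory.Number_Theory" "HOL-Real_Asymp.Real_Asymp"
begin

text \<open>Each of the three conditions says that there is a set \<open>T\<close> of indices with
  \<open>m_jk = - m_kj\<close> for distinct \<open>j, k\<close> in \<open>T\<close> and \<open>m_jk = m_kj\<close> for all other pairs. In (a), \<open>T\<close> is the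
  index set of the skew-symmetric block. In (c), the \<open>j\<close>-th diagonal entry is \<open>n - 1\<close> minus twice the
  number of \<open>k\<close> with \<open>m_jk = - m_kj \<noteq> 0\<close>; the prescribed values force these graph degrees to be
  \<open>s - 1\<close> on \<open>s\<close> vertices and 0 elsewhere, so that the graph is a clique \<open>T\<close> with isolated vertices.
  In (b), quartic reciprocity gives the pattern with \<open>T\<close> the set of those \<open>j\<close> with
  \<open>\<pi>_j \<equiv> 3 + 2i\<close> modulo 4; conversely, primes with prescribed symbols and residues modulo 4 are chosen
  one after the other, and reciprocity determines the entries on the other side of the diagonal.

  Reciprocity is reduced to the case of one rational entry, which is obtained from the fourth power
  of the quartic Gauss sum. The primes come from Dirichlet's theorem for characters of the Gaussian
  integers with values in the fourth roots of unity; \<open>L(1, \<xi>) \<noteq> 0\<close> follows from Landau's theorem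
  applied to \<open>\<zeta>\<^sup>2 L(s, \<xi>) L(s, cnj \<xi>)\<close>, whose logarithmic derivative has coefficients of constant
  sign.\<close>

section \<open>Gaussian integers\<close>

text \<open>A type of its own provides Euclidean division and unique factorization; ideals are
  related to it only near the end, through normalized generators. A Gauss sum over residues modulo a
  rational prime only sees a symbol restricted to rational integers, whence the detour through one
  rational entry. For two split primes the bridge is \<open>A = Re (cnj \<pi> * \<theta>)\<close>,
  congruent to \<open>Re \<theta> * \<pi>\<close> modulo \<open>\<theta>\<close> and to
  \<open>Re \<pi> * \<theta>\<close> modulo \<open>\<pi>\<close>: beside the two symbols in question
  only those of rational integers occur, and \<open>A\<close> modulo 8 yields the sign of the law. A
  character of order 4 is not real, so a zero of its \<open>L\<close>-function at 1 comes with one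
  of the conjugate function, and the two cancel the double pole of the squared zeta function. The
  contradiction arises at the point 1/4, where fourth prime powers weigh \<open>1 / N(p)\<close> and
  fourth powers of character values are 0 or 1. The series must therefore be continued beyond
  \<open>Re s = 1 / 2\<close>, which dictates second differences instead of first ones. Zeta itself,
  having a pole, is reached through an alternating series.\<close>

datatype gint = Gint (gre: int) (gim: int)

lemma gint_eq_iff: "a = b \<longleftrightarrow> gre a = gre b \<and> gim a = gim b"
  by (cases a; cases b) auto

instantiation gint :: comm_ring_1
begin

definition "0 = Gint 0 0"
definition "1 = Gint 1 0"
definition "a + b = Gint (gre a + gre b) (gim a + gim b)"
definition "a - b = Gint (gre a - gre b) (gim a - gim b)"
definition "- a = Gint (- gre a) (- gim a)"
definition "a * b = Gint (gre a * gre b - gim a * gim b) (gre a * gim b + gim a * gre b)"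

instance
  by standard
    (auto simp: zero_gint_def one_gint_def plus_gint_def minus_gint_def uminus_gint_def
      times_gint_def algebra_simps gint_eq_iff)

end

lemma gint_sel [simp]:
  "gre 0 = 0" "gim 0 = 0" "gre 1 = 1" "gim 1 = 0"
  "gre (a + b) = gre a + gre b" "gim (a + b) = gim a + gim b"
  "gre (a - b) = gre a - gre b" "gim (a - b) = gim a - gim b"
  "gre (- a) = - gre a" "gim (- a) = - gim a"
  "gre (a * b) = gre a * gre b - gim a * gim b"
  "gim (a * b) = gre a * gim b + gim a * gre b"
  by (simp_all add: zero_gint_def one_gint_def plus_gint_def minus_gint_def uminus_gint_def
      times_gint_def)

lemma gint_of_nat [simp]: "gre (of_nat n) = int n" "gim (of_nat n) = 0"
  by (induction n) auto

lemma gint_of_int [simp]: "gre (of_int n) = n" "gim (of_int n) = 0"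
  by (cases n; simp)+

lemma gint_numeral [simp]: "gre (numeral n) = numeral n" "gim (numeral n) = 0"
  using gint_of_nat[of "numeral n"] by simp_all

instance gint :: ring_char_0
  by standard (auto simp: inj_on_def gint_eq_iff)

definition gi :: gint where "gi = Gint 0 1"

lemma gi_sel [simp]: "gre gi = 0" "gim gi = 1"
  by (simp_all add: gi_def)

lemma gi_sq [simp]: "gi * gi = -1" "gi\<^sup>2 = -1" "gi ^ 4 = 1"
  by (simp_all add: gint_eq_iff power2_eq_square power4_eq_xxxx)

definition gcnj :: "gint \<Rightarrow> gint" where "gcnj a = Gint (gre a) (- gim a)"

lemma gcnj_sel [simp]: "gre (gcnj a) = gre a" "gim (gcnj a) = - gim a"
  by (simp_all add: gcnj_def)

lemma gcnj_simps [simp]: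
  "gcnj 0 = 0" "gcnj 1 = 1" "gcnj (a + b) = gcnj a + gcnj b" "gcnj (a - b) = gcnj a - gcnj b"
  "gcnj (- a) = - gcnj a" "gcnj (a * b) = gcnj a * gcnj b" "gcnj (gcnj a) = a" "gcnj gi = - gi"
  "gcnj (of_int n) = of_int n" "gcnj (of_nat k) = of_nat k"
  by (simp_all add: gint_eq_iff)

lemma gcnj_power [simp]: "gcnj (a ^ n) = gcnj a ^ n"
  by (induction n) auto

lemma gcnj_dvd [simp]: "gcnj a dvd gcnj b \<longleftrightarrow> a dvd b"
  by (metis dvdE dvdI gcnj_simps(6,7))

definition gnorm :: "gint \<Rightarrow> int" where "gnorm a = (gre a)\<^sup>2 + (gim a)\<^sup>2"

lemma gnorm_mult: "gnorm (a * b) = gnorm a * gnorm b"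
  by (simp add: gnorm_def algebra_simps power2_eq_square)

lemma gnorm_power: "gnorm (a ^ n) = gnorm a ^ n"
  by (induction n) (auto simp: gnorm_mult, simp add: gnorm_def)

lemma gnorm_nonneg [simp]: "gnorm a \<ge> 0"
  by (simp add: gnorm_def)

lemma gnorm_eq_0 [simp]: "gnorm a = 0 \<longleftrightarrow> a = 0"
  by (simp add: gnorm_def gint_eq_iff)

lemma gnorm_0 [simp]: "gnorm 0 = 0" and gnorm_1 [simp]: "gnorm 1 = 1"
  by (simp_all add: gnorm_def)

lemma gnorm_pos [simp]: "gnorm a > 0 \<longleftrightarrow> a \<noteq> 0"
  using gnorm_nonneg[of a] gnorm_eq_0[of a] by linarith

lemma gnorm_of_int: "gnorm (of_int n) = n\<^sup>2"
  by (simp add: gnorm_def)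

lemma gnorm_of_nat: "gnorm (of_nat n) = (int n)\<^sup>2"
  by (simp add: gnorm_def)

lemma gnorm_uminus [simp]: "gnorm (- a) = gnorm a"
  by (simp add: gnorm_def)

lemma gnorm_gcnj [simp]: "gnorm (gcnj a) = gnorm a"
  by (simp add: gnorm_def)

lemma mult_gcnj: "a * gcnj a = of_int (gnorm a)"
  by (simp add: gint_eq_iff gnorm_def power2_eq_square)

lemma gnorm_dvd: "a dvd b \<Longrightarrow> gnorm a dvd gnorm b"
  by (auto simp: gnorm_mult)

lemma dvd_gnorm: "a dvd of_int (gnorm a)"
  by (metis dvd_triv_left mult_gcnj)

lemma of_int_dvd_gint_iff: "of_int n dvd a \<longleftrightarrow> n dvd gre a \<and> n dvd gim a"
proof safe
  assume "n dvd gre a" "n dvd gim a"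
  then obtain x y where "gre a = n * x" "gim a = n * y" by (auto elim!: dvdE)
  then have "a = of_int n * Gint x y" by (simp add: gint_eq_iff)
  then show "of_int n dvd a" by simp
qed (auto elim!: dvdE)

instance gint :: idom
proof
  fix a b :: gint
  assume "a \<noteq> 0" "b \<noteq> 0"
  then have "gnorm (a * b) \<noteq> 0" by (simp add: gnorm_mult)
  then show "a * b \<noteq> 0" by force
qed

definition godd :: "gint \<Rightarrow> bool" where "godd a \<longleftrightarrow> odd (gre a + gim a)"

lemma godd_mult: "godd (a * b) \<longleftrightarrow> godd a \<and> godd b"
  by (auto simp: godd_def)

lemma godd_1 [simp]: "godd 1" and godd_0 [simp]: "\<not> godd 0" and godd_gi [simp]: "godd gi"
  by (auto simp: godd_def)

lemma gunit_iff: "a dvd 1 \<longleftrightarrow> a \<in> {1, -1, gi, -gi}" (is "_ \<longleftrightarrow> a \<in> ?U")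
proof
  assume "a dvd 1"
  then have "gnorm a = 1"
    using gnorm_dvd[of a 1] by (simp add: zdvd1_eq)
  then have 1: "(gre a)\<^sup>2 + (gim a)\<^sup>2 = 1" by (simp add: gnorm_def)
  then have "(gre a)\<^sup>2 \<le> 1\<^sup>2" "(gim a)\<^sup>2 \<le> 1\<^sup>2"
    using zero_le_power2[of "gre a"] zero_le_power2[of "gim a"] unfolding one_power2 by linarith+
  then have "\<bar>gre a\<bar> \<le> 1" "\<bar>gim a\<bar> \<le> 1"
    by (simp_all only: abs_le_square_iff[symmetric] abs_one)
  then have "gre a \<in> {-1, 0, 1}" "gim a \<in> {-1, 0, 1}" by auto
  with 1 show "a \<in> ?U" by (auto simp: gint_eq_iff)
next
  assume "a \<in> ?U"
  then show "a dvd 1"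
    by (auto intro: dvdI[of _ _ 1] dvdI[of _ _ "-1"] dvdI[of _ _ gi] dvdI[of _ _ "-gi"])
qed

text \<open>The unit factor is chosen such that the normalized odd elements are exactly the 2-primary
  ones; on the multiples of \<open>1 + i\<close> the choice (first quadrant) is immaterial.\<close>

definition guf :: "gint \<Rightarrow> gint" where
  "guf a =
     (if godd a then
        if even (gim a) then (if (gre a + gim a) mod 4 = 1 then 1 else -1)
        else (if (gim a - gre a) mod 4 = 1 then gi else -gi)
      else if a = 0 then 0
      else if gre a > 0 \<and> gim a \<ge> 0 then 1
      else if gre a \<le> 0 \<and> gim a > 0 then gi
      else if gre a < 0 \<and> gim a \<le> 0 then -1 else -gi)"

lemma guf_0 [simp]: "guf 0 = 0"
  by (simp add: guf_def)

lemma guf_gi: "guf (gi * a) = gi * guf a"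
proof (cases "godd a")
  case True
  then have o: "odd (gre a + gim a)" "odd (gre a - gim a)" "odd (gim a - gre a)"
    by (auto simp: godd_def)
  have "(gre a - - gim a) mod 4 = (gre a + gim a) mod 4" by simp
  have **: "x mod 4 = 1 \<or> x mod 4 = 3" if "odd x" for x :: int
    using that by presburger
  have *: "(- gim a + gre a) mod 4 = 1 \<longleftrightarrow> (gim a - gre a) mod 4 \<noteq> 1"
    using o by presburger
  show ?thesis
    using True o * by (auto simp: guf_def godd_def gint_eq_iff algebra_simps)
next
  case False
  then have o: "\<not> godd (gi * a)" by (simp add: godd_mult)
  consider "a = 0" | "gre a > 0" "gim a \<ge> 0" | "gre a \<le> 0" "gim a > 0" | "gre a < 0" "gim a \<le> 0"
    | "gre a \<ge> 0" "gim a < 0"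
    unfolding gint_eq_iff gint_sel by linarith
  then show ?thesis
    by cases (use False o in \<open>simp_all add: guf_def gint_eq_iff\<close>)
qed

lemma guf_uminus: "guf (- a) = - guf a"
proof -
  have "guf (- a) = guf (gi * (gi * a))" by (simp flip: mult.assoc)
  also have "\<dots> = - guf a" by (simp only: guf_gi) (simp flip: mult.assoc)
  finally show ?thesis .
qed

lemma guf_unit: "a \<noteq> 0 \<Longrightarrow> guf a dvd 1"
  unfolding gunit_iff by (auto simp: guf_def)

lemma guf_1: "guf 1 = 1"
  by (simp add: guf_def)

lemma guf_mult_unit:
  assumes "a dvd 1"
  shows "guf (a * b) = a * guf b"
proof -
  have "guf (- gi * b) = - gi * guf b"
    using guf_uminus[of "gi * b"] guf_gi[of b] by simp
  then show ?thesis using assms unfolding gunit_iff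
    by (auto simp: guf_gi guf_uminus)
qed

lemma gunit_gcnj: "u dvd 1 \<Longrightarrow> u * gcnj u = (1 :: gint)"
  unfolding gunit_iff by auto

text \<open>The nearest integer to \<open>x / n\<close>, as the floor of
  \<open>x / n + 1 / 2\<close>. Rounding to the nearest integer, not down, is what makes the
  remainder smaller than the divisor.\<close>

definition round_div :: "int \<Rightarrow> int \<Rightarrow> int" where "round_div x n = (2 * x + n) div (2 * n)"

lemma round_div_bound:
  assumes "n > 0"
  shows "\<bar>2 * (x - round_div x n * n)\<bar> \<le> n"
proof -
  define q where "q = round_div x n"
  have "(2 * x + n) = q * (2 * n) + (2 * x + n) mod (2 * n)"
    unfolding q_def round_div_def by (rule div_mult_mod_eq[symmetric])
  moreover have "0 \<le> (2 * x + n) mod (2 * n)" "(2 * x + n) mod (2 * n) < 2 * n"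
    using assms by simp_all
  ultimately have "- n \<le> 2 * (x - q * n)" "2 * (x - q * n) \<le> n"
    by (simp_all add: algebra_simps)
  then show ?thesis unfolding q_def by linarith
qed

lemma round_div_exact: "n > 0 \<Longrightarrow> round_div (a * n) n = a"
  unfolding round_div_def
  by (rule div_pos_pos_trivial[THEN subst[where P = "\<lambda>z. _"]] int_div_pos_eq[where r = n])
    (auto simp: algebra_simps)

instantiation gint :: normalization_euclidean_semiring
begin

definition "a div b = Gint (round_div (gre (a * gcnj b)) (gnorm b)) (round_div (gim (a * gcnj b)) (gnorm b))"
definition "a mod b = a - a div b * (b :: gint)"
definition "euclidean_size a = nat (gnorm a)"
definition "unit_factor a = guf a"
definition "normalize a = gcnj (guf a) * a"

text \<open>Times \<open>gcnj b\<close>, the remainder is the rounding error in both coordinates of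
  \<open>a * gcnj b\<close>, each at most half of \<open>gnorm b\<close>; hence
  \<open>2 * gnorm (a mod b) \<le> gnorm b\<close>.\<close>

lemma gint_mod_norm:
  fixes a b :: gint
  assumes "b \<noteq> 0"
  shows "gnorm (a mod b) < gnorm b"
proof -
  define n where "n = gnorm b"
  have n: "n > 0" using assms by (simp add: n_def)
  define z where "z = a * gcnj b - a div b * of_int n"
  have z: "\<bar>2 * gre z\<bar> \<le> n" "\<bar>2 * gim z\<bar> \<le> n"
    using round_div_bound[OF n, of "gre (a * gcnj b)"] round_div_bound[OF n, of "gim (a * gcnj b)"]
    by (simp_all add: z_def divide_gint_def n_def algebra_simps)
  have "a mod b * gcnj b = a * gcnj b - a div b * (b * gcnj b)"
    by (simp add: modulo_gint_def algebra_simps)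
  then have "a mod b * gcnj b = z"
    by (simp add: z_def n_def mult_gcnj)
  then have "gnorm (a mod b) * n = (gre z)\<^sup>2 + (gim z)\<^sup>2"
    by (metis gnorm_def gnorm_gcnj gnorm_mult n_def)
  moreover have "(2 * gre z)\<^sup>2 \<le> n\<^sup>2" "(2 * gim z)\<^sup>2 \<le> n\<^sup>2"
    using z n unfolding abs_le_square_iff[symmetric] by simp_all
  ultimately have "2 * (gnorm (a mod b) * n) \<le> n * n"
    by (simp add: power2_eq_square)
  then have "2 * gnorm (a mod b) \<le> n"
    using n by (simp add: mult.assoc[symmetric])
  then show ?thesis
    using n unfolding n_def by linarith
qed

instance
proof
  fix a b :: gint
  show "b \<noteq> 0 \<Longrightarrow> a * b div b = a"
    by (simp add: divide_gint_def mult.assoc mult_gcnj round_div_exact gint_eq_iff)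
  show "a div 0 = 0"
    by (simp add: divide_gint_def round_div_def gint_eq_iff)
  show "a div b * b + a mod b = a"
    by (simp add: modulo_gint_def)
  show "euclidean_size (0 :: gint) = 0" by (simp add: euclidean_size_gint_def)
  show "b \<noteq> 0 \<Longrightarrow> euclidean_size (a mod b) < euclidean_size b"
    using gint_mod_norm[of b a] by (simp add: euclidean_size_gint_def)
  show "b \<noteq> 0 \<Longrightarrow> euclidean_size a \<le> euclidean_size (a * b)"
    using gnorm_pos[of b] mult_left_mono[of 1 "gnorm b" "gnorm a"] gnorm_nonneg[of a]
    unfolding euclidean_size_gint_def gnorm_mult by (intro nat_mono) linarith
  show "unit_factor (0 :: gint) = 0" by (simp add: unit_factor_gint_def)
  show "a dvd 1 \<Longrightarrow> unit_factor a = a"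
    using guf_mult_unit[of a 1] by (simp add: unit_factor_gint_def guf_1)
  show "a \<noteq> 0 \<Longrightarrow> unit_factor a dvd 1"
    by (simp add: unit_factor_gint_def guf_unit)
  show "a dvd 1 \<Longrightarrow> unit_factor (a * b) = a * unit_factor b"
    by (simp add: unit_factor_gint_def guf_mult_unit)
  show "unit_factor a * normalize a = a"
  proof (cases "a = 0")
    case False
    then show ?thesis
      using gunit_gcnj[OF guf_unit[of a]]
      by (simp add: unit_factor_gint_def normalize_gint_def flip: mult.assoc)
  qed (simp_all add: unit_factor_gint_def normalize_gint_def)
  show "normalize (0 :: gint) = 0" by (simp add: normalize_gint_def)
qed

end

text \<open>Congruence to 1 modulo \<open>2 * (1 + gi)\<close>, written in coordinates to be
  accessible to integer arithmetic; see \<open>gprimary_iff\<close>.\<close>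

definition gprimary :: "gint \<Rightarrow> bool" where
  "gprimary a \<longleftrightarrow> even (gim a) \<and> (gre a + gim a) mod 4 = 1"

lemma gprimary_1 [simp]: "gprimary 1"
  by (simp add: gprimary_def)

lemma gprimary_imp_godd: "gprimary a \<Longrightarrow> godd a"
  unfolding gprimary_def godd_def by presburger

lemma guf_eq_1_iff: "godd a \<Longrightarrow> guf a = 1 \<longleftrightarrow> gprimary a"
  by (auto simp: guf_def gprimary_def gint_eq_iff)

lemma gprimary_normalize: "godd a \<Longrightarrow> gprimary (normalize a)"
proof -
  assume a: "godd a"
  then have "a \<noteq> 0" by auto
  have "guf (normalize a) = 1"
    using \<open>a \<noteq> 0\<close> unit_factor_normalize[of a] by (simp add: unit_factor_gint_def)
  moreover have "godd (normalize a)"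
    using a by (metis godd_mult unit_factor_mult_normalize)
  ultimately show ?thesis by (simp add: guf_eq_1_iff)
qed

lemma normalize_gprimary: "gprimary a \<Longrightarrow> normalize a = a"
  using guf_eq_1_iff[of a] gprimary_imp_godd[of a] by (simp add: normalize_gint_def)

lemma gprimary_mult: "gprimary a \<Longrightarrow> gprimary b \<Longrightarrow> gprimary (a * b)"
proof -
  assume "gprimary a" "gprimary b"
  then obtain x y u v where *: "gim a = 2 * x" "gre a + gim a = 4 * y + 1"
     "gim b = 2 * u" "gre b + gim b = 4 * v + 1"
    unfolding gprimary_def by (metis dvdE mult_div_mod_eq)
  then have r: "gre a = 4 * y + 1 - 2 * x" "gre b = 4 * v + 1 - 2 * u" by auto
  have "gre (a * b) + gim (a * b) = 4 * (4 * v * y + v + y - 2 * x * u) + 1" "gim (a * b) = 2 * (u * gre a + x * gre b)"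
    unfolding gint_sel r *(1) *(3) by (simp_all add: algebra_simps)
  then show ?thesis unfolding gprimary_def by presburger
qed

text \<open>Normalization is not multiplicative on even elements: \<open>1 + gi\<close> is
  normalized but its square \<open>2 * gi\<close> is not. On odd elements it is, because products of
  2-primary elements are 2-primary.\<close>

lemma normalize_mult_godd: "godd a \<Longrightarrow> godd b \<Longrightarrow> normalize (a * b) = normalize a * normalize (b :: gint)"
proof -
  assume a: "godd a" "godd b"
  have "normalize (a * b) = normalize (normalize a * normalize b)"
    by simp
  also have "\<dots> = normalize a * normalize b"
    by (intro normalize_gprimary gprimary_mult gprimary_normalize a)
  finally show ?thesis .
qed

lemma prime_godd_gprimary: "prime p \<Longrightarrow> godd p \<Longrightarrow> gprimary p"
  by (metis gprimary_normalize normalize_prime)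

lemma prime_gprimary: "prime_elem p \<Longrightarrow> gprimary p \<Longrightarrow> prime p"
  by (simp add: prime_def normalize_gprimary)

section \<open>Primes of the Gaussian integers\<close>

lemma dvd_diff_trans: "(m :: 'a :: comm_ring_1) dvd a - b \<Longrightarrow> m dvd b - c \<Longrightarrow> m dvd a - c"
  using dvd_add[of m "a - b" "b - c"] by simp

lemma dvd_diff_sym: "(m :: 'a :: comm_ring_1) dvd a - b \<Longrightarrow> m dvd b - a"
  by (metis dvd_minus_iff minus_diff_eq)

lemma dvd_diff_mult:
  "(m :: 'a :: comm_ring_1) dvd a - b \<Longrightarrow> m dvd c - d \<Longrightarrow> m dvd a * c - b * d"
proof -
  assume "m dvd a - b" "m dvd c - d"
  then have "m dvd (a - b) * c + b * (c - d)" by (intro dvd_add dvd_mult dvd_mult2)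
  then show ?thesis by (simp add: algebra_simps)
qed

lemma dvd_diff_power: "(m :: 'a :: comm_ring_1) dvd a - b \<Longrightarrow> m dvd a ^ n - b ^ n"
  by (induction n) (auto intro: dvd_diff_mult)

lemma freshman_dvd:
  fixes a b :: "'a :: comm_ring_1"
  assumes "prime p"
  shows "of_nat p dvd (a + b) ^ p - (a ^ p + b ^ p)"
proof -
  have p: "p > 0" using assms by (simp add: prime_gt_0_nat)
  have "{..p} = insert 0 (insert p {0<..<p})" using p by auto
  then have "(a + b) ^ p = b ^ p + (a ^ p + (\<Sum>k\<in>{0<..<p}. of_nat (p choose k) * a ^ k * b ^ (p - k)))"
    using p by (simp add: binomial_ring)
  moreover have "of_nat p dvd (of_nat (p choose k) :: 'a)" if "0 < k" "k < p" for k
  proof -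
    have "p dvd (p choose k)" using that assms by (intro dvd_choose_prime) auto
    then obtain m where "(p choose k) = p * m" ..
    then show ?thesis by simp
  qed
  then have "of_nat p dvd (\<Sum>k\<in>{0<..<p}. of_nat (p choose k) * a ^ k * b ^ (p - k))"
    by (intro dvd_sum dvd_mult2) auto
  ultimately show ?thesis by simp
qed

lemma freshman_sum_dvd:
  fixes f :: "'b \<Rightarrow> 'a :: comm_ring_1"
  assumes "prime p"
  shows "of_nat p dvd (\<Sum>x\<in>A. f x) ^ p - (\<Sum>x\<in>A. f x ^ p)"
proof (induction A rule: infinite_finite_induct)
  case (insert x A)
  have "of_nat p dvd ((f x + sum f A) ^ p - (f x ^ p + sum f A ^ p)) + (sum f A ^ p - (\<Sum>x\<in>A. f x ^ p))"
    using freshman_dvd[OF assms] insert.IH by (intro dvd_add)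
  then show ?case using insert.hyps by (simp add: algebra_simps)
qed (use assms in \<open>auto simp: prime_gt_0_nat power_0_left\<close>)

lemma fermat_int:
  assumes "prime p"
  shows "int p dvd x ^ p - x"
proof -
  have *: "int p dvd int n ^ p - int n" for n
  proof (induction n)
    case (Suc n)
    have "int p dvd ((int n + 1) ^ p - (int n ^ p + 1 ^ p)) + (int n ^ p - int n)"
      using freshman_dvd[OF assms, of "int n" 1] Suc by (intro dvd_add) auto
    then show ?case by (simp add: algebra_simps)
  qed (use assms in \<open>simp add: prime_gt_0_nat power_0_left\<close>)
  define y where "y = nat (x mod int p)"
  have y: "int y = x mod int p"
    using assms by (simp add: y_def prime_gt_0_nat)
  have "int p dvd x - int y" by (simp add: y mod_eq_dvd_iff[symmetric])
  then have "int p dvd (x ^ p - int y ^ p) + (int y ^ p - int y) - (x - int y)"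
    using * by (intro dvd_add[OF _ *] dvd_diff[OF _ \<open>int p dvd x - int y\<close>] dvd_diff_power)
  then show ?thesis by simp
qed

lemma of_int_dvd_of_int_gint [simp]: "(of_int a :: gint) dvd of_int b \<longleftrightarrow> a dvd b"
  by (simp add: of_int_dvd_gint_iff)

lemma of_nat_dvd_of_nat_gint [simp]: "(of_nat a :: gint) dvd of_nat b \<longleftrightarrow> a dvd b"
  using of_int_dvd_of_int_gint[of "int a" "int b"] by (simp del: of_int_dvd_of_int_gint)

lemma gi_neq [simp]: "gi \<noteq> 0" "gi \<noteq> 1" "gi \<noteq> -1" "1 \<noteq> gi" "gi \<noteq> - gi" "1 \<noteq> (-1 :: gint)"
  by (auto simp: gint_eq_iff)

lemma fermat_int':
  assumes "prime p" "\<not> int p dvd x"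
  shows "int p dvd x ^ (p - 1) - 1"
proof -
  have "x ^ p = x * x ^ (p - 1)"
    using assms(1) by (simp add: prime_gt_0_nat flip: power_Suc)
  then have "int p dvd x * (x ^ (p - 1) - 1)"
    using fermat_int[OF assms(1), of x] by (simp add: algebra_simps)
  then show ?thesis
    using assms by (simp add: prime_dvd_mult_iff)
qed

text \<open>Normalized primes not dividing 2; they are 2-primary by the choice of the unit factor.\<close>

definition gprime :: "gint \<Rightarrow> bool" where "gprime \<pi> \<longleftrightarrow> prime \<pi> \<and> godd \<pi>"

lemma gprime_prime: "gprime \<pi> \<Longrightarrow> prime \<pi>"
  and gprime_prime_elem: "gprime \<pi> \<Longrightarrow> prime_elem \<pi>"
  and gprime_godd: "gprime \<pi> \<Longrightarrow> godd \<pi>"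
  and gprime_gprimary: "gprime \<pi> \<Longrightarrow> gprimary \<pi>"
  and gprime_nonzero: "gprime \<pi> \<Longrightarrow> \<pi> \<noteq> 0"
  by (auto simp: gprime_def prime_godd_gprimary)

lemma gprime_iff: "gprime \<pi> \<longleftrightarrow> prime_elem \<pi> \<and> gprimary \<pi>"
  unfolding gprime_def using prime_gprimary prime_godd_gprimary gprimary_imp_godd by blast

lemma prime_elem_gcnj: "prime_elem (gcnj \<pi>) \<longleftrightarrow> prime_elem \<pi>"
proof -
  have "prime_elem (gcnj \<pi>)" if "prime_elem \<pi>" for \<pi>
  proof (rule prime_elemI)
    fix a b assume "gcnj \<pi> dvd a * b"
    then have "\<pi> dvd gcnj a * gcnj b" by (metis gcnj_dvd gcnj_simps(6,7))
    then show "gcnj \<pi> dvd a \<or> gcnj \<pi> dvd b"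
      using that by (metis gcnj_dvd gcnj_simps(7) prime_elem_dvd_multD)
  next
    have "gcnj z = 0 \<longleftrightarrow> z = 0" for z by (auto simp: gint_eq_iff)
    then show "gcnj \<pi> \<noteq> 0" using that by (auto simp: prime_elem_def)
    show "\<not> gcnj \<pi> dvd 1" using gcnj_dvd[of \<pi> 1] that prime_elem_not_unit by auto
  qed
  from this[of \<pi>] this[of "gcnj \<pi>"] show ?thesis by auto
qed

lemma gprimary_gcnj [simp]: "gprimary (gcnj \<pi>) \<longleftrightarrow> gprimary \<pi>"
  unfolding gprimary_def gcnj_sel by presburger

lemma gprime_gcnj [simp]: "gprime (gcnj \<pi>) \<longleftrightarrow> gprime \<pi>"
  by (simp add: gprime_iff prime_elem_gcnj)

lemma gprime_dvd_mult: "gprime \<pi> \<Longrightarrow> \<pi> dvd a * b \<longleftrightarrow> \<pi> dvd a \<or> \<pi> dvd b"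
  by (simp add: gprime_prime prime_dvd_mult_iff)

lemma gprime_dvd_gprime: "gprime \<pi> \<Longrightarrow> gprime \<rho> \<Longrightarrow> \<pi> dvd \<rho> \<longleftrightarrow> \<pi> = \<rho>"
  by (auto simp: gprime_prime primes_dvd_imp_eq)

lemma gnorm_odd_iff: "odd (gnorm a) \<longleftrightarrow> godd a"
  by (auto simp: gnorm_def godd_def)

lemma gnorm_gprime_mod4: "godd \<pi> \<Longrightarrow> gnorm \<pi> mod 4 = 1"
proof -
  assume "godd \<pi>"
  have sq: "x\<^sup>2 mod 4 = (if even x then 0 else 1)" for x :: int
  proof (cases "even x")
    case False
    then obtain y where "x = 2 * y + 1" by (auto elim!: oddE)
    then have "x\<^sup>2 = 4 * (y * y + y) + 1" by (simp add: power2_eq_square algebra_simps)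
    then show ?thesis using False by presburger
  qed (auto elim!: evenE)
  have "gnorm \<pi> mod 4 = ((gre \<pi>)\<^sup>2 mod 4 + (gim \<pi>)\<^sup>2 mod 4) mod 4"
    by (simp add: gnorm_def mod_add_eq)
  then show ?thesis using \<open>godd \<pi>\<close> by (auto simp: sq godd_def)
qed

lemma gnorm_eq_1_iff: "gnorm a = 1 \<longleftrightarrow> a dvd 1"
proof
  assume "gnorm a = 1"
  then have "a * gcnj a = 1" by (simp add: mult_gcnj)
  then show "a dvd 1" by (metis dvd_triv_left)
qed (use gnorm_dvd[of a 1] in \<open>simp add: zdvd1_eq\<close>)

lemma gnorm_gprime_gt_1: "gprime \<pi> \<Longrightarrow> gnorm \<pi> > 1"
proof -
  assume "gprime \<pi>"
  then have "gnorm \<pi> \<noteq> 0" "gnorm \<pi> \<noteq> 1"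
    using gprime_prime[of \<pi>] by (auto simp: gnorm_eq_1_iff)
  then show ?thesis using gnorm_nonneg[of \<pi>] by linarith
qed

lemma gprime_dvd_rational_prime:
  assumes "gprime \<pi>"
  obtains p where "prime p" "\<pi> dvd of_nat p"
proof -
  define n where "n = nat (gnorm \<pi>)"
  have n: "\<pi> dvd of_nat n" "n > 1"
    using dvd_gnorm[of \<pi>] gnorm_gprime_gt_1[OF assms] by (simp_all add: n_def)
  have "\<exists>p. prime p \<and> \<pi> dvd of_nat p" if "\<pi> dvd of_nat n" "n > 0" for n
    using that
  proof (induction n rule: prime_divisors_induct)
    case (unit x)
    then show ?case using gprime_prime[OF assms] by simp
  next
    case (factor p x)
    then show ?case
      using gprime_dvd_mult[OF assms, of "of_nat p" "of_nat x"] by auto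
  qed simp
  with n that show ?thesis by auto
qed

lemma prime_sq_divisor_int:
  assumes "prime p" "d dvd (int p)\<^sup>2" "d > 1"
  shows "d = int p \<or> d = (int p)\<^sup>2"
proof -
  have "nat d dvd p ^ 2"
    using assms(2,3) by (simp add: nat_dvd_iff)
  then obtain i where i: "i \<le> 2" "nat d = p ^ i"
    using divides_primepow_nat[OF assms(1)] by blast
  then have "int (nat d) = int (p ^ i)" by simp
  then have "d = int p ^ i" using assms(3) by simp
  moreover have "i \<noteq> 0" using assms(3) \<open>d = int p ^ i\<close> by (cases i) auto
  ultimately show ?thesis using i(1) by (cases "i = 1") (auto simp: le_Suc_eq numeral_2_eq_2)
qed

lemma QuadRes_minus_1:
  assumes "prime p" "p mod 4 = 1"
  shows "\<exists>x. int p dvd x\<^sup>2 + 1"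
proof -
  have p2: "2 < p" using assms prime_ge_2_nat[of p] by (cases "p = 2") auto
  have ev: "even ((p - 1) div 2)" using assms(2) by presburger
  have "[Legendre (-1) (int p) = (-1) ^ ((p - 1) div 2)] (mod (int p))"
    using euler_criterion[of "p" "-1"] assms p2 by simp
  then have "[Legendre (-1) (int p) = 1] (mod (int p))" using ev by simp
  moreover have "\<not> [0 = 1] (mod (int p))" "\<not> [-1 = 1] (mod (int p))"
    using p2 by (auto simp: cong_iff_dvd_diff zdvd_not_zless)
  ultimately have "QuadRes (int p) (-1)"
    unfolding Legendre_def by (auto split: if_splits)
  then obtain y where "[y\<^sup>2 = -1] (mod (int p))" by (auto simp: QuadRes_def)
  then show ?thesis by (auto simp: cong_iff_dvd_diff)
qed

text \<open>The norm of \<open>\<pi>\<close> divides \<open>p ^ 2\<close>. If it equals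
  \<open>p ^ 2\<close>, then \<open>\<pi>\<close> is an associate of \<open>p\<close>, and being
  2-primary it is \<open>p\<close> or \<open>- p\<close> according to \<open>p mod 4\<close>. The
  first is impossible: \<open>p\<close> divides some \<open>x ^ 2 + 1\<close>, which factors over
  \<open>gi\<close>, but divides neither factor.\<close>

lemma gprime_cases:
  assumes "gprime \<pi>"
  obtains (split) p where "prime p" "p mod 4 = 1" "gnorm \<pi> = int p"
  | (inert) q where "prime q" "q mod 4 = 3" "\<pi> = - of_nat q"
proof -
  obtain p where p: "prime p" "\<pi> dvd of_nat p"
    by (rule gprime_dvd_rational_prime[OF assms])
  have "gnorm \<pi> dvd (int p)\<^sup>2"
    using gnorm_dvd[OF p(2)] by (simp add: gnorm_of_nat)
  then have "gnorm \<pi> = int p \<or> gnorm \<pi> = (int p)\<^sup>2"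
    using prime_sq_divisor_int p(1) gnorm_gprime_gt_1[OF assms] by blast
  then show ?thesis
  proof
    assume *: "gnorm \<pi> = int p"
    then have "int p mod 4 = 1" using gnorm_gprime_mod4[OF gprime_godd[OF assms]] by simp
    then have "p mod 4 = 1" by presburger
    with * p(1) show ?thesis by (rule split[rotated 2])
  next
    assume *: "gnorm \<pi> = (int p)\<^sup>2"
    obtain u where u: "of_nat p = \<pi> * u" using p(2) by auto
    then have "(int p)\<^sup>2 = (int p)\<^sup>2 * gnorm u"
      using * by (metis gnorm_mult gnorm_of_nat)
    then have "gnorm u = 1" using p(1) by auto
    then have "u dvd 1" by (simp add: gnorm_eq_1_iff)
    then have \<pi>: "\<pi> = gcnj u * of_nat p" and cu: "gcnj u dvd 1"
      using u gunit_gcnj[of u] by (auto simp: mult.assoc mult.left_commute dvd_def mult.commute)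
    have gp: "gprimary \<pi>" by (rule gprime_gprimary[OF assms])
    have "odd p" using gprime_godd[OF assms] \<pi> by (auto simp: godd_mult godd_def)
    then have \<pi>': "\<pi> = of_nat p \<and> p mod 4 = 1 \<or> \<pi> = - of_nat p \<and> p mod 4 = 3"
    proof -
      have *: "int p mod 4 = 1 \<Longrightarrow> p mod 4 = 1" "(- int p) mod 4 = 1 \<Longrightarrow> p mod 4 = 3" by presburger+
      from cu consider "gcnj u = 1" | "gcnj u = -1" | "gcnj u = gi" | "gcnj u = - gi"
        unfolding gunit_iff by blast
      then show ?thesis
      proof cases
        case 1 with * gp \<pi> show ?thesis by (simp add: gprimary_def)
      next
        case 2 with * gp \<pi> show ?thesis by (simp add: gprimary_def)
      next
        case 3 with gp \<pi> \<open>odd p\<close> show ?thesis by (simp add: gprimary_def)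
      next
        case 4 with gp \<pi> \<open>odd p\<close> show ?thesis by (simp add: gprimary_def)
      qed
    qed
    have "p mod 4 \<noteq> 1"
    proof
      assume "p mod 4 = 1"
      then obtain x where x: "int p dvd x\<^sup>2 + 1" using QuadRes_minus_1[OF p(1)] by blast
      have "of_int (int p) dvd (of_int (x\<^sup>2 + 1) :: gint)" using x by (simp only: of_int_dvd_of_int_gint)
      moreover have "of_int (x\<^sup>2 + 1) = (of_int x + gi) * (of_int x - gi)"
        by (simp add: gint_eq_iff power2_eq_square)
      moreover have "\<pi> = of_int (int p)" using \<pi>' \<open>p mod 4 = 1\<close> by auto
      ultimately have "of_int (int p) dvd of_int x + gi \<or> of_int (int p) dvd of_int x - gi"
        using gprime_dvd_mult[OF assms] by metis
      then show False using prime_gt_1_nat[OF p(1)] unfolding of_int_dvd_gint_iff by auto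
    qed
    then show ?thesis using inert \<pi>' p(1) by blast
  qed
qed

lemma gprime_not_dvd_unit: "gprime \<pi> \<Longrightarrow> u dvd 1 \<Longrightarrow> \<not> \<pi> dvd u"
  by (meson dvd_trans gprime_prime not_prime_unit)

lemma gprime_of_rational:
  assumes "prime l" "odd l"
  obtains \<rho> where "gprime \<rho>" "\<rho> dvd of_nat l"
    "l mod 4 = 1 \<and> gnorm \<rho> = int l \<or> l mod 4 = 3 \<and> \<rho> = - of_nat l"
proof -
  have "\<not> (of_nat l :: gint) dvd 1"
    using prime_gt_1_nat[OF assms(1)] by (auto simp: gunit_iff gint_eq_iff)
  moreover have "(of_nat l :: gint) \<noteq> 0" using assms by (auto simp: prime_gt_0_nat)
  ultimately obtain \<rho> :: gint where \<rho>: "prime \<rho>" "\<rho> dvd of_nat l"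
    using prime_divisor_exists by blast
  have "godd (of_nat l)" using assms(2) by (simp add: godd_def)
  then have "godd \<rho>" using \<rho>(2) by (metis dvdE godd_mult)
  then have g: "gprime \<rho>" using \<rho>(1) by (simp add: gprime_def)
  have N: "gnorm \<rho> dvd (int l)\<^sup>2" using gnorm_dvd[OF \<rho>(2)] by (simp add: gnorm_of_nat)
  from g show ?thesis
  proof (cases rule: gprime_cases)
    case (split p)
    then have "int p dvd int l ^ 2" using N by simp
    then have "p dvd l" using split(1) by (metis int_dvd_int_iff of_nat_power prime_dvd_power)
    then have "p = l" using split(1) assms(1) by (simp add: primes_dvd_imp_eq)
    then show ?thesis using that[OF g \<rho>(2)] split by auto
  next
    case (inert q)
    then have "int q dvd int l" using \<rho>(2) by simp
    then have "q = l" using inert(1) assms(1) by (simp add: primes_dvd_imp_eq)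
    then show ?thesis using that[OF g \<rho>(2)] inert by auto
  qed
qed

lemma split_dvd_of_int:
  assumes "gprime \<pi>" "gnorm \<pi> = int p" "prime p"
  shows "\<pi> dvd of_int x \<longleftrightarrow> int p dvd x"
proof
  assume "\<pi> dvd of_int x"
  then have "int p dvd x\<^sup>2" using gnorm_dvd[of \<pi> "of_int x"] assms(2) by (simp add: gnorm_of_int)
  then show "int p dvd x" using assms(3) by (metis prime_dvd_power prime_nat_int_transfer)
next
  assume "int p dvd x"
  then have "(of_int (gnorm \<pi>) :: gint) dvd of_int x" unfolding assms(2) by (simp only: of_int_dvd_of_int_gint)
  then show "\<pi> dvd of_int x" using dvd_gnorm dvd_trans by blast
qed

text \<open>The residue field has prime order, so rational integers represent all classes.
  Concretely, \<open>gim \<pi>\<close> is invertible modulo \<open>p\<close>, a rational multiple of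
  \<open>\<pi>\<close> makes the imaginary part of \<open>a\<close> divisible by \<open>p\<close>,
  and \<open>\<pi>\<close> divides \<open>p\<close>.\<close>

lemma split_dvd_diff_of_int:
  assumes "gprime \<pi>" "gnorm \<pi> = int p" "prime p"
  obtains x where "\<pi> dvd a - of_int x"
proof -
  have nd: "\<not> int p dvd gim \<pi>"
  proof
    assume "int p dvd gim \<pi>"
    then obtain k where k: "gim \<pi> = int p * k" by auto
    have "(gre \<pi>)\<^sup>2 + int p * (int p * k\<^sup>2) = int p"
      using assms(2) by (simp add: gnorm_def k power2_eq_square algebra_simps)
    then have "(gre \<pi>)\<^sup>2 = int p * (1 - int p * k\<^sup>2)" by (simp add: algebra_simps)
    then have "int p dvd (gre \<pi>)\<^sup>2" by simp
    then have "int p dvd gre \<pi>" using assms(3) by (metis prime_dvd_power prime_nat_int_transfer)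
    then have "of_int (int p) dvd \<pi>" using \<open>int p dvd gim \<pi>\<close> by (simp only: of_int_dvd_gint_iff)
    then have "gnorm (of_int (int p)) dvd gnorm \<pi>" by (rule gnorm_dvd)
    then have "(int p)\<^sup>2 dvd int p" using assms(2) by (simp add: gnorm_of_nat)
    then show False
      using prime_gt_1_nat[OF assms(3)] by (auto simp: power2_eq_square dest!: zdvd_imp_le)
  qed
  have "coprime (int p) (gim \<pi>)" using nd assms(3) by (simp add: prime_imp_coprime)
  then obtain t where t: "int p dvd gim \<pi> * t - 1"
    by (metis cong_iff_dvd_diff cong_solve_coprime_int coprime_commute)
  define w where "w = a - \<pi> * of_int (t * gim a)"
  have "int p dvd gim w"
  proof -
    have "gim w = - gim a * (gim \<pi> * t - 1)" by (simp add: w_def algebra_simps)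
    then show ?thesis using t by simp
  qed
  then obtain k where "gim w = int p * k" by auto
  then have "w = of_int (gre w) + of_int (gnorm \<pi>) * of_int k * gi"
    using assms(2) by (simp add: gint_eq_iff)
  then have "\<pi> dvd w - of_int (gre w)"
    using dvd_gnorm[of \<pi>] by (metis add_diff_cancel_left' dvd_mult2)
  then have "\<pi> dvd (w - of_int (gre w)) + \<pi> * of_int (t * gim a)" by (intro dvd_add) auto
  moreover have "(w - of_int (gre w)) + \<pi> * of_int (t * gim a) = a - of_int (gre w)"
    by (simp add: w_def)
  ultimately show ?thesis using that by metis
qed

text \<open>The Frobenius map of the field with \<open>q ^ 2\<close> elements is conjugation: it
  fixes rational integers and sends \<open>gi\<close> to \<open>gi ^ q = - gi\<close>, as
  \<open>q mod 4 = 3\<close>.\<close>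

lemma inert_frobenius:
  assumes "prime q" "q mod 4 = 3"
  shows "of_nat q dvd a ^ q - gcnj a"
proof -
  define x y :: gint where "x = of_int (gre a)" and "y = of_int (gim a)"
  have a: "a = x + gi * y" "gcnj a = x - gi * y"
    by (simp_all add: gint_eq_iff x_def y_def)
  have gq: "gi ^ q = - gi"
  proof -
    have "q = 4 * (q div 4) + 3" using assms(2) by presburger
    then have "gi ^ q = (gi ^ 4) ^ (q div 4) * gi ^ 3" by (metis power_add power_mult)
    then show ?thesis by (simp add: power3_eq_cube)
  qed
  have "of_nat q dvd (x ^ q - x)" "of_nat q dvd (y ^ q - y)"
    using fermat_int[OF assms(1)] unfolding x_def y_def
    by (metis of_int_diff of_int_dvd_of_int_gint of_int_of_nat_eq of_int_power)+
  then have "of_nat q dvd ((x + gi * y) ^ q - (x ^ q + (gi * y) ^ q)) + (x ^ q - x) + gi ^ q * (y ^ q - y)"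
    by (intro dvd_add dvd_mult freshman_dvd assms)
  also have "\<dots> = (x + gi * y) ^ q - (x - gi * y)" unfolding gq power_mult_distrib by (simp add: algebra_simps)
  also have "\<dots> = a ^ q - gcnj a" unfolding a(1)[symmetric] a(2)[symmetric] ..
  finally show ?thesis .
qed

text \<open>Split: a rational representative reduces the claim to the integers. Inert:
  \<open>a ^ (q + 1)\<close> is congruent to \<open>gnorm a\<close> by
  \<open>inert_frobenius\<close>, and Fermat's theorem for this integer supplies the remaining
  exponent \<open>q - 1\<close>.\<close>

lemma gprime_fermat:
  assumes "gprime \<pi>" "\<not> \<pi> dvd a"
  shows "\<pi> dvd a ^ nat (gnorm \<pi> - 1) - 1"
  using assms(1)
proof (cases rule: gprime_cases)
  case (split p)
  obtain x where x: "\<pi> dvd a - of_int x"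
    using split_dvd_diff_of_int[OF assms(1)] split by blast
  then have "\<not> \<pi> dvd of_int x" using assms(2)
    by (metis diff_add_cancel dvd_add_right_iff)
  then have "\<not> int p dvd x" using split_dvd_of_int[OF assms(1)] split by blast
  then have "int p dvd x ^ (p - 1) - 1" using fermat_int' split by blast
  then have "\<pi> dvd of_int (x ^ (p - 1) - 1)" using split_dvd_of_int[OF assms(1)] split by blast
  then have "\<pi> dvd of_int x ^ (p - 1) - 1" by simp
  moreover have "\<pi> dvd a ^ (p - 1) - of_int x ^ (p - 1)" by (rule dvd_diff_power[OF x])
  ultimately have "\<pi> dvd a ^ (p - 1) - 1" by (rule dvd_diff_trans[rotated])
  moreover have "nat (gnorm \<pi> - 1) = p - 1" using split by (simp add: nat_diff_distrib)
  ultimately show ?thesis by simp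
next
  case (inert q)
  have \<pi>q: "\<pi> dvd z \<longleftrightarrow> of_nat q dvd z" for z using inert(3) by simp
  define n where "n = gnorm a"
  have "\<pi> dvd a ^ q - gcnj a" using inert_frobenius inert by simp
  then have "\<pi> dvd a * (a ^ q - gcnj a)" by simp
  then have 1: "\<pi> dvd a ^ (q + 1) - of_int n" by (simp add: algebra_simps mult_gcnj n_def)
  have "\<not> int q dvd n"
  proof
    assume "int q dvd n"
    then have "\<pi> dvd of_int n" using \<pi>q by (metis of_int_dvd_of_int_gint of_int_of_nat_eq)
    then have "\<pi> dvd a * gcnj a" by (simp add: mult_gcnj n_def)
    then have "\<pi> dvd gcnj a" using assms gprime_dvd_mult by blast
    then have "gcnj \<pi> dvd a" by (metis gcnj_dvd gcnj_simps(7))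
    then show False using assms(2) inert(3) by simp
  qed
  then have "int q dvd n ^ (q - 1) - 1" using fermat_int' inert by blast
  then have 2: "\<pi> dvd of_int n ^ (q - 1) - 1"
    using \<pi>q by (metis of_int_1 of_int_diff of_int_dvd_of_int_gint of_int_of_nat_eq of_int_power)
  have "\<pi> dvd (a ^ (q + 1)) ^ (q - 1) - 1"
    using dvd_diff_trans[OF dvd_diff_power[OF 1] 2] .
  moreover have "nat (gnorm \<pi> - 1) = (q + 1) * (q - 1)"
    using prime_gt_0_nat[OF inert(1)] inert(3)
    by (simp add: gnorm_of_nat nat_diff_distrib algebra_simps power2_eq_square nat_mult_distrib
        flip: of_nat_mult)
  ultimately show ?thesis by (simp only: power_mult)
qed

section \<open>The quartic residue symbol\<close>

definition qexp :: "gint \<Rightarrow> nat" where "qexp \<pi> = nat (gnorm \<pi> - 1) div 4"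

definition qsym :: "gint \<Rightarrow> gint \<Rightarrow> gint" where
  "qsym a \<pi> = (if \<pi> dvd a then 0 else (THE u. u dvd 1 \<and> \<pi> dvd u - a ^ qexp \<pi>))"

lemma qexp_eq: "godd \<pi> \<Longrightarrow> \<pi> \<noteq> 0 \<Longrightarrow> nat (gnorm \<pi> - 1) = qexp \<pi> * 4"
proof -
  assume "godd \<pi>" "\<pi> \<noteq> 0"
  then have "gnorm \<pi> mod 4 = 1" "gnorm \<pi> > 0" using gnorm_gprime_mod4 by auto
  then have "gnorm \<pi> - 1 = 4 * (gnorm \<pi> div 4)" "gnorm \<pi> div 4 \<ge> 0" by presburger+
  then show ?thesis unfolding qexp_def by (metis div_mult_self1_is_m mult.commute nat_mult_distrib nat_numeral zero_less_numeral zero_le_numeral)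
qed

lemma qexp_gcnj [simp]: "qexp (gcnj \<pi>) = qexp \<pi>"
  by (simp add: qexp_def)

text \<open>Two units differ by an element of norm 0, 2 or 4, while an odd prime has norm at least
  5. This makes the symbol well defined and later turns congruences between symbols into
  equalities.\<close>

lemma gunit_dvd_diff:
  assumes "gprime \<pi>" "u dvd 1" "v dvd 1" "\<pi> dvd u - v"
  shows "u = v"
proof -
  have "gnorm \<pi> dvd gnorm (u - v)" using assms(4) by (rule gnorm_dvd)
  moreover have "gnorm (u - v) \<in> {0, 2, 4}"
    using assms(2,3) unfolding gunit_iff by (auto simp: gnorm_def)
  moreover have "gnorm \<pi> mod 4 = 1" "gnorm \<pi> > 1"
    using assms(1) gnorm_gprime_mod4 gprime_godd gnorm_gprime_gt_1 by auto
  then have "gnorm \<pi> > 4" by presburger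
  then have "\<not> gnorm \<pi> dvd 2" "\<not> gnorm \<pi> dvd 4"
    by (auto dest: zdvd_imp_le)
  ultimately have "gnorm (u - v) = 0" by auto
  then show ?thesis by simp
qed

lemma qsym_eqI:
  assumes "gprime \<pi>" "u dvd 1" "\<pi> dvd u - a ^ qexp \<pi>"
  shows "qsym a \<pi> = u"
proof -
  have e: "qexp \<pi> > 0"
    using qexp_eq[OF gprime_godd gprime_nonzero, OF assms(1,1)] gnorm_gprime_gt_1[OF assms(1)]
    by (cases "qexp \<pi>") auto
  have "\<not> \<pi> dvd a"
  proof
    assume "\<pi> dvd a"
    then have "\<pi> dvd a ^ qexp \<pi>" using e by (simp add: dvd_power_le dvd_trans[OF _ dvd_power])
    then have "\<pi> dvd u" using assms(3) by (metis diff_add_cancel dvd_add)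
    then show False using assms gprime_not_dvd_unit by blast
  qed
  moreover have "(THE u. u dvd 1 \<and> \<pi> dvd u - a ^ qexp \<pi>) = u"
  proof (rule the_equality)
    fix v assume v: "v dvd 1 \<and> \<pi> dvd v - a ^ qexp \<pi>"
    then have "\<pi> dvd v - u" using assms(3) by (meson dvd_diff_sym dvd_diff_trans)
    then show "v = u" using gunit_dvd_diff assms(1,2) v by blast
  qed (use assms in auto)
  ultimately show ?thesis by (simp add: qsym_def)
qed

text \<open>The three facts share the existence of the symbol: by Fermat
  \<open>x = a ^ qexp \<pi>\<close> satisfies \<open>\<pi> dvd x ^ 4 - 1\<close>, and
  \<open>x ^ 4 - 1\<close> is the product of \<open>u - x\<close> over the four units
  \<open>u\<close>.\<close>

lemma qsym_0_iff [simp]: "gprime \<pi> \<Longrightarrow> qsym a \<pi> = 0 \<longleftrightarrow> \<pi> dvd a"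
  and qsym_unit: "gprime \<pi> \<Longrightarrow> \<not> \<pi> dvd a \<Longrightarrow> qsym a \<pi> dvd 1"
  and qsym_cong_power: "gprime \<pi> \<Longrightarrow> \<pi> dvd qsym a \<pi> - a ^ qexp \<pi>"
proof -
  have *: "\<exists>u. u dvd 1 \<and> \<pi> dvd u - a ^ qexp \<pi>" if \<pi>: "gprime \<pi>" and nd: "\<not> \<pi> dvd a"
  proof -
    define x where "x = a ^ qexp \<pi>"
    have "\<pi> dvd x ^ 4 - 1"
      using gprime_fermat[OF \<pi> nd] qexp_eq[OF gprime_godd gprime_nonzero, OF \<pi> \<pi>]
      by (simp add: x_def power_mult)
    also have "x ^ 4 - 1 = (x * x - 1) * (x * x + 1)"
      by (simp add: algebra_simps power4_eq_xxxx)
    also have "x * x - 1 = (1 - x) * (-1 - x)"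
      by (simp add: algebra_simps)
    also have "x * x + 1 = (gi - x) * (-gi - x)"
      by (simp add: algebra_simps)
    finally have "\<pi> dvd 1 - x \<or> \<pi> dvd -1 - x \<or> \<pi> dvd gi - x \<or> \<pi> dvd -gi - x"
      by (simp add: gprime_dvd_mult[OF \<pi>])
    then show ?thesis unfolding x_def gunit_iff by blast
  qed
  show z: "qsym a \<pi> = 0 \<longleftrightarrow> \<pi> dvd a" if \<pi>: "gprime \<pi>"
    using *[OF \<pi>] qsym_eqI[OF \<pi>, of _ a] by (metis not_is_unit_0 qsym_def)
  show "qsym a \<pi> dvd 1" if \<pi>: "gprime \<pi>" and nd: "\<not> \<pi> dvd a"
    using *[OF \<pi> nd] qsym_eqI[OF \<pi>, of _ a] by auto
  show "\<pi> dvd qsym a \<pi> - a ^ qexp \<pi>" if \<pi>: "gprime \<pi>"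
  proof (cases "\<pi> dvd a")
    case True
    have e: "qexp \<pi> > 0"
      using qexp_eq[OF gprime_godd gprime_nonzero, OF \<pi> \<pi>] gnorm_gprime_gt_1[OF \<pi>]
      by (cases "qexp \<pi>") auto
    then have "\<pi> dvd a ^ qexp \<pi>" using True by (meson dvd_power dvd_trans)
    then show ?thesis using z[OF \<pi>] True by simp
  next
    case False
    from *[OF \<pi> this] show ?thesis using qsym_eqI[OF \<pi>, of _ a] by auto
  qed
qed

lemma qsym_cases: "gprime \<pi> \<Longrightarrow> qsym a \<pi> \<in> {0, 1, -1, gi, -gi}"
  using qsym_unit[of \<pi> a] unfolding gunit_iff by auto

lemma qsym_mult:
  assumes "gprime \<pi>"
  shows "qsym (a * b) \<pi> = qsym a \<pi> * qsym b \<pi>"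
proof (cases "\<pi> dvd a \<or> \<pi> dvd b")
  case True
  then have "qsym (a * b) \<pi> = 0" "qsym a \<pi> = 0 \<or> qsym b \<pi> = 0"
    using assms by (auto simp: gprime_dvd_mult)
  then show ?thesis by auto
next
  case False
  have "\<pi> dvd qsym a \<pi> * qsym b \<pi> - (a * b) ^ qexp \<pi>"
    using dvd_diff_mult[OF qsym_cong_power[OF assms, of a] qsym_cong_power[OF assms, of b]]
    by (simp add: power_mult_distrib)
  moreover have "qsym a \<pi> * qsym b \<pi> dvd 1"
    using mult_dvd_mono[OF qsym_unit qsym_unit, of \<pi> a \<pi> b] False assms by simp
  ultimately show ?thesis by (rule qsym_eqI[OF assms, rotated])
qed

lemma qsym_cong:
  assumes "gprime \<pi>" "\<pi> dvd a - b"
  shows "qsym a \<pi> = qsym b \<pi>"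
proof (cases "\<pi> dvd a")
  case True
  then have "\<pi> dvd b" using assms(2) by (metis diff_add_cancel dvd_add_right_iff)
  then show ?thesis using True by (simp add: qsym_def)
next
  case False
  have "\<pi> dvd qsym a \<pi> - b ^ qexp \<pi>"
    using dvd_diff_trans[OF qsym_cong_power[OF assms(1)] dvd_diff_power[OF assms(2)]] .
  then show ?thesis using qsym_eqI[OF assms(1) qsym_unit[OF assms(1) False]] by metis
qed

lemma qsym_of_unit: "gprime \<pi> \<Longrightarrow> u dvd 1 \<Longrightarrow> qsym u \<pi> = u ^ qexp \<pi>"
  by (rule qsym_eqI) (auto simp: is_unit_power_iff)

lemma qsym_1 [simp]: "gprime \<pi> \<Longrightarrow> qsym 1 \<pi> = 1"
  by (simp add: qsym_of_unit)

lemma qsym_gcnj: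
  assumes "gprime \<pi>"
  shows "qsym (gcnj a) (gcnj \<pi>) = gcnj (qsym a \<pi>)"
proof (cases "\<pi> dvd a")
  case True
  then show ?thesis by (simp add: qsym_def)
next
  case False
  have "gcnj \<pi> dvd gcnj (qsym a \<pi> - a ^ qexp \<pi>)"
    using qsym_cong_power[OF assms, of a] by (simp only: gcnj_dvd)
  moreover have "gcnj (qsym a \<pi>) dvd 1"
    using gcnj_dvd[of "qsym a \<pi>" 1] qsym_unit[OF assms False] by simp
  ultimately show ?thesis using assms by (intro qsym_eqI) auto
qed

text \<open>Here \<open>qexp\<close> is \<open>(q - 1) * ((q + 1) div 4)\<close>, a multiple of
  \<open>q - 1\<close>, so Fermat's theorem for the integer \<open>r\<close> already gives
  1.\<close>

lemma qsym_of_rational_inert: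
  assumes "prime q" "q mod 4 = 3" "\<not> int q dvd r" "gprime (- of_nat q)"
  shows "qsym (of_int r) (- of_nat q) = 1"
proof (rule qsym_eqI[OF assms(4)])
  define m where "m = (q + 1) div 4"
  have m: "q + 1 = 4 * m" using assms(2) unfolding m_def by presburger
  have q: "q > 0" using assms(1) by (simp add: prime_gt_0_nat)
  have "nat (gnorm (- of_nat q :: gint) - 1) = (q + 1) * (q - 1)"
    using q by (simp add: gnorm_of_nat nat_diff_distrib algebra_simps power2_eq_square flip: of_nat_mult)
  then have e: "qexp (- of_nat q) = (q - 1) * m"
    unfolding qexp_def m by simp
  have "int q dvd (r ^ (q - 1)) ^ m - 1 ^ m"
    by (intro dvd_diff_power fermat_int' assms)
  then have "int q dvd 1 - r ^ qexp (- of_nat q)"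
    unfolding e power_mult by (simp add: dvd_diff_commute)
  then show "- of_nat q dvd (1 :: gint) - of_int r ^ qexp (- of_nat q)"
    using of_int_dvd_of_int_gint[of "int q" "1 - r ^ qexp (- of_nat q)"]
    unfolding minus_dvd_iff by (simp only: of_int_1 of_int_diff of_int_power of_int_of_nat_eq)
qed simp

text \<open>Lagrange's bound on the number of roots, with divisibility by \<open>\<pi>\<close> in
  place of a quotient ring: \<open>\<not> [:\<pi>:] dvd P\<close> says that \<open>P\<close> is
  nonzero there, and \<open>S\<close> consists of pairwise incongruent roots. Synthetic division by
  one root lowers the degree.\<close>

lemma root_count:
  fixes P :: "'a :: idom poly"
  assumes "prime_elem \<pi>" "\<not> [:\<pi>:] dvd P" "finite S"
    "\<And>x. x \<in> S \<Longrightarrow> \<pi> dvd poly P x" "\<And>x y. x \<in> S \<Longrightarrow> y \<in> S \<Longrightarrow> \<pi> dvd x - y \<Longrightarrow> x = y"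
  shows "card S \<le> degree P"
  using assms(2-5)
proof (induction "degree P" arbitrary: P S)
  case 0
  then obtain c where "P = [:c:]" by (metis degree_eq_zeroE)
  moreover have "\<not> \<pi> dvd c"
    using 0(2) unfolding \<open>P = [:c:]\<close> by (auto elim!: dvdE)
  ultimately have "S = {}" using 0(4) by auto
  then show ?case by simp
next
  case (Suc d)
  show ?case
  proof (cases "S = {}")
    case False
    then obtain a where a: "a \<in> S" by auto
    define Q where "Q = synthetic_div P a"
    have P: "P = [:-a, 1:] * Q + [:poly P a:]"
      by (simp only: Q_def synthetic_div_correct')
    have "[:\<pi>:] dvd [:poly P a:]" using Suc.prems(3)[OF a]
      by (auto simp: const_poly_dvd_iff coeff_pCons split: nat.splits)
    then have nd: "\<not> [:\<pi>:] dvd Q"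
      using Suc.prems(1) by (subst (asm) P) (meson dvd_add dvd_mult)
    have "card (S - {a}) \<le> degree Q"
    proof (rule Suc.hyps)
      show "d = degree Q" using Suc.hyps(2) by (simp add: Q_def degree_synthetic_div)
      fix x assume x: "x \<in> S - {a}"
      then have "\<pi> dvd poly P x - poly P a"
        using Suc.prems(3) a by (intro dvd_diff) auto
      also have "poly P x - poly P a = (x - a) * poly Q x"
        by (subst P) (simp add: left_diff_distrib)
      finally have "\<pi> dvd x - a \<or> \<pi> dvd poly Q x"
        using assms(1) by (simp add: prime_elem_dvd_mult_iff)
      then show "\<pi> dvd poly Q x" using Suc.prems(4)[of x a] x a by auto
    qed (use nd Suc.prems in auto)
    then show ?thesis
      using a Suc.prems(2) Suc.hyps(2) by (simp add: Q_def degree_synthetic_div)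
  qed simp
qed

lemma gprime_residues:
  assumes "gprime \<pi>"
  obtains S where "finite S" "card S = nat (gnorm \<pi> - 1)" "\<And>x. x \<in> S \<Longrightarrow> \<not> \<pi> dvd x"
    "\<And>x y. x \<in> S \<Longrightarrow> y \<in> S \<Longrightarrow> \<pi> dvd x - y \<Longrightarrow> x = y"
  using assms
proof (cases rule: gprime_cases)
  case (split p)
  let ?S = "(of_int :: int \<Rightarrow> gint) ` {0<..<int p}"
  have 1: "\<pi> dvd of_int x \<longleftrightarrow> int p dvd x" for x
    using split_dvd_of_int[OF assms] split by blast
  show ?thesis
  proof (rule that[of ?S])
    show "card ?S = nat (gnorm \<pi> - 1)"
      using split by (subst card_image) (auto simp: inj_on_def nat_diff_distrib)
    show "\<not> \<pi> dvd x" if "x \<in> ?S" for x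
      using that zdvd_not_zless by (auto simp: 1)
    show "x = y" if xy: "x \<in> ?S" "y \<in> ?S" "\<pi> dvd x - y" for x y
    proof -
      obtain a b where ab: "x = of_int a" "y = of_int b" "0 < a" "a < int p" "0 < b" "b < int p"
        using xy by auto
      then have "int p dvd a - b" using xy(3) 1[of "a - b"] by simp
      then have "a mod int p = b mod int p" by (simp add: mod_eq_dvd_iff)
      then show ?thesis using ab by simp
    qed
  qed simp
next
  case (inert q)
  let ?T = "(\<lambda>(x, y). Gint x y) ` ({0..<int q} \<times> {0..<int q})"
  let ?S = "?T - {0}"
  have 1: "\<pi> dvd z \<longleftrightarrow> int q dvd gre z \<and> int q dvd gim z" for z
    using inert(3) of_int_dvd_gint_iff[of "int q" z] by simp
  have "inj_on (\<lambda>(x, y). Gint x y) ({0..<int q} \<times> {0..<int q})"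
    by (auto simp: inj_on_def)
  then have "card ?T = q * q" by (simp only: card_image card_cartesian_product) simp
  moreover have "0 \<in> ?T" using prime_gt_0_nat[OF inert(1)] by (force simp: zero_gint_def)
  ultimately have "card ?S = q * q - 1" by simp
  moreover have "nat (gnorm \<pi> - 1) = q * q - 1"
    using prime_gt_0_nat[OF inert(1)] inert(3)
    by (simp add: gnorm_of_nat nat_diff_distrib power2_eq_square flip: of_nat_mult)
  moreover have *: "x = y" if xy: "x \<in> ?T" "y \<in> ?T" "\<pi> dvd x - y" for x y
  proof -
    have "gre x mod int q = gre y mod int q" "gim x mod int q = gim y mod int q"
      using xy(3) by (simp_all add: 1 mod_eq_dvd_iff)
    then show ?thesis using xy(1,2) by auto
  qed
  moreover have "\<not> \<pi> dvd x" if "x \<in> ?S" for x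
    using *[of x 0] that \<open>0 \<in> ?T\<close> by auto
  ultimately show ?thesis using that[of ?S] by (metis (no_types, lifting) DiffD1 finite_Diff finite_SigmaI finite_atLeastLessThan_int finite_imageI)
qed

text \<open>If all symbols squared to 1, the \<open>4 * e\<close> incongruent nonzero residues would
  be roots of \<open>X ^ (2 * e) - 1\<close>. So some symbol is \<open>gi\<close> or
  \<open>- gi\<close>, and its powers run through all units.\<close>

lemma qsym_surj:
  assumes "gprime \<pi>" "u dvd 1"
  obtains a where "qsym a \<pi> = u"
proof -
  obtain S where S: "finite S" "card S = nat (gnorm \<pi> - 1)" "\<And>x. x \<in> S \<Longrightarrow> \<not> \<pi> dvd x"
    "\<And>x y. x \<in> S \<Longrightarrow> y \<in> S \<Longrightarrow> \<pi> dvd x - y \<Longrightarrow> x = y"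
    using gprime_residues[OF assms(1)] by metis
  define e where "e = qexp \<pi>"
  have cS: "card S = e * 4" "e > 0"
    using S(2) qexp_eq[OF gprime_godd gprime_nonzero, OF assms(1,1)] gnorm_gprime_gt_1[OF assms(1)]
    unfolding e_def by (auto intro!: Nat.gr0I)
  let ?P = "Polynomial.monom 1 (2 * e) - 1 :: gint poly"
  have deg: "degree ?P = 2 * e"
  proof (rule antisym)
    show "degree ?P \<le> 2 * e" by (rule degree_diff_le) (auto simp: degree_monom_eq)
    show "2 * e \<le> degree ?P" by (rule le_degree) (use cS(2) in simp)
  qed
  have "\<not> [:\<pi>:] dvd ?P"
  proof
    assume "[:\<pi>:] dvd ?P"
    then have "\<pi> dvd Polynomial.coeff ?P (2 * e)" by (simp only: const_poly_dvd_iff)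
    then show False using cS(2) gprime_prime[OF assms(1)] by simp
  qed
  have "\<exists>x\<in>S. \<not> \<pi> dvd poly ?P x"
  proof (rule ccontr)
    assume "\<not> ?thesis"
    then have "card S \<le> degree ?P"
      using S by (intro root_count[OF gprime_prime_elem[OF assms(1)] \<open>\<not> [:\<pi>:] dvd ?P\<close>]) auto
    then show False using deg cS by simp
  qed
  then obtain x where x: "x \<in> S" "\<not> \<pi> dvd x ^ (2 * e) - 1"
    by (auto simp: poly_monom)
  define v where "v = qsym x \<pi>"
  have v: "v dvd 1" unfolding v_def by (rule qsym_unit[OF assms(1) S(3)[OF x(1)]])
  have "\<pi> dvd v ^ 2 - (x ^ e) ^ 2"
    unfolding v_def e_def by (intro dvd_diff_power qsym_cong_power assms)
  then have "v\<^sup>2 \<noteq> 1"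
    using x(2) by (auto simp: mult.commute[of 2] power_mult dest: dvd_diff_sym)
  then have "v = gi \<or> v = - gi" using v unfolding gunit_iff by auto
  then have "u \<in> {v ^ 0, v ^ 1, v ^ 2, v ^ 3}"
    using assms(2) unfolding gunit_iff by (auto simp: power3_eq_cube)
  then obtain k where "u = v ^ k" by blast
  moreover have "qsym (x ^ k) \<pi> = v ^ k"
    by (induction k) (auto simp: qsym_mult assms v_def)
  ultimately show ?thesis using that by metis
qed

section \<open>Gauss sums in the group ring\<close>

text \<open>The Gauss sum of a character modulo \<open>p\<close> is taken in \<open>\<int>[\<i>][X] / (X ^ p - 1)\<close>, with \<open>X\<close> in
  the place of a primitive \<open>p\<close>-th root of unity; congruences there can be read off coefficientwise.\<close>

definition cyc :: "nat \<Rightarrow> gint poly" where "cyc p = Polynomial.monom 1 p - 1"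

definition gsum :: "nat \<Rightarrow> (int \<Rightarrow> gint) \<Rightarrow> gint poly" where
  "gsum p f = (\<Sum>x<p. Polynomial.monom (f (int x)) x)"

text \<open>The coefficient at \<open>X ^ z\<close> after reduction modulo \<open>X ^ p - 1\<close>,
  provided that the cutoff \<open>N\<close> exceeds the degree. A fixed \<open>N\<close> keeps the
  sum finite and additive in \<open>P\<close>; in applications it is chosen large.\<close>

definition cycoeff :: "nat \<Rightarrow> nat \<Rightarrow> nat \<Rightarrow> gint poly \<Rightarrow> gint" where
  "cycoeff p z N P = (\<Sum>k | k < N \<and> k mod p = z mod p. Polynomial.coeff P k)"

definition periodic :: "nat \<Rightarrow> (int \<Rightarrow> 'a) \<Rightarrow> bool" where
  "periodic p f \<longleftrightarrow> (\<forall>x y. int p dvd x - y \<longrightarrow> f x = f y)"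

lemma periodicD: "periodic p f \<Longrightarrow> int p dvd x - y \<Longrightarrow> f x = f y"
  by (auto simp: periodic_def)

lemma cycoeff_diff: "cycoeff p z N (P - Q) = cycoeff p z N P - cycoeff p z N Q"
  by (simp add: cycoeff_def sum_subtractf)

lemma cycoeff_sum: "cycoeff p z N (\<Sum>x\<in>A. P x) = (\<Sum>x\<in>A. cycoeff p z N (P x))"
  unfolding cycoeff_def coeff_sum by (rule sum.swap)

lemma cycoeff_const_mult: "cycoeff p z N ([:c:] * P) = c * cycoeff p z N P"
  by (simp add: cycoeff_def sum_distrib_left)

lemma cycoeff_monom:
  "k < N \<Longrightarrow> cycoeff p z N (Polynomial.monom a k) = (if k mod p = z mod p then a else 0)"
  by (simp add: cycoeff_def)

lemma cycoeff_cyc_mult: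
  assumes "degree A + p < N"
  shows "cycoeff p z N (cyc p * A) = 0"
proof -
  have "cyc p * A = (\<Sum>i\<le>degree A. cyc p * Polynomial.monom (Polynomial.coeff A i) i)"
    by (subst (1) poly_as_sum_of_monoms[of A, symmetric]) (simp add: sum_distrib_left)
  also have "\<dots> = (\<Sum>i\<le>degree A. Polynomial.monom (Polynomial.coeff A i) (p + i) - Polynomial.monom (Polynomial.coeff A i) i)"
    by (simp add: cyc_def left_diff_distrib mult_monom)
  finally show ?thesis
    using assms by (simp add: cycoeff_sum cycoeff_diff cycoeff_monom)
qed

text \<open>Carries congruences modulo \<open>m\<close> from the group ring back to Gaussian
  integers; \<open>m = 0\<close> gives equalities. The bound \<open>N0\<close> comes from the degree
  of the cofactor of \<open>cyc p\<close>.\<close>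

lemma cycoeff_cong:
  assumes "cyc p dvd P - Q - [:m:] * B"
  obtains N0 where "\<And>N z. N \<ge> N0 \<Longrightarrow> m dvd cycoeff p z N P - cycoeff p z N Q"
proof -
  obtain A where A: "P - Q - [:m:] * B = cyc p * A" using assms ..
  have "m dvd cycoeff p z N P - cycoeff p z N Q" if "N \<ge> degree A + p + 1" for N z
  proof -
    have "cycoeff p z N P - cycoeff p z N Q - m * cycoeff p z N B = 0"
      using cycoeff_cyc_mult[of A p N z] that
      by (simp only: A[symmetric] cycoeff_diff cycoeff_const_mult)
    then show ?thesis by simp
  qed
  then show ?thesis by (rule that)
qed

lemma cycoeff_gsum: "z < p \<Longrightarrow> p \<le> N \<Longrightarrow> cycoeff p z N (gsum p f) = f (int z)"
  by (simp add: gsum_def cycoeff_sum cycoeff_monom sum.delta)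

lemma cyc_monom_mod:
  assumes "p > 0"
  shows "cyc p dvd Polynomial.monom c k - Polynomial.monom c (k mod p)"
proof -
  have "cyc p dvd Polynomial.monom 1 p ^ n - 1 ^ n" for n
    unfolding cyc_def by (intro dvd_diff_power) simp
  then have "cyc p dvd Polynomial.monom c (k mod p) * (Polynomial.monom 1 p ^ (k div p) - 1)"
    by simp
  then show ?thesis by (simp add: monom_power right_diff_distrib mult_monom)
qed

lemma sum_residues_reindex:
  fixes F :: "int \<Rightarrow> 'a :: comm_monoid_add"
  assumes "p > 0" "periodic p F" "\<And>x y. int p dvd \<phi> x - \<phi> y \<Longrightarrow> int p dvd x - y"
  shows "(\<Sum>x<p. F (\<phi> (int x))) = (\<Sum>x<p. F (int x))"
proof -
  let ?h = "\<lambda>x. nat (\<phi> (int x) mod int p)"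
  have h: "int (?h x) = \<phi> (int x) mod int p" for x using assms(1) by simp
  have "inj_on ?h {..<p}"
  proof (rule inj_onI)
    fix x y assume xy: "x \<in> {..<p}" "y \<in> {..<p}" "?h x = ?h y"
    then have "int p dvd int x - int y" using h[of x] h[of y] assms(3) by (metis mod_eq_dvd_iff)
    then have "int x mod int p = int y mod int p" by (simp add: mod_eq_dvd_iff)
    then show "x = y" using xy by simp
  qed
  moreover have "?h ` {..<p} \<subseteq> {..<p}" using assms(1) by (auto simp: nat_less_iff)
  ultimately have b: "bij_betw ?h {..<p} {..<p}"
    by (simp add: bij_betw_def endo_inj_surj)
  have "(\<Sum>x<p. F (\<phi> (int x))) = (\<Sum>x<p. F (int (?h x)))"
    unfolding h by (intro sum.cong periodicD[OF assms(2)]) (auto simp: minus_mod_eq_mult_div)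
  also have "\<dots> = (\<Sum>x<p. F (int x))" by (rule sum.reindex_bij_betw[OF b])
  finally show ?thesis .
qed

definition conv :: "nat \<Rightarrow> (int \<Rightarrow> gint) \<Rightarrow> (int \<Rightarrow> gint) \<Rightarrow> int \<Rightarrow> gint" where
  "conv p f g z = (\<Sum>x<p. f (int x) * g (z - int x))"

lemma dvd_diff_sum: "(\<And>x. x \<in> A \<Longrightarrow> (m :: 'a :: comm_ring_1) dvd f x - g x) \<Longrightarrow> m dvd sum f A - sum g A"
  by (simp add: dvd_sum flip: sum_subtractf)

lemma gsum_mult:
  assumes "p > 0" "periodic p g"
  shows "cyc p dvd gsum p f * gsum p g - gsum p (conv p f g)"
proof -
  have *: "cyc p dvd (\<Sum>y<p. Polynomial.monom (f (int x) * g (int y)) (x + y))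
                  - (\<Sum>z<p. Polynomial.monom (f (int x) * g (int z - int x)) z)" for x
  proof -
    let ?F = "\<lambda>z. Polynomial.monom (f (int x) * g (z - int x)) (nat (z mod int p))"
    have "periodic p ?F"
      unfolding periodic_def
    proof (intro allI impI)
      fix a b assume ab: "int p dvd a - b"
      then have "g (a - int x) = g (b - int x)" by (intro periodicD[OF assms(2)]) simp
      moreover have "a mod int p = b mod int p" using ab by (simp add: mod_eq_dvd_iff)
      ultimately show "?F a = ?F b" by simp
    qed
    then have "(\<Sum>y<p. ?F (int x + int y)) = (\<Sum>z<p. ?F (int z))"
      by (intro sum_residues_reindex[OF assms(1)]) auto
    also have "\<dots> = (\<Sum>z<p. Polynomial.monom (f (int x) * g (int z - int x)) z)"
      by (intro sum.cong) auto
    finally have 1: "(\<Sum>z<p. Polynomial.monom (f (int x) * g (int z - int x)) z) = (\<Sum>y<p. ?F (int x + int y))" ..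
    have "nat ((int x + int y) mod int p) = (x + y) mod p" for y
      by (metis nat_int of_nat_add of_nat_mod)
    then show ?thesis unfolding 1
      by (intro dvd_diff_sum) (simp add: cyc_monom_mod[OF assms(1)])
  qed
  have "gsum p f * gsum p g = (\<Sum>x<p. \<Sum>y<p. Polynomial.monom (f (int x) * g (int y)) (x + y))"
    unfolding gsum_def sum_product mult_monom ..
  moreover have "gsum p (conv p f g) = (\<Sum>x<p. \<Sum>z<p. Polynomial.monom (f (int x) * g (int z - int x)) z)"
    unfolding gsum_def conv_def by (subst sum.swap) (simp add: monom_sum)
  ultimately show ?thesis
    using dvd_diff_sum[OF *] by simp
qed

lemma gsum_frobenius:
  assumes "prime l"
  obtains B where "gsum p f ^ l - (\<Sum>x<p. Polynomial.monom (f (int x) ^ l) (l * x)) = [:of_nat l:] * B"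
proof -
  have "of_nat l dvd gsum p f ^ l - (\<Sum>x<p. Polynomial.monom (f (int x)) x ^ l)"
    unfolding gsum_def by (rule freshman_sum_dvd[OF assms])
  then show ?thesis using that by (auto simp: monom_power of_nat_poly mult.commute elim!: dvdE)
qed

section \<open>Multiplicative characters and Jacobi sums\<close>

definition mchar :: "nat \<Rightarrow> (int \<Rightarrow> gint) \<Rightarrow> bool" where
  "mchar p f \<longleftrightarrow> periodic p f \<and> (\<forall>x y. f (x * y) = f x * f y) \<and> (\<forall>x. f x = 0 \<longleftrightarrow> int p dvd x) \<and>
     f 1 = 1 \<and> (\<exists>g. \<not> int p dvd g \<and> f g \<noteq> 1)"

lemma mcharD:
  assumes "mchar p f"
  shows "periodic p f" "f (x * y) = f x * f y" "f x = 0 \<longleftrightarrow> int p dvd x" "f 1 = 1"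
  using assms unfolding mchar_def by blast+

lemma sum_residues_scale:
  assumes "prime p" "periodic p F" "\<not> int p dvd u"
  shows "(\<Sum>x<p. F (u * int x)) = (\<Sum>x<p. F (int x))"
proof (rule sum_residues_reindex)
  fix x y assume "int p dvd u * x - u * y"
  then have "int p dvd u * (x - y)" by (simp add: algebra_simps)
  then show "int p dvd x - y" using assms by (simp add: prime_dvd_mult_iff)
qed (use assms prime_gt_0_nat in auto)

lemma sum_mchar:
  assumes "prime p" "mchar p f"
  shows "(\<Sum>x<p. f (int x)) = 0"
proof -
  obtain g where g: "\<not> int p dvd g" "f g \<noteq> 1" using assms(2) unfolding mchar_def by blast
  have "(\<Sum>x<p. f (int x)) = (\<Sum>x<p. f (g * int x))"
    using sum_residues_scale[OF assms(1) mcharD(1)[OF assms(2)] g(1)] by simp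
  also have "\<dots> = f g * (\<Sum>x<p. f (int x))"
    by (simp add: mcharD(2)[OF assms(2)] sum_distrib_left)
  finally have "(f g - 1) * (\<Sum>x<p. f (int x)) = 0" by (simp add: algebra_simps)
  then show ?thesis using g(2) by simp
qed

text \<open>The Jacobi sum. By \<open>conv_mchar\<close> it is the factor between the convolution of
  two characters and their product.\<close>

definition jsum :: "nat \<Rightarrow> (int \<Rightarrow> gint) \<Rightarrow> (int \<Rightarrow> gint) \<Rightarrow> gint" where
  "jsum p f h = (\<Sum>x<p. f (int x) * h (1 - int x))"

lemma conv_mchar:
  assumes "prime p" "mchar p f" "mchar p h" "\<not> int p dvd z"
  shows "conv p f h z = f z * h z * jsum p f h"
proof -
  have per: "periodic p (\<lambda>x. f x * h (z - x))"
    unfolding periodic_def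
  proof (intro allI impI)
    fix x y assume "int p dvd x - y"
    then have "f x = f y" "int p dvd (z - x) - (z - y)"
      using mcharD(1)[OF assms(2)] by (auto simp: periodic_def dvd_diff_commute)
    then show "f x * h (z - x) = f y * h (z - y)"
      using mcharD(1)[OF assms(3)] by (auto simp: periodic_def)
  qed
  have "conv p f h z = (\<Sum>x<p. f (z * int x) * h (z - z * int x))"
    unfolding conv_def using sum_residues_scale[OF assms(1) per assms(4)] by simp
  also have "\<dots> = (\<Sum>x<p. f z * h z * (f (int x) * h (1 - int x)))"
  proof (intro sum.cong refl)
    fix x
    have "z - z * int x = z * (1 - int x)" by (simp add: algebra_simps)
    then show "f (z * int x) * h (z - z * int x) = f z * h z * (f (int x) * h (1 - int x))"
      by (simp only: mcharD(2)[OF assms(2)] mcharD(2)[OF assms(3)]) (simp add: algebra_simps)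
  qed
  finally show ?thesis by (simp add: jsum_def sum_distrib_left)
qed

lemma conv_mchar_0:
  assumes "mchar p f" "mchar p h" "int p dvd z"
  shows "conv p f h z = h (-1) * (\<Sum>x<p. f (int x) * h (int x))"
proof -
  have "h (z - int x) = h (-1) * h (int x)" for x
  proof -
    have "h (z - int x) = h (-1 * int x)"
      using assms(3) by (intro periodicD[OF mcharD(1)[OF assms(2)]]) simp
    then show ?thesis by (simp only: mcharD(2)[OF assms(2)])
  qed
  then show ?thesis by (simp add: conv_def sum_distrib_left algebra_simps)
qed

lemma sum_inverse_mchar:
  assumes "prime p" "mchar p f" "mchar p h" "\<And>x. \<not> int p dvd x \<Longrightarrow> f x * h x = 1"
  shows "(\<Sum>x<p. f (int x) * h (int x)) = of_nat p - 1"
proof -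
  have "f (int x) * h (int x) = (if x = 0 then 0 else 1)" if "x < p" for x
    using that assms(4)[of "int x"] mcharD(3)[OF assms(2), of 0] by (auto dest: nat_dvd_not_less)
  then have "(\<Sum>x<p. f (int x) * h (int x)) = (\<Sum>x<p. if x = 0 then 0 else 1)"
    by (intro sum.cong) auto
  also have "\<dots> = (\<Sum>x\<in>insert 0 {0<..<p}. if x = 0 then 0 else 1)"
    using prime_gt_0_nat[OF assms(1)] by (intro sum.cong) auto
  also have "\<dots> = of_nat p - 1" using prime_gt_0_nat[OF assms(1)] by (simp add: of_nat_diff)
  finally show ?thesis .
qed

text \<open>Away from the multiples of \<open>p\<close> the convolution is the constant
  \<open>jsum p f h\<close>. Its total over all residues is a product of two vanishing character
  sums, and the value at multiples of \<open>p\<close> is known, so the constant must be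
  \<open>- h (-1)\<close>.\<close>

lemma conv_inverse_mchar:
  assumes "prime p" "mchar p f" "mchar p h" "\<And>x. \<not> int p dvd x \<Longrightarrow> f x * h x = 1"
  shows "conv p f h z = h (-1) * ((if int p dvd z then of_nat p else 0) - 1)"
proof -
  have p: "p > 0" using assms(1) by (simp add: prime_gt_0_nat)
  have z: "conv p f h z = h (-1) * (of_nat p - 1)" if "int p dvd z" for z
    using conv_mchar_0[OF assms(2,3) that] sum_inverse_mchar[OF assms] by simp
  have nz: "conv p f h z = jsum p f h" if "\<not> int p dvd z" for z
    using conv_mchar[OF assms(1-3) that] assms(4)[OF that] by simp
  have "(\<Sum>z<p. conv p f h (int z)) = (\<Sum>x<p. f (int x) * (\<Sum>z<p. h (int z - int x)))"
    unfolding conv_def by (subst sum.swap) (simp add: sum_distrib_left)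
  also have "\<dots> = (\<Sum>x<p. f (int x) * (\<Sum>z<p. h (int z)))"
    using sum_residues_reindex[OF p mcharD(1)[OF assms(3)], of "\<lambda>z. z - int x" for x] by simp
  also have "\<dots> = 0" by (simp add: sum_mchar assms)
  finally have "0 = (\<Sum>z<p. conv p f h (int z))" ..
  also have "{..<p} = insert 0 {0<..<p}" using p by auto
  also have "(\<Sum>z\<in>\<dots>. conv p f h (int z)) = conv p f h 0 + (\<Sum>z\<in>{0<..<p}. conv p f h (int z))"
    by simp
  also have "(\<Sum>z\<in>{0<..<p}. conv p f h (int z)) = (\<Sum>z\<in>{0<..<p}. jsum p f h)"
    by (intro sum.cong nz refl) (auto dest: nat_dvd_not_less)
  also have "conv p f h 0 = h (-1) * (of_nat p - 1)" by (rule z) simp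
  also have "(\<Sum>z\<in>{0<..<p}. jsum p f h) = (of_nat p - 1) * jsum p f h"
    using p by (simp add: of_nat_diff)
  finally have "(of_nat p - 1) * (h (-1) + jsum p f h) = 0"
    by (simp only: distrib_left mult.commute)
  moreover have "(of_nat p :: gint) \<noteq> 1"
    using prime_gt_1_nat[OF assms(1)] by (metis less_numeral_extra(4) of_nat_eq_1_iff)
  ultimately have "jsum p f h = - h (-1)" by (simp add: eq_neg_iff_add_eq_0 add.commute)
  then show ?thesis using z[of z] nz[of z] by simp
qed


lemma conv_mchar_1: "prime p \<Longrightarrow> mchar p f \<Longrightarrow> conv p f (\<lambda>_. 1) z = 0"
  by (simp add: conv_def sum_mchar)

lemma conv_1_1: "conv p (\<lambda>_. 1) (\<lambda>_. 1) z = of_nat p"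
  by (simp add: conv_def)

lemma gsum_0: "gsum p (\<lambda>_. 0) = 0"
  by (simp add: gsum_def)

lemma gsum_const_mult: "gsum p (\<lambda>x. c * f x) = [:c:] * gsum p f"
  by (simp add: gsum_def sum_distrib_left smult_monom)

lemma gsum_delta:
  assumes "p > 0"
  shows "gsum p (\<lambda>z. (if int p dvd z then a else 0) - b) = [:a:] - [:b:] * gsum p (\<lambda>_. 1)"
proof -
  have "Polynomial.monom ((if int p dvd int x then a else 0) - b) x
      = (if x = 0 then [:a:] else 0) - Polynomial.monom b x" if "x < p" for x
    using that by (auto simp: diff_monom [symmetric] monom_0 dest: nat_dvd_not_less)
  then have "gsum p (\<lambda>z. (if int p dvd z then a else 0) - b)
      = (\<Sum>x<p. (if x = 0 then [:a:] else 0) - Polynomial.monom b x)"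
    unfolding gsum_def by (intro sum.cong) auto
  then show ?thesis
    using assms gsum_const_mult[of p b "\<lambda>_. 1"] by (simp add: sum_subtractf gsum_def)
qed

text \<open>As \<open>e < p - 1\<close>, not every nonzero residue is a root of
  \<open>X ^ e - 1\<close>. Scaling the summation variable by a non-root \<open>g\<close> multiplies
  the sum by \<open>g ^ e\<close>, so the sum vanishes modulo \<open>p\<close>.\<close>

lemma power_sum_dvd:
  assumes "prime p" "0 < e" "e < p - 1"
  shows "int p dvd (\<Sum>x<p. int x ^ e)"
proof -
  let ?P = "Polynomial.monom 1 e - 1 :: int poly"
  have deg: "degree ?P = e"
  proof (rule antisym)
    show "degree ?P \<le> e" by (rule degree_diff_le) (auto simp: degree_monom_eq)
    show "e \<le> degree ?P" by (rule le_degree) (use assms in simp)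
  qed
  have nd: "\<not> [:int p:] dvd ?P"
  proof
    assume "[:int p:] dvd ?P"
    then have "int p dvd Polynomial.coeff ?P e" by (simp only: const_poly_dvd_iff)
    then show False using assms(1,2) prime_gt_1_nat[of p] by simp
  qed
  have "\<exists>g\<in>{0<..<int p}. \<not> int p dvd poly ?P g"
  proof (rule ccontr)
    assume "\<not> ?thesis"
    then have "card {0<..<int p} \<le> degree ?P"
    proof (intro root_count[OF _ nd])
      fix x y assume xy: "x \<in> {0<..<int p}" "y \<in> {0<..<int p}" "int p dvd x - y"
      have "x mod int p = y mod int p" using xy(3) by (simp only: mod_eq_dvd_iff)
      moreover have "x mod int p = x" "y mod int p = y" using xy by simp_all
      ultimately show "x = y" by metis
    qed (use assms(1) in auto)
    then show False using deg assms(3) by simp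
  qed
  then obtain g where g: "g \<in> {0<..<int p}" "\<not> int p dvd g ^ e - 1" by (auto simp: poly_monom)
  have g': "\<not> int p dvd g" using g(1) zdvd_not_zless by auto
  \<comment> \<open>Reduced modulo \<open>p\<close>, because the substitution lemma asks for a
    periodic function, not for one that is periodic up to congruence.\<close>
  define F where "F x = x ^ e mod int p" for x
  have per: "periodic p F"
    unfolding periodic_def F_def by (auto simp: mod_eq_dvd_iff intro: dvd_diff_power)
  have "(\<Sum>x<p. F (g * int x)) = (\<Sum>x<p. F (int x))"
    by (rule sum_residues_scale[OF assms(1) per g'])
  then have "(\<Sum>x<p. (g * int x) ^ e) mod int p = (\<Sum>x<p. int x ^ e) mod int p"
    unfolding F_def by (metis mod_sum_eq)
  then have "int p dvd (\<Sum>x<p. (g * int x) ^ e) - (\<Sum>x<p. int x ^ e)" by (simp add: mod_eq_dvd_iff)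
  also have "(\<Sum>x<p. (g * int x) ^ e) - (\<Sum>x<p. int x ^ e) = (g ^ e - 1) * (\<Sum>x<p. int x ^ e)"
    by (simp add: power_mult_distrib sum_distrib_left left_diff_distrib sum_subtractf)
  finally show ?thesis using g(2) assms(1) by (simp add: prime_dvd_mult_iff)
qed

text \<open>Expanding \<open>(1 - x) ^ m\<close> leaves power sums with exponents from
  \<open>m\<close> to \<open>2 * m\<close>, strictly between 0 and
  \<open>p - 1 = 4 * m\<close>.\<close>

lemma jacobi_power_sum_dvd:
  assumes "prime p" "p = 4 * m + 1"
  shows "int p dvd (\<Sum>x<p. int x ^ m * (1 - int x) ^ m)"
proof -
  have "m > 0" using assms prime_gt_1_nat[of p] by (intro Nat.gr0I) auto
  have "(1 - x) ^ m = (\<Sum>k\<le>m. of_nat (m choose k) * (- 1) ^ k * x ^ k)" for x :: int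
    using binomial_ring[of "- x" 1 m] by (simp add: power_minus[of x] algebra_simps)
  then have "(\<Sum>x<p. int x ^ m * (1 - int x) ^ m)
     = (\<Sum>x<p. \<Sum>k\<le>m. of_nat (m choose k) * (- 1) ^ k * int x ^ (m + k))"
    by (simp add: sum_distrib_left power_add algebra_simps)
  also have "\<dots> = (\<Sum>k\<le>m. of_nat (m choose k) * (- 1) ^ k * (\<Sum>x<p. int x ^ (m + k)))"
    by (subst sum.swap) (simp add: sum_distrib_left)
  also have "int p dvd \<dots>"
    using \<open>m > 0\<close> assms by (intro dvd_sum dvd_mult power_sum_dvd) auto
  finally show ?thesis .
qed

lemma dvd_lambda_iff: "2 * (1 + gi) dvd z \<longleftrightarrow> 4 dvd gre z + gim z \<and> 4 dvd gim z - gre z"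
proof
  assume "2 * (1 + gi) dvd z"
  then show "4 dvd gre z + gim z \<and> 4 dvd gim z - gre z" by (auto elim!: dvdE)
next
  assume "4 dvd gre z + gim z \<and> 4 dvd gim z - gre z"
  then obtain a b where "gre z + gim z = 4 * a" "gim z - gre z = 4 * b" by (auto elim!: dvdE)
  then have "z = 2 * (1 + gi) * Gint a b" by (simp add: gint_eq_iff)
  then show "2 * (1 + gi) dvd z" by simp
qed

lemma gprimary_iff: "gprimary a \<longleftrightarrow> 2 * (1 + gi) dvd a - 1"
  unfolding gprimary_def dvd_lambda_iff gint_sel by presburger

section \<open>The quartic Gauss sum of a split prime\<close>

locale split_prime =
  fixes \<pi> :: gint and p :: nat
  assumes gprime: "gprime \<pi>" and norm: "gnorm \<pi> = int p" and p: "prime p" and p4: "p mod 4 = 1"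
begin

definition chi :: "int \<Rightarrow> gint" where "chi x = qsym (of_int x) \<pi>"

abbreviation rho :: "int \<Rightarrow> gint" where "rho x \<equiv> chi x ^ 2"
abbreviation chib :: "int \<Rightarrow> gint" where "chib x \<equiv> gcnj (chi x)"

lemma p_pos: "p > 1"
  by (rule prime_gt_1_nat[OF p])

lemma p_eq: "p = 4 * qexp \<pi> + 1"
  using qexp_eq[OF gprime_godd gprime_nonzero, OF gprime gprime] norm p_pos
  by (simp add: nat_diff_distrib)

lemma chi_mult: "chi (x * y) = chi x * chi y"
  by (simp add: chi_def qsym_mult gprime)

lemma chi_0_iff: "chi x = 0 \<longleftrightarrow> int p dvd x"
  unfolding chi_def using split_dvd_of_int[OF gprime norm p, of x] gprime by simp

lemma chi_unit: "\<not> int p dvd x \<Longrightarrow> chi x dvd 1"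
  unfolding chi_def using split_dvd_of_int[OF gprime norm p, of x] qsym_unit[OF gprime] by simp

lemma chi_periodic: "periodic p chi"
  unfolding periodic_def chi_def
proof (intro allI impI)
  fix x y assume "int p dvd x - y"
  then have "\<pi> dvd of_int x - of_int y"
    using split_dvd_of_int[OF gprime norm p, of "x - y"] by simp
  then show "qsym (of_int x) \<pi> = qsym (of_int y) \<pi>" by (rule qsym_cong[OF gprime])
qed

lemma chi_1 [simp]: "chi 1 = 1"
  by (simp add: chi_def gprime)

lemma chi_gen: "\<exists>g. chi g = gi"
proof -
  obtain a where a: "qsym a \<pi> = gi" using qsym_surj[OF gprime, of gi] by (auto simp: gunit_iff)
  obtain x where "\<pi> dvd a - of_int x" using split_dvd_diff_of_int[OF gprime norm p] by blast
  then show ?thesis using a qsym_cong[OF gprime] unfolding chi_def by metis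
qed

lemma mchar_chi: "mchar p chi"
  and mchar_rho: "mchar p rho"
  and mchar_chib: "mchar p chib"
proof -
  obtain g where g: "chi g = gi" using chi_gen by blast
  then have ng: "\<not> int p dvd g" using chi_0_iff[of g] by simp
  have neq: "gi \<noteq> 1" "gi\<^sup>2 \<noteq> 1" "- gi \<noteq> 1" by (auto simp: gint_eq_iff)
  have c0: "gcnj z = 0 \<longleftrightarrow> z = 0" for z by (auto simp: gint_eq_iff)
  show "mchar p chi" unfolding mchar_def
    using chi_periodic chi_mult chi_0_iff g ng neq by (intro conjI exI[of _ g]) auto
  show "mchar p rho" unfolding mchar_def
    using chi_periodic chi_mult chi_0_iff g ng neq
    by (intro conjI exI[of _ g]) (auto simp: periodic_def power_mult_distrib)
  show "mchar p chib" unfolding mchar_def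
    using chi_periodic chi_mult chi_0_iff g ng neq
    by (intro conjI exI[of _ g]) (auto simp: periodic_def c0)
qed

lemma chi_cases: "chi x \<in> {0, 1, -1, gi, -gi}"
  unfolding chi_def by (rule qsym_cases[OF gprime])

lemma rho_rho: "\<not> int p dvd x \<Longrightarrow> rho x * rho x = 1"
  using chi_unit[of x] unfolding gunit_iff by auto

lemma chi_chib: "\<not> int p dvd x \<Longrightarrow> chi x * chib x = 1"
  using gunit_gcnj chi_unit by blast

lemma chi_minus_1: "chi (-1) = 1 \<or> chi (-1) = -1"
proof -
  have "chi (-1) ^ 2 = 1" using chi_mult[of "-1" "-1"] by (simp add: power2_eq_square)
  then show ?thesis by (simp add: power2_eq_1_iff)
qed

definition J :: gint where "J = jsum p chi chi"

text \<open>At multiples of \<open>p\<close> both sides vanish, the left one as a multiple of the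
  sum over the nontrivial character \<open>rho\<close>.\<close>

lemma conv_chi_chi: "conv p chi chi z = J * rho z"
proof (cases "int p dvd z")
  case True
  then have "conv p chi chi z = chi (-1) * (\<Sum>x<p. rho (int x))"
    using conv_mchar_0[OF mchar_chi mchar_chi] by (simp add: power2_eq_square)
  then show ?thesis using sum_mchar[OF p mchar_rho] True chi_0_iff[of z] by simp
next
  case False
  then show ?thesis using conv_mchar[OF p mchar_chi mchar_chi] by (simp add: J_def power2_eq_square)
qed

lemma rho_cnj: "gcnj (rho z) = rho z"
  using chi_cases[of z] by auto

lemma conv_chib_chib: "conv p chib chib z = gcnj J * rho z"
proof -
  have gs: "gcnj (\<Sum>x\<in>A. f x) = (\<Sum>x\<in>A. gcnj (f x))" for f :: "nat \<Rightarrow> gint" and A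
    by (induction A rule: infinite_finite_induct) auto
  have "conv p chib chib z = gcnj (conv p chi chi z)"
    by (simp add: conv_def gs)
  then show ?thesis by (simp add: conv_chi_chi rho_cnj del: gcnj_power)
qed

text \<open>\<open>G\<close>, \<open>G'\<close> and \<open>R\<close> are the Gauss sums of
  \<open>chi\<close>, of its conjugate and of its square. \<open>E\<close> would be 0 for a
  primitive root of unity but is not 0 in the group ring. So \<open>D\<close> takes the place of
  \<open>p\<close>: products of Gauss sums that should be multiples of \<open>p\<close> are
  multiples of \<open>D\<close>, and \<open>D\<close> acts as \<open>p\<close> on \<open>G\<close>
  and \<open>G'\<close>.\<close>

definition "G = gsum p chi"
definition "G' = gsum p chib"
definition "R = gsum p rho"
definition "E = gsum p (\<lambda>_. 1)"
definition "D = [:of_nat p:] - E"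

lemma p0: "p > 0" using p_pos by simp

lemma GG: "cyc p dvd G * G - [:J:] * R"
  using gsum_mult[OF p0 chi_periodic, of chi]
  unfolding G_def R_def gsum_const_mult[symmetric] conv_chi_chi[abs_def] .

lemma G'G': "cyc p dvd G' * G' - [:gcnj J:] * R"
  using gsum_mult[OF p0 mcharD(1)[OF mchar_chib], of chib]
  unfolding G'_def R_def gsum_const_mult[symmetric] conv_chib_chib[abs_def] .

lemma D_eq: "D = gsum p (\<lambda>z. (if int p dvd z then of_nat p else 0) - 1)"
  unfolding gsum_delta[OF p0] D_def E_def by simp

lemma RR: "cyc p dvd R * R - D"
proof -
  have "rho (-1) = 1" using chi_minus_1 by auto
  then have "conv p rho rho = (\<lambda>z. (if int p dvd z then of_nat p else 0) - 1)"
    using conv_inverse_mchar[OF p mchar_rho mchar_rho rho_rho] by (intro ext) simp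
  then show ?thesis
    using gsum_mult[OF p0 mcharD(1)[OF mchar_rho], of rho] unfolding D_eq R_def by simp
qed

lemma GG': "cyc p dvd G * G' - [:chi (-1):] * D"
proof -
  have "chib (-1) = chi (-1)" using chi_minus_1 by auto
  then have "conv p chi chib = (\<lambda>z. chi (-1) * ((if int p dvd z then of_nat p else 0) - 1))"
    using conv_inverse_mchar[OF p mchar_chi mchar_chib chi_chib] by (intro ext) simp
  then show ?thesis
    using gsum_mult[OF p0 mcharD(1)[OF mchar_chib], of chi]
    unfolding D_eq G_def G'_def by (simp only: gsum_const_mult)
qed

lemma periodic_const: "periodic p (\<lambda>_. c)"
  by (simp add: periodic_def)

lemma GE: "cyc p dvd G * E"
proof -
  have "conv p chi (\<lambda>_. 1) = (\<lambda>_. 0)" by (intro ext conv_mchar_1 p mchar_chi)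
  then show ?thesis
    using gsum_mult[OF p0 periodic_const, of chi 1] unfolding G_def E_def by (simp add: gsum_0)
qed

lemma G'E: "cyc p dvd G' * E"
proof -
  have "conv p chib (\<lambda>_. 1) = (\<lambda>_. 0)" by (intro ext conv_mchar_1 p mchar_chib)
  then show ?thesis
    using gsum_mult[OF p0 periodic_const, of chib 1] unfolding G'_def E_def by (simp add: gsum_0)
qed

lemma EE: "cyc p dvd E * E - [:of_nat p:] * E"
proof -
  have "conv p (\<lambda>_. 1) (\<lambda>_. 1) = (\<lambda>_. of_nat p)" by (intro ext conv_1_1)
  then show ?thesis
    using gsum_mult[OF p0 periodic_const, of "\<lambda>_. 1" 1] gsum_const_mult[of p "of_nat p" "\<lambda>_. 1"]
    unfolding E_def by simp
qed

lemma GD: "cyc p dvd G * D - [:of_nat p:] * G"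
proof -
  have "G * D - [:of_nat p:] * G = - (G * E)" by (simp add: D_def right_diff_distrib)
  then show ?thesis using GE by simp
qed

lemma G'D: "cyc p dvd G' * D - [:of_nat p:] * G'"
proof -
  have "G' * D - [:of_nat p:] * G' = - (G' * E)" by (simp add: D_def right_diff_distrib)
  then show ?thesis using G'E by simp
qed

lemma DD: "cyc p dvd D * D - [:of_nat p:] * D"
proof -
  have "D * D - [:of_nat p:] * D = E * E - [:of_nat p:] * E"
    unfolding D_def by (simp add: algebra_simps)
  then show ?thesis using EE by simp
qed

lemma G4: "cyc p dvd G ^ 4 - [:J\<^sup>2:] * D"
proof -
  have "cyc p dvd (G * G) * (G * G) - ([:J:] * R) * ([:J:] * R)"
    by (intro dvd_diff_mult GG)
  moreover have "cyc p dvd [:J\<^sup>2:] * (R * R) - [:J\<^sup>2:] * D"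
    using dvd_mult[OF RR, of "[:J\<^sup>2:]"] by (simp only: right_diff_distrib)
  moreover have "([:J:] * R) * ([:J:] * R) = [:J\<^sup>2:] * (R * R)"
    by (simp add: power2_eq_square)
  ultimately show ?thesis
    using dvd_diff_trans by (metis (no_types, lifting) mult.assoc power4_eq_xxxx)
qed

text \<open>Two evaluations of \<open>(G * G') ^ 2\<close> modulo \<open>cyc p\<close>: as
  \<open>G ^ 2 * G' ^ 2\<close> it is \<open>J * gcnj J\<close> times \<open>R ^ 2\<close>, that is,
  times \<open>D\<close>; as the square of \<open>G * G'\<close> it is \<open>D ^ 2\<close>, that
  is, \<open>p\<close> times \<open>D\<close>.\<close>

lemma norm_J: "J * gcnj J = of_nat p"
proof -
  have c: "chi (-1) * chi (-1) = 1" using chi_minus_1 by auto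
  have 1: "cyc p dvd (G * G) * (G' * G') - ([:J:] * R) * ([:gcnj J:] * R)"
    by (intro dvd_diff_mult GG G'G')
  have 2: "([:J:] * R) * ([:gcnj J:] * R) = [:J * gcnj J:] * (R * R)"
    by (simp add: mult.commute)
  have 3: "cyc p dvd [:J * gcnj J:] * (R * R) - [:J * gcnj J:] * D"
    using dvd_mult[OF RR] by (simp only: right_diff_distrib[symmetric])
  have 4: "cyc p dvd (G * G') * (G * G') - ([:chi (-1):] * D) * ([:chi (-1):] * D)"
    by (intro dvd_diff_mult GG')
  have "([:chi (-1):] * D) * ([:chi (-1):] * D) = [:chi (-1) * chi (-1):] * (D * D)"
    by simp
  then have 5: "([:chi (-1):] * D) * ([:chi (-1):] * D) = D * D" unfolding c by simp
  have 6: "(G * G) * (G' * G') = (G * G') * (G * G')" by (simp add: algebra_simps)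
  have 7: "cyc p dvd [:J * gcnj J:] * (R * R) - (G * G) * (G' * G')"
    using dvd_diff_sym[OF 1] unfolding 2 .
  have 8: "cyc p dvd (G * G) * (G' * G') - D * D"
    using 4 unfolding 5 6 .
  have "cyc p dvd [:J * gcnj J:] * D - [:of_nat p:] * D"
    by (rule dvd_diff_trans[OF dvd_diff_trans[OF dvd_diff_sym[OF 3] 7] dvd_diff_trans[OF 8 DD]])
  then have "cyc p dvd [:J * gcnj J:] * D - [:of_nat p:] * D - [:0:] * 0" by simp
  then obtain N0 where N0: "\<And>N z. N \<ge> N0 \<Longrightarrow> 0 dvd cycoeff p z N ([:J * gcnj J:] * D) - cycoeff p z N ([:of_nat p:] * D)"
    by (rule cycoeff_cong) blast
  define N where "N = max N0 p"
  \<comment> \<open>The coefficient of \<open>D\<close> at \<open>X\<close> is the unit -1, so the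
    factor \<open>D\<close> can be cancelled.\<close>
  have "cycoeff p 1 N D = -1" using p_pos unfolding D_eq N_def by (subst cycoeff_gsum) auto
  then show ?thesis using N0[of N 1] by (simp add: cycoeff_const_mult N_def del: mult_pCons_left)
qed

text \<open>Modulo \<open>\<pi>\<close> the character is the power \<open>x ^ qexp \<pi>\<close>,
  which turns the Jacobi sum into the power sum of \<open>jacobi_power_sum_dvd\<close>.\<close>

lemma pi_dvd_J: "\<pi> dvd J"
proof -
  let ?m = "qexp \<pi>"
  have "\<pi> dvd J - (\<Sum>x<p. of_int (int x) ^ ?m * of_int (1 - int x) ^ ?m)"
    unfolding J_def jsum_def chi_def by (intro dvd_diff_sum dvd_diff_mult qsym_cong_power gprime)
  moreover have "(\<Sum>x<p. of_int (int x) ^ ?m * of_int (1 - int x) ^ ?m)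
      = (of_int (\<Sum>x<p. int x ^ ?m * (1 - int x) ^ ?m) :: gint)" by simp
  moreover have "\<pi> dvd of_int (\<Sum>x<p. int x ^ ?m * (1 - int x) ^ ?m)"
    unfolding split_dvd_of_int[OF gprime norm p] using jacobi_power_sum_dvd[OF p p_eq] .
  ultimately show ?thesis by (metis diff_add_cancel dvd_add)
qed

text \<open>Replacing \<open>x\<close> by \<open>1 - x\<close> pairs equal terms, and every unit is
  1 modulo \<open>1 + gi\<close>. So, with \<open>m = qexp \<pi>\<close>, the
  \<open>2 * m - 1\<close> pairs contribute \<open>2 * (2 * m - 1)\<close> modulo
  \<open>2 * (1 + gi)\<close>. The fixed point contributes a value of \<open>rho\<close>, which is 1
  or -1.\<close>

lemma J_mod: "2 * (1 + gi) dvd J - 1 \<or> 2 * (1 + gi) dvd J + 1"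
proof -
  let ?m = "qexp \<pi>"
  define t where "t x = chi (int x) * chi (1 - int x)" for x :: nat
  have m: "?m > 0" using p_eq p_pos by (intro Nat.gr0I) auto
  \<comment> \<open>\<open>4 * m + 2 - x\<close> is \<open>p + 1 - x\<close>, a natural number
    congruent to \<open>1 - x\<close>.\<close>
  have sym: "t x = t (4 * ?m + 2 - x)" if "x \<le> 4 * ?m + 2" for x
  proof -
    have "int (4 * ?m + 2 - x) - (1 - int x) = int p" "1 - int (4 * ?m + 2 - x) - int x = - int p"
      using that p_eq by simp_all
    then have "int p dvd int (4 * ?m + 2 - x) - (1 - int x)" "int p dvd 1 - int (4 * ?m + 2 - x) - int x"
      by (simp_all only: dvd_refl dvd_minus_iff)
    then have "chi (int (4 * ?m + 2 - x)) = chi (1 - int x)" "chi (1 - int (4 * ?m + 2 - x)) = chi (int x)"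
      by (auto intro!: periodicD[OF chi_periodic])
    then show ?thesis by (simp add: t_def)
  qed
  have "J = (\<Sum>x<p. t x)" by (simp add: J_def jsum_def t_def)
  \<comment> \<open>The terms at 0 and 1 vanish, and \<open>2 * m + 1 = (p + 1) / 2\<close> is the
    fixed point of the pairing; the rest are two mirrored halves.\<close>
  also have "{..<p} = insert 0 (insert 1 (insert (2 * ?m + 1) ({2..2 * ?m} \<union> {2 * ?m + 2..4 * ?m})))"
    using p_eq m by auto
  also have "(\<Sum>x\<in>\<dots>. t x) = t 0 + (t 1 + (t (2 * ?m + 1) + (\<Sum>x\<in>{2..2 * ?m} \<union> {2 * ?m + 2..4 * ?m}. t x)))"
    using m by simp
  also have "(\<Sum>x\<in>{2..2 * ?m} \<union> {2 * ?m + 2..4 * ?m}. t x) = (\<Sum>x=2..2 * ?m. t x) + (\<Sum>x=2 * ?m + 2..4 * ?m. t x)"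
    by (rule sum.union_disjoint) auto
  also have "(\<Sum>x=2 * ?m + 2..4 * ?m. t x) = (\<Sum>x=2..2 * ?m. t x)"
    by (rule sum.reindex_bij_witness[where i = "\<lambda>x. 4 * ?m + 2 - x" and j = "\<lambda>x. 4 * ?m + 2 - x"])
      (auto simp: sym[symmetric] simp del: add_2_eq_Suc add_2_eq_Suc')
  finally have "J = t 0 + (t 1 + (t (2 * ?m + 1) + ((\<Sum>x=2..2 * ?m. t x) + (\<Sum>x=2..2 * ?m. t x))))" .
  moreover have "t 0 = 0" "t 1 = 0" using chi_0_iff[of 0] by (auto simp: t_def)
  ultimately have J: "J = 2 * (\<Sum>x=2..2 * ?m. t x) + t (2 * ?m + 1)" by simp
  have tu: "1 + gi dvd t x - 1" if "x \<in> {2..2 * ?m}" for x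
  proof -
    have "\<not> int p dvd int x" "\<not> int p dvd int x - 1"
      using that p_eq by (intro zdvd_not_zless; simp)+
    then have "\<not> int p dvd int x" "\<not> int p dvd 1 - int x"
      by (simp_all add: dvd_diff_commute)
    then have "chi (int x) * chi (1 - int x) dvd 1 * 1" by (intro mult_dvd_mono chi_unit)
    then have "t x dvd 1" by (simp add: t_def)
    moreover have "- gi - 1 = (1 + gi) * (-1)" "gi - 1 = (1 + gi) * gi" "-1 - 1 = (1 + gi) * (gi - 1)"
      by (simp_all add: gint_eq_iff)
    then have "1 + gi dvd -1 - 1" "1 + gi dvd gi - 1" "1 + gi dvd - gi - 1"
      by (metis dvd_triv_left)+
    ultimately show ?thesis unfolding gunit_iff by auto
  qed
  have "1 + gi dvd (\<Sum>x=2..2 * ?m. t x) - (\<Sum>x=2..2 * ?m. 1)"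
    by (intro dvd_diff_sum tu)
  moreover have "(\<Sum>x=2..2 * ?m. 1 :: gint) = of_int (2 * int ?m - 1)" using m by (simp add: of_nat_diff)
  ultimately have "2 * (1 + gi) dvd 2 * ((\<Sum>x=2..2 * ?m. t x) - of_int (2 * int ?m - 1))"
    by (metis mult_dvd_mono dvd_refl)
  then have "2 * (1 + gi) dvd J - (of_int (4 * int ?m - 2) + t (2 * ?m + 1))"
    unfolding J by (simp add: algebra_simps)
  moreover have "2 * (1 + gi) dvd of_int (4 * int ?m)" unfolding dvd_lambda_iff by simp
  ultimately have 1: "2 * (1 + gi) dvd J - (of_int (4 * int ?m - 2) + t (2 * ?m + 1)) + of_int (4 * int ?m)"
    by (rule dvd_add)
  have "chi (1 - int (2 * ?m + 1)) = chi (int (2 * ?m + 1))"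
  proof (rule periodicD[OF chi_periodic])
    have "1 - int (2 * ?m + 1) - int (2 * ?m + 1) = - int p" using p_eq by simp
    then show "int p dvd 1 - int (2 * ?m + 1) - int (2 * ?m + 1)" by simp
  qed
  then have "t (2 * ?m + 1) = rho (int (2 * ?m + 1))" by (simp add: t_def power2_eq_square)
  moreover have "\<not> int p dvd int (2 * ?m + 1)" using m p_eq zdvd_not_zless[of "int (2 * ?m + 1)" "int p"] by auto
  then have "rho (int (2 * ?m + 1)) = 1 \<or> rho (int (2 * ?m + 1)) = -1"
  proof -
    have "u\<^sup>2 = 1 \<or> u\<^sup>2 = -1" if "u dvd 1" for u :: gint
      using that unfolding gunit_iff by auto
    then show ?thesis using chi_unit \<open>\<not> int p dvd int (2 * ?m + 1)\<close> by blast
  qed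
  ultimately have "t (2 * ?m + 1) = 1 \<or> t (2 * ?m + 1) = -1" by simp
  then show ?thesis
  proof
    assume "t (2 * ?m + 1) = 1"
    then have "2 * (1 + gi) dvd J + 1" using 1 by (simp add: algebra_simps)
    then show ?thesis ..
  next
    assume "t (2 * ?m + 1) = -1"
    then have "2 * (1 + gi) dvd J + 3" using 1 by (simp add: algebra_simps)
    moreover have "2 * (1 + gi) dvd 4" unfolding dvd_lambda_iff by simp
    ultimately have "2 * (1 + gi) dvd (J + 3) - 4" by (rule dvd_diff)
    then show ?thesis by simp
  qed
qed

text \<open>\<open>\<pi>\<close> divides \<open>J\<close> and has the same norm, so \<open>J\<close>
  is a unit times \<open>\<pi>\<close>; as \<open>\<pi>\<close> is 1 and \<open>J\<close> is 1 or -1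
  modulo \<open>2 * (1 + gi)\<close>, that unit is 1 or -1. The sign is left open because only the
  square enters.\<close>

lemma J_sq: "J\<^sup>2 = \<pi>\<^sup>2"
proof -
  obtain u where u: "J = \<pi> * u" using pi_dvd_J by blast
  have "gnorm J = int p"
    using norm_J gint_of_nat(1)[of p] unfolding mult_gcnj by (metis gint_of_int(1))
  then have "gnorm u = 1" using p0 norm unfolding u gnorm_mult by simp
  then have uu: "u dvd 1" by (simp add: gnorm_eq_1_iff)
  have "2 * (1 + gi) dvd u * (\<pi> - 1)"
    using gprime_gprimary[OF gprime] by (simp add: gprimary_iff)
  then have 1: "2 * (1 + gi) dvd J - u" by (simp add: u algebra_simps)
  then have "2 * (1 + gi) dvd (J - 1) - (J - u) \<or> 2 * (1 + gi) dvd (J + 1) - (J - u)"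
    using J_mod by (meson dvd_diff)
  then have "2 * (1 + gi) dvd u - 1 \<or> 2 * (1 + gi) dvd u + 1" by (simp add: add.commute)
  then have "u = 1 \<or> u = -1"
    using uu unfolding gunit_iff dvd_lambda_iff by auto
  then show ?thesis by (auto simp: u)
qed

text \<open>\<open>G ^ 4\<close> is \<open>\<pi> ^ 2 * D\<close>, and the factor \<open>G\<close>
  that is kept lets each \<open>D\<close> act as \<open>p\<close>.\<close>

lemma G_power: "cyc p dvd G ^ (4 * k + 1) - [:(of_nat p * \<pi>\<^sup>2) ^ k:] * G"
proof (induction k)
  case (Suc k)
  have 1: "cyc p dvd G ^ 4 * G ^ (4 * k + 1) - ([:J\<^sup>2:] * D) * ([:(of_nat p * \<pi>\<^sup>2) ^ k:] * G)"
    by (intro dvd_diff_mult G4 Suc.IH)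
  have 2: "cyc p dvd [:J\<^sup>2 * (of_nat p * \<pi>\<^sup>2) ^ k:] * (G * D) - [:J\<^sup>2 * (of_nat p * \<pi>\<^sup>2) ^ k:] * ([:of_nat p:] * G)"
    using dvd_mult[OF GD] by (simp only: right_diff_distrib[symmetric])
  have e1: "([:J\<^sup>2:] * D) * ([:(of_nat p * \<pi>\<^sup>2) ^ k:] * G) = [:J\<^sup>2 * (of_nat p * \<pi>\<^sup>2) ^ k:] * (G * D)"
    by (simp add: algebra_simps)
  have e2: "[:J\<^sup>2 * (of_nat p * \<pi>\<^sup>2) ^ k:] * ([:of_nat p:] * G) = [:(of_nat p * \<pi>\<^sup>2) ^ Suc k:] * G"
    by (simp add: J_sq algebra_simps)
  have e3: "G ^ 4 * G ^ (4 * k + 1) = G ^ (4 * Suc k + 1)"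
    unfolding power_add[symmetric] by (rule arg_cong[where f = "power G"]) simp
  show ?case using dvd_diff_trans[OF 1[unfolded e1] 2] unfolding e2 e3 .
qed simp

text \<open>\<open>G'\<close> stands in for an inverse of \<open>G\<close>: both sides evaluate
  \<open>G ^ 4 * G'\<close>, one through \<open>GG'\<close> and one through \<open>G4\<close>. The
  common factor \<open>p\<close> is cancelled only later, modulo \<open>l\<close>.\<close>

lemma G3: "cyc p dvd [:chi (-1) * of_nat p:] * G ^ 3 - [:of_nat p * \<pi>\<^sup>2:] * G'"
proof -
  have c: "chi (-1) * chi (-1) = 1" using chi_minus_1 by auto
  have 1: "cyc p dvd G ^ 4 * G' - ([:J\<^sup>2:] * D) * G'" by (intro dvd_diff_mult G4) simp
  have 2: "cyc p dvd [:J\<^sup>2:] * (G' * D) - [:J\<^sup>2:] * ([:of_nat p:] * G')"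
    using dvd_mult[OF G'D] by (simp only: right_diff_distrib[symmetric])
  have 3: "cyc p dvd G ^ 3 * (G * G') - G ^ 3 * ([:chi (-1):] * D)" by (intro dvd_diff_mult GG') simp
  have 4: "cyc p dvd ([:chi (-1):] * G\<^sup>2) * (G * D) - ([:chi (-1):] * G\<^sup>2) * ([:of_nat p:] * G)"
    using dvd_mult[OF GD] by (simp only: right_diff_distrib[symmetric])
  have e1: "G ^ 4 * G' = G ^ 3 * (G * G')" by (simp add: power4_eq_xxxx power3_eq_cube algebra_simps)
  have e2: "([:J\<^sup>2:] * D) * G' = [:J\<^sup>2:] * (G' * D)" by (simp add: algebra_simps)
  have e3: "G ^ 3 * ([:chi (-1):] * D) = ([:chi (-1):] * G\<^sup>2) * (G * D)"
    by (simp add: power3_eq_cube power2_eq_square algebra_simps)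
  have e4: "([:chi (-1):] * G\<^sup>2) * ([:of_nat p:] * G) = [:chi (-1) * of_nat p:] * G ^ 3"
    by (simp add: power3_eq_cube power2_eq_square algebra_simps)
  have e5: "[:J\<^sup>2:] * ([:of_nat p:] * G') = [:of_nat p * \<pi>\<^sup>2:] * G'"
    by (simp add: J_sq algebra_simps)
  show ?thesis using 1 2 3 4 unfolding e1 e2 e3 e4 e5 by (meson dvd_diff_sym dvd_diff_trans)
qed

lemma cycoeff_frobenius:
  assumes "prime l" "l \<noteq> p" "N > l * p"
  shows "cycoeff p l N (\<Sum>x<p. Polynomial.monom (f (int x)) (l * x)) = f 1"
proof -
  have "coprime l p" using assms p by (simp add: primes_coprime)
  have "(l * x) mod p = l mod p \<longleftrightarrow> x = 1" if "x < p" for x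
  proof -
    have "(l * x) mod p = (l * 1) mod p \<longleftrightarrow> [x = 1] (mod p)"
      using \<open>coprime l p\<close> by (metis cong_def cong_mult_lcancel_nat)
    then show ?thesis using that p_pos by (simp add: cong_def)
  qed
  then have "cycoeff p l N (\<Sum>x<p. Polynomial.monom (f (int x)) (l * x)) = (\<Sum>x<p. if x = 1 then f (int x) else 0)"
    unfolding cycoeff_sum using assms(3)
    by (intro sum.cong refl)
      (subst cycoeff_monom, auto intro: le_less_trans[OF mult_le_mono2[OF less_imp_le]])
  also have "\<dots> = f 1" using p_pos by simp
  finally show ?thesis .
qed

lemma cycoeff_gsum_periodic:
  assumes "periodic p f" "N \<ge> p"
  shows "cycoeff p z N (gsum p f) = f (int z)"
proof -
  have "cycoeff p z N (gsum p f) = cycoeff p (z mod p) N (gsum p f)" by (simp add: cycoeff_def)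
  also have "\<dots> = f (int (z mod p))" using p0 assms(2) by (intro cycoeff_gsum) auto
  also have "\<dots> = f (int z)" by (intro periodicD[OF assms(1)]) (simp add: of_nat_mod mod_eq_dvd_iff[symmetric])
  finally show ?thesis .
qed

text \<open>Compares two expressions for the coefficient of \<open>G ^ l\<close> at
  \<open>X ^ l\<close>. Raising term by term, correct modulo \<open>l\<close>, gives
  \<open>chi 1 ^ l = 1\<close>, since \<open>l * x\<close> is \<open>l\<close> modulo
  \<open>p\<close> only for \<open>x = 1\<close>; \<open>G_power\<close> gives
  \<open>(p * \<pi> ^ 2) ^ k * chi l\<close>.\<close>

lemma frobenius_1:
  assumes "prime l" "l \<noteq> p" "l = 4 * k + 1"
  shows "of_nat l dvd (of_nat p * \<pi>\<^sup>2) ^ k * chi (int l) - 1"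
proof -
  let ?F = "\<Sum>x<p. Polynomial.monom (chi (int x) ^ l) (l * x)"
  obtain B where B: "G ^ l - ?F = [:of_nat l:] * B"
    unfolding G_def by (rule gsum_frobenius[OF assms(1)])
  have "cyc p dvd [:(of_nat p * \<pi>\<^sup>2) ^ k:] * G - G ^ l"
    using G_power[of k] unfolding assms(3) by (rule dvd_diff_sym)
  then have "cyc p dvd [:(of_nat p * \<pi>\<^sup>2) ^ k:] * G - ?F - [:of_nat l:] * B"
    by (simp only: B[symmetric]) (simp add: algebra_simps)
  then obtain N0 where N0: "\<And>N z. N \<ge> N0 \<Longrightarrow> of_nat l dvd cycoeff p z N ([:(of_nat p * \<pi>\<^sup>2) ^ k:] * G) - cycoeff p z N ?F"
    by (rule cycoeff_cong) blast
  define N where "N = max N0 (l * p + 1 + p)"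
  have "cycoeff p l N ?F = chi 1 ^ l" by (intro cycoeff_frobenius assms) (simp add: N_def)
  moreover have "cycoeff p l N G = chi (int l)"
    unfolding G_def by (intro cycoeff_gsum_periodic chi_periodic) (simp add: N_def)
  ultimately show ?thesis using N0[of N l] by (simp add: cycoeff_const_mult N_def del: mult_pCons_left)
qed

text \<open>The comparison of \<open>frobenius_1\<close> again. Now \<open>G ^ l\<close> contains
  \<open>G ^ 3\<close>, which \<open>G3\<close> converts to \<open>G'\<close> after multiplication
  by \<open>chi (-1) * p\<close>; this is why the conjugate character appears.\<close>

lemma frobenius_3:
  assumes "prime l" "l \<noteq> p" "l = 4 * k + 3"
  shows "of_nat l dvd (of_nat p * \<pi>\<^sup>2) ^ k * \<pi>\<^sup>2 * chib (int l) - chi (-1)"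
proof -
  let ?F = "\<Sum>x<p. Polynomial.monom (chi (int x) ^ l) (l * x)" and ?a = "chi (-1) * of_nat p"
  let ?b = "(of_nat p * \<pi>\<^sup>2) ^ k * (of_nat p * \<pi>\<^sup>2)"
  obtain B where B: "G ^ l - ?F = [:of_nat l:] * B"
    unfolding G_def by (rule gsum_frobenius[OF assms(1)])
  have 1: "cyc p dvd G ^ (4 * k + 1) * ([:?a:] * G\<^sup>2) - ([:(of_nat p * \<pi>\<^sup>2) ^ k:] * G) * ([:?a:] * G\<^sup>2)"
    by (rule dvd_diff_mult[OF G_power]) simp
  have 2: "cyc p dvd [:(of_nat p * \<pi>\<^sup>2) ^ k:] * ([:?a:] * G ^ 3) - [:(of_nat p * \<pi>\<^sup>2) ^ k:] * ([:of_nat p * \<pi>\<^sup>2:] * G')"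
    using dvd_mult[OF G3] by (simp only: right_diff_distrib[symmetric])
  have e1: "([:(of_nat p * \<pi>\<^sup>2) ^ k:] * G) * ([:?a:] * G\<^sup>2) = [:(of_nat p * \<pi>\<^sup>2) ^ k:] * ([:?a:] * G ^ 3)"
    by (simp add: power3_eq_cube power2_eq_square algebra_simps)
  have e2: "G ^ (4 * k + 1) * ([:?a:] * G\<^sup>2) = [:?a:] * G ^ l"
  proof -
    have "G ^ l = G ^ (4 * k + 1) * G\<^sup>2" 
      unfolding assms(3) power_add[symmetric] by (rule arg_cong[where f = "power G"]) simp
    then show ?thesis by (simp add: algebra_simps)
  qed
  have e3: "[:(of_nat p * \<pi>\<^sup>2) ^ k:] * ([:of_nat p * \<pi>\<^sup>2:] * G') = [:?b:] * G'"
    by (simp add: mult.commute)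
  have "cyc p dvd [:?a:] * G ^ l - [:?b:] * G'"
    using 1 2 unfolding e1 e2 e3 by (rule dvd_diff_trans)
  then have "cyc p dvd [:?b:] * G' - [:?a:] * G ^ l" by (rule dvd_diff_sym)
  moreover have "[:?a:] * G ^ l = [:?a:] * ?F + [:of_nat l:] * ([:?a:] * B)"
  proof -
    have "G ^ l = ?F + [:of_nat l:] * B" using B by (simp add: algebra_simps)
    then show ?thesis by (simp only: distrib_left mult.left_commute)
  qed
  ultimately have "cyc p dvd [:?b:] * G' - [:?a:] * ?F - [:of_nat l:] * ([:?a:] * B)"
    by (simp only: diff_diff_eq)
  then obtain N0 where N0: "\<And>N z. N \<ge> N0 \<Longrightarrow> of_nat l dvd cycoeff p z N ([:?b:] * G') - cycoeff p z N ([:?a:] * ?F)"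
    by (rule cycoeff_cong) blast
  define N where "N = max N0 (l * p + 1 + p)"
  have "cycoeff p l N ?F = chi 1 ^ l" by (intro cycoeff_frobenius assms) (simp add: N_def)
  moreover have "cycoeff p l N G' = chib (int l)"
    unfolding G'_def by (intro cycoeff_gsum_periodic mcharD(1)[OF mchar_chib]) (simp add: N_def)
  ultimately have "of_nat l dvd ?b * chib (int l) - ?a"
    using N0[of N l] by (simp add: cycoeff_const_mult N_def del: mult_pCons_left)
  also have "?b * chib (int l) - ?a = of_nat p * ((of_nat p * \<pi>\<^sup>2) ^ k * \<pi>\<^sup>2 * chib (int l) - chi (-1))"
    by (simp add: algebra_simps)
  finally have d: "of_nat l dvd of_nat p * ((of_nat p * \<pi>\<^sup>2) ^ k * \<pi>\<^sup>2 * chib (int l) - chi (-1))" .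
  have "coprime (int p) (int l)" using assms(1,2) p by (simp add: primes_coprime)
  then obtain t where "int l dvd int p * t - 1"
    by (metis cong_iff_dvd_diff cong_solve_coprime_int)
  then have "of_int (int l) dvd (of_int (int p * t - 1) :: gint)" by (simp only: of_int_dvd_of_int_gint)
  then have t: "of_nat l dvd of_nat p * of_int t - (1 :: gint)" by simp
  define w where "w = (of_nat p * \<pi>\<^sup>2) ^ k * \<pi>\<^sup>2 * chib (int l) - chi (-1)"
  have "of_nat l dvd (of_nat p * w) * of_int t - w * (of_nat p * of_int t - 1)"
    by (rule dvd_diff[OF dvd_mult2[OF d[folded w_def]] dvd_mult[OF t]])
  then show ?thesis unfolding w_def by (simp add: algebra_simps)
qed

end

section \<open>Quartic reciprocity\<close>

lemma gi_power_even: "gi ^ (2 * n) = (-1) ^ n"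
  by (simp add: power_mult)

text \<open>For odd \<open>x\<close>, the Jacobi symbol of 2 over the absolute value of
  \<open>x\<close>. It enters as the value of \<open>rational_symbol\<close> at
  \<open>gi\<close>.\<close>

definition tsgn :: "int \<Rightarrow> gint" where "tsgn x = (if x mod 8 = 1 \<or> x mod 8 = 7 then 1 else -1)"

lemma odd_mod_8: "odd (x :: int) \<Longrightarrow> x mod 8 \<in> {1, 3, 5, 7}"
proof -
  assume "odd x"
  then have "x mod 8 = 1 \<or> x mod 8 = 3 \<or> x mod 8 = 5 \<or> x mod 8 = 7" by presburger
  then show ?thesis by auto
qed

lemma tsgn_mult:
  assumes "odd x" "odd y"
  shows "tsgn (x * y) = tsgn x * tsgn y"
proof -
  have *: "(x * y) mod 8 = ((x mod 8) * (y mod 8)) mod 8" by (rule mod_mult_eq[symmetric])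
  have "(if (u * v) mod 8 = 1 \<or> (u * v) mod 8 = 7 then 1 else -1) =
      (if u = 1 \<or> u = 7 then 1 else -1) * (if v = 1 \<or> v = 7 then 1 else (-1 :: gint))"
    if "u \<in> {1, 3, 5, 7}" "v \<in> {1, 3, 5, 7}" for u v :: int
    using that by auto
  then show ?thesis unfolding tsgn_def * using odd_mod_8 assms by blast
qed

lemma tsgn_minus: "odd x \<Longrightarrow> tsgn (- x) = tsgn x"
  unfolding tsgn_def by (intro if_cong refl) presburger

text \<open>For odd \<open>a\<close> the sign makes \<open>star a\<close> congruent to 1 modulo 4,
  hence 2-primary, and keeps it multiplicative.\<close>

definition star :: "nat \<Rightarrow> int" where "star a = (if a mod 4 = 1 then int a else - int a)"

lemma star_mult:
  assumes "odd a" "odd b"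
  shows "star (a * b) = star a * star b"
proof -
  have "(a * b) mod 4 = ((a mod 4) * (b mod 4)) mod 4" by (simp add: mod_mult_eq)
  moreover have "a mod 4 = 1 \<or> a mod 4 = 3" "b mod 4 = 1 \<or> b mod 4 = 3" using assms by presburger+
  ultimately show ?thesis unfolding star_def by auto
qed

lemma split_prime_gcnj: "split_prime \<pi> p \<Longrightarrow> split_prime (gcnj \<pi>) p"
  by (simp add: split_prime_def)

text \<open>For odd \<open>a\<close>, the function \<open>\<psi>\<close> plays the role of the Jacobi-type symbol with lower entry \<open>a\<close>,
  and the last conjunct is rational quartic reciprocity.\<close>

definition rational_symbol :: "nat \<Rightarrow> (gint \<Rightarrow> gint) \<Rightarrow> bool" where
  "rational_symbol a \<psi> \<longleftrightarrow>
     (\<forall>x y. \<psi> (x * y) = \<psi> x * \<psi> y) \<and>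
     (\<forall>x y. of_nat a dvd x - y \<longrightarrow> \<psi> x = \<psi> y) \<and>
     (\<forall>r. coprime r (int a) \<longrightarrow> \<psi> (of_int r) = 1) \<and>
     \<psi> gi = tsgn (int a) \<and>
     (\<forall>\<pi> p. split_prime \<pi> p \<and> \<not> p dvd a \<longrightarrow> qsym (of_int (star a)) \<pi> = \<psi> \<pi>)"

lemma rational_symbol_1: "rational_symbol 1 (\<lambda>_. 1)"
  by (simp add: rational_symbol_def tsgn_def star_def split_prime_def)

lemma rational_symbol_mult:
  assumes "rational_symbol a \<psi>" "rational_symbol b \<phi>" "odd a" "odd b"
  shows "rational_symbol (a * b) (\<lambda>x. \<psi> x * \<phi> x)"
  unfolding rational_symbol_def
proof (intro conjI allI impI)
  fix x y :: gint
  show "\<psi> (x * y) * \<phi> (x * y) = \<psi> x * \<phi> x * (\<psi> y * \<phi> y)"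
    using assms(1,2) unfolding rational_symbol_def by simp
  assume "of_nat (a * b) dvd x - y"
  then have "of_nat a dvd x - y" "of_nat b dvd x - y"
    by (metis dvd_mult_left dvd_mult_right of_nat_mult)+
  then show "\<psi> x * \<phi> x = \<psi> y * \<phi> y"
    using assms(1,2) unfolding rational_symbol_def by metis
next
  fix r assume "coprime r (int (a * b))"
  then show "\<psi> (of_int r) * \<phi> (of_int r) = 1"
    using assms(1,2) unfolding rational_symbol_def by simp
next
  show "\<psi> gi * \<phi> gi = tsgn (int (a * b))"
    using assms unfolding rational_symbol_def by (simp add: tsgn_mult)
next
  fix \<pi> p assume *: "split_prime \<pi> p \<and> \<not> p dvd a * b"
  then have "gprime \<pi>" by (simp add: split_prime_def)
  then show "qsym (of_int (star (a * b))) \<pi> = \<psi> \<pi> * \<phi> \<pi>"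
    using * assms unfolding rational_symbol_def star_mult[OF assms(3,4)] of_int_mult
    by (simp add: qsym_mult) (metis dvd_mult dvd_mult2)
qed

lemma unit_power4: "u dvd 1 \<Longrightarrow> u ^ 4 = (1 :: gint)"
  unfolding gunit_iff by (auto simp: power4_eq_xxxx)

text \<open>A split \<open>l\<close> is \<open>\<rho> * gcnj \<rho>\<close>, so its symbol is a
  product of two, which are conjugate units at rational arguments. In \<open>frobenius_1\<close> the
  exponent is \<open>k = qexp \<rho>\<close>; modulo \<open>\<rho>\<close> the power there is the
  symbol of \<open>p * \<pi> ^ 2 = \<pi> ^ 3 * gcnj \<pi>\<close>.\<close>

lemma rational_symbol_split:
  assumes "gprime \<rho>" "gnorm \<rho> = int l" "prime l" "l mod 4 = 1"
  shows "rational_symbol l (\<lambda>x. qsym x \<rho> * qsym x (gcnj \<rho>))"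
  unfolding rational_symbol_def
proof (intro conjI allI impI)
  have \<rho>': "gprime (gcnj \<rho>)" using assms(1) by simp
  interpret \<rho>: split_prime \<rho> l by standard (use assms in auto)
  fix x y :: gint
  show "qsym (x * y) \<rho> * qsym (x * y) (gcnj \<rho>) =
      qsym x \<rho> * qsym x (gcnj \<rho>) * (qsym y \<rho> * qsym y (gcnj \<rho>))"
    by (simp add: qsym_mult assms \<rho>')
  assume "of_nat l dvd x - y"
  then have "\<rho> dvd x - y" "gcnj \<rho> dvd x - y"
    using dvd_gnorm[of \<rho>] dvd_gnorm[of "gcnj \<rho>"] assms(2) by (auto intro: dvd_trans)
  then show "qsym x \<rho> * qsym x (gcnj \<rho>) = qsym y \<rho> * qsym y (gcnj \<rho>)"
    using qsym_cong assms(1) \<rho>' by metis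
next
  fix r assume "coprime r (int l)"
  then have "\<not> int l dvd r" using prime_gt_1_nat[OF assms(3)]
    by (metis coprime_absorb_right coprime_commute assms(3) not_prime_unit prime_int_nat_transfer prime_nat_int_transfer)
  then have "\<not> \<rho> dvd of_int r" using split_dvd_of_int assms by blast
  then have "qsym (of_int r) \<rho> * gcnj (qsym (of_int r) \<rho>) = 1"
    using gunit_gcnj qsym_unit assms by blast
  then show "qsym (of_int r) \<rho> * qsym (of_int r) (gcnj \<rho>) = 1"
    using qsym_gcnj[OF assms(1), of "of_int r"] by simp
next
  interpret \<rho>: split_prime \<rho> l by standard (use assms in auto)
  have "qsym gi \<rho> * qsym gi (gcnj \<rho>) = gi ^ (2 * qexp \<rho>)"
    using assms(1) by (simp add: qsym_of_unit gunit_iff mult_2 power_add)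
  also have "\<dots> = (-1) ^ qexp \<rho>" by (rule gi_power_even)
  also have "\<dots> = tsgn (int l)"
  proof (cases "even (qexp \<rho>)")
    case True
    then have "int l mod 8 = 1" using \<rho>.p_eq by presburger
    then show ?thesis using True by (simp add: tsgn_def)
  next
    case False
    then have "int l mod 8 = 5" using \<rho>.p_eq by presburger
    then show ?thesis using False by (simp add: tsgn_def)
  qed
  finally show "qsym gi \<rho> * qsym gi (gcnj \<rho>) = tsgn (int l)" .
next
  fix \<pi> p assume *: "split_prime \<pi> p \<and> \<not> p dvd l"
  interpret \<rho>: split_prime \<rho> l by standard (use assms in auto)
  interpret split_prime \<pi> p using * by simp
  have lp: "l \<noteq> p" using * by auto
  define a b X where "a = qsym \<pi> \<rho>" and "b = qsym \<pi> (gcnj \<rho>)" and "X = chi (int l)"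
  have nd: "\<not> \<rho> dvd \<pi>" "\<not> gcnj \<rho> dvd \<pi>"
    using lp gprime assms(1,2) norm gprime_dvd_gprime[of \<rho> \<pi>] gprime_dvd_gprime[of "gcnj \<rho>" \<pi>]
    by auto
  have ab: "a dvd 1" "b dvd 1" unfolding a_def b_def using nd assms(1) by (auto intro: qsym_unit)
  have "l = 4 * qexp \<rho> + 1" by (rule \<rho>.p_eq)
  then have "of_nat l dvd (of_nat p * \<pi>\<^sup>2) ^ qexp \<rho> * chi (int l) - 1"
    by (intro frobenius_1 assms(3) lp)
  then have 1: "\<rho> dvd (of_nat p * \<pi>\<^sup>2) ^ qexp \<rho> * X - 1"
    using dvd_gnorm[of \<rho>] assms(2) dvd_trans unfolding X_def by auto
  have "\<rho> dvd qsym (of_nat p * \<pi>\<^sup>2) \<rho> * X - (of_nat p * \<pi>\<^sup>2) ^ qexp \<rho> * X"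
    by (intro dvd_diff_mult qsym_cong_power assms(1)) simp
  then have 2: "\<rho> dvd qsym (of_nat p * \<pi>\<^sup>2) \<rho> * X - 1" using 1 by (rule dvd_diff_trans)
  have pp: "of_nat p = \<pi> * gcnj \<pi>" by (simp add: mult_gcnj norm)
  have "qsym (gcnj \<pi>) \<rho> = gcnj b"
    unfolding b_def using qsym_gcnj[of "gcnj \<rho>" \<pi>] assms(1) by simp
  then have 3: "qsym (of_nat p * \<pi>\<^sup>2) \<rho> = a ^ 3 * gcnj b"
    unfolding pp by (simp add: qsym_mult assms(1) a_def power3_eq_cube power2_eq_square algebra_simps)
  have Xu: "X dvd 1"
    unfolding X_def using lp p assms(3) by (intro chi_unit) (auto dest: primes_dvd_imp_eq)
  have "gcnj b dvd 1" using gcnj_dvd[of b 1] ab by simp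
  then have "a ^ 3 * gcnj b * X dvd 1"
    using ab Xu by (simp add: is_unit_power_iff is_unit_mult_iff)
  then have "a ^ 3 * gcnj b * X = 1"
    using gunit_dvd_diff[OF assms(1) _ _ 2[unfolded 3]] by simp
  then have "(a ^ 3 * gcnj b * X) * (a * b) = a * b" by simp
  then have "(a ^ 4 * (b * gcnj b)) * X = a * b" by (simp add: power4_eq_xxxx power3_eq_cube algebra_simps)
  then have "X = a * b" using unit_power4[OF ab(1)] gunit_gcnj[OF ab(2)] by simp
  then show "qsym (of_int (star l)) \<pi> = qsym \<pi> \<rho> * qsym \<pi> (gcnj \<rho>)"
    using assms(4) by (simp add: X_def star_def chi_def a_def b_def)
qed

lemma qexp_inert:
  assumes "q = 4 * k + 3"
  shows "qexp (- of_nat q) = 4 * k\<^sup>2 + 6 * k + 2"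
proof -
  have "nat (gnorm (- of_nat q :: gint) - 1) = q * q - 1"
    by (simp add: gnorm_of_nat power2_eq_square nat_diff_distrib flip: of_nat_mult)
  also have "q * q - 1 = (4 * k\<^sup>2 + 6 * k + 2) * 4"
    unfolding assms by (simp add: power2_eq_square algebra_simps)
  finally show ?thesis by (simp add: qexp_def)
qed

text \<open>Modulo \<open>l\<close>, \<open>p = \<pi> * gcnj \<pi>\<close> is
  \<open>\<pi> ^ (l + 1)\<close> by Frobenius, which makes the power in \<open>frobenius_3\<close>
  exactly \<open>\<pi> ^ qexp (- l)\<close>. The factor \<open>chi (-1)\<close> supplies the sign of
  \<open>star l = - l\<close>.\<close>

lemma rational_symbol_inert:
  assumes "prime l" "l mod 4 = 3" "gprime (- of_nat l)"
  shows "rational_symbol l (\<lambda>x. qsym x (- of_nat l))"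
  unfolding rational_symbol_def
proof (intro conjI allI impI)
  fix x y :: gint
  show "qsym (x * y) (- of_nat l) = qsym x (- of_nat l) * qsym y (- of_nat l)"
    by (rule qsym_mult[OF assms(3)])
  assume "of_nat l dvd x - y"
  then show "qsym x (- of_nat l) = qsym y (- of_nat l)"
    by (intro qsym_cong assms(3)) simp
next
  fix r assume "coprime r (int l)"
  then have "\<not> int l dvd r"
    by (metis coprime_absorb_right coprime_commute assms(1) not_prime_unit prime_int_nat_transfer prime_nat_int_transfer)
  then show "qsym (of_int r) (- of_nat l) = 1"
    by (intro qsym_of_rational_inert assms)
next
  define k where "k = l div 4"
  have k: "l = 4 * k + 3" using assms(2) unfolding k_def by presburger
  have "qsym gi (- of_nat l) = gi ^ (2 * (2 * k\<^sup>2 + 3 * k + 1))"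
    using qsym_of_unit[OF assms(3), of gi] qexp_inert[OF k] by (simp add: gunit_iff algebra_simps)
  also have "\<dots> = (-1) ^ (2 * k\<^sup>2 + 3 * k + 1)" by (rule gi_power_even)
  also have "\<dots> = tsgn (int l)"
  proof (cases "even k")
    case True
    then have "int l mod 8 = 3" using k by presburger
    then show ?thesis using True by (simp add: tsgn_def)
  next
    case False
    then have "int l mod 8 = 7" using k by presburger
    then show ?thesis using False by (simp add: tsgn_def)
  qed
  finally show "qsym gi (- of_nat l) = tsgn (int l)" .
next
  fix \<pi> p assume *: "split_prime \<pi> p \<and> \<not> p dvd l"
  interpret split_prime \<pi> p using * by simp
  have lp: "l \<noteq> p" using * by auto
  define k where "k = l div 4"
  have k: "l = 4 * k + 3" using assms(2) unfolding k_def by presburger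
  let ?l = "- of_nat l :: gint"
  have f: "?l dvd (of_nat p * \<pi>\<^sup>2) ^ k * \<pi>\<^sup>2 * chib (int l) - chi (-1)"
    using frobenius_3[OF assms(1) lp k] by simp
  have "?l dvd \<pi> * \<pi> ^ l - \<pi> * gcnj \<pi>"
    using inert_frobenius[OF assms(1,2), of \<pi>] by (intro dvd_diff_mult) auto
  then have "?l dvd \<pi> ^ (l + 1) - of_nat p" by (simp add: mult_gcnj norm)
  then have "?l dvd (\<pi> ^ (l + 1) * \<pi>\<^sup>2) ^ k * \<pi>\<^sup>2 * chib (int l) - (of_nat p * \<pi>\<^sup>2) ^ k * \<pi>\<^sup>2 * chib (int l)"
    by (intro dvd_diff_mult dvd_diff_power) auto
  moreover have "(\<pi> ^ (l + 1) * \<pi>\<^sup>2) ^ k * \<pi>\<^sup>2 = \<pi> ^ qexp ?l"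
  proof -
    have "(\<pi> ^ (l + 1) * \<pi>\<^sup>2) ^ k * \<pi>\<^sup>2 = \<pi> ^ ((l + 1 + 2) * k + 2)"
      by (simp only: power_add power_mult)
    also have "(l + 1 + 2) * k + 2 = qexp ?l"
      unfolding qexp_inert[OF k] unfolding k by (simp add: power2_eq_square algebra_simps)
    finally show ?thesis .
  qed
  ultimately have "?l dvd \<pi> ^ qexp ?l * chib (int l) - chi (-1)" using f by (metis dvd_diff_trans)
  moreover have "?l dvd qsym \<pi> ?l * chib (int l) - \<pi> ^ qexp ?l * chib (int l)"
    by (rule dvd_diff_mult[OF qsym_cong_power[OF assms(3)]]) simp
  ultimately have d: "?l dvd qsym \<pi> ?l * chib (int l) - chi (-1)" by (rule dvd_diff_trans[rotated])
  have cu: "chi (int l) dvd 1" using lp p assms(1) by (intro chi_unit) (auto dest: primes_dvd_imp_eq)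
  then have cbu: "chib (int l) dvd 1" using gcnj_dvd[of "chi (int l)" 1] by simp
  have "?l \<noteq> \<pi>"
  proof
    assume "?l = \<pi>"
    then have "gnorm (- of_nat l :: gint) = int p" using norm by simp
    then have "int p = int l * int l" by (simp add: gnorm_of_nat power2_eq_square)
    then have "p = l * l" by (metis of_nat_eq_iff of_nat_mult)
    then show False using p prime_product[of l l] prime_gt_1_nat[OF assms(1)] by auto
  qed
  then have "\<not> ?l dvd \<pi>" using gprime_dvd_gprime[OF assms(3) gprime] by simp
  then have qu: "qsym \<pi> ?l dvd 1" by (rule qsym_unit[OF assms(3)])
  have "chi (-1) dvd 1" using chi_minus_1 by auto
  then have "qsym \<pi> ?l * chib (int l) = chi (-1)"
    using gunit_dvd_diff[OF assms(3) _ _ d] qu cbu by (simp add: is_unit_mult_iff)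
  then have "qsym \<pi> ?l * chib (int l) * chi (int l) = chi (-1) * chi (int l)" by simp
  then have "qsym \<pi> ?l * (chi (int l) * chib (int l)) = chi (-1 * int l)"
    unfolding chi_mult by (simp add: algebra_simps)
  then have "qsym \<pi> ?l = chi (- int l)" using gunit_gcnj[OF cu] by simp
  then show "qsym (of_int (star l)) \<pi> = qsym \<pi> (- of_nat l)"
    using assms(2) by (simp add: star_def chi_def)
qed

lemma rational_symbol_exists:
  assumes "odd a"
  shows "\<exists>\<psi>. rational_symbol a \<psi>"
  using assms
proof (induction a rule: prime_divisors_induct)
  case (unit a)
  then show ?case using rational_symbol_1 by auto
next
  case (factor l a)
  then have "odd l" "odd a" by auto
  then obtain \<psi> where \<psi>: "rational_symbol a \<psi>" using factor.IH by blast
  obtain \<rho> where \<rho>: "gprime \<rho>" "l mod 4 = 1 \<and> gnorm \<rho> = int l \<or> l mod 4 = 3 \<and> \<rho> = - of_nat l"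
    using gprime_of_rational[OF factor.hyps \<open>odd l\<close>] by blast
  then obtain \<phi> where "rational_symbol l \<phi>"
    using rational_symbol_split[OF \<rho>(1)] rational_symbol_inert factor.hyps by blast
  then show ?case using rational_symbol_mult \<psi> \<open>odd l\<close> \<open>odd a\<close> by blast
qed simp

text \<open>The 2-primary elements congruent to \<open>3 + 2i\<close>, as opposed to 1, modulo 4.\<close>

definition gtwisted :: "gint \<Rightarrow> bool" where "gtwisted a \<longleftrightarrow> gim a mod 4 = 2"

lemma gprimary_gre_mod4:
  assumes "gprimary a"
  shows "gre a mod 4 = (if gtwisted a then 3 else 1)" "gim a mod 4 = (if gtwisted a then 2 else 0)"
  using assms unfolding gprimary_def gtwisted_def by presburger+

text \<open>For a prime \<open>a\<close>, \<open>(-1) ^ qexp a\<close> is the symbol of -1 modulo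
  \<open>a\<close>; so -1 has symbol -1 exactly at the twisted primes.\<close>

lemma qexp_parity:
  assumes "gprimary a"
  shows "odd (qexp a) \<longleftrightarrow> gtwisted a"
proof -
  have "a \<noteq> 0" using gprimary_imp_godd[OF assms] by auto
  have "odd (gre a)" "even (gim a)" using assms unfolding gprimary_def by presburger+
  then obtain x y where xy: "gre a = 2 * x + 1" "gim a = 2 * y" by (auto elim!: oddE evenE)
  have "even (x * (x + 1))" by simp
  then obtain z where z: "x * (x + 1) = 2 * z" by (rule evenE)
  have "gnorm a - 1 = 4 * (x * (x + 1)) + 4 * y\<^sup>2"
    by (simp add: gnorm_def xy power2_eq_square algebra_simps)
  also have "\<dots> = 4 * (2 * z + y\<^sup>2)" unfolding z by simp
  finally have "int (qexp a) * 4 = 4 * (2 * z + y\<^sup>2)"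
    using qexp_eq[OF gprimary_imp_godd[OF assms] \<open>a \<noteq> 0\<close>] gnorm_pos[of a] \<open>a \<noteq> 0\<close>
    by (metis (no_types, lifting) int_nat_eq int_one_le_iff_zero_less diff_ge_0_iff_ge of_nat_mult of_nat_numeral)
  then have "int (qexp a) = 2 * z + y\<^sup>2" by simp
  then have "odd (int (qexp a)) \<longleftrightarrow> odd y" by simp
  moreover have "gtwisted a \<longleftrightarrow> odd y" unfolding gtwisted_def xy by presburger
  ultimately show ?thesis by simp
qed

lemma gtwisted_mult:
  assumes "gprimary a" "gprimary b"
  shows "gtwisted (a * b) \<longleftrightarrow> gtwisted a \<noteq> gtwisted b"
proof -
  have "gim (a * b) mod 4 = ((gre a mod 4) * (gim b mod 4) + (gim a mod 4) * (gre b mod 4)) mod 4"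
    unfolding gint_sel by (metis (no_types) mod_add_eq mod_mult_eq)
  then show ?thesis
    unfolding gtwisted_def[of "a * b"] gprimary_gre_mod4[OF assms(1)] gprimary_gre_mod4[OF assms(2)] by auto
qed

lemma gtwisted_gcnj: "gtwisted (gcnj a) = gtwisted a"
  unfolding gtwisted_def gcnj_sel by presburger

definition sgnt :: "gint \<Rightarrow> gint" where "sgnt a = (if gtwisted a then -1 else 1)"

lemma real_part_star:
  assumes "gprimary a"
  shows "of_int (gre a) = sgnt a * of_int (star (nat \<bar>gre a\<bar>))"
proof -
  have g: "gre a mod 4 = (if gtwisted a then 3 else 1)" by (rule gprimary_gre_mod4[OF assms])
  show ?thesis
  proof (cases "gre a" rule: int_cases2)
    case (nonneg n)
    have "int n mod 4 = 1 \<longleftrightarrow> n mod 4 = 1" by presburger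
    then show ?thesis using g nonneg by (auto simp: sgnt_def star_def)
  next
    case (nonpos n)
    have "(- int n) mod 4 = 3 \<longleftrightarrow> n mod 4 = 1" by presburger
    then show ?thesis using g nonpos by (auto simp: sgnt_def star_def)
  qed
qed

lemma odd_gre: "gprimary a \<Longrightarrow> odd (gre a)"
  unfolding gprimary_def by presburger

text \<open>Modulo \<open>gre a\<close>, the element \<open>a\<close> is \<open>gi * gim a\<close>.
  The rational factor is coprime to the modulus and has symbol 1, so only the symbol of
  \<open>gi\<close> remains.\<close>

lemma rational_symbol_real_part:
  assumes "gprimary a" "coprime (gre a) (gim a)" "rational_symbol (nat \<bar>gre a\<bar>) \<psi>"
  shows "\<psi> a = tsgn (gre a)"
proof -
  let ?n = "nat \<bar>gre a\<bar>"
  have "of_int \<bar>gre a\<bar> dvd (of_int (gre a) :: gint)"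
    by (simp only: of_int_dvd_of_int_gint abs_dvd_iff dvd_refl)
  then have "of_nat ?n dvd (of_int (gre a) :: gint)" by simp
  moreover have "a - of_int (gim a) * gi = of_int (gre a)" by (simp add: gint_eq_iff)
  ultimately have "of_nat ?n dvd a - of_int (gim a) * gi" by simp
  then have "\<psi> a = \<psi> (of_int (gim a) * gi)"
    using assms(3) unfolding rational_symbol_def by blast
  also have "\<dots> = \<psi> (of_int (gim a)) * \<psi> gi"
    using assms(3) unfolding rational_symbol_def by blast
  also have "\<psi> (of_int (gim a)) = 1"
    using assms(2,3) unfolding rational_symbol_def by (simp add: coprime_commute)
  also have "\<psi> gi = tsgn (int ?n)" using assms(3) unfolding rational_symbol_def by blast
  also have "\<dots> = tsgn (gre a)"
    using tsgn_minus[of "gre a"] odd_gre[OF assms(1)] by (cases "gre a \<ge> 0") auto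
  finally show ?thesis by simp
qed

lemma sgnt_qsym: "gprime \<pi> \<Longrightarrow> qsym (sgnt a) \<pi> = (if gtwisted a \<and> gtwisted \<pi> then -1 else 1)"
  using qsym_of_unit[of \<pi> "sgnt a"] qexp_parity[OF gprime_gprimary, of \<pi>] by (auto simp: sgnt_def)

section \<open>From one rational entry to two arbitrary primes\<close>

context split_prime
begin

lemma gim_nonzero: "gim \<pi> \<noteq> 0"
proof
  assume "gim \<pi> = 0"
  then have "int p = (gre \<pi>)\<^sup>2" using norm by (simp add: gnorm_def)
  then have "p = nat \<bar>gre \<pi>\<bar> * nat \<bar>gre \<pi>\<bar>"
    by (metis abs_mult_self_eq nat_int nat_mult_distrib abs_ge_zero power2_eq_square)
  then show False using p prime_product[of "nat \<bar>gre \<pi>\<bar>" "nat \<bar>gre \<pi>\<bar>"] p_pos by auto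
qed

lemma gcnj_neq: "gcnj \<pi> \<noteq> \<pi>"
  using gim_nonzero by (auto simp: gint_eq_iff)

lemma coprime_parts: "coprime (gre \<pi>) (gim \<pi>)"
proof (rule coprimeI)
  fix c assume "c dvd gre \<pi>" "c dvd gim \<pi>"
  then have "of_int c dvd \<pi>" by (simp add: of_int_dvd_gint_iff)
  then have "c\<^sup>2 dvd int p" using gnorm_dvd norm by (metis gnorm_of_int)
  then have "nat \<bar>c\<bar> * nat \<bar>c\<bar> dvd p"
    by (simp add: power2_eq_square nat_abs_mult_distrib[symmetric] flip: int_dvd_int_iff)
  have "nat \<bar>c\<bar> = 1"
  proof (rule ccontr)
    assume "nat \<bar>c\<bar> \<noteq> 1"
    moreover have "nat \<bar>c\<bar> dvd p" using \<open>nat \<bar>c\<bar> * nat \<bar>c\<bar> dvd p\<close> by (rule dvd_mult_left)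
    ultimately have "nat \<bar>c\<bar> = p" using p unfolding prime_nat_iff by blast
    then have "p * p \<le> p" using \<open>nat \<bar>c\<bar> * nat \<bar>c\<bar> dvd p\<close> p0 by (auto dest: dvd_imp_le)
    then show False using p_pos by simp
  qed
  then show "is_unit c" by auto
qed

lemma gre_not_dvd: "\<not> int p dvd gre \<pi>"
proof
  assume d: "int p dvd gre \<pi>"
  have "(gim \<pi>)\<^sup>2 = int p - (gre \<pi>)\<^sup>2" using norm by (simp add: gnorm_def)
  then have "int p dvd (gim \<pi>)\<^sup>2" using d by (simp add: power2_eq_square)
  then have "int p dvd gim \<pi>" using p by (metis prime_dvd_power prime_nat_int_transfer)
  then show False using d coprime_parts p_pos
    by (metis coprime_common_divisor p not_prime_unit prime_nat_int_transfer)
qed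

text \<open>Rational reciprocity turns the symbol of \<open>gre \<pi>\<close> at
  \<open>\<pi>\<close> into that of \<open>\<pi>\<close> at \<open>gre \<pi>\<close>, known from
  \<open>rational_symbol_real_part\<close>. The factor \<open>sgnt \<pi>\<close> is the symbol of
  the sign between \<open>gre \<pi>\<close> and the \<open>star\<close> of its absolute
  value.\<close>

lemma qsym_real_part:
  "qsym (of_int (gre \<pi>)) \<pi> = sgnt \<pi> * tsgn (gre \<pi>)"
proof -
  let ?n = "nat \<bar>gre \<pi>\<bar>"
  note pr = gprime_gprimary[OF gprime]
  have "odd ?n" using odd_gre[OF pr] by (simp add: even_nat_iff)
  then obtain \<psi> where \<psi>: "rational_symbol ?n \<psi>" using rational_symbol_exists by blast
  have "\<not> p dvd ?n" using gre_not_dvd by (simp add: int_dvd_int_iff[symmetric])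
  then have "qsym (of_int (star ?n)) \<pi> = \<psi> \<pi>"
    using \<psi> split_prime_axioms unfolding rational_symbol_def by blast
  also have "\<dots> = tsgn (gre \<pi>)"
    by (rule rational_symbol_real_part[OF pr coprime_parts \<psi>])
  finally show ?thesis
    unfolding real_part_star[OF pr] qsym_mult[OF gprime] by (simp add: sgnt_qsym gprime) (simp add: sgnt_def)
qed

end

text \<open>A common rational prime factor is odd, and for a prime \<open>\<rho>\<close> above it
  both \<open>\<rho>\<close> and \<open>gcnj \<rho>\<close> divide
  \<open>gcnj \<pi> * \<theta>\<close>. By unique factorization this forces
  \<open>\<pi> = \<theta>\<close> or one of the two to equal its own conjugate.\<close>

lemma split_product_coprime_parts:
  assumes "split_prime \<pi> p" "split_prime \<theta> r" "\<pi> \<noteq> \<theta>"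
  shows "coprime (gre (gcnj \<pi> * \<theta>)) (gim (gcnj \<pi> * \<theta>))"
proof (rule ccontr)
  interpret \<pi>: split_prime \<pi> p by (rule assms)
  interpret \<theta>: split_prime \<theta> r by (rule assms)
  define A B where "A = gre (gcnj \<pi> * \<theta>)" and "B = gim (gcnj \<pi> * \<theta>)"
  assume "\<not> coprime (gre (gcnj \<pi> * \<theta>)) (gim (gcnj \<pi> * \<theta>))"
  then have "gcd A B \<noteq> 1" by (simp add: A_def B_def coprime_iff_gcd_eq_1)
  then have "nat (gcd A B) \<noteq> 1" by simp
  then obtain l where l: "prime l" "l dvd nat (gcd A B)" using prime_factor_nat by blast
  then have "int l dvd gcd A B" by (simp add: int_dvd_int_iff[symmetric])
  then have "int l dvd A" "int l dvd B" by auto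
  then have dvd: "of_nat l dvd gcnj \<pi> * \<theta>"
    using of_int_dvd_gint_iff[of "int l" "gcnj \<pi> * \<theta>"] unfolding A_def B_def by (simp del: gint_sel gcnj_sel)
  have "gprimary (gcnj \<pi> * \<theta>)" using \<pi>.gprime \<theta>.gprime gprime_gprimary by (simp add: gprimary_mult)
  then have "odd A" unfolding A_def by (rule odd_gre)
  then have "odd l" using \<open>int l dvd A\<close> by (metis dvd_trans even_of_nat)
  obtain \<rho> where \<rho>: "gprime \<rho>" "\<rho> dvd of_nat l"
    "l mod 4 = 1 \<and> gnorm \<rho> = int l \<or> l mod 4 = 3 \<and> \<rho> = - of_nat l"
    by (rule gprime_of_rational[OF l(1) \<open>odd l\<close>])
  have "gcnj \<rho> dvd gcnj (of_nat l)" using \<rho>(2) by (simp only: gcnj_dvd)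
  then have "\<rho> dvd gcnj \<pi> * \<theta>" "gcnj \<rho> dvd gcnj \<pi> * \<theta>" using dvd \<rho>(2) dvd_trans by auto
  then have "\<rho> = gcnj \<pi> \<or> \<rho> = \<theta>" "gcnj \<rho> = gcnj \<pi> \<or> gcnj \<rho> = \<theta>"
    using \<rho>(1) \<pi>.gprime \<theta>.gprime by (auto simp: gprime_dvd_mult gprime_dvd_gprime)
  then show False
    using \<pi>.gcnj_neq \<theta>.gcnj_neq assms(3) by (metis gcnj_simps(7))
qed

text \<open>The rational integer \<open>A = gre (gcnj \<pi> * \<theta>)\<close> links the two
  symbols; the symbols of \<open>gre \<pi>\<close> and \<open>gre \<theta>\<close> are known from
  \<open>qsym_real_part\<close>, and those of \<open>A\<close> at \<open>gcnj \<pi>\<close> and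
  \<open>\<theta>\<close> together from rational reciprocity for
  \<open>gcnj \<pi> * \<theta>\<close>.\<close>

lemma reciprocity_split:
  assumes "split_prime \<pi> p" "split_prime \<theta> r" "\<pi> \<noteq> \<theta>"
  shows "qsym \<pi> \<theta> = (if gtwisted \<pi> \<and> gtwisted \<theta> then - qsym \<theta> \<pi> else qsym \<theta> \<pi>)"
proof -
  interpret \<pi>: split_prime \<pi> p by (rule assms)
  interpret \<theta>: split_prime \<theta> r by (rule assms)
  interpret \<pi>': split_prime "gcnj \<pi>" p by (rule split_prime_gcnj[OF assms(1)])
  note pr = gprime_gprimary[OF \<pi>.gprime] gprime_gprimary[OF \<theta>.gprime]
  define z where "z = gcnj \<pi> * \<theta>"
  have z: "gprimary z" using pr by (simp add: z_def gprimary_mult)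
  have cz: "coprime (gre z) (gim z)" unfolding z_def by (rule split_product_coprime_parts[OF assms])
  define a c where "a = gre \<pi>" and "c = gre \<theta>"
  define A where "A = gre z"
  \<comment> \<open>Since \<open>2 * A = gcnj \<pi> * \<theta> + \<pi> * gcnj \<theta>\<close> and
    \<open>gcnj \<theta> = 2 * c - \<theta>\<close>, one expects \<open>A\<close> to be
    \<open>c * \<pi>\<close> modulo \<open>\<theta>\<close>; the identity displays the exact
    multiple of \<open>\<theta>\<close>.\<close>
  have "of_int A - of_int c * \<pi> = \<theta> * (- gi * of_int (gim \<pi>))"
    by (simp add: A_def z_def c_def gint_eq_iff algebra_simps)
  then have "\<theta> dvd of_int A - of_int c * \<pi>" by simp
  then have 1: "qsym (of_int A) \<theta> = qsym (of_int c) \<theta> * qsym \<pi> \<theta>"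
    using qsym_cong[OF \<theta>.gprime] qsym_mult[OF \<theta>.gprime] by metis
  have "of_int A - of_int a * \<theta> = \<pi> * (- gi * of_int (gim \<theta>))"
    by (simp add: A_def z_def a_def gint_eq_iff algebra_simps)
  then have "\<pi> dvd of_int A - of_int a * \<theta>" by simp
  then have 2: "qsym (of_int A) \<pi> = qsym (of_int a) \<pi> * qsym \<theta> \<pi>"
    using qsym_cong[OF \<pi>.gprime] qsym_mult[OF \<pi>.gprime] by metis
  have nd: "\<not> \<pi> dvd \<theta>" "\<not> \<theta> dvd \<pi>"
    using assms(3) \<pi>.gprime \<theta>.gprime by (auto simp: gprime_dvd_gprime)
  have ra: "qsym (of_int a) \<pi> = sgnt \<pi> * tsgn a" unfolding a_def by (rule \<pi>.qsym_real_part)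
  have rc: "qsym (of_int c) \<theta> = sgnt \<theta> * tsgn c" unfolding c_def by (rule \<theta>.qsym_real_part)
  have unz: "sgnt x \<noteq> 0" "tsgn y \<noteq> 0" for x y by (auto simp: sgnt_def tsgn_def)
  have "qsym (of_int A) \<theta> \<noteq> 0" "qsym (of_int A) \<pi> \<noteq> 0"
    unfolding 1 2 ra rc using nd \<pi>.gprime \<theta>.gprime unz by auto
  then have ndA: "\<not> int r dvd A" "\<not> int p dvd A"
    using \<pi>.gprime \<theta>.gprime split_dvd_of_int[OF \<pi>.gprime \<pi>.norm \<pi>.p] split_dvd_of_int[OF \<theta>.gprime \<theta>.norm \<theta>.p]
    by auto
  let ?n = "nat \<bar>A\<bar>"
  have "odd ?n" using odd_gre[OF z] by (simp add: A_def even_nat_iff del: gint_sel)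
  then obtain \<psi> where \<psi>: "rational_symbol ?n \<psi>" using rational_symbol_exists by blast
  have ndn: "\<not> r dvd ?n" "\<not> p dvd ?n" using ndA by (simp_all add: int_dvd_int_iff[symmetric])
  have s1: "qsym (of_int (star ?n)) \<theta> = \<psi> \<theta>" "qsym (of_int (star ?n)) (gcnj \<pi>) = \<psi> (gcnj \<pi>)"
    using \<psi> ndn \<theta>.split_prime_axioms \<pi>'.split_prime_axioms unfolding rational_symbol_def by blast+
  have s2: "\<psi> (gcnj \<pi>) * \<psi> \<theta> = tsgn A"
    using rational_symbol_real_part[OF z cz] \<psi> unfolding A_def z_def rational_symbol_def by metis
  have Ae: "of_int A = sgnt z * of_int (star ?n)" unfolding A_def by (rule real_part_star[OF z])
  have tz: "gtwisted z \<longleftrightarrow> gtwisted \<pi> \<noteq> gtwisted \<theta>"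
    unfolding z_def using pr by (simp add: gtwisted_mult gtwisted_gcnj)
  \<comment> \<open>The prime \<open>gcnj \<pi>\<close> enters because \<open>A\<close> is the real
    part of \<open>gcnj \<pi> * \<theta>\<close>; as \<open>A\<close> is rational, its symbol there
    is the conjugate of the one at \<open>\<pi>\<close>.\<close>
  have "qsym (of_int A) (gcnj \<pi>) * qsym (of_int A) \<theta> = sgnt z * tsgn A"
    unfolding Ae qsym_mult[OF \<theta>.gprime] qsym_mult[OF \<pi>'.gprime] s1 s2[symmetric]
    using \<pi>.gprime \<theta>.gprime tz by (auto simp: sgnt_qsym gtwisted_gcnj) (auto simp: sgnt_def)
  moreover have "qsym (of_int A) (gcnj \<pi>) = gcnj (qsym (of_int A) \<pi>)"
    using qsym_gcnj[OF \<pi>.gprime, of "of_int A"] by simp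
  ultimately have main: "gcnj (qsym (of_int A) \<pi>) * qsym (of_int A) \<theta> = sgnt z * tsgn A" by simp
  have "odd a" "odd c" using odd_gre pr by (auto simp: a_def c_def)
  obtain y w where yw: "gim \<pi> = 2 * y" "gim \<theta> = 2 * w" using pr unfolding gprimary_def by (auto elim!: evenE)
  have Aeq: "A = a * c + 4 * (y * w)" by (simp add: A_def z_def a_def c_def yw)
  have par: "gtwisted \<pi> \<longleftrightarrow> odd y" "gtwisted \<theta> \<longleftrightarrow> odd w" unfolding gtwisted_def yw by presburger+
  \<comment> \<open>The source of the sign: modulo 8, \<open>A\<close> differs from
    \<open>a * c\<close> by 4 exactly if the halved imaginary parts \<open>y\<close> and
    \<open>w\<close> are both odd, that is, if both primes are twisted.\<close>
  have tA: "tsgn A = (if gtwisted \<pi> \<and> gtwisted \<theta> then -1 else 1) * (tsgn a * tsgn c)"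
  proof (cases "even (y * w)")
    case True
    then obtain v where "y * w = 2 * v" by (rule evenE)
    then have "A = a * c + 8 * v" by (simp add: Aeq)
    then have "A mod 8 = (a * c) mod 8" by simp
    then have "tsgn A = tsgn (a * c)" by (simp add: tsgn_def)
    then show ?thesis using True par \<open>odd a\<close> \<open>odd c\<close> by (auto simp: tsgn_mult)
  next
    case False
    then obtain v where "y * w = 2 * v + 1" by (rule oddE)
    then have "A = a * c + 4 + 8 * v" by (simp add: Aeq)
    then have "A mod 8 = (a * c + 4) mod 8" by simp
    moreover have "((u + 4) mod 8 = 1 \<or> (u + 4) mod 8 = 7) \<longleftrightarrow> \<not> (u mod 8 = 1 \<or> u mod 8 = 7)"
      if "odd u" for u :: int using that by presburger
    moreover have "odd (a * c)" using \<open>odd a\<close> \<open>odd c\<close> by simp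
    ultimately have "tsgn A = - tsgn (a * c)" by (simp add: tsgn_def)
    then show ?thesis using False par \<open>odd a\<close> \<open>odd c\<close> by (auto simp: tsgn_mult)
  qed
  have cn: "gcnj (sgnt x) = sgnt x" "gcnj (tsgn y) = tsgn y" for x y by (auto simp: sgnt_def tsgn_def)
  have sq: "sgnt x * sgnt x = 1" "tsgn y * tsgn y = 1" for x y by (auto simp: sgnt_def tsgn_def)
  have sz: "sgnt z = sgnt \<pi> * sgnt \<theta>" using tz by (auto simp: sgnt_def)
  define e :: gint where "e = (if gtwisted \<pi> \<and> gtwisted \<theta> then -1 else 1)"
  define P T where "P = qsym \<pi> \<theta>" and "T = qsym \<theta> \<pi>"
  have "sgnt \<pi> * tsgn a * gcnj T * (sgnt \<theta> * tsgn c * P) = sgnt \<pi> * sgnt \<theta> * (e * (tsgn a * tsgn c))"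
    using main unfolding 1 2 ra rc sz tA e_def P_def T_def by (simp only: gcnj_simps cn)
  then have "(sgnt \<pi> * sgnt \<theta> * (tsgn a * tsgn c)) * (gcnj T * P) = (sgnt \<pi> * sgnt \<theta> * (tsgn a * tsgn c)) * e"
    by (simp add: algebra_simps)
  then have "gcnj T * P = e" using unz by simp
  then have "(T * gcnj T) * P = T * e" by (simp add: mult.assoc)
  moreover have "T dvd 1" unfolding T_def using nd \<pi>.gprime by (auto intro: qsym_unit)
  ultimately have "P = T * e" by (simp add: gunit_gcnj)
  then show ?thesis by (simp add: P_def T_def e_def)
qed

lemma reciprocity_inert:
  assumes "split_prime \<pi> p" "prime q" "q mod 4 = 3" "gprime (- of_nat q)"
  shows "qsym \<pi> (- of_nat q) = qsym (- of_nat q) \<pi>"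
proof -
  interpret split_prime \<pi> p by (rule assms)
  have "q \<noteq> p" using assms(3) p4 by auto
  then have "\<not> p dvd q" using assms(2) p by (auto dest: primes_dvd_imp_eq)
  then have "qsym (of_int (star q)) \<pi> = qsym \<pi> (- of_nat q)"
    using rational_symbol_inert[OF assms(2-4)] split_prime_axioms
    unfolding rational_symbol_def by blast
  then show ?thesis using assms(3) by (simp add: star_def)
qed

text \<open>Inert primes are real, hence not twisted, and two of them have symbol 1 in both
  directions; so the sign arises only between split primes.\<close>

theorem quartic_reciprocity:
  assumes "gprime \<pi>" "gprime \<theta>" "\<pi> \<noteq> \<theta>"
  shows "qsym \<pi> \<theta> = (if gtwisted \<pi> \<and> gtwisted \<theta> then - qsym \<theta> \<pi> else qsym \<theta> \<pi>)"
  using assms(1)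
proof (cases rule: gprime_cases)
  case (split p)
  then have \<pi>: "split_prime \<pi> p" using assms(1) by unfold_locales
  from assms(2) show ?thesis
  proof (cases rule: gprime_cases)
    case (split r)
    then have "split_prime \<theta> r" using assms(2) by unfold_locales
    then show ?thesis using reciprocity_split \<pi> assms(3) by blast
  next
    case (inert q)
    then show ?thesis using reciprocity_inert[OF \<pi>, of q] assms(2) by (simp add: gtwisted_def)
  qed
next
  case (inert q)
  note \<pi> = this
  from assms(2) show ?thesis
  proof (cases rule: gprime_cases)
    case (split r)
    then have "split_prime \<theta> r" using assms(2) by unfold_locales
    then show ?thesis using reciprocity_inert[of \<theta> r q] assms(1) \<pi> by (simp add: gtwisted_def)
  next
    case (inert r)
    have "q \<noteq> r" using inert \<pi> assms(3) by auto
    then have "\<not> q dvd r" "\<not> r dvd q" using inert \<pi> by (auto dest: primes_dvd_imp_eq)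
    then have "\<not> int q dvd - int r" "\<not> int r dvd - int q" by simp_all
    then have "qsym (of_int (- int q)) (- of_nat r) = 1" "qsym (of_int (- int r)) (- of_nat q) = 1"
      using inert \<pi> assms by (auto intro!: qsym_of_rational_inert simp del: of_int_minus of_int_of_nat_eq)
    then show ?thesis using inert \<pi> by (simp add: gtwisted_def)
  qed
qed

section \<open>Dirichlet series over the Gaussian integers\<close>

definition gN :: "gint \<Rightarrow> real" where "gN a = real_of_int (gnorm a)"

lemma gN_ge_1: "a \<noteq> 0 \<Longrightarrow> gN a \<ge> 1"
  using gnorm_pos[of a] unfolding gN_def by linarith

lemma gN_mult: "gN (a * b) = gN a * gN b"
  by (simp add: gN_def gnorm_mult)

lemma gN_power: "gN (a ^ n) = gN a ^ n"
  by (simp add: gN_def gnorm_power)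

lemma ln_gN_nonneg: "a \<noteq> 0 \<Longrightarrow> ln (gN a) \<ge> 0"
  using gN_ge_1[of a] by simp

section \<open>Absolute convergence and termwise derivatives\<close>

lemma summable_int_powr:
  assumes "\<sigma> > 1"
  shows "(\<lambda>x::int. (1 + \<bar>of_int x\<bar>) powr (-\<sigma>) :: real) summable_on UNIV"
proof -
  let ?f = "\<lambda>x::int. (1 + \<bar>of_int x\<bar>) powr (-\<sigma>) :: real"
  have "summable (\<lambda>n. real n powr (-\<sigma>))" using assms by (simp add: summable_real_powr_iff)
  then have "summable (\<lambda>n. real (Suc n) powr (-\<sigma>))" by (subst summable_Suc_iff)
  then have "summable (\<lambda>n. norm ((1 + real n) powr (-\<sigma>)))" by (simp add: add.commute)
  then have n: "(\<lambda>n. (1 + real n) powr (-\<sigma>)) summable_on UNIV" by (rule norm_summable_imp_summable_on)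
  have "?f summable_on range int" "?f summable_on range (\<lambda>n. - int n)"
    by (subst summable_on_reindex; use n in \<open>simp add: inj_on_def o_def\<close>)+
  then have "?f summable_on (range int \<union> range (\<lambda>n. - int n))" by (rule summable_on_union)
  also have "range int \<union> range (\<lambda>n. - int n) = UNIV"
    by (auto intro: int_cases2)
  finally show ?thesis .
qed

lemma summable_on_product_nonneg:
  fixes f :: "'a \<Rightarrow> real" and g :: "'b \<Rightarrow> real"
  assumes "f summable_on A" "g summable_on B" "\<And>x. x \<in> A \<Longrightarrow> f x \<ge> 0" "\<And>y. y \<in> B \<Longrightarrow> g y \<ge> 0"
  shows "(\<lambda>(x, y). f x * g y) summable_on A \<times> B"
proof (rule summable_on_SigmaI)
  show "((\<lambda>y. case (x, y) of (x, y) \<Rightarrow> f x * g y) has_sum f x * infsum g B) B" for x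
    using assms(2) by (auto intro!: has_sum_cmult_right)
  show "(\<lambda>x. f x * infsum g B) summable_on A"
    by (intro summable_on_cmult_left assms)
qed (use assms in auto)

text \<open>The lattice sum is dominated by a product of two sums over the integers, since \<open>(1
  + \<bar>x\<bar>) * (1 + \<bar>y\<bar>) \<le> 4 * (x ^ 2 + y ^ 2)\<close> at nonzero lattice
  points.\<close>

lemma summable_gN_powr:
  assumes "\<sigma> > 1"
  shows "(\<lambda>a. exp (- \<sigma> * ln (gN a))) summable_on (- {0})"
proof -
  let ?F = "\<lambda>x::int. (1 + \<bar>of_int x\<bar>) powr (-\<sigma>) :: real"
  have "(\<lambda>(x, y). ?F x * ?F y) summable_on UNIV \<times> UNIV"
    using summable_int_powr[OF assms] by (intro summable_on_product_nonneg) auto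
  then have "(\<lambda>a. ?F (gre a) * ?F (gim a)) summable_on (\<lambda>(x, y). Gint x y) ` (UNIV \<times> UNIV)"
    by (subst summable_on_reindex) (auto simp: inj_on_def o_def case_prod_unfold)
  also have "(\<lambda>(x, y). Gint x y) ` (UNIV \<times> UNIV) = UNIV"
  proof -
    have "a \<in> (\<lambda>(x, y). Gint x y) ` (UNIV \<times> UNIV)" for a
      by (rule image_eqI[where x = "(gre a, gim a)"]) (auto simp: gint_eq_iff)
    then show ?thesis by blast
  qed
  finally have "(\<lambda>a. ?F (gre a) * ?F (gim a)) summable_on (- {0})"
    by (rule summable_on_subset) auto
  then have "(\<lambda>a. 4 powr \<sigma> * (?F (gre a) * ?F (gim a))) summable_on (- {0})"
    by (rule summable_on_cmult_right)
  then show ?thesis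
  proof (rule summable_on_comparison_test)
    fix a :: gint assume "a \<in> - {0}"
    then have N1: "gN a \<ge> 1" using gN_ge_1 by simp
    define x y where "x = \<bar>real_of_int (gre a)\<bar>" and "y = \<bar>real_of_int (gim a)\<bar>"
    have xs: "x \<le> x\<^sup>2" "y \<le> y\<^sup>2"
    proof -
      have "\<bar>z\<bar> \<le> z\<^sup>2" for z :: int
      proof (cases "z = 0")
        case False
        then have "\<bar>z\<bar> * 1 \<le> \<bar>z\<bar> * \<bar>z\<bar>" by (intro mult_left_mono) auto
        then show ?thesis by (simp add: power2_eq_square)
      qed simp
      from this[of "gre a"] this[of "gim a"] show "x \<le> x\<^sup>2" "y \<le> y\<^sup>2"
        unfolding x_def y_def power2_abs by (metis of_int_abs of_int_le_iff of_int_power)+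
    qed
    have N: "gN a = x\<^sup>2 + y\<^sup>2" by (simp add: gN_def gnorm_def x_def y_def)
    have xy: "2 * (x * y) \<le> x\<^sup>2 + y\<^sup>2" using sum_squares_bound[of x y] by simp
    have "(1 + x) * (1 + y) = 1 + x + y + x * y" by (simp add: algebra_simps)
    then have le: "(1 + x) * (1 + y) \<le> 4 * gN a" using xs xy N N1 by linarith
    have pos: "0 < (1 + x) * (1 + y)" by (simp add: x_def y_def add_pos_nonneg)
    have "exp (- \<sigma> * ln (gN a)) = gN a powr (- \<sigma>)" using N1 by (simp add: powr_def)
    also have "\<dots> = 4 powr \<sigma> * (4 * gN a) powr (- \<sigma>)"
      using N1 by (simp add: powr_mult powr_minus)
    also have "\<dots> \<le> 4 powr \<sigma> * ((1 + x) * (1 + y)) powr (- \<sigma>)"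
      using le pos assms by (intro mult_left_mono powr_mono2') auto
    also have "((1 + x) * (1 + y)) powr (- \<sigma>) = ?F (gre a) * ?F (gim a)"
      by (subst powr_mult) (auto simp: x_def y_def)
    finally show "exp (- \<sigma> * ln (gN a)) \<le> 4 powr \<sigma> * (?F (gre a) * ?F (gim a))" .
  qed auto
qed

lemma norm_exp_term: "norm (exp (- s * complex_of_real l)) = exp (- Re s * l)"
  by simp

lemma mult_exp_bound:
  assumes "\<delta> > 0" "l \<ge> (0 :: real)"
  shows "l * exp (- \<sigma> * l) \<le> (1 / \<delta>) * exp (- (\<sigma> - \<delta>) * l)"
proof -
  have "\<delta> * l \<le> exp (\<delta> * l)" using exp_ge_add_one_self[of "\<delta> * l"] by linarith
  then have "l \<le> (1 / \<delta>) * exp (\<delta> * l)" using assms by (simp add: field_simps)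
  then have "l * exp (- \<sigma> * l) \<le> (1 / \<delta>) * exp (\<delta> * l) * exp (- \<sigma> * l)"
    by (rule mult_right_mono) simp
  also have "\<dots> = (1 / \<delta>) * exp (- (\<sigma> - \<delta>) * l)" by (simp add: algebra_simps flip: exp_add)
  finally show ?thesis .
qed

text \<open>A general Dirichlet series with frequencies \<open>l\<close>. The index set is arbitrary
  so that sums over elements and sums over prime powers share one theory.\<close>

definition dser :: "'j set \<Rightarrow> ('j \<Rightarrow> complex) \<Rightarrow> ('j \<Rightarrow> real) \<Rightarrow> complex \<Rightarrow> complex" where
  "dser A c l s = (\<Sum>\<^sub>\<infinity>j\<in>A. c j * exp (- s * of_real (l j)))"

definition dser_abs :: "real \<Rightarrow> 'j set \<Rightarrow> ('j \<Rightarrow> complex) \<Rightarrow> ('j \<Rightarrow> real) \<Rightarrow> bool" where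
  "dser_abs x0 A c l \<longleftrightarrow> (\<forall>j\<in>A. l j \<ge> 0) \<and>
     (\<forall>\<sigma>>x0. (\<lambda>j. norm (c j) * exp (- \<sigma> * l j)) summable_on A)"

lemma dser_abs_norm_summable:
  assumes "dser_abs x0 A c l" "Re s > x0"
  shows "(\<lambda>j. norm (c j * exp (- s * of_real (l j)))) summable_on A"
  using assms unfolding dser_abs_def by (simp add: norm_mult)

lemma dser_has_sum:
  assumes "dser_abs x0 A c l" "Re s > x0"
  shows "((\<lambda>j. c j * exp (- s * of_real (l j))) has_sum dser A c l s) A"
  unfolding dser_def
  by (rule has_sum_infsum[OF abs_summable_summable[OF dser_abs_norm_summable[OF assms]]])

lemma dser_abs_deriv:
  assumes "dser_abs x0 A c l"
  shows "dser_abs x0 A (\<lambda>j. of_real (l j) * c j) l"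
  unfolding dser_abs_def
proof (intro conjI allI impI)
  show "\<forall>j\<in>A. 0 \<le> l j" using assms by (simp add: dser_abs_def)
  fix \<sigma> assume "\<sigma> > x0"
  define \<delta> where "\<delta> = (\<sigma> - x0) / 2"
  have \<delta>: "\<delta> > 0" "\<sigma> - \<delta> > x0" using \<open>\<sigma> > x0\<close> by (auto simp: \<delta>_def field_simps)
  have "(\<lambda>j. (1 / \<delta>) * (norm (c j) * exp (- (\<sigma> - \<delta>) * l j))) summable_on A"
    using assms \<delta>(2) unfolding dser_abs_def by (intro summable_on_cmult_right) blast
  then show "(\<lambda>j. norm (of_real (l j) * c j) * exp (- \<sigma> * l j)) summable_on A"
  proof (rule summable_on_comparison_test)
    fix j assume j: "j \<in> A"
    then have "l j \<ge> 0" using assms by (simp add: dser_abs_def)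
    then have "norm (of_real (l j) * c j) * exp (- \<sigma> * l j) = norm (c j) * (l j * exp (- \<sigma> * l j))"
      by (simp add: norm_mult)
    also have "\<dots> \<le> norm (c j) * ((1 / \<delta>) * exp (- (\<sigma> - \<delta>) * l j))"
      by (intro mult_left_mono mult_exp_bound \<delta> \<open>l j \<ge> 0\<close>) simp
    finally show "norm (of_real (l j) * c j) * exp (- \<sigma> * l j) \<le> (1 / \<delta>) * (norm (c j) * exp (- (\<sigma> - \<delta>) * l j))"
      by (simp only: mult.left_commute)
  qed simp
qed

text \<open>On the closed disc of radius \<open>r\<close>, half the distance to the line
  \<open>Re s = x0\<close>, the terms are dominated by those at \<open>Re s - r\<close>; uniform
  convergence then permits termwise differentiation.\<close>

lemma dser_deriv:
  assumes "dser_abs x0 A c l" "Re s > x0"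
  shows "(dser A c l has_field_derivative - dser A (\<lambda>j. of_real (l j) * c j) l s) (at s)"
proof -
  define r where "r = (Re s - x0) / 2"
  have r: "r > 0" "Re s - r > x0" using assms(2) by (auto simp: r_def field_simps)
  let ?F = "finite_subsets_at_top A"
  let ?f = "\<lambda>j s. c j * exp (- s * complex_of_real (l j))"
  let ?f' = "\<lambda>j s. - (of_real (l j) * c j * exp (- s * complex_of_real (l j)))"
  have d: "(?f j has_field_derivative ?f' j w) (at w)" for j w
    by (auto intro!: derivative_eq_intros simp: mult_ac)
  have ul: "uniform_limit (cball s r) (\<lambda>X w. \<Sum>j\<in>X. ?f j w) (\<lambda>w. dser A c l w) ?F"
    unfolding dser_def
  proof (rule Weierstrass_m_test_general)
    show "(\<lambda>j. norm (c j) * exp (- (Re s - r) * l j)) summable_on A"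
      using assms(1) r(2) unfolding dser_abs_def by blast
    fix j w assume j: "j \<in> A" and w: "w \<in> cball s r"
    have "Re s - Re w \<le> r" using w abs_Re_le_cmod[of "s - w"] by (simp add: dist_norm)
    then have "Re s - r \<le> Re w" by simp
    moreover have "l j \<ge> 0" using assms(1) j by (simp add: dser_abs_def)
    ultimately have "- Re w * l j \<le> - (Re s - r) * l j" by (intro mult_right_mono) auto
    then show "norm (?f j w) \<le> norm (c j) * exp (- (Re s - r) * l j)"
      unfolding norm_mult norm_exp_term by (intro mult_left_mono) auto
  qed
  obtain g' where g': "\<And>w. w \<in> ball s r \<Longrightarrow> (dser A c l has_field_derivative g' w) (at w) \<and>
      ((\<lambda>X. \<Sum>j\<in>X. ?f' j w) \<longlongrightarrow> g' w) ?F"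
    by (rule has_complex_derivative_uniform_limit[OF _ ul _ r(1), where f' = "\<lambda>X w. \<Sum>j\<in>X. ?f' j w"])
      (auto intro!: always_eventually continuous_intros DERIV_sum d[unfolded mult_minus_left])
  have "((\<lambda>X. \<Sum>j\<in>X. ?f' j s) \<longlongrightarrow> - dser A (\<lambda>j. of_real (l j) * c j) l s) ?F"
  proof -
    have "((\<lambda>j. ?f' j s) has_sum - dser A (\<lambda>j. of_real (l j) * c j) l s) A"
      using dser_has_sum[OF dser_abs_deriv[OF assms(1)] assms(2)] by (simp add: has_sum_uminus)
    then show ?thesis unfolding has_sum_def .
  qed
  then have "g' s = - dser A (\<lambda>j. of_real (l j) * c j) l s"
    using g'[of s] r(1) by (intro tendsto_unique[OF finite_subsets_at_top_neq_bot]) auto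
  then show ?thesis using g'[of s] r(1) by auto
qed

lemma dser_holomorphic:
  assumes "dser_abs x0 A c l"
  shows "dser A c l holomorphic_on {s. Re s > x0}"
  using dser_deriv[OF assms]
  by (intro holomorphic_on_open[THEN iffD2]) (auto simp: open_halfspace_Re_gt)

text \<open>The sum runs over elements, not ideals: for a character trivial on units it is 4 times
  the usual \<open>L\<close>-function.\<close>

definition gser :: "(gint \<Rightarrow> complex) \<Rightarrow> complex \<Rightarrow> complex" where
  "gser c = dser (- {0}) c (\<lambda>a. ln (gN a))"

lemma dser_abs_gser:
  assumes "\<And>a. norm (c a) \<le> B"
  shows "dser_abs 1 (- {0}) c (\<lambda>a. ln (gN a))"
  unfolding dser_abs_def
proof (intro conjI allI impI ballI)
  fix \<sigma> :: real assume "\<sigma> > 1"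
  then have "(\<lambda>a. B * exp (- \<sigma> * ln (gN a))) summable_on (- {0})"
    by (intro summable_on_cmult_right summable_gN_powr)
  then show "(\<lambda>a. norm (c a) * exp (- \<sigma> * ln (gN a))) summable_on (- {0})"
    by (rule summable_on_comparison_test) (auto intro: mult_right_mono assms)
qed (use ln_gN_nonneg in auto)

section \<open>Series over prime powers and the logarithmic derivative\<close>

definition gpp :: "(gint \<times> nat) set" where "gpp = {(p, k). prime p \<and> k \<ge> 1}"

definition mlog :: "gint \<times> nat \<Rightarrow> real" where "mlog = (\<lambda>(p, k). real k * ln (gN p))"

text \<open>The series of the negative logarithmic derivative of \<open>gser \<xi>\<close>. Pairs
  \<open>(p, k)\<close> of a normalized prime and an exponent take the place of the von Mangoldt
  function.\<close>

definition mser :: "(gint \<Rightarrow> complex) \<Rightarrow> complex \<Rightarrow> complex" where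
  "mser \<xi> = dser gpp (\<lambda>(p, k). \<xi> p ^ k * of_real (ln (gN p))) mlog"

lemma gN_prime_gt_1: "prime p \<Longrightarrow> gN p > 1"
proof -
  assume "prime p"
  then have "gnorm p \<noteq> 0" "gnorm p \<noteq> 1" by (auto simp: gnorm_eq_1_iff)
  then have "gnorm p > 1" using gnorm_nonneg[of p] by linarith
  then show ?thesis by (simp add: gN_def)
qed

lemma inj_on_gpp: "inj_on (\<lambda>(p, k). p ^ k) gpp"
proof (rule inj_onI, clarify)
  fix p q :: gint and k j :: nat
  assume *: "(p, k) \<in> gpp" "(q, j) \<in> gpp" "p ^ k = q ^ j"
  then have pq: "prime p" "prime q" "k \<ge> 1" "j \<ge> 1" by (auto simp: gpp_def)
  have "p dvd p ^ k" using pq by (intro dvd_power) auto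
  then have "p dvd q" using * pq prime_dvd_power by metis
  then have "p = q" using pq by (simp add: primes_dvd_imp_eq)
  moreover have "gN p ^ k = gN q ^ j" using *(3) by (metis gN_power)
  ultimately show "p = q \<and> k = j" using gN_prime_gt_1[OF pq(1)] by simp
qed

lemma dser_abs_mser:
  assumes "\<And>a. norm (\<xi> a) \<le> 1"
  shows "dser_abs 1 gpp (\<lambda>(p, k). \<xi> p ^ k * of_real (ln (gN p))) mlog"
  unfolding dser_abs_def
proof (intro conjI allI impI ballI)
  fix pk assume "pk \<in> gpp"
  then show "mlog pk \<ge> 0" using gN_prime_gt_1 by (auto simp: mlog_def gpp_def less_imp_le)
next
  fix \<sigma> :: real assume \<sigma>: "\<sigma> > 1"
  have "dser_abs 1 (- {0}) (\<lambda>a. complex_of_real (ln (gN a)) * 1) (\<lambda>a. ln (gN a))"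
    by (intro dser_abs_deriv dser_abs_gser[where B = 1]) auto
  then have "(\<lambda>a. norm (complex_of_real (ln (gN a)) * 1) * exp (- \<sigma> * ln (gN a))) summable_on (- {0})"
    using \<sigma> unfolding dser_abs_def by blast
  then have "(\<lambda>a. norm (complex_of_real (ln (gN a)) * 1) * exp (- \<sigma> * ln (gN a))) summable_on ((\<lambda>(p, k). p ^ k) ` gpp)"
    by (rule summable_on_subset) (auto simp: gpp_def)
  then have "((\<lambda>a. norm (complex_of_real (ln (gN a)) * 1) * exp (- \<sigma> * ln (gN a))) \<circ> (\<lambda>(p, k). p ^ k)) summable_on gpp"
    by (simp only: summable_on_reindex[OF inj_on_gpp])
  then show "(\<lambda>j. norm (case j of (p, k) \<Rightarrow> \<xi> p ^ k * of_real (ln (gN p))) * exp (- \<sigma> * mlog j)) summable_on gpp"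
  proof (rule summable_on_comparison_test)
    fix pk assume "pk \<in> gpp"
    then obtain p k where pk: "pk = (p, k)" "prime p" "k \<ge> 1" by (auto simp: gpp_def)
    have l: "ln (gN p) \<ge> 0" using gN_prime_gt_1[OF pk(2)] by simp
    have lk: "ln (gN (p ^ k)) = real k * ln (gN p)"
      using gN_prime_gt_1[OF pk(2)] by (simp add: gN_power ln_realpow)
    have "norm (\<xi> p ^ k * of_real (ln (gN p))) \<le> 1 * ln (gN p)"
      unfolding norm_mult norm_power using assms[of p] l by (intro mult_mono power_le_one) auto
    also have "\<dots> \<le> real k * ln (gN p)" using pk(3) l by (intro mult_right_mono) auto
    finally show "norm (case pk of (p, k) \<Rightarrow> \<xi> p ^ k * of_real (ln (gN p))) * exp (- \<sigma> * mlog pk)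
       \<le> ((\<lambda>a. norm (complex_of_real (ln (gN a)) * 1) * exp (- \<sigma> * ln (gN a))) \<circ> (\<lambda>(p, k). p ^ k)) pk"
      using l by (simp add: pk(1) mlog_def lk)
  qed simp
qed

lemma gN_normalize: "gN (normalize a) = gN a"
proof (cases "a = 0")
  case False
  have "gN a = gN (unit_factor a) * gN (normalize a)" by (metis gN_mult unit_factor_mult_normalize)
  moreover have "gN (unit_factor a) = 1" using False gnorm_eq_1_iff[of "unit_factor a"] by (simp add: gN_def)
  ultimately show ?thesis by simp
qed simp

text \<open>The von Mangoldt identity: the logarithm of the norm is collected from the prime
  factorization, each prime \<open>p\<close> counted once for every \<open>k\<close> up to its
  multiplicity.\<close>

lemma sum_prime_powers_dvd:
  assumes "a \<noteq> 0"
  shows "finite {(p, k) \<in> gpp. p ^ k dvd a}"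
    and "(\<Sum>(p, k)\<in>{(p, k) \<in> gpp. p ^ k dvd a}. ln (gN p)) = ln (gN a)"
proof -
  have eq: "{(p, k) \<in> gpp. p ^ k dvd a} = (SIGMA p:prime_factors a. {1..multiplicity p a})"
  proof (rule Set.set_eqI)
    fix pk :: "gint \<times> nat"
    obtain p k where pk: "pk = (p, k)" by (cases pk)
    show "pk \<in> {(p, k) \<in> gpp. p ^ k dvd a} \<longleftrightarrow> pk \<in> (SIGMA p:prime_factors a. {1..multiplicity p a})"
    proof (cases "prime p \<and> k \<ge> 1")
      case True
      then have "p ^ k dvd a \<longleftrightarrow> k \<le> multiplicity p a"
        using assms by (intro power_dvd_iff_le_multiplicity) auto
      moreover have "p dvd a" if "p ^ k dvd a"
      proof -
        have "p dvd p ^ k" by (rule dvd_power) (use True in auto)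
        then show ?thesis using that by (rule dvd_trans)
      qed
      ultimately show ?thesis using True assms by (auto simp: pk gpp_def in_prime_factors_iff)
    qed (auto simp: pk gpp_def)
  qed
  show "finite {(p, k) \<in> gpp. p ^ k dvd a}" unfolding eq by (intro finite_SigmaI) auto
  have "(\<Sum>(p, k)\<in>{(p, k) \<in> gpp. p ^ k dvd a}. ln (gN p)) = (\<Sum>p\<in>prime_factors a. real (multiplicity p a) * ln (gN p))"
    unfolding eq by (subst sum.Sigma[symmetric]) auto
  also have "\<dots> = (\<Sum>p\<in>prime_factors a. ln (gN p ^ multiplicity p a))"
    by (intro sum.cong refl) (auto simp: ln_realpow dest!: in_prime_factors_imp_prime gN_prime_gt_1)
  also have "\<dots> = ln (\<Prod>p\<in>prime_factors a. gN p ^ multiplicity p a)"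
    by (intro ln_prod[symmetric]) (auto dest!: in_prime_factors_imp_prime gN_prime_gt_1)
  also have "(\<Prod>p\<in>prime_factors a. gN p ^ multiplicity p a) = gN (\<Prod>p\<in>prime_factors a. p ^ multiplicity p a)"
    by (induction rule: infinite_finite_induct) (auto simp: gN_mult gN_power, simp_all add: gN_def)
  also have "gN (\<Prod>p\<in>prime_factors a. p ^ multiplicity p a) = gN a"
  proof -
    have "(\<Prod>p\<in>prime_factors a. p ^ multiplicity p a) = prod_mset (prime_factorization a)"
      unfolding prod_mset_multiplicity
      by (intro prod.cong refl) (simp add: count_prime_factorization_prime in_prime_factors_imp_prime)
    then show ?thesis using prod_mset_prime_factorization_weak[OF assms] by (metis gN_normalize)
  qed
  finally show "(\<Sum>(p, k)\<in>{(p, k) \<in> gpp. p ^ k dvd a}. ln (gN p)) = ln (gN a)" .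
qed

lemma has_sum_product:
  fixes f :: "'a \<Rightarrow> complex" and g :: "'b \<Rightarrow> complex"
  assumes "(f has_sum S) A" "(g has_sum T) B"
    and "(\<lambda>x. norm (f x)) summable_on A" "(\<lambda>y. norm (g y)) summable_on B"
  shows "((\<lambda>(x, y). f x * g y) has_sum S * T) (A \<times> B)"
proof (rule has_sum_SigmaI)
  show "((\<lambda>y. case (x, y) of (x, y) \<Rightarrow> f x * g y) has_sum f x * T) B" for x
    using assms(2) by (auto intro: has_sum_cmult_right)
  show "((\<lambda>x. f x * T) has_sum S * T) A" by (rule has_sum_cmult_left[OF assms(1)])
  have "(\<lambda>(x, y). norm (f x) * norm (g y)) summable_on A \<times> B"
    by (intro summable_on_product_nonneg assms) auto
  then have "(\<lambda>z. norm (case z of (x, y) \<Rightarrow> f x * g y)) summable_on A \<times> B"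
    by (simp add: case_prod_unfold norm_mult)
  then show "(\<lambda>(x, y). f x * g y) summable_on A \<times> B" by (rule abs_summable_summable)
qed

text \<open>In the product, the pairs with \<open>b * p ^ k = a\<close> combine to
  \<open>\<xi> a\<close> times the sum of \<open>ln (gN p)\<close> over the prime powers dividing
  \<open>a\<close>, which is \<open>ln (gN a)\<close>. The result is minus the derivative of
  \<open>gser \<xi>\<close>.\<close>

lemma gser_mult_mser:
  assumes mult: "\<And>a b. \<xi> (a * b) = \<xi> a * \<xi> b" and one: "\<xi> 1 = 1"
    and bound: "\<And>a. norm (\<xi> a) \<le> 1" and s: "Re s > 1"
  shows "gser \<xi> s * mser \<xi> s = dser (- {0}) (\<lambda>a. of_real (ln (gN a)) * \<xi> a) (\<lambda>a. ln (gN a)) s"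
proof -
  have power: "\<xi> (a ^ k) = \<xi> a ^ k" for a k
    by (induction k) (simp_all add: mult one)
  have da: "dser_abs 1 (- {0}) \<xi> (\<lambda>a. ln (gN a))" by (rule dser_abs_gser[OF bound])
  note dm = dser_abs_mser[of \<xi>, OF bound]
  let ?X = "\<lambda>a. \<xi> a * exp (- s * of_real (ln (gN a)))"
  let ?Y = "\<lambda>j. (case j of (p, k) \<Rightarrow> \<xi> p ^ k * of_real (ln (gN p))) * exp (- s * of_real (mlog j))"
  have 1: "((\<lambda>(b, j). ?X b * ?Y j) has_sum gser \<xi> s * mser \<xi> s) ((- {0}) \<times> gpp)"
    unfolding gser_def mser_def
    by (intro has_sum_product dser_has_sum[OF da s] dser_has_sum[OF dm s]
        dser_abs_norm_summable[OF da s] dser_abs_norm_summable[OF dm s])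
  let ?T = "SIGMA a:(- {0}). {(p, k) \<in> gpp. p ^ k dvd a}"
  let ?h = "\<lambda>(a, (p, k)). \<xi> a * exp (- s * of_real (ln (gN a))) * of_real (ln (gN p))"
  have "((\<lambda>(b, j). ?X b * ?Y j) has_sum gser \<xi> s * mser \<xi> s) ((- {0}) \<times> gpp)
      \<longleftrightarrow> (?h has_sum gser \<xi> s * mser \<xi> s) ?T"
  proof (rule has_sum_reindex_bij_witness[where i = "\<lambda>(a, (p, k)). (a div p ^ k, (p, k))" and j = "\<lambda>(b, (p, k)). (b * p ^ k, (p, k))"])
    fix x :: "gint \<times> gint \<times> nat" assume "x \<in> (- {0}) \<times> gpp"
    then obtain b :: gint and p k where x: "x = (b, (p, k))" "b \<noteq> 0" "prime p" "k \<ge> 1" by (auto simp: gpp_def)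
    have p: "gN p > 0" "gN b > 0" using gN_prime_gt_1[OF x(3)] gN_ge_1[OF x(2)] by auto
    have "ln (gN (b * p ^ k)) = ln (gN b) + real k * ln (gN p)"
      using p by (simp add: gN_mult gN_power ln_mult ln_realpow)
    then have "exp (- s * of_real (ln (gN (b * p ^ k)))) =
        exp (- s * of_real (ln (gN b))) * exp (- s * of_real (real k * ln (gN p)))"
      by (simp add: distrib_left exp_add [symmetric])
    then show "?h (case x of (b, (p, k)) \<Rightarrow> (b * p ^ k, (p, k))) = (case x of (b, j) \<Rightarrow> ?X b * ?Y j)"
      by (simp add: x mult power mlog_def)
    show "(case (case x of (b, (p, k)) \<Rightarrow> (b * p ^ k, (p, k))) of (a, (p, k)) \<Rightarrow> (a div p ^ k, (p, k))) = x"
      using x by simp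
    show "(case x of (b, (p, k)) \<Rightarrow> (b * p ^ k, (p, k))) \<in> ?T"
      using x by (auto simp: gpp_def)
  next
    fix x :: "gint \<times> gint \<times> nat" assume "x \<in> ?T"
    then obtain a p k where x: "x = (a, (p, k))" "a \<noteq> 0" "prime p" "k \<ge> 1" "p ^ k dvd a" by (auto simp: gpp_def)
    then show "(case (case x of (a, (p, k)) \<Rightarrow> (a div p ^ k, (p, k))) of (b, (p, k)) \<Rightarrow> (b * p ^ k, (p, k))) = x"
      "(case x of (a, (p, k)) \<Rightarrow> (a div p ^ k, (p, k))) \<in> (- {0}) \<times> gpp"
      by (auto simp: gpp_def dvd_div_eq_0_iff)
  qed simp
  then have 2: "(?h has_sum gser \<xi> s * mser \<xi> s) ?T" using 1 by simp
  have "((\<lambda>a. of_real (ln (gN a)) * \<xi> a * exp (- s * of_real (ln (gN a)))) has_sum gser \<xi> s * mser \<xi> s) (- {0})"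
  proof (rule has_sum_SigmaD[OF 2])
    fix a :: gint assume "a \<in> - {0}"
    then have a: "a \<noteq> 0" by simp
    have "(\<Sum>y\<in>{(p, k) \<in> gpp. p ^ k dvd a}. ?h (a, y)) = ?X a * of_real (\<Sum>(p, k)\<in>{(p, k) \<in> gpp. p ^ k dvd a}. ln (gN p))"
      by (simp add: sum_distrib_left case_prod_unfold)
    also have "\<dots> = of_real (ln (gN a)) * \<xi> a * exp (- s * of_real (ln (gN a)))"
      unfolding sum_prime_powers_dvd(2)[OF a] by simp
    finally show "((\<lambda>y. ?h (a, y)) has_sum of_real (ln (gN a)) * \<xi> a * exp (- s * of_real (ln (gN a)))) {(p, k) \<in> gpp. p ^ k dvd a}"
      using has_sum_finite[OF sum_prime_powers_dvd(1)[OF a], of "\<lambda>y. ?h (a, y)"] by simp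
  qed
  then show ?thesis unfolding dser_def by (rule infsumI[symmetric])
qed

lemma gser_deriv:
  assumes mult: "\<And>a b. \<xi> (a * b) = \<xi> a * \<xi> b" and one: "\<xi> 1 = 1"
    and bound: "\<And>a. norm (\<xi> a) \<le> 1" and s: "Re s > 1"
  shows "(gser \<xi> has_field_derivative - (gser \<xi> s * mser \<xi> s)) (at s)"
  unfolding gser_mult_mser[OF assms] unfolding gser_def
  by (rule dser_deriv[OF dser_abs_gser[OF bound] s])

section \<open>Continuation of mean-zero series to positive real part\<close>

definition gbox :: "nat \<Rightarrow> gint set" where
  "gbox N = (\<lambda>(x, y). Gint (int x) (int y)) ` ({..<N} \<times> {..<N})"

lemma finite_gbox [simp]: "finite (gbox N)"
  by (simp add: gbox_def)

lemma in_gbox_iff: "a \<in> gbox N \<longleftrightarrow> gre a \<in> {0..<int N} \<and> gim a \<in> {0..<int N}"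
proof
  assume "gre a \<in> {0..<int N} \<and> gim a \<in> {0..<int N}"
  then show "a \<in> gbox N" unfolding gbox_def
    by (intro image_eqI[where x = "(nat (gre a), nat (gim a))"]) (auto simp: gint_eq_iff nat_less_iff)
qed (auto simp: gbox_def)

text \<open>The norm to the power \<open>- s\<close>, with the value 0 at 0 so that shifted sums can
  run over the whole lattice.\<close>

definition gterm :: "complex \<Rightarrow> gint \<Rightarrow> complex" where
  "gterm s z = (if z = 0 then 0 else exp (- s * of_real (ln (gN z))))"

lemma gN_uminus [simp]: "gN (- a) = gN a"
  by (simp add: gN_def)

lemma gN_of_nat_mult: "gN (of_nat N * w) = (real N)\<^sup>2 * gN w"
  by (simp add: gN_def gnorm_mult gnorm_of_nat)

lemma gterm_uminus [simp]: "gterm s (- z) = gterm s z"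
  by (simp add: gterm_def)

lemma holomorphic_gterm [holomorphic_intros]: "(\<lambda>s. gterm s z) holomorphic_on A"
  by (cases "z = 0") (auto simp: gterm_def intro!: holomorphic_intros)

lemma gser_has_sum_UNIV:
  assumes "\<And>a. norm (c a) \<le> B" "Re s > 1"
  shows "((\<lambda>a. c a * gterm s a) has_sum gser c s) UNIV"
proof -
  have "((\<lambda>a. c a * exp (- s * of_real (ln (gN a)))) has_sum gser c s) (- {0})"
    unfolding gser_def by (rule dser_has_sum[OF dser_abs_gser[OF assms(1)] assms(2)])
  then show ?thesis
    by (rule has_sum_cong_neutral[THEN iffD1, rotated -1]) (auto simp: gterm_def)
qed

text \<open>The second symmetric differences of \<open>z \<mapsto> N(z) powr (-s)\<close> are summable as soon as \<open>Re s > 0\<close>;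
  this is where the mean value 0 of the coefficients enters.\<close>

definition gdiff :: "(gint \<Rightarrow> complex) \<Rightarrow> nat \<Rightarrow> gint \<Rightarrow> complex \<Rightarrow> complex" where
  "gdiff e N w s = (\<Sum>r\<in>gbox N. e r *
     (gterm s (of_nat N * w + r) + gterm s (of_nat N * w - r) - 2 * gterm s (of_nat N * w))) / 2"

lemma holomorphic_gdiff: "gdiff e N w holomorphic_on A"
  unfolding gdiff_def[abs_def] by (intro holomorphic_intros) auto

text \<open>Every element is \<open>N * w + r\<close> with \<open>r\<close> in the box. Averaging
  over \<open>w\<close> and \<open>- w\<close> produces the symmetric terms, and subtracting
  \<open>gterm\<close> at \<open>N * w\<close> costs nothing since the coefficients sum to 0 over
  the box. First differences would only reach \<open>Re s > 1 / 2\<close>, too little for the later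
  use of the point 1/4.\<close>

lemma gdiff_has_sum:
  assumes N: "N > 0" and per: "\<And>a b. e (a + of_nat N * b) = e a" and zero: "(\<Sum>r\<in>gbox N. e r) = 0"
    and bound: "\<And>a. norm (e a) \<le> B" and s: "Re s > 1"
  shows "((\<lambda>w. gdiff e N w s) has_sum gser e s) UNIV"
proof -
  have "((\<lambda>a. e a * gterm s a) has_sum gser e s) UNIV" by (rule gser_has_sum_UNIV[OF bound s])
  also have "?this \<longleftrightarrow> ((\<lambda>(w, r). e r * gterm s (of_nat N * w + r)) has_sum gser e s) (UNIV \<times> gbox N)"
  proof (rule has_sum_reindex_bij_witness[where i = "\<lambda>(w, r). of_nat N * w + r"
      and j = "\<lambda>a. (Gint (gre a div int N) (gim a div int N), Gint (gre a mod int N) (gim a mod int N))"])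
    fix a
    have a: "of_nat N * Gint (gre a div int N) (gim a div int N) + Gint (gre a mod int N) (gim a mod int N) = a"
      by (simp add: gint_eq_iff)
    then show "(case (Gint (gre a div int N) (gim a div int N), Gint (gre a mod int N) (gim a mod int N)) of
        (w, r) \<Rightarrow> of_nat N * w + r) = a" by simp
    show "(Gint (gre a div int N) (gim a div int N), Gint (gre a mod int N) (gim a mod int N)) \<in> UNIV \<times> gbox N"
      using N by (simp add: in_gbox_iff)
    have "e (Gint (gre a mod int N) (gim a mod int N)) = e a"
      using per[of "Gint (gre a mod int N) (gim a mod int N)" "Gint (gre a div int N) (gim a div int N)"] a
      by (simp add: add.commute)
    then show "(case (Gint (gre a div int N) (gim a div int N), Gint (gre a mod int N) (gim a mod int N)) of
        (w, r) \<Rightarrow> e r * gterm s (of_nat N * w + r)) = e a * gterm s a" using a by simp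
  next
    fix b assume "b \<in> (UNIV :: gint set) \<times> gbox N"
    then obtain w r where b: "b = (w, r)" "r \<in> gbox N" by auto
    show "(\<lambda>a. (Gint (gre a div int N) (gim a div int N), Gint (gre a mod int N) (gim a mod int N)))
        (case b of (w, r) \<Rightarrow> of_nat N * w + r) = b"
      using b N by (auto simp: in_gbox_iff gint_eq_iff)
  qed auto
  finally have 1: "((\<lambda>w. \<Sum>r\<in>gbox N. e r * gterm s (of_nat N * w + r)) has_sum gser e s) UNIV"
    by (rule has_sum_SigmaD) (auto intro!: has_sum_finite)
  then have "((\<lambda>w. \<Sum>r\<in>gbox N. e r * gterm s (of_nat N * (- w) + r)) has_sum gser e s) UNIV"
    by (subst has_sum_reindex_bij_betw[of uminus UNIV UNIV "\<lambda>w. \<Sum>r\<in>gbox N. e r * gterm s (of_nat N * w + r)"])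
      (auto intro: bij_uminus)
  moreover have "gterm s (of_nat N * (- w) + r) = gterm s (of_nat N * w - r)" for w r
    using gterm_uminus[of s "of_nat N * w - r"] by (simp add: algebra_simps)
  ultimately have 2: "((\<lambda>w. \<Sum>r\<in>gbox N. e r * gterm s (of_nat N * w - r)) has_sum gser e s) UNIV" by simp
  have "((\<lambda>w. ((\<Sum>r\<in>gbox N. e r * gterm s (of_nat N * w + r)) + (\<Sum>r\<in>gbox N. e r * gterm s (of_nat N * w - r))) * (1 / 2))
      has_sum (gser e s + gser e s) * (1 / 2)) UNIV"
    by (intro has_sum_cmult_left has_sum_add 1 2)
  moreover have "gdiff e N w s = ((\<Sum>r\<in>gbox N. e r * gterm s (of_nat N * w + r)) + (\<Sum>r\<in>gbox N. e r * gterm s (of_nat N * w - r))) * (1 / 2)" for w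
  proof -
    have "(\<Sum>r\<in>gbox N. e r * (2 * gterm s (of_nat N * w))) = 0"
      using zero by (simp flip: sum_distrib_right)
    then show ?thesis unfolding gdiff_def by (simp add: algebra_simps sum.distrib sum_subtractf)
  qed
  moreover have "(gser e s + gser e s) * (1 / 2) = gser e s" by simp
  ultimately show ?thesis by (simp only:)
qed

text \<open>The expansion \<open>1 - s * d + O(d ^ 2)\<close> of \<open>1 + d\<close> to the power
  \<open>- s\<close>, uniform for \<open>norm s \<le> K\<close>: \<open>4 * K ^ 2 * exp K\<close>
  bounds the remainder of the exponential and \<open>2 * K\<close> that of the logarithm.\<close>

lemma exp_ln_second_order:
  fixes s :: complex and d K :: real
  assumes "\<bar>d\<bar> \<le> 1 / 2" "norm s \<le> K"
  shows "norm (exp (- s * of_real (ln (1 + d))) - 1 + s * of_real d) \<le> (4 * K\<^sup>2 * exp K + 2 * K) * d\<^sup>2"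
proof -
  define u where "u = - s * complex_of_real (ln (1 + d))"
  have K: "K \<ge> 0" using assms(2) norm_ge_zero order_trans by blast
  have l: "\<bar>ln (1 + d) - d\<bar> \<le> 2 * d\<^sup>2" by (rule abs_ln_one_plus_x_minus_x_bound[OF assms(1)])
  have "2 * d\<^sup>2 \<le> \<bar>d\<bar>"
    using mult_right_mono[OF assms(1), of "2 * \<bar>d\<bar>"] by (simp add: power2_eq_square)
  then have l2: "\<bar>ln (1 + d)\<bar> \<le> 2 * \<bar>d\<bar>" using l by linarith
  have nu: "norm u \<le> K * (2 * \<bar>d\<bar>)"
    unfolding u_def norm_mult norm_minus_cancel norm_of_real
    by (intro mult_mono assms l2 K) auto
  also have "\<dots> \<le> K * 1" using assms(1) K by (intro mult_left_mono) auto
  finally have nu1: "norm u \<le> K" by simp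
  have "norm (exp u - (\<Sum>k\<le>1. u ^ k / fact k)) \<le> exp \<bar>Re u\<bar> * (norm u) ^ Suc 1 / fact 1"
    by (rule Taylor_exp)
  then have "norm (exp u - 1 - u) \<le> exp \<bar>Re u\<bar> * (norm u)\<^sup>2"
    by (simp add: numeral_2_eq_2 diff_diff_eq)
  also have "\<dots> \<le> exp K * (K * (2 * \<bar>d\<bar>))\<^sup>2"
    using nu nu1 abs_Re_le_cmod[of u] by (intro mult_mono power_mono) auto
  also have "\<dots> = 4 * K\<^sup>2 * exp K * d\<^sup>2" by (simp add: power_mult_distrib)
  finally have 1: "norm (exp u - 1 - u) \<le> 4 * K\<^sup>2 * exp K * d\<^sup>2" .
  have "u + s * of_real d = - s * of_real (ln (1 + d) - d)" by (simp add: u_def algebra_simps)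
  then have "norm (u + s * of_real d) = norm s * \<bar>ln (1 + d) - d\<bar>"
    by (simp add: norm_mult del: of_real_diff)
  also have "\<dots> \<le> K * (2 * d\<^sup>2)" by (intro mult_mono assms l K) auto
  finally have 2: "norm (u + s * of_real d) \<le> K * (2 * d\<^sup>2)" .
  have "exp (- s * of_real (ln (1 + d))) - 1 + s * of_real d = (exp u - 1 - u) + (u + s * of_real d)"
    by (simp add: u_def)
  then show ?thesis
    using norm_triangle_mono[OF 1 2] by (simp add: algebra_simps)
qed

lemma gterm_shift:
  assumes "z \<noteq> 0" "d = (gN y - gN z) / gN z" "\<bar>d\<bar> \<le> 1 / 2"
  shows "gterm s y = gterm s z * exp (- s * of_real (ln (1 + d)))"
proof -
  have z: "gN z > 0" using gN_ge_1[OF assms(1)] by linarith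
  have y: "gN y = gN z * (1 + d)" using z assms(2) by (simp add: field_simps)
  have d: "1 + d > 0" using assms(3) by linarith
  then have "gN y > 0" using y z by simp
  then have "y \<noteq> 0" by (auto simp: gN_def)
  have "ln (gN y) = ln (gN z) + ln (1 + d)" unfolding y using z d by (rule ln_mult_pos)
  then show ?thesis using assms(1) \<open>y \<noteq> 0\<close> by (simp add: gterm_def distrib_left exp_add [symmetric])
qed

text \<open>The relative changes of the norm are \<open>gN r / gN z\<close> plus or minus
  \<open>2 * ip / gN z\<close>. The inner products cancel in \<open>d1 + d2\<close>, which is
  therefore of order \<open>1 / gN w\<close>, although each summand is only known to be of the order
  of its square root. The threshold 100 ensures \<open>24 / gN w \<le> 1 / 4\<close>.\<close>

lemma gN_shift_bounds:
  fixes N :: nat and w r :: gint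
  assumes r: "r \<in> gbox N" and N: "N > 0" and w: "gN w \<ge> 100"
  defines "z \<equiv> of_nat N * w"
  defines "d1 \<equiv> (gN (z + r) - gN z) / gN z" and "d2 \<equiv> (gN (z - r) - gN z) / gN z"
  shows "d1\<^sup>2 \<le> 24 / gN w" "d2\<^sup>2 \<le> 24 / gN w" "\<bar>d1\<bar> \<le> 1 / 2" "\<bar>d2\<bar> \<le> 1 / 2"
    "\<bar>d1 + d2\<bar> \<le> 4 / gN w"
proof -
  define n W where "n = real N" and "W = gN w"
  have n: "n \<ge> 1" using N by (simp add: n_def)
  have W: "W \<ge> 100" using w by (simp add: W_def)
  have Z: "gN z = n\<^sup>2 * W" by (simp add: z_def gN_of_nat_mult n_def W_def)
  have R: "gN r \<le> 2 * n\<^sup>2" "gN r \<ge> 0"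
  proof -
    have "(gre r)\<^sup>2 \<le> (int N)\<^sup>2" "(gim r)\<^sup>2 \<le> (int N)\<^sup>2"
      using r by (auto simp: in_gbox_iff intro!: power_mono)
    then have "gnorm r \<le> 2 * (int N)\<^sup>2" by (simp add: gnorm_def)
    then have "real_of_int (gnorm r) \<le> real_of_int (2 * (int N)\<^sup>2)" by (simp only: of_int_le_iff)
    then show "gN r \<le> 2 * n\<^sup>2" by (simp add: gN_def n_def)
  qed (simp add: gN_def)
  define ip where "ip = real_of_int (gre z * gre r + gim z * gim r)"
  have ip1: "gN (z + r) - gN z = 2 * ip + gN r" and ip2: "gN (z - r) - gN z = - 2 * ip + gN r"
    by (simp_all add: gN_def gnorm_def ip_def power2_eq_square algebra_simps)
  \<comment> \<open>Cauchy-Schwarz; the difference of the two sides is the square of a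
    determinant.\<close>
  have ip: "ip\<^sup>2 \<le> gN z * gN r"
  proof -
    have "gN z * gN r - ip\<^sup>2 = (real_of_int (gre z * gim r - gim z * gre r))\<^sup>2"
      by (simp add: gN_def gnorm_def ip_def power2_eq_square algebra_simps)
    then show ?thesis using zero_le_power2[of "real_of_int (gre z * gim r - gim z * gre r)"] by linarith
  qed
  have Zpos: "gN z > 0" using n W unfolding Z by simp
  have main: "(v / gN z)\<^sup>2 \<le> 24 / W" if v: "v = c * 2 * ip + gN r" "c = 1 \<or> c = -1" for v c
  proof -
    have "v\<^sup>2 \<le> 2 * (2 * ip)\<^sup>2 + 2 * (gN r)\<^sup>2"
    proof -
      have "0 \<le> (c * 2 * ip - gN r)\<^sup>2" by simp
      also have "\<dots> = 2 * (2 * ip)\<^sup>2 + 2 * (gN r)\<^sup>2 - v\<^sup>2"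
        using v(2) unfolding v(1) by (auto simp: power2_eq_square algebra_simps)
      finally show ?thesis by simp
    qed
    also have "\<dots> \<le> 8 * (gN z * gN r) + 2 * (gN r)\<^sup>2" using ip by (simp add: power_mult_distrib)
    also have "\<dots> \<le> 8 * (n\<^sup>2 * W * (2 * n\<^sup>2)) + 2 * (2 * n\<^sup>2)\<^sup>2"
      using R n W unfolding Z by (intro add_mono mult_left_mono power_mono) auto
    also have "\<dots> = n ^ 4 * (16 * W + 8)" by (simp add: power2_eq_square power4_eq_xxxx algebra_simps)
    also have "\<dots> \<le> n ^ 4 * (24 * W)" using n W by (intro mult_left_mono) auto
    finally have "v\<^sup>2 \<le> n ^ 4 * (24 * W)" .
    then have "v\<^sup>2 / (gN z)\<^sup>2 \<le> n ^ 4 * (24 * W) / (gN z)\<^sup>2" by (rule divide_right_mono) simp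
    also have "\<dots> = 24 / W" using n W unfolding Z by (simp add: power2_eq_square power4_eq_xxxx field_simps)
    finally show ?thesis by (simp add: power_divide)
  qed
  show d: "d1\<^sup>2 \<le> 24 / gN w" "d2\<^sup>2 \<le> 24 / gN w"
    using main[of "2 * ip + gN r" 1] main[of "- 2 * ip + gN r" "-1"]
    unfolding d1_def d2_def ip1 ip2 W_def by auto
  have "24 / W \<le> (1 / 2)\<^sup>2" using W by (simp add: field_simps power2_eq_square)
  then have "d1\<^sup>2 \<le> (1 / 2)\<^sup>2" "d2\<^sup>2 \<le> (1 / 2)\<^sup>2" using d unfolding W_def by linarith+
  then have "\<bar>d1\<bar> \<le> \<bar>1 / 2\<bar>" "\<bar>d2\<bar> \<le> \<bar>1 / 2\<bar>" by (simp_all only: abs_le_square_iff)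
  then show "\<bar>d1\<bar> \<le> 1 / 2" "\<bar>d2\<bar> \<le> 1 / 2" by simp_all
  have "d1 + d2 = 2 * gN r / gN z"
    unfolding d1_def d2_def ip1 ip2 by (simp add: add_divide_distrib[symmetric])
  moreover have "2 * gN r / gN z \<le> 2 * (2 * n\<^sup>2) / gN z" using R Zpos by (intro divide_right_mono) auto
  moreover have "2 * (2 * n\<^sup>2) / gN z = 4 / W" using n W unfolding Z by (simp add: field_simps power2_eq_square)
  moreover have "0 \<le> 2 * gN r / gN z" using R Zpos by simp
  ultimately show "\<bar>d1 + d2\<bar> \<le> 4 / gN w" unfolding W_def by simp
qed

text \<open>In a symmetric difference the linear terms add up to \<open>s * (d1 + d2)\<close>, which
  is of the same order \<open>1 / gN w\<close> as the bound for the quadratic remainders; this is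
  the extra factor gained.\<close>

lemma gdiff_bound:
  assumes N: "N > 0" and bound: "\<And>a. norm (e a) \<le> B" and \<sigma>: "\<sigma> > 0"
  obtains C where "\<And>w s. gN w \<ge> 100 \<Longrightarrow> Re s \<ge> \<sigma> \<Longrightarrow> norm s \<le> K \<Longrightarrow>
    norm (gdiff e N w s) \<le> C * exp (- (\<sigma> + 1) * ln (gN w))"
proof
  define CK where "CK = 4 * K\<^sup>2 * exp K + 2 * K"
  fix w s assume w: "gN w \<ge> 100" and s: "Re s \<ge> \<sigma>" "norm s \<le> K"
  have K: "K \<ge> 0" using s(2) norm_ge_zero order_trans by blast
  have CK: "CK \<ge> 0" using K by (simp add: CK_def)
  define z where "z = of_nat N * w"
  have w0: "w \<noteq> 0" using w by (auto simp: gN_def)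
  then have z0: "z \<noteq> 0" using N by (simp add: z_def)
  have zw: "gN z \<ge> gN w"
  proof -
    have "gN z = (real N)\<^sup>2 * gN w" by (simp add: z_def gN_of_nat_mult)
    moreover have "1 \<le> (real N)\<^sup>2" using N by (simp add: one_le_power)
    ultimately show ?thesis using w mult_right_mono[of 1 "(real N)\<^sup>2" "gN w"] by simp
  qed
  have tz: "norm (gterm s z) \<le> exp (- \<sigma> * ln (gN w))"
  proof -
    have "\<sigma> * ln (gN w) \<le> Re s * ln (gN z)"
      using s(1) \<sigma> zw w by (intro mult_mono) auto
    then show ?thesis using z0 by (simp add: gterm_def)
  qed
  have one: "norm (e r * (gterm s (z + r) + gterm s (z - r) - 2 * gterm s z))
      \<le> B * (exp (- \<sigma> * ln (gN w)) * ((48 * CK + 4 * K) / gN w))" if r: "r \<in> gbox N" for r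
  proof -
    define d1 d2 where "d1 = (gN (z + r) - gN z) / gN z" and "d2 = (gN (z - r) - gN z) / gN z"
    note d = gN_shift_bounds[OF r N w, folded z_def, folded d1_def d2_def]
    define E1 E2 where "E1 = exp (- s * of_real (ln (1 + d1)))" and "E2 = exp (- s * of_real (ln (1 + d2)))"
    have "gterm s (z + r) = gterm s z * E1" "gterm s (z - r) = gterm s z * E2"
      unfolding E1_def E2_def by (rule gterm_shift[OF z0 d1_def d(3)] gterm_shift[OF z0 d2_def d(4)])+
    then have eq: "gterm s (z + r) + gterm s (z - r) - 2 * gterm s z = gterm s z * (E1 + E2 - 2)"
      by (simp add: algebra_simps)
    have "norm (E1 - 1 + s * of_real d1) \<le> CK * d1\<^sup>2" "norm (E2 - 1 + s * of_real d2) \<le> CK * d2\<^sup>2"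
      unfolding E1_def E2_def CK_def by (intro exp_ln_second_order d s)+
    moreover have "CK * d1\<^sup>2 \<le> CK * (24 / gN w)" "CK * d2\<^sup>2 \<le> CK * (24 / gN w)"
      by (intro mult_left_mono d CK)+
    moreover have "norm (s * of_real (d1 + d2)) \<le> K * (4 / gN w)"
      unfolding norm_mult norm_of_real by (intro mult_mono s d K) auto
    moreover have "norm (E1 + E2 - 2) \<le> norm (E1 - 1 + s * of_real d1) + norm (E2 - 1 + s * of_real d2) + norm (s * of_real (d1 + d2))"
    proof -
      have *: "norm (a + b - c) \<le> norm a + norm b + norm c" for a b c :: complex
        using norm_triangle_ineq4[of "a + b" c] norm_triangle_ineq[of a b] by linarith
      have eq2: "E1 + E2 - 2 = (E1 - 1 + s * of_real d1) + (E2 - 1 + s * of_real d2) - s * of_real (d1 + d2)"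
        by (simp add: algebra_simps)
      show ?thesis by (subst eq2) (rule *)
    qed
    ultimately have "norm (E1 + E2 - 2) \<le> CK * (24 / gN w) + CK * (24 / gN w) + K * (4 / gN w)" by linarith
    also have "\<dots> = (48 * CK + 4 * K) / gN w" by (simp add: add_divide_distrib)
    finally have nE: "norm (E1 + E2 - 2) \<le> (48 * CK + 4 * K) / gN w" .
    have B: "B \<ge> 0" using bound norm_ge_zero order_trans by blast
    show ?thesis unfolding eq norm_mult
      using B by (intro mult_mono bound tz nE) auto
  qed
  have "norm (gdiff e N w s) \<le> norm (\<Sum>r\<in>gbox N. e r * (gterm s (z + r) + gterm s (z - r) - 2 * gterm s z))"
    unfolding gdiff_def z_def[symmetric] norm_divide by simp
  also have "\<dots> \<le> (\<Sum>r\<in>gbox N. norm (e r * (gterm s (z + r) + gterm s (z - r) - 2 * gterm s z)))"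
    by (rule norm_sum)
  also have "\<dots> \<le> (\<Sum>r\<in>gbox N. B * (exp (- \<sigma> * ln (gN w)) * ((48 * CK + 4 * K) / gN w)))"
    by (intro sum_mono one)
  also have "\<dots> = (real (card (gbox N)) * B * (48 * CK + 4 * K)) * (exp (- \<sigma> * ln (gN w)) / gN w)"
    by simp
  also have "exp (- \<sigma> * ln (gN w)) / gN w = exp (- (\<sigma> + 1) * ln (gN w))"
  proof -
    have "gN w = exp (ln (gN w))" using w by simp
    then have "exp (- \<sigma> * ln (gN w)) / gN w = exp (- \<sigma> * ln (gN w) - ln (gN w))" by (simp add: exp_diff)
    then show ?thesis by (simp add: algebra_simps)
  qed
  finally show "norm (gdiff e N w s) \<le> (real (card (gbox N)) * B * (48 * CK + 4 * K)) * exp (- (\<sigma> + 1) * ln (gN w))" .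
qed

lemma finite_gN_less: "finite {w. gN w < 100}"
proof (rule finite_subset)
  show "{w. gN w < 100} \<subseteq> (\<lambda>(x, y). Gint x y) ` ({-10..10} \<times> {-10..10})"
  proof
    fix w assume "w \<in> {w. gN w < 100}"
    then have "gnorm w < 100" by (simp add: gN_def)
    then have "(gre w)\<^sup>2 + (gim w)\<^sup>2 < 100" by (simp add: gnorm_def)
    then have "(gre w)\<^sup>2 \<le> 100" "(gim w)\<^sup>2 \<le> 100"
      using zero_le_power2[of "gre w"] zero_le_power2[of "gim w"] by linarith+
    then have "(gre w)\<^sup>2 \<le> 10\<^sup>2" "(gim w)\<^sup>2 \<le> 10\<^sup>2" by simp_all
    then have "\<bar>gre w\<bar> \<le> 10" "\<bar>gim w\<bar> \<le> 10" unfolding abs_le_square_iff[symmetric] by auto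
    then show "w \<in> (\<lambda>(x, y). Gint x y) ` ({-10..10} \<times> {-10..10})"
      by (intro image_eqI[where x = "(gre w, gim w)"]) (auto simp: gint_eq_iff)
  qed
qed auto

text \<open>Near each point the sum of \<open>gdiff e N w\<close> over \<open>w\<close> converges
  uniformly by \<open>gdiff_bound\<close>, once the finitely many \<open>w\<close> with
  \<open>gN w < 100\<close> are split off. As one sum defines \<open>F\<close> everywhere, local
  holomorphy suffices.\<close>

theorem gser_continuation:
  assumes N: "N > 0" and per: "\<And>a b. e (a + of_nat N * b) = e a" and zero: "(\<Sum>r\<in>gbox N. e r) = 0"
    and bound: "\<And>a. norm (e a) \<le> B"
  obtains F where "F holomorphic_on {s. Re s > 0}" "\<And>s. Re s > 1 \<Longrightarrow> F s = gser e s"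
proof
  define F where "F s = (\<Sum>\<^sub>\<infinity>w. gdiff e N w s)" for s
  show "F s = gser e s" if "Re s > 1" for s
    unfolding F_def using gdiff_has_sum[OF N per zero bound that] by (rule infsumI)
  let ?W = "{w. gN w < 100}"
  have "\<exists>r>0. F holomorphic_on ball s0 r" if s0: "Re s0 > 0" for s0
  proof -
    define r where "r = Re s0 / 2"
    have r: "r > 0" using s0 by (simp add: r_def)
    obtain C where C: "\<And>w s. gN w \<ge> 100 \<Longrightarrow> Re s \<ge> r \<Longrightarrow> norm s \<le> norm s0 + r \<Longrightarrow>
        norm (gdiff e N w s) \<le> C * exp (- (r + 1) * ln (gN w))"
      by (rule gdiff_bound[where e = e and B = B and K = "norm s0 + r", OF N bound r]) blast
    have cb: "Re s \<ge> r" "norm s \<le> norm s0 + r" if "s \<in> cball s0 r" for s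
    proof -
      have n: "norm (s0 - s) \<le> r" using that by (simp add: dist_norm)
      then show "Re s \<ge> r" using abs_Re_le_cmod[of "s0 - s"] by (simp add: r_def)
      show "norm s \<le> norm s0 + r" using n norm_triangle_ineq2[of s s0] by (simp add: norm_minus_commute)
    qed
    have "(\<lambda>w. exp (- (r + 1) * ln (gN w))) summable_on (- {0})"
      using r by (intro summable_gN_powr) simp
    then have "(\<lambda>w. exp (- (r + 1) * ln (gN w))) summable_on (- ?W)"
      by (rule summable_on_subset) (auto simp: gN_def)
    then have sm: "(\<lambda>w. C * exp (- (r + 1) * ln (gN w))) summable_on (- ?W)"
      by (rule summable_on_cmult_right)
    have nb: "norm (gdiff e N w s) \<le> C * exp (- (r + 1) * ln (gN w))" if "w \<in> - ?W" "s \<in> cball s0 r" for w s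
      using that by (intro C cb) auto
    have ul: "uniform_limit (cball s0 r) (\<lambda>X s. \<Sum>w\<in>X. gdiff e N w s) (\<lambda>s. \<Sum>\<^sub>\<infinity>w\<in>- ?W. gdiff e N w s)
        (finite_subsets_at_top (- ?W))"
      by (rule Weierstrass_m_test_general[OF nb sm])
    have hs: "(\<lambda>s. \<Sum>w\<in>X. gdiff e N w s) holomorphic_on A" for X A
      by (intro holomorphic_on_sum holomorphic_gdiff)
    obtain "(\<lambda>s. \<Sum>\<^sub>\<infinity>w\<in>- ?W. gdiff e N w s) holomorphic_on ball s0 r"
      by (rule holomorphic_uniform_limit[OF _ ul])
        (auto intro!: always_eventually hs holomorphic_on_imp_continuous_on)
    then have "(\<lambda>s. (\<Sum>w\<in>?W. gdiff e N w s) + (\<Sum>\<^sub>\<infinity>w\<in>- ?W. gdiff e N w s)) holomorphic_on ball s0 r"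
      by (intro holomorphic_intros hs)
    moreover have "F s = (\<Sum>w\<in>?W. gdiff e N w s) + (\<Sum>\<^sub>\<infinity>w\<in>- ?W. gdiff e N w s)" if "s \<in> ball s0 r" for s
    proof -
      have "(\<lambda>w. norm (gdiff e N w s)) summable_on (- ?W)"
        using that by (intro Infinite_Sum.abs_summable_on_comparison_test'[OF sm] nb) auto
      then have "(\<lambda>w. gdiff e N w s) summable_on (- ?W)" by (rule abs_summable_summable)
      then have "(\<Sum>\<^sub>\<infinity>w\<in>?W \<union> - ?W. gdiff e N w s) = (\<Sum>\<^sub>\<infinity>w\<in>?W. gdiff e N w s) + (\<Sum>\<^sub>\<infinity>w\<in>- ?W. gdiff e N w s)"
        using finite_gN_less by (intro infsum_Un_disjoint) auto
      then show ?thesis unfolding F_def using finite_gN_less by simp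
    qed
    ultimately have "F holomorphic_on ball s0 r" by (subst holomorphic_cong[OF refl])
    then show ?thesis using r by blast
  qed
  then have *: "\<exists>r>0. F holomorphic_on ball s0 r" if "Re s0 > 0" for s0 using that .
  show "F holomorphic_on {s. Re s > 0}"
    unfolding holomorphic_on_def
  proof
    fix s :: complex assume "s \<in> {s. Re s > 0}"
    then obtain r where "r > 0" "F holomorphic_on ball s r" using * by auto
    then have "F field_differentiable at s"
      by (intro holomorphic_on_imp_differentiable_at[of _ "ball s r"]) auto
    then show "F field_differentiable at s within {s. Re s > 0}" by (rule field_differentiable_at_within)
  qed
qed

text \<open>These signs sum to 0 over the residues modulo 2, so they satisfy the mean-value
  condition that the constant 1 violates; \<open>gser_esgn\<close> then recovers zeta up to an
  explicit factor with a zero at 1.\<close>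

definition esgn :: "gint \<Rightarrow> complex" where "esgn a = (if godd a then 1 else -1)"

lemma not_godd_iff: "\<not> godd a \<longleftrightarrow> 1 + gi dvd a"
proof
  assume "\<not> godd a"
  then have e: "even (gre a + gim a)" "even (gim a - gre a)" by (auto simp: godd_def)
  obtain x where "gre a + gim a = 2 * x" using e(1) by (rule evenE)
  moreover obtain y where "gim a - gre a = 2 * y" using e(2) by (rule evenE)
  ultimately have "a = (1 + gi) * Gint x y" by (simp add: gint_eq_iff)
  then show "1 + gi dvd a" by simp
qed (auto simp: godd_mult godd_def)

text \<open>The even elements are the multiples of \<open>1 + gi\<close>, which has norm 2, so their
  part of the zeta series is \<open>exp (- s * ln 2)\<close> times the whole; it is subtracted
  twice.\<close>

lemma gser_esgn:
  assumes s: "Re s > 1"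
  shows "gser esgn s = (1 - 2 * exp (- s * of_real (ln 2))) * gser (\<lambda>_. 1) s"
proof -
  let ?f = "\<lambda>a. exp (- s * complex_of_real (ln (gN a)))"
  let ?E = "{a. a \<noteq> 0 \<and> \<not> godd a}"
  have 1: "(?f has_sum gser (\<lambda>_. 1) s) (- {0})"
    using dser_has_sum[OF dser_abs_gser[of "\<lambda>_. 1" 1] s] by (simp add: gser_def)
  have e: "?f ((1 + gi) * b) = exp (- s * of_real (ln 2)) * ?f b" if "b \<in> - {0}" for b
  proof -
    have "gN b > 0" using gN_ge_1[of b] that by auto
    then have "ln (gN ((1 + gi) * b)) = ln 2 + ln (gN b)"
      by (subst gN_mult, subst ln_mult_pos) (auto simp: gN_def gnorm_def)
    then show ?thesis by (simp add: distrib_left exp_add [symmetric])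
  qed
  have "((\<lambda>b. exp (- s * of_real (ln 2)) * ?f b) has_sum exp (- s * of_real (ln 2)) * gser (\<lambda>_. 1) s) (- {0})"
    by (rule has_sum_cmult_right[OF 1])
  also have "?this \<longleftrightarrow> (?f has_sum exp (- s * of_real (ln 2)) * gser (\<lambda>_. 1) s) ?E"
  proof (rule has_sum_reindex_bij_witness[where i = "\<lambda>a. a div (1 + gi)" and j = "\<lambda>b. (1 + gi) * b"])
    have nz: "1 + gi \<noteq> 0" by (simp add: gint_eq_iff)
    show "(1 + gi) * b div (1 + gi) = b" for b using nz by simp
    show "(1 + gi) * b \<in> ?E" if "b \<in> - {0}" for b using that nz not_godd_iff[of "(1 + gi) * b"] by auto
    show "(1 + gi) * (a div (1 + gi)) = a" "a div (1 + gi) \<in> - {0}" if "a \<in> ?E" for a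
      using that nz by (auto simp: not_godd_iff dvd_div_eq_0_iff)
  qed (simp_all only: e)
  finally have "((\<lambda>a. - 2 * ?f a) has_sum - 2 * (exp (- s * of_real (ln 2)) * gser (\<lambda>_. 1) s)) ?E"
    by (rule has_sum_cmult_right)
  then have "((\<lambda>a. (if godd a then 0 else - 2) * ?f a) has_sum - 2 * (exp (- s * of_real (ln 2)) * gser (\<lambda>_. 1) s)) (- {0})"
    by (rule has_sum_cong_neutral[THEN iffD1, rotated -1]) auto
  then have "((\<lambda>a. ?f a + (if godd a then 0 else - 2) * ?f a) has_sum
      gser (\<lambda>_. 1) s + - 2 * (exp (- s * of_real (ln 2)) * gser (\<lambda>_. 1) s)) (- {0})"
    by (rule has_sum_add[OF 1])
  moreover have "?f a + (if godd a then 0 else - 2) * ?f a = esgn a * ?f a" for a by (simp add: esgn_def)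
  ultimately have "((\<lambda>a. esgn a * ?f a) has_sum
      gser (\<lambda>_. 1) s - 2 * (exp (- s * of_real (ln 2)) * gser (\<lambda>_. 1) s)) (- {0})" by simp
  moreover have "((\<lambda>a. esgn a * ?f a) has_sum gser esgn s) (- {0})"
    unfolding gser_def by (rule dser_has_sum[OF dser_abs_gser[of _ 1] s]) (auto simp: esgn_def)
  ultimately have "gser esgn s = gser (\<lambda>_. 1) s - 2 * (exp (- s * of_real (ln 2)) * gser (\<lambda>_. 1) s)"
    by (rule has_sum_unique[rotated])
  then show ?thesis by (simp add: algebra_simps)
qed

lemma esgn_continuation:
  obtains E where "E holomorphic_on {s. Re s > 0}" "\<And>s. Re s > 1 \<Longrightarrow> E s = gser esgn s"
proof (rule gser_continuation[of 2 esgn 1])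
  show "esgn (a + of_nat 2 * b) = esgn a" for a b by (simp add: esgn_def godd_def)
  have "gbox 2 = {Gint 0 0, Gint 0 1, Gint 1 0, Gint 1 1}"
    by (auto simp: gbox_def numeral_2_eq_2 lessThan_Suc image_Un)
  then show "(\<Sum>r\<in>gbox 2. esgn r) = 0" by (simp add: esgn_def godd_def)
qed (auto simp: esgn_def)

text \<open>On \<open>0 \<le> y < x\<close> each of the \<open>x\<close> values of \<open>y\<close>
  contributes at least \<open>1 / (2 * x ^ 2)\<close>, so that the column at \<open>x\<close>
  contributes at least \<open>1 / (2 * x)\<close>, a term of the harmonic series.\<close>

lemma not_summable_inverse_gN: "\<not> (\<lambda>a. 1 / gN a) summable_on (- {0})"
proof
  assume s: "(\<lambda>a. 1 / gN a) summable_on (- {0})"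
  let ?S = "SIGMA x:{1::nat..}. {..<x}"
  let ?h = "\<lambda>(x, y). Gint (int x) (int y)"
  have "(\<lambda>a. 1 / gN a) summable_on ?h ` ?S"
    by (rule summable_on_subset[OF s]) (auto simp: gint_eq_iff)
  then have "((\<lambda>a. 1 / gN a) \<circ> ?h) summable_on ?S"
    by (subst (asm) summable_on_reindex) (auto simp: inj_on_def)
  then have "(\<lambda>x. infsum (\<lambda>y. ((\<lambda>a. 1 / gN a) \<circ> ?h) (x, y)) {..<x}) summable_on {1..}"
    by (rule summable_on_SigmaD) auto
  then have "(\<lambda>x::nat. 1 / (2 * real x)) summable_on {1..}"
  proof (rule summable_on_comparison_test)
    fix x :: nat assume x: "x \<in> {1..}"
    have "1 / (2 * real x) = (\<Sum>y<x. 1 / (2 * (real x)\<^sup>2))"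
      using x by (simp add: power2_eq_square field_simps)
    also have "\<dots> \<le> (\<Sum>y<x. 1 / gN (Gint (int x) (int y)))"
    proof (rule sum_mono)
      fix y assume "y \<in> {..<x}"
      then have "(real y)\<^sup>2 \<le> (real x)\<^sup>2" by (intro power_mono) auto
      then have "gN (Gint (int x) (int y)) \<le> 2 * (real x)\<^sup>2" by (simp add: gN_def gnorm_def)
      moreover have "gN (Gint (int x) (int y)) > 0" using x gN_ge_1[of "Gint (int x) (int y)"] by (auto simp: gint_eq_iff)
      ultimately show "1 / (2 * (real x)\<^sup>2) \<le> 1 / gN (Gint (int x) (int y))" 
        using x by (intro divide_left_mono mult_pos_pos) auto
    qed
    finally show "1 / (2 * real x) \<le> infsum (\<lambda>y. ((\<lambda>a. 1 / gN a) \<circ> ?h) (x, y)) {..<x}" by simp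
  qed auto
  also have "{1::nat..} = range Suc" by (auto simp: image_iff Suc_le_eq gr0_conv_Suc)
  finally have "(\<lambda>n. 1 / (2 * real (Suc n))) summable_on UNIV"
    by (subst (asm) summable_on_reindex) (auto simp: o_def)
  then have "summable (\<lambda>n. 1 / (2 * real (Suc n)))" by (rule summable_on_imp_summable)
  then have "summable (\<lambda>n. 2 * (1 / (2 * real (Suc n))))" by (rule summable_mult)
  moreover have "2 * (1 / (2 * c)) = inverse c" for c :: real
    by (cases "c = 0") (simp_all add: field_simps)
  ultimately have "summable (\<lambda>n. inverse (real (Suc n)))" by (simp only:)
  then have "summable (\<lambda>n. inverse (real n))" by (subst (asm) summable_Suc_iff)
  then show False using not_summable_harmonic[where 'a = real] by simp
qed

lemma dser_real:
  assumes "dser_abs x0 A c l" "x > x0" "\<And>j. j \<in> A \<Longrightarrow> c j = of_real (b j)"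
  shows "((\<lambda>j. b j * exp (- x * l j)) has_sum Re (dser A c l (of_real x))) A"
    and "Im (dser A c l (of_real x)) = 0"
proof -
  have "((\<lambda>j. c j * exp (- of_real x * of_real (l j))) has_sum dser A c l (of_real x)) A"
    by (rule dser_has_sum[OF assms(1)]) (use assms(2) in simp)
  also have "?this \<longleftrightarrow> ((\<lambda>j. complex_of_real (b j * exp (- x * l j))) has_sum dser A c l (of_real x)) A"
  proof (intro has_sum_cong)
    fix j assume "j \<in> A"
    have "exp (- of_real x * of_real (l j)) = complex_of_real (exp (- x * l j))"
      by (simp flip: exp_of_real)
    then show "c j * exp (- of_real x * of_real (l j)) = complex_of_real (b j * exp (- x * l j))"
      using assms(3)[OF \<open>j \<in> A\<close>] by simp
  qed
  finally have *: "((\<lambda>j. complex_of_real (b j * exp (- x * l j))) has_sum dser A c l (of_real x)) A" .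
  from has_sum_Re[OF *] show "((\<lambda>j. b j * exp (- x * l j)) has_sum Re (dser A c l (of_real x))) A" by simp
  from has_sum_Im[OF *] show "Im (dser A c l (of_real x)) = 0"
    by (simp add: has_sum_0_simp has_sum_unique del: has_sum_0_simp) (metis has_sum_0_simp has_sum_unique)
qed

lemma mser_1_real:
  assumes "x > 1"
  shows "((\<lambda>(p, k). ln (gN p) * exp (- x * mlog (p, k))) has_sum Re (mser (\<lambda>_. 1) (of_real x))) gpp"
    and "Im (mser (\<lambda>_. 1) (of_real x)) = 0"
proof -
  note d = dser_abs_mser[of "\<lambda>_. 1"]
  show "((\<lambda>(p, k). ln (gN p) * exp (- x * mlog (p, k))) has_sum Re (mser (\<lambda>_. 1) (of_real x))) gpp"
    using dser_real(1)[OF d assms, of "\<lambda>(p, k). ln (gN p)"] unfolding mser_def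
    by (simp add: case_prod_unfold)
  show "Im (mser (\<lambda>_. 1) (of_real x)) = 0"
    using dser_real(2)[OF d assms, of "\<lambda>(p, k). ln (gN p)"] unfolding mser_def
    by (simp add: case_prod_unfold)
qed

text \<open>Here \<open>mser\<close> is minus the derivative of \<open>ln Z\<close>. An upper bound
  near 1 would bound \<open>Z\<close> there by the mean value theorem; letting \<open>x\<close> tend
  to 1 in finite partial sums, the sum of \<open>1 / gN a\<close> would then be finite.\<close>

lemma mser_1_unbounded:
  assumes "\<delta> > 0"
  shows "\<exists>x. 1 < x \<and> x < 1 + \<delta> \<and> Re (mser (\<lambda>_. 1) (of_real x)) > C"
proof (rule ccontr)
  assume "\<not> ?thesis"
  then have M: "Re (mser (\<lambda>_. 1) (of_real x)) \<le> C" if "1 < x" "x < 1 + \<delta>" for x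
    using that by force
  define Z where "Z x = Re (gser (\<lambda>_. 1) (of_real x))" for x :: real
  note dg = dser_abs_gser[of "\<lambda>_. 1" 1, simplified]
  have Zs: "((\<lambda>a. exp (- x * ln (gN a))) has_sum Z x) (- {0})" if "x > 1" for x
    using dser_real(1)[OF dg that, of "\<lambda>_. 1"] unfolding Z_def gser_def by simp
  have ImZ: "Im (gser (\<lambda>_. 1) (of_real x)) = 0" if "x > 1" for x
    using dser_real(2)[OF dg that, of "\<lambda>_. 1"] unfolding gser_def by simp
  have fin: "(\<Sum>a\<in>F. exp (- x * ln (gN a))) \<le> Z x" if "x > 1" "finite F" "F \<subseteq> - {0}" for F x
    by (rule finite_sum_le_has_sum[OF Zs[OF that(1)] that(2,3)]) simp
  have Zpos: "Z x > 0" if "x > 1" for x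
    using fin[OF that, of "{1}"] by (simp add: gN_def)
  have dZ: "(Z has_real_derivative - (Z x * Re (mser (\<lambda>_. 1) (of_real x)))) (at x)" if x: "x > 1" for x
  proof -
    have "(gser (\<lambda>_. 1) has_field_derivative - (gser (\<lambda>_. 1) (of_real x) * mser (\<lambda>_. 1) (of_real x))) (at (of_real x))"
      by (rule gser_deriv) (use x in auto)
    then have "((\<lambda>x. gser (\<lambda>_. 1) (of_real x)) has_vector_derivative
        - (gser (\<lambda>_. 1) (of_real x) * mser (\<lambda>_. 1) (of_real x))) (at x)"
      by (rule has_vector_derivative_real_field)
    then have "((\<lambda>x. Re (gser (\<lambda>_. 1) (of_real x))) has_vector_derivative
        Re (- (gser (\<lambda>_. 1) (of_real x) * mser (\<lambda>_. 1) (of_real x)))) (at x)"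
      by (rule bounded_linear.has_vector_derivative[OF bounded_linear_Re])
    then show ?thesis
      unfolding has_real_derivative_iff_has_vector_derivative Z_def[abs_def]
      using ImZ[OF x] mser_1_real(2)[OF x] by simp
  qed
  define b where "b = 1 + \<delta> / 2"
  have b: "1 < b" "b < 1 + \<delta>" using assms by (auto simp: b_def)
  define K where "K = Z b * exp (\<bar>C\<bar> * b)"
  have ZK: "Z x \<le> K" if x: "1 < x" "x < b" for x
  proof -
    have "((\<lambda>x. ln (Z x)) has_real_derivative - Re (mser (\<lambda>_. 1) (of_real t))) (at t)" if "x \<le> t" "t \<le> b" for t
    proof -
      have t1: "t > 1" using that x by simp
      have "((\<lambda>x. ln (Z x)) has_real_derivative (1 / Z t) * - (Z t * Re (mser (\<lambda>_. 1) (of_real t)))) (at t)"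
        by (rule DERIV_chain'[OF dZ[OF t1] DERIV_ln_divide[OF Zpos[OF t1]]])
      then show ?thesis using Zpos[OF t1] by simp
    qed
    then obtain t where t: "x < t" "t < b" "ln (Z b) - ln (Z x) = (b - x) * - Re (mser (\<lambda>_. 1) (of_real t))"
      using MVT2[OF x(2), of "\<lambda>x. ln (Z x)" "\<lambda>t. - Re (mser (\<lambda>_. 1) (of_real t))"] by blast
    have "(b - x) * Re (mser (\<lambda>_. 1) (of_real t)) \<le> (b - x) * \<bar>C\<bar>"
      using M[of t] t x b by (intro mult_left_mono) auto
    also have "\<dots> \<le> b * \<bar>C\<bar>" using x by (intro mult_right_mono) auto
    finally have "ln (Z x) \<le> ln (Z b) + \<bar>C\<bar> * b" using t(3) by (simp add: mult.commute)
    then have "exp (ln (Z x)) \<le> exp (ln (Z b) + \<bar>C\<bar> * b)" by simp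
    then show ?thesis using Zpos[of x] Zpos[OF b(1)] x by (simp add: K_def exp_add)
  qed
  have "(\<lambda>a. 1 / gN a) summable_on (- {0})"
  proof (rule nonneg_bdd_above_summable_on)
    show "bdd_above (sum (\<lambda>a. 1 / gN a) ` {F. F \<subseteq> - {0} \<and> finite F})"
    proof (rule bdd_aboveI2)
      fix F assume F: "F \<in> {F. F \<subseteq> - {0 :: gint} \<and> finite F}"
      have "((\<lambda>x. \<Sum>a\<in>F. exp (- x * ln (gN a))) \<longlongrightarrow> (\<Sum>a\<in>F. exp (- 1 * ln (gN a)))) (at_right 1)"
        by (intro tendsto_intros)
      moreover have "eventually (\<lambda>x. (\<Sum>a\<in>F. exp (- x * ln (gN a))) \<le> K) (at_right 1)"
        using eventually_at_right_real[OF b(1)]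
      proof eventually_elim
        case (elim x)
        then show ?case using F by (intro order_trans[OF fin ZK]) auto
      qed
      ultimately have "(\<Sum>a\<in>F. exp (- 1 * ln (gN a))) \<le> K"
        by (intro tendsto_upperbound) auto
      also have "(\<Sum>a\<in>F. exp (- 1 * ln (gN a))) = (\<Sum>a\<in>F. 1 / gN a)"
      proof (intro sum.cong refl)
        fix a assume "a \<in> F"
        then have "a \<noteq> 0" using F by auto
        then have "gN a \<ge> 1" by (rule gN_ge_1)
        then show "exp (- 1 * ln (gN a)) = 1 / gN a" by (simp add: exp_minus field_simps)
      qed
      finally show "(\<Sum>a\<in>F. 1 / gN a) \<le> K" .
    qed
  qed (auto simp: gN_def)
  then show False using not_summable_inverse_gN by blast
qed

text \<open>Landau's argument: a differential equation \<open>P' = - P M\<close> with a Dirichlet series \<open>M\<close> with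
  nonnegative coefficients gives a recursion for the Taylor coefficients of \<open>P\<close> about 2 which
  dominates those of \<open>M\<close>, so that \<open>M\<close> converges wherever the Taylor series of \<open>P\<close> does.\<close>

context
  fixes A :: "'j set" and c l :: "'j \<Rightarrow> real" and P :: "complex \<Rightarrow> complex" and p0 :: real
  assumes holo: "P holomorphic_on ball 2 2"
    and c: "\<And>j. j \<in> A \<Longrightarrow> c j \<ge> 0"
    and da: "dser_abs 1 A (\<lambda>j. of_real (c j)) l"
    and deriv: "\<And>s. s \<in> ball 2 1 \<Longrightarrow> (P has_field_derivative - (P s * dser A (\<lambda>j. of_real (c j)) l s)) (at s)"
    and P2: "P 2 = of_real p0" "p0 > 0"
begin

text \<open>The terms of the double series obtained by expanding \<open>exp (u * l j)\<close> in the
  series at \<open>2 - u\<close>. They are nonnegative for \<open>u \<ge> 0\<close>, which justifies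
  the interchanges of summation.\<close>

definition lterm :: "real \<Rightarrow> 'j \<Rightarrow> nat \<Rightarrow> real" where
  "lterm u j n = c j * exp (- 2 * l j) * (l j * u) ^ n / fact n"

definition lcoeff :: "nat \<Rightarrow> real" where "lcoeff n = (\<Sum>\<^sub>\<infinity>j\<in>A. lterm 1 j n)"

lemma l_nonneg: "j \<in> A \<Longrightarrow> l j \<ge> 0"
  using da by (simp add: dser_abs_def)

lemma lterm_has_sum: "(lterm u j has_sum c j * exp (- (2 - u) * l j)) UNIV"
proof -
  have "(\<lambda>n. (l j * u) ^ n / fact n) sums exp (l j * u)"
    using exp_converges[of "l j * u"] by (simp add: divide_inverse mult.commute)
  moreover have "summable (\<lambda>n. norm ((l j * u) ^ n / fact n))"
    using summable_norm_exp[of "l j * u"] by (simp add: divide_inverse mult.commute)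
  ultimately have "((\<lambda>n. (l j * u) ^ n / fact n) has_sum exp (l j * u)) UNIV"
    by (intro norm_summable_imp_has_sum)
  then have "((\<lambda>n. (c j * exp (- 2 * l j)) * ((l j * u) ^ n / fact n)) has_sum (c j * exp (- 2 * l j)) * exp (l j * u)) UNIV"
    by (rule has_sum_cmult_right)
  moreover have eq: "(c j * exp (- 2 * l j)) * exp (l j * u) = c j * exp (- (2 - u) * l j)"
    by (simp add: algebra_simps exp_add [symmetric])
  ultimately show ?thesis unfolding eq by (simp add: lterm_def[abs_def])
qed

lemma lterm_nonneg: "j \<in> A \<Longrightarrow> u \<ge> 0 \<Longrightarrow> lterm u j n \<ge> 0"
  using c l_nonneg by (simp add: lterm_def)

lemma lterm_scale: "lterm u j n = lterm 1 j n * u ^ n"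
  by (simp add: lterm_def power_mult_distrib)

lemma lterm_summable:
  assumes "0 \<le> u" "u < 1"
  shows "(\<lambda>(j, n). lterm u j n) summable_on A \<times> UNIV"
proof (rule summable_on_SigmaI)
  show "((\<lambda>n. case (j, n) of (j, n) \<Rightarrow> lterm u j n) has_sum c j * exp (- (2 - u) * l j)) UNIV" for j
    using lterm_has_sum by simp
  have "2 - u > 1" using assms by simp
  then have "(\<lambda>j. norm (complex_of_real (c j)) * exp (- (2 - u) * l j)) summable_on A"
    using da unfolding dser_abs_def by blast
  also have "?this \<longleftrightarrow> (\<lambda>j. c j * exp (- (2 - u) * l j)) summable_on A"
    by (intro summable_on_cong) (simp add: c)
  finally show "(\<lambda>j. c j * exp (- (2 - u) * l j)) summable_on A" .
qed (use assms lterm_nonneg in auto)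

text \<open>At \<open>u = 1\<close> the point \<open>2 - u\<close> lies on the boundary of the
  assumed convergence, so summability is taken at \<open>u = 1 / 2\<close> and rescaled by
  \<open>2 ^ n\<close>.\<close>

lemma lcoeff_has_sum: "((\<lambda>j. lterm 1 j n) has_sum lcoeff n) A"
proof -
  have "(\<lambda>(n, j). lterm (1 / 2) j n) summable_on UNIV \<times> A"
    using lterm_summable[of "1 / 2"] by (subst summable_on_swap) simp
  then have "(\<lambda>j. lterm (1 / 2) j n) summable_on A" by (rule summable_on_SigmaD1) simp
  then have "(\<lambda>j. lterm (1 / 2) j n * 2 ^ n) summable_on A" by (rule summable_on_cmult_left)
  moreover have "lterm (1 / 2) j n * 2 ^ n = lterm 1 j n" for j
    by (subst lterm_scale) (simp add: power_one_over)
  ultimately have "(\<lambda>j. lterm 1 j n) summable_on A" by simp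
  then show ?thesis unfolding lcoeff_def by (rule has_sum_infsum)
qed

lemma lcoeff_nonneg: "lcoeff n \<ge> 0"
  by (rule has_sum_nonneg[OF lcoeff_has_sum]) (simp add: lterm_nonneg)

lemma lcoeff_sums:
  fixes u :: complex
  assumes "norm u < 1"
  shows "(\<lambda>n. of_real (lcoeff n) * u ^ n) sums dser A (\<lambda>j. of_real (c j)) l (2 - u)"
proof -
  let ?t = "\<lambda>(j, n). complex_of_real (lterm 1 j n) * u ^ n"
  have "(\<lambda>(j, n). lterm (norm u) j n) summable_on A \<times> UNIV"
    by (rule lterm_summable) (use assms in auto)
  also have "?this \<longleftrightarrow> (\<lambda>x. norm (?t x)) summable_on A \<times> UNIV"
    by (intro summable_on_cong) (auto simp: norm_mult norm_power lterm_nonneg lterm_scale[of "norm u"])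
  finally have "?t summable_on A \<times> UNIV" by (rule abs_summable_summable)
  then obtain S where S: "(?t has_sum S) (A \<times> UNIV)" by (auto simp: summable_on_def)
  have inner: "((\<lambda>n. ?t (j, n)) has_sum of_real (c j) * exp (- (2 - u) * of_real (l j))) UNIV" for j
  proof -
    have "(\<lambda>n. (of_real (l j) * u) ^ n / fact n) sums exp (of_real (l j) * u)"
      using exp_converges[of "of_real (l j) * u"] by (simp add: scaleR_conv_of_real divide_inverse mult.commute)
    moreover have "summable (\<lambda>n. norm ((of_real (l j) * u) ^ n / fact n))"
      using summable_norm_exp[of "of_real (l j) * u"] by (simp add: scaleR_conv_of_real divide_inverse mult.commute)
    ultimately have "((\<lambda>n. (of_real (l j) * u) ^ n / fact n) has_sum exp (of_real (l j) * u)) UNIV"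
      by (intro norm_summable_imp_has_sum)
    then have "((\<lambda>n. (of_real (c j) * exp (- 2 * of_real (l j))) * ((of_real (l j) * u) ^ n / fact n)) has_sum
        (of_real (c j) * exp (- 2 * of_real (l j))) * exp (of_real (l j) * u)) UNIV"
      by (rule has_sum_cmult_right)
    moreover have "(complex_of_real (c j) * exp (- 2 * of_real (l j))) * exp (of_real (l j) * u)
        = of_real (c j) * exp (- (2 - u) * of_real (l j))"
      by (simp add: algebra_simps exp_add [symmetric])
    then have "((\<lambda>n. (of_real (c j) * exp (- 2 * of_real (l j))) * ((of_real (l j) * u) ^ n / fact n)) has_sum
        of_real (c j) * exp (- (2 - u) * of_real (l j))) UNIV"
      using calculation by (simp only:)
    moreover have "?t (j, n) = (of_real (c j) * exp (- 2 * of_real (l j))) * ((of_real (l j) * u) ^ n / fact n)" for n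
      by (simp add: lterm_def power_mult_distrib exp_of_real [symmetric])
    ultimately show ?thesis by (simp only:)
  qed
  have "((\<lambda>j. of_real (c j) * exp (- (2 - u) * of_real (l j))) has_sum S) A"
    by (rule has_sum_SigmaD[OF S inner])
  moreover have "Re (2 - u) > 1" using assms complex_Re_le_cmod[of u] by simp
  then have "((\<lambda>j. of_real (c j) * exp (- (2 - u) * of_real (l j))) has_sum dser A (\<lambda>j. of_real (c j)) l (2 - u)) A"
    by (rule dser_has_sum[OF da])
  ultimately have SD: "S = dser A (\<lambda>j. of_real (c j)) l (2 - u)" by (rule has_sum_unique)
  have "((\<lambda>(n, j). ?t (j, n)) has_sum S) (UNIV \<times> A)"
    using S by (subst (asm) has_sum_swap) (simp add: case_prod_unfold)
  then have "((\<lambda>n. of_real (lcoeff n) * u ^ n) has_sum S) UNIV"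
  proof (rule has_sum_SigmaD)
    show "((\<lambda>j. case (n, j) of (n, j) \<Rightarrow> ?t (j, n)) has_sum of_real (lcoeff n) * u ^ n) A" for n
      using has_sum_cmult_left[OF has_sum_of_real[OF lcoeff_has_sum[of n]], of "u ^ n"] by simp
  qed
  then show ?thesis unfolding SD by (rule has_sum_imp_sums)
qed

theorem landau_summable:
  assumes x: "0 < x" "x < 2"
  shows "(\<lambda>j. c j * exp (- x * l j)) summable_on A"
proof -
  let ?M = "dser A (\<lambda>j. complex_of_real (c j)) l"
  \<comment> \<open>The reflection turns \<open>P' = - P * M\<close> into \<open>Q' = Q * M\<close>
    with \<open>M\<close> taken at \<open>2 - u\<close>, so that the recursion for the Taylor
    coefficients has no negative signs.\<close>
  define Q where "Q u = P (2 - u)" for u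
  have holoQ: "Q holomorphic_on ball 0 2"
    unfolding Q_def[abs_def]
    by (rule holomorphic_on_compose_gen[OF _ holo, unfolded o_def, of "\<lambda>u. 2 - u"])
      (auto intro!: holomorphic_intros simp: dist_norm)
  define F where "F = fps_expansion Q 0"
  have F: "Q has_fps_expansion F"
    unfolding F_def by (rule has_fps_expansion_fps_expansion[OF _ _ holoQ]) auto
  define L where "L = Abs_fps (\<lambda>n. complex_of_real (lcoeff n))"
  have L: "(\<lambda>u. ?M (2 - u)) has_fps_expansion L"
  proof (rule has_fps_expansionI)
    have "eventually (\<lambda>u::complex. u \<in> ball 0 1) (nhds 0)" by (intro eventually_nhds_in_open) auto
    then show "eventually (\<lambda>u. (\<lambda>n. fps_nth L n * u ^ n) sums ?M (2 - u)) (nhds 0)"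
      by eventually_elim (use lcoeff_sums in \<open>auto simp: L_def\<close>)
  qed
  have "deriv Q has_fps_expansion fps_deriv F" by (rule has_fps_expansion_deriv[OF F])
  moreover have "(\<lambda>u. Q u * ?M (2 - u)) has_fps_expansion F * L" by (rule has_fps_expansion_mult[OF F L])
  moreover have "eventually (\<lambda>u. deriv Q u = Q u * ?M (2 - u)) (nhds 0)"
  proof -
    have "eventually (\<lambda>u::complex. u \<in> ball 0 1) (nhds 0)" by (intro eventually_nhds_in_open) auto
    then show ?thesis
    proof eventually_elim
      fix u :: complex assume u: "u \<in> ball 0 1"
      then have "2 - u \<in> ball 2 1" by (simp add: dist_norm)
      then have "(Q has_field_derivative - (P (2 - u) * ?M (2 - u)) * (0 - 1)) (at u)"
        unfolding Q_def[abs_def] by (intro DERIV_chain'[where g = P] deriv derivative_intros) auto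
      then show "deriv Q u = Q u * ?M (2 - u)" by (simp add: DERIV_imp_deriv Q_def)
    qed
  qed
  then have "deriv Q has_fps_expansion F * L \<longleftrightarrow> (\<lambda>u. Q u * ?M (2 - u)) has_fps_expansion F * L"
    by (rule has_fps_expansion_cong) simp
  ultimately have FL: "fps_deriv F = F * L" using fps_expansion_unique_complex by blast
  have rec: "of_nat (Suc n) * fps_nth F (Suc n) = (\<Sum>i\<le>n. fps_nth F i * of_real (lcoeff (n - i)))" for n
    using arg_cong[OF FL, of "\<lambda>G. fps_nth G n"] by (simp add: fps_mult_nth L_def atLeast0AtMost)
  have F0: "fps_nth F 0 = of_real p0"
    by (simp add: F_def fps_expansion_def Q_def P2)
  have "\<exists>a. fps_nth F n = of_real a \<and> a \<ge> 0" for n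
  proof (induction n rule: less_induct)
    case (less n)
    show ?case
    proof (cases n)
      case 0
      then show ?thesis using F0 P2 by auto
    next
      case (Suc m)
      have "\<forall>i\<in>{..m}. \<exists>a. fps_nth F i = complex_of_real a \<and> a \<ge> 0" using less Suc by auto
      then obtain a where a: "\<And>i. i \<le> m \<Longrightarrow> fps_nth F i = complex_of_real (a i) \<and> a i \<ge> 0" by (metis atMost_iff)
      have "of_nat (Suc m) * fps_nth F (Suc m) = of_real (\<Sum>i\<le>m. a i * lcoeff (m - i))"
        unfolding rec using a by simp
      then have "fps_nth F n = of_real ((\<Sum>i\<le>m. a i * lcoeff (m - i)) / real (Suc m))"
        by (simp add: Suc field_simps del: of_nat_Suc)
      moreover have "(\<Sum>i\<le>m. a i * lcoeff (m - i)) / real (Suc m) \<ge> 0"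
        using a lcoeff_nonneg by (intro divide_nonneg_nonneg sum_nonneg mult_nonneg_nonneg) auto
      ultimately show ?thesis by blast
    qed
  qed
  then obtain a where a: "\<And>n. fps_nth F n = complex_of_real (a n)" "\<And>n. a n \<ge> 0" by metis
  have a0: "a 0 = p0" using F0 a(1)[of 0] by simp
  \<comment> \<open>Only the term \<open>i = 0\<close> of the recursion is kept; the others are
    nonnegative.\<close>
  have dom: "p0 * lcoeff n \<le> real (Suc n) * a (Suc n)" for n
  proof -
    have "complex_of_real (real (Suc n) * a (Suc n)) = complex_of_real (\<Sum>i\<le>n. a i * lcoeff (n - i))"
      using rec[of n] by (simp add: a)
    then have "real (Suc n) * a (Suc n) = (\<Sum>i\<le>n. a i * lcoeff (n - i))" by (simp only: of_real_eq_iff)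
    also have "\<dots> \<ge> (\<Sum>i\<in>{0}. a i * lcoeff (n - i))"
      using a lcoeff_nonneg by (intro sum_mono2) auto
    finally show ?thesis using a0 by simp
  qed
  define u where "u = 2 - x"
  have u: "0 < u" "u < 2" using x by (auto simp: u_def)
  have "summable (\<lambda>n. fps_nth F n * w ^ n)" if "norm w < 2" for w
  proof -
    have "(\<lambda>n. (deriv ^^ n) Q 0 / fact n * (w - 0) ^ n) sums Q w"
      by (rule holomorphic_power_series[OF holoQ]) (use that in simp)
    then show ?thesis by (auto simp: F_def fps_expansion_def sums_iff)
  qed
  \<comment> \<open>The Taylor series of \<open>Q\<close> converges on the whole disc of radius 2,
    and so does its termwise derivative, which carries the factor \<open>Suc n\<close> of the
    comparison.\<close>
  then have "summable (\<lambda>n. diffs (fps_nth F) n * of_real u ^ n)"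
    using u by (intro termdiff_converges[of _ 2]) auto
  also have "(\<lambda>n. diffs (fps_nth F) n * of_real u ^ n) = (\<lambda>n. complex_of_real (real (Suc n) * a (Suc n) * u ^ n))"
    by (simp add: diffs_def a)
  finally have "summable (\<lambda>n. real (Suc n) * a (Suc n) * u ^ n)" by (simp only: summable_of_real_iff)
  then have "summable (\<lambda>n. (1 / p0) * (real (Suc n) * a (Suc n) * u ^ n))" by (rule summable_mult)
  then have "summable (\<lambda>n. lcoeff n * u ^ n)"
  proof (rule summable_comparison_test'[where N = 0])
    fix n
    have "lcoeff n \<le> (1 / p0) * (real (Suc n) * a (Suc n))" using dom[of n] P2(2) by (simp add: field_simps)
    then have "lcoeff n * u ^ n \<le> (1 / p0) * (real (Suc n) * a (Suc n)) * u ^ n"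
      using u by (intro mult_right_mono) auto
    then show "norm (lcoeff n * u ^ n) \<le> (1 / p0) * (real (Suc n) * a (Suc n) * u ^ n)"
      using u lcoeff_nonneg[of n] by (simp only: real_norm_def abs_mult) (simp add: mult.assoc)
  qed
  then have 1: "(\<lambda>n. lcoeff n * u ^ n) summable_on UNIV"
    using u lcoeff_nonneg by (subst summable_on_UNIV_nonneg_real_iff) auto
  have "(\<lambda>(n, j). lterm u j n) summable_on UNIV \<times> A"
  proof (rule summable_on_SigmaI)
    show "((\<lambda>j. case (n, j) of (n, j) \<Rightarrow> lterm u j n) has_sum lcoeff n * u ^ n) A" for n
      using has_sum_cmult_left[OF lcoeff_has_sum[of n], of "u ^ n"] by (simp add: lterm_scale[of u])
  qed (use 1 u lterm_nonneg in auto)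
  then have "(\<lambda>(j, n). lterm u j n) summable_on A \<times> UNIV" by (subst summable_on_swap) simp
  then have "(\<lambda>j. infsum (\<lambda>n. (\<lambda>(j, n). lterm u j n) (j, n)) UNIV) summable_on A"
    by (rule summable_on_SigmaD) (use lterm_has_sum in \<open>auto simp: summable_on_def\<close>)
  then show ?thesis
    using infsumI[OF lterm_has_sum, of u] by (simp add: u_def)
qed

end

section \<open>Nonvanishing at 1\<close>

lemma gnorm_ge_2: "a \<noteq> 0 \<Longrightarrow> \<not> a dvd 1 \<Longrightarrow> gN a \<ge> 2"
proof -
  assume "a \<noteq> 0" "\<not> a dvd 1"
  then have "gnorm a \<noteq> 0" "gnorm a \<noteq> 1" by (auto simp: gnorm_eq_1_iff)
  then have "gnorm a \<ge> 2" using gnorm_nonneg[of a] by linarith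
  then show ?thesis by (simp add: gN_def)
qed

text \<open>\<open>unit\<close> makes the value depend only on the ideal. By \<open>quartic\<close>
  the fourth power of a value is 0 or 1, which explains the exponent 4 in the nonvanishing proof and
  in the orthogonality relations.\<close>

locale gchar =
  fixes \<xi> :: "gint \<Rightarrow> complex"
  assumes mult: "\<xi> (a * b) = \<xi> a * \<xi> b" and one: "\<xi> 1 = 1" and unit: "\<xi> gi = 1"
    and quartic: "\<xi> a = 0 \<or> \<xi> a ^ 4 = 1"
begin

lemma norm_le: "norm (\<xi> a) \<le> 1"
proof (cases "\<xi> a = 0")
  case False
  then have "norm (\<xi> a ^ 4) = 1" using quartic[of a] by simp
  then have "norm (\<xi> a) ^ 4 = 1 ^ 4" by (simp only: norm_power power_one)
  then have "norm (\<xi> a) = 1" by (rule power_eq_imp_eq_base) auto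
  then show ?thesis by simp
qed simp

lemma unit_eq_1: "u dvd 1 \<Longrightarrow> \<xi> u = 1"
proof -
  have "\<xi> (-1) = \<xi> (gi * gi)" by simp
  then have "\<xi> (-1) = 1" by (simp only: mult) (simp add: unit)
  moreover from this have "\<xi> (- gi) = 1" using mult[of "-1" gi] by (simp add: unit)
  ultimately show "u dvd 1 \<Longrightarrow> \<xi> u = 1" unfolding gunit_iff using one unit by auto
qed

lemmas da = dser_abs_gser[of \<xi>, OF norm_le]
lemmas dm = dser_abs_mser[of \<xi>, OF norm_le]
lemmas deriv = gser_deriv[of \<xi>, OF mult one norm_le]

text \<open>For large \<open>x\<close> only the four elements of norm 1 survive, all others having
  norm at least 2. This excludes that the series vanishes identically.\<close>

lemma gser_tendsto_4: "((\<lambda>x. gser \<xi> (of_real x)) \<longlongrightarrow> 4) at_top"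
proof -
  let ?U = "{1, -1, gi, - gi}"
  let ?f = "\<lambda>x a. \<xi> a * exp (- complex_of_real x * of_real (ln (gN a)))"
  define S where "S = (\<Sum>\<^sub>\<infinity>a\<in>- {0} - ?U. exp (- 2 * ln (gN a)))"
  have sm: "(\<lambda>a. exp (- 2 * ln (gN a))) summable_on (- {0} - ?U)"
    using summable_gN_powr[of 2] by (rule summable_on_subset) auto
  have bound: "norm (gser \<xi> (of_real x) - 4) \<le> exp (- (x - 2) * ln 2) * S" if x: "x > 2" for x
  proof -
    have "(?f x has_sum gser \<xi> (of_real x)) (- {0})"
      unfolding gser_def by (rule dser_has_sum[OF da]) (use x in auto)
    moreover have "(?f x has_sum (\<Sum>a\<in>?U. ?f x a)) ?U" by (rule has_sum_finite) simp
    ultimately have "(?f x has_sum gser \<xi> (of_real x) - (\<Sum>a\<in>?U. ?f x a)) (- {0} - ?U)"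
      by (rule has_sum_Diff) auto
    moreover have "(\<Sum>a\<in>?U. ?f x a) = (\<Sum>a\<in>?U. 1)"
      by (intro sum.cong refl) (auto simp: unit_eq_1 gunit_iff gN_def gnorm_def)
    moreover have "(\<Sum>a\<in>?U. 1 :: complex) = 4"
    proof -
      have "card ?U = 4" by (simp add: gint_eq_iff card_insert_if)
      then show ?thesis by simp
    qed
    ultimately have 1: "(?f x has_sum gser \<xi> (of_real x) - 4) (- {0} - ?U)" by simp
    have 2: "((\<lambda>a. exp (- (x - 2) * ln 2) * exp (- 2 * ln (gN a))) has_sum exp (- (x - 2) * ln 2) * S) (- {0} - ?U)"
      unfolding S_def by (intro has_sum_cmult_right has_sum_infsum sm)
    have nb: "norm (?f x a) \<le> exp (- (x - 2) * ln 2) * exp (- 2 * ln (gN a))" if a: "a \<in> - {0} - ?U" for a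
    proof -
      have "gN a \<ge> 2" using a gnorm_ge_2[of a] unfolding gunit_iff by auto
      then have "(x - 2) * ln 2 \<le> (x - 2) * ln (gN a)" using x by (intro mult_left_mono) auto
      then have le: "- x * ln (gN a) \<le> - (x - 2) * ln 2 + - 2 * ln (gN a)" by (simp add: algebra_simps)
      have "norm (?f x a) \<le> 1 * exp (- x * ln (gN a))"
        unfolding norm_mult norm_exp_term by (intro mult_mono norm_le) auto
      also have "\<dots> \<le> exp (- (x - 2) * ln 2 + - 2 * ln (gN a))" using le by simp
      finally show ?thesis by (simp only: exp_add)
    qed
    show ?thesis
      using norm_infsum_le[OF 1 2 nb] .
  qed
  have "((\<lambda>x. exp (- (x - 2) * ln 2) * S) \<longlongrightarrow> 0) at_top"
  proof -
    have "((\<lambda>x::real. exp (- (x - 2) * ln 2)) \<longlongrightarrow> 0) at_top" by real_asymp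
    then show ?thesis using tendsto_mult_left_zero by blast
  qed
  then have "((\<lambda>x. gser \<xi> (of_real x) - 4) \<longlongrightarrow> 0) at_top"
    by (rule Lim_null_comparison[rotated]) (rule eventually_mono[OF eventually_gt_at_top[of 2] bound])
  then show ?thesis by (simp add: LIM_zero_iff)
qed

text \<open>With a primitive \<open>Q\<close> of \<open>mser \<xi>\<close>, the product
  \<open>gser \<xi> * exp Q\<close> is constant on the half-plane. A single zero would make the
  series 0 throughout, against the limit 4.\<close>

lemma gser_nonzero:
  assumes "Re s > 1"
  shows "gser \<xi> s \<noteq> 0"
proof
  assume z: "gser \<xi> s = 0"
  let ?H = "{s. Re s > 1}"
  have H: "convex ?H" "open ?H" by (simp_all add: convex_halfspace_Re_gt open_halfspace_Re_gt)
  have "mser \<xi> holomorphic_on ?H" unfolding mser_def by (rule dser_holomorphic[OF dm])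
  then obtain Q where Q: "\<And>x. x \<in> ?H \<Longrightarrow> (Q has_field_derivative mser \<xi> x) (at x within ?H)"
    using holomorphic_convex_primitive'[OF H] by metis
  have "((\<lambda>x. gser \<xi> x * exp (Q x)) has_field_derivative 0) (at x within ?H)" if "x \<in> ?H" for x
  proof -
    have d: "(gser \<xi> has_field_derivative - (gser \<xi> x * mser \<xi> x)) (at x within ?H)"
      by (rule has_field_derivative_at_within[OF deriv]) (use that in simp)
    have "((\<lambda>x. exp (Q x)) has_field_derivative exp (Q x) * mser \<xi> x) (at x within ?H)"
      by (rule DERIV_chain2[OF DERIV_exp Q[OF that]])
    from DERIV_mult[OF d this] show ?thesis by (simp add: algebra_simps)
  qed
  then obtain k where k: "\<forall>x\<in>?H. gser \<xi> x * exp (Q x) = k"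
    using has_field_derivative_zero_constant[OF H(1)] by blast
  then have "k = 0" using z assms by force
  then have zero: "gser \<xi> x = 0" if "Re x > 1" for x using k that by auto
  have "((\<lambda>x. gser \<xi> (of_real x)) \<longlongrightarrow> 0) at_top"
    by (intro tendsto_eventually eventually_mono[OF eventually_gt_at_top[of 1]]) (simp add: zero)
  from tendsto_unique[OF _ this gser_tendsto_4] have "(0 :: complex) = 4" by simp
  then show False by simp
qed

lemma gchar_cnj: "gchar (\<lambda>a. cnj (\<xi> a))"
proof
  show "cnj (\<xi> a) = 0 \<or> cnj (\<xi> a) ^ 4 = 1" for a
    using quartic[of a] by (metis complex_cnj_cancel_iff complex_cnj_one complex_cnj_power complex_cnj_zero)
qed (auto simp: mult one unit)

lemma gser_cnj: "gser (\<lambda>a. cnj (\<xi> a)) s = cnj (gser \<xi> (cnj s))"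
  unfolding gser_def dser_def infsum_cnj[symmetric] by (simp add: exp_cnj)

end

lemma gchar_1: "gchar (\<lambda>_. 1)"
  by standard auto

lemma geometric_bound:
  fixes q x :: real
  assumes "q \<ge> 2" "x \<ge> 1"
  shows "((\<lambda>k. exp (- x * (real k * ln q))) has_sum 1 / (q powr x - 1)) {1..}"
    and "1 / (q powr x - 1) \<le> 2 / q"
proof -
  have qx: "q powr x \<ge> q" using assms powr_mono[of 1 x q] by simp
  have e: "exp (- x * (real k * ln q)) = (1 / q powr x) ^ k" for k
  proof -
    have "exp (- x * (real k * ln q)) = exp (- (x * ln q)) ^ k"
      by (simp add: exp_of_nat_mult[symmetric] algebra_simps)
    then show ?thesis using assms by (simp add: powr_def exp_minus divide_inverse)
  qed
  have "norm (1 / q powr x) < 1" using qx assms by simp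
  then have "((\<lambda>k. (1 / q powr x) ^ k) has_sum (1 / q powr x) / (1 - 1 / q powr x)) {1..}"
    by (rule has_sum_geometric_from_1)
  moreover have "(1 / q powr x) / (1 - 1 / q powr x) = 1 / (q powr x - 1)"
    using qx assms by (simp add: field_simps)
  ultimately show "((\<lambda>k. exp (- x * (real k * ln q))) has_sum 1 / (q powr x - 1)) {1..}" by (simp only: e)
  have "1 / (q powr x - 1) \<le> 1 / (q - 1)" using qx assms by (intro divide_left_mono) auto
  also have "\<dots> \<le> 2 / q" using assms by (simp add: field_simps)
  finally show "1 / (q powr x - 1) \<le> 2 / q" .
qed

lemma gpp_Sigma: "gpp = (SIGMA p:{p. prime p}. {1..})"
  by (auto simp: gpp_def)

lemma gN_prime_ge_2: "prime p \<Longrightarrow> gN p \<ge> 2"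
  using gnorm_ge_2[of p] by auto

text \<open>Convergence of the sum of \<open>ln N(p) / N(p)\<close> over the primes would bound the logarithmic
  derivative of the zeta function near 1.\<close>

lemma not_summable_ln_gN:
  "\<not> (\<lambda>p. ln (gN p) / gN p) summable_on {p. prime p}"
proof
  assume s: "(\<lambda>p. ln (gN p) / gN p) summable_on {p. prime p}"
  let ?C = "\<Sum>\<^sub>\<infinity>p\<in>{p. prime p}. 2 * (ln (gN p) / gN p)"
  have "Re (mser (\<lambda>_. 1) (of_real x)) \<le> ?C" if x: "1 < x" for x
  proof -
    have "((\<lambda>(p, k). ln (gN p) * exp (- x * mlog (p, k))) has_sum Re (mser (\<lambda>_. 1) (of_real x))) (SIGMA p:{p. prime p}. {1..})"
      using mser_1_real(1)[OF x] by (simp only: gpp_Sigma)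
    then have "((\<lambda>p. ln (gN p) * (1 / (gN p powr x - 1))) has_sum Re (mser (\<lambda>_. 1) (of_real x))) {p. prime p}"
    proof (rule has_sum_SigmaD)
      fix p :: gint assume "p \<in> {p. prime p}"
      then have "gN p \<ge> 2" using gN_prime_ge_2 by simp
      then show "((\<lambda>k. case (p, k) of (p, k) \<Rightarrow> ln (gN p) * exp (- x * mlog (p, k))) has_sum ln (gN p) * (1 / (gN p powr x - 1))) {1..}"
        using has_sum_cmult_right[OF geometric_bound(1)[of "gN p" x], of "ln (gN p)"] x by (simp add: mlog_def)
    qed
    moreover have "((\<lambda>p. 2 * (ln (gN p) / gN p)) has_sum ?C) {p. prime p}"
      by (intro has_sum_infsum summable_on_cmult_right s)
    ultimately show ?thesis
    proof (rule has_sum_mono)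
      fix p :: gint assume "p \<in> {p. prime p}"
      then have 2: "gN p \<ge> 2" using gN_prime_ge_2 by simp
      then have "ln (gN p) * (1 / (gN p powr x - 1)) \<le> ln (gN p) * (2 / gN p)"
        using x by (intro mult_left_mono geometric_bound(2)) auto
      then show "ln (gN p) * (1 / (gN p powr x - 1)) \<le> 2 * (ln (gN p) / gN p)" by (simp add: mult.commute)
    qed
  qed
  moreover obtain x where "1 < x" "Re (mser (\<lambda>_. 1) (of_real x)) > ?C" using mser_1_unbounded[of 1 ?C] by auto
  ultimately show False by force
qed

text \<open>The zeros of the factor are \<open>1 + 2 * pi * \<i> * n / ln 2\<close> for integers
  \<open>n\<close>; unless \<open>n = 0\<close>, the imaginary part is too large for the
  disc.\<close>

lemma exp_minus_ln2_eq:
  fixes s :: complex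
  assumes "s \<in> ball 2 2" "1 - 2 * exp (- s * of_real (ln 2)) = 0"
  shows "s = 1"
proof -
  have e2: "exp (complex_of_real (ln 2)) = 2" by (simp add: exp_of_real)
  have "exp ((1 - s) * of_real (ln 2)) = exp (complex_of_real (ln 2)) * exp (- s * of_real (ln 2))"
    by (simp add: exp_add [symmetric] algebra_simps)
  then have "exp ((1 - s) * of_real (ln 2)) = 1" using assms(2) unfolding e2 by simp
  then obtain n :: int where n: "Re ((1 - s) * of_real (ln 2)) = 0" "Im ((1 - s) * of_real (ln 2)) = of_int (2 * n) * pi"
    unfolding exp_eq_1 by auto
  have re: "Re s = 1" using n(1) by simp
  have im: "- Im s * ln 2 = of_int (2 * n) * pi" using n(2) by simp
  have "norm (2 - s) < 2" using assms(1) by (simp add: dist_norm)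
  then have "\<bar>Im s\<bar> < 2" using abs_Im_le_cmod[of "2 - s"] by simp
  have "n = 0"
  proof (rule ccontr)
    assume "n \<noteq> 0"
    then have "1 \<le> \<bar>real_of_int n\<bar>" by simp
    have "2 * pi \<le> \<bar>of_int (2 * n) * pi\<bar>"
      using \<open>1 \<le> \<bar>real_of_int n\<bar>\<close> by (simp add: abs_mult)
    also have "\<dots> = \<bar>Im s\<bar> * ln 2" unfolding im[symmetric] by (simp add: abs_mult)
    also have "\<dots> \<le> 2 * 1" using \<open>\<bar>Im s\<bar> < 2\<close> ln_2_less_1 by (intro mult_mono) auto
    finally show False using pi_gt3 by simp
  qed
  then have "Im s = 0" using im by simp
  then show ?thesis using re by (simp add: complex_eq_iff)
qed

lemma ball_2_2: "s \<in> ball 2 2 \<Longrightarrow> Re s > 0"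
  and ball_2_1: "s \<in> ball 2 1 \<Longrightarrow> Re s > 1"
  using abs_Re_le_cmod[of "2 - s"] by (auto simp: dist_norm)

context gchar
begin

text \<open>The coefficients \<open>2 + 2 * Re (\<xi> p ^ k)\<close> are nonnegative, and at least 2
  for \<open>k = 4\<close>. Landau's theorem yields convergence at 1/4, where the terms with
  \<open>k = 4\<close> have weight \<open>1 / gN p\<close>; this contradicts
  \<open>not_summable_ln_gN\<close>.\<close>

theorem nonzero_at_1:
  assumes F: "F holomorphic_on {s. Re s > 0}" "\<And>s. Re s > 1 \<Longrightarrow> F s = gser \<xi> s"
  shows "F 1 \<noteq> 0"
proof
  assume F1: "F 1 = 0"
  interpret c: gchar "\<lambda>a. cnj (\<xi> a)" by (rule gchar_cnj)
  interpret o: gchar "\<lambda>_. 1" by (rule gchar_1)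
  let ?H = "{s. Re s > 0}"
  have opH: "open ?H" by (rule open_halfspace_Re_gt)
  define F' where "F' = cnj \<circ> F \<circ> cnj"
  have "cnj ` ?H = ?H" by (auto simp: image_iff intro!: exI[of _ "cnj x" for x])
  then have F': "F' holomorphic_on ?H" unfolding F'_def
    using F(1) opH by (intro holomorphic_on_compose_cnj_cnj) auto
  have F'g: "F' s = gser (\<lambda>a. cnj (\<xi> a)) s" if "Re s > 1" for s
    using that by (simp add: F'_def gser_cnj F(2))
  have F'1: "F' 1 = 0" by (simp add: F'_def F1)
  have "\<exists>E. E holomorphic_on ?H \<and> (\<forall>s. Re s > 1 \<longrightarrow> E s = gser esgn s)"
  proof (rule esgn_continuation)
    fix E assume "E holomorphic_on ?H" "\<And>s. Re s > 1 \<Longrightarrow> E s = gser esgn s"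
    then show ?thesis by (intro exI[of _ E]) simp
  qed
  then obtain E where E: "E holomorphic_on ?H" and E_eq: "\<And>s. Re s > 1 \<Longrightarrow> E s = gser esgn s" by blast
  define W where "W s = 1 - 2 * exp (- s * complex_of_real (ln 2))" for s
  have W: "W holomorphic_on ?H" unfolding W_def[abs_def] by (intro holomorphic_intros)
  have W1: "W 1 = 0" by (simp add: W_def exp_minus exp_of_real)
  have dW: "(W has_field_derivative of_real (ln 2)) (at 1)"
    unfolding W_def[abs_def] by (auto intro!: derivative_eq_intros simp: exp_minus exp_of_real)
  \<comment> \<open>The difference quotient at 1 with the removable singularity filled in; it
    divides out the zeros of \<open>F\<close>, \<open>F'\<close> and \<open>W\<close>.\<close>
  define q where "q f s = (if s = 1 then deriv f 1 else (f s - f 1) / (s - 1))" for f and s :: complex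
  have q: "q f holomorphic_on ?H" if "f holomorphic_on ?H" for f
    unfolding q_def[abs_def] by (rule pole_lemma[OF that]) (use opH in \<open>simp add: interior_open\<close>)
  have qW: "q W s \<noteq> 0" if "s \<in> ball 2 2" for s
  proof (cases "s = 1")
    case True
    then show ?thesis by (simp add: q_def DERIV_imp_deriv[OF dW])
  next
    case False
    then show ?thesis using exp_minus_ln2_eq[OF that] W1 by (auto simp: q_def W_def)
  qed
  \<comment> \<open>For \<open>Re s > 1\<close> this is \<open>?Z ^ 2 * F * F'\<close>, since
    \<open>E = W * ?Z\<close> there and the factors \<open>s - 1\<close>, two above and two below,
    cancel.\<close>
  define P where "P s = (E s)\<^sup>2 * (q F s * q F' s) / (q W s)\<^sup>2" for s
  have sub: "ball 2 2 \<subseteq> ?H" using ball_2_2 by auto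
  have holP: "P holomorphic_on ball 2 2"
    unfolding P_def[abs_def]
    by (intro holomorphic_intros holomorphic_on_subset[OF _ sub] E q F F' W) (use qW in auto)
  let ?Z = "gser (\<lambda>_. 1)"
  let ?c = "\<lambda>(p, k). ln (gN p) * (2 + 2 * Re (\<xi> p ^ k))"
  have Peq: "P s = (?Z s)\<^sup>2 * (gser \<xi> s * gser (\<lambda>a. cnj (\<xi> a)) s)" if "Re s > 1" "s \<in> ball 2 2" for s
  proof -
    have s1: "s \<noteq> 1" using that(1) by auto
    have Wn: "W s \<noteq> 0" using exp_minus_ln2_eq[OF that(2)] s1 by (auto simp: W_def)
    have "E s = W s * ?Z s" unfolding E_eq[OF that(1)] gser_esgn[OF that(1)] W_def ..
    moreover have "(w * z)\<^sup>2 * ((f - 0) / d * ((g - 0) / d)) / ((w - 0) / d)\<^sup>2 = z\<^sup>2 * (f * g)"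
      if "w \<noteq> 0" "d \<noteq> 0" for w z f g d :: complex
      using that by (simp add: power2_eq_square field_simps)
    ultimately show ?thesis
      unfolding P_def q_def F1 F'1 W1 using s1 Wn F(2)[OF that(1)] F'g[OF that(1)] by simp
  qed
  have abs: "dser_abs 1 gpp (\<lambda>j. complex_of_real (?c j)) mlog"
    unfolding dser_abs_def
  proof (intro conjI allI impI)
    show "\<forall>j\<in>gpp. mlog j \<ge> 0" using o.dm by (simp add: dser_abs_def)
    fix \<sigma> :: real assume "\<sigma> > 1"
    then have "(\<lambda>j. 4 * (norm (case j of (p, k) \<Rightarrow> 1 ^ k * complex_of_real (ln (gN p))) * exp (- \<sigma> * mlog j))) summable_on gpp"
      using o.dm unfolding dser_abs_def by (intro summable_on_cmult_right) auto
    then show "(\<lambda>j. norm (complex_of_real (?c j)) * exp (- \<sigma> * mlog j)) summable_on gpp"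
    proof (rule summable_on_comparison_test)
      fix j assume "j \<in> gpp"
      obtain p k where j: "j = (p, k)" by (cases j)
      have "\<bar>Re (\<xi> p ^ k)\<bar> \<le> 1"
        using abs_Re_le_cmod[of "\<xi> p ^ k"] power_le_one[of "norm (\<xi> p)" k] norm_le[of p] by (simp add: norm_power)
      then have "\<bar>2 + 2 * Re (\<xi> p ^ k)\<bar> \<le> 4" by linarith
      then have "norm (complex_of_real (?c j)) \<le> 4 * norm (complex_of_real (ln (gN p)))"
        unfolding j prod.case norm_of_real abs_mult
        using mult_left_mono[of "\<bar>2 + 2 * Re (\<xi> p ^ k)\<bar>" 4 "\<bar>ln (gN p)\<bar>"] by (simp only: mult.commute[of 4] abs_ge_zero abs_mult)
      then show "norm (complex_of_real (?c j)) * exp (- \<sigma> * mlog j) \<le>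
          4 * (norm (case j of (p, k) \<Rightarrow> 1 ^ k * complex_of_real (ln (gN p))) * exp (- \<sigma> * mlog j))"
        unfolding mult.assoc[symmetric] by (intro mult_right_mono) (auto simp: j)
    qed simp
  qed
  have Meq: "dser gpp (\<lambda>j. complex_of_real (?c j)) mlog s =
      2 * mser (\<lambda>_. 1) s + (mser \<xi> s + mser (\<lambda>a. cnj (\<xi> a)) s)" if s: "Re s > 1" for s
  proof -
    have "((\<lambda>j. 2 * ((case j of (p, k) \<Rightarrow> 1 ^ k * complex_of_real (ln (gN p))) * exp (- s * of_real (mlog j))) +
        ((case j of (p, k) \<Rightarrow> \<xi> p ^ k * complex_of_real (ln (gN p))) * exp (- s * of_real (mlog j)) +
         (case j of (p, k) \<Rightarrow> cnj (\<xi> p) ^ k * complex_of_real (ln (gN p))) * exp (- s * of_real (mlog j)))) has_sum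
      (2 * mser (\<lambda>_. 1) s + (mser \<xi> s + mser (\<lambda>a. cnj (\<xi> a)) s))) gpp"
      unfolding mser_def
      by (intro has_sum_add has_sum_cmult_right dser_has_sum[OF o.dm s] dser_has_sum[OF dm s] dser_has_sum[OF c.dm s])
    also have "?this \<longleftrightarrow> ((\<lambda>j. complex_of_real (?c j) * exp (- s * of_real (mlog j))) has_sum
      (2 * mser (\<lambda>_. 1) s + (mser \<xi> s + mser (\<lambda>a. cnj (\<xi> a)) s))) gpp"
    proof (intro has_sum_cong)
      fix j :: "gint \<times> nat"
      obtain p k where j: "j = (p, k)" by (cases j)
      have "of_real (2 * Re (\<xi> p ^ k)) = \<xi> p ^ k + cnj (\<xi> p) ^ k"
        by (simp only: complex_add_cnj complex_cnj_power[symmetric])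
      then have "complex_of_real (?c j) = of_real (ln (gN p)) * (2 + (\<xi> p ^ k + cnj (\<xi> p) ^ k))"
        by (simp add: j)
      then show "2 * ((case j of (p, k) \<Rightarrow> 1 ^ k * complex_of_real (ln (gN p))) * exp (- s * of_real (mlog j))) +
        ((case j of (p, k) \<Rightarrow> \<xi> p ^ k * complex_of_real (ln (gN p))) * exp (- s * of_real (mlog j)) +
         (case j of (p, k) \<Rightarrow> cnj (\<xi> p) ^ k * complex_of_real (ln (gN p))) * exp (- s * of_real (mlog j))) =
        complex_of_real (?c j) * exp (- s * of_real (mlog j))"
        by (simp only: j prod.case) (simp add: algebra_simps)
    qed
    finally show ?thesis using dser_has_sum[OF abs s] by (rule has_sum_unique[symmetric])
  qed
  have dP: "(P has_field_derivative - (P s * dser gpp (\<lambda>j. complex_of_real (?c j)) mlog s)) (at s)"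
    if s: "s \<in> ball 2 1" for s
  proof -
    have s1: "Re s > 1" by (rule ball_2_1[OF s])
    have "((\<lambda>s. (?Z s)\<^sup>2 * (gser \<xi> s * gser (\<lambda>a. cnj (\<xi> a)) s)) has_field_derivative
        - (((?Z s)\<^sup>2 * (gser \<xi> s * gser (\<lambda>a. cnj (\<xi> a)) s)) * (2 * mser (\<lambda>_. 1) s + (mser \<xi> s + mser (\<lambda>a. cnj (\<xi> a)) s)))) (at s)"
      by (auto intro!: derivative_eq_intros o.deriv[OF s1] deriv[OF s1] c.deriv[OF s1])
        (simp add: power2_eq_square algebra_simps)
    then have "(P has_field_derivative
        - (((?Z s)\<^sup>2 * (gser \<xi> s * gser (\<lambda>a. cnj (\<xi> a)) s)) * (2 * mser (\<lambda>_. 1) s + (mser \<xi> s + mser (\<lambda>a. cnj (\<xi> a)) s)))) (at s)"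
    proof (rule has_field_derivative_transform_within_open[where S = "ball 2 1"])
      fix z :: complex assume z: "z \<in> ball 2 1"
      show "(?Z z)\<^sup>2 * (gser \<xi> z * gser (\<lambda>a. cnj (\<xi> a)) z) = P z"
        using z by (intro Peq[symmetric] ball_2_1) auto
    qed (use s in auto)
    moreover have "P s = (?Z s)\<^sup>2 * (gser \<xi> s * gser (\<lambda>a. cnj (\<xi> a)) s)" using s by (intro Peq s1) auto
    ultimately show ?thesis unfolding Meq[OF s1] by (simp only:)
  qed
  define p0 where "p0 = (Re (?Z 2))\<^sup>2 * (norm (gser \<xi> 2))\<^sup>2"
  have Im0: "Im (?Z 2) = 0"
    using dser_real(2)[OF o.da, of 2 "\<lambda>_. 1"] unfolding gser_def by simp
  have Z2: "?Z 2 = of_real (Re (?Z 2))" using Im0 by (simp add: complex_eq_iff)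
  have "P 2 = (?Z 2)\<^sup>2 * (gser \<xi> 2 * cnj (gser \<xi> 2))" using Peq[of 2] by (simp add: gser_cnj)
  also have "\<dots> = of_real p0"
    by (subst Z2) (simp only: p0_def complex_norm_square[symmetric] of_real_mult of_real_power)
  finally have P2: "P 2 = of_real p0" .
  have "Re (?Z 2) \<noteq> 0" using o.gser_nonzero[of 2] Z2 by auto
  then have p0: "p0 > 0" using gser_nonzero[of 2] by (simp add: p0_def)
  have cn: "?c j \<ge> 0" if j: "j \<in> gpp" for j
  proof -
    obtain p k where pk: "j = (p, k)" "prime p" using j by (auto simp: gpp_def)
    have "\<bar>Re (\<xi> p ^ k)\<bar> \<le> 1"
      using abs_Re_le_cmod[of "\<xi> p ^ k"] power_le_one[of "norm (\<xi> p)" k] norm_le[of p] by (simp add: norm_power)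
    then show ?thesis using gN_prime_ge_2[OF pk(2)] by (simp add: pk(1))
  qed
  have "(\<lambda>j. ?c j * exp (- (1 / 4) * mlog j)) summable_on gpp"
    using landau_summable[OF holP cn abs dP P2 p0, of "1 / 4"] by simp
  then have "(\<lambda>j. ?c j * exp (- (1 / 4) * mlog j)) summable_on (\<lambda>p. (p, 4)) ` {p. prime p}"
    by (rule summable_on_subset) (auto simp: gpp_def)
  then have "((\<lambda>j. ?c j * exp (- (1 / 4) * mlog j)) \<circ> (\<lambda>p. (p, 4))) summable_on {p. prime p}"
    by (subst (asm) summable_on_reindex) (auto simp: inj_on_def)
  then have "(\<lambda>p. ln (gN p) / gN p) summable_on {p. prime p}"
  proof (rule summable_on_comparison_test)
    fix p :: gint assume "p \<in> {p. prime p}"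
    then have 2: "gN p \<ge> 2" using gN_prime_ge_2 by simp
    have "Re (\<xi> p ^ 4) \<ge> 0" using quartic[of p] by auto
    then have "ln (gN p) * 1 \<le> ln (gN p) * (2 + 2 * Re (\<xi> p ^ 4))" using 2 by (intro mult_left_mono) auto
    then have "ln (gN p) * 1 * exp (- ln (gN p)) \<le> ln (gN p) * (2 + 2 * Re (\<xi> p ^ 4)) * exp (- ln (gN p))"
      by (rule mult_right_mono) simp
    moreover have "exp (- ln (gN p)) = 1 / gN p" using 2 by (simp add: exp_minus divide_inverse)
    ultimately show "ln (gN p) / gN p \<le> ((\<lambda>j. ?c j * exp (- (1 / 4) * mlog j)) \<circ> (\<lambda>p. (p, 4))) p"
      by (simp add: mlog_def)
    show "0 \<le> ln (gN p) / gN p" using 2 by simp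
  qed
  then show False using not_summable_ln_gN by blast
qed

end

section \<open>Primes with prescribed character values\<close>

instantiation gint :: euclidean_ring_gcd
begin

definition gcd_gint :: "gint \<Rightarrow> gint \<Rightarrow> gint" where "gcd_gint = Euclidean_Algorithm.gcd"
definition lcm_gint :: "gint \<Rightarrow> gint \<Rightarrow> gint" where "lcm_gint = Euclidean_Algorithm.lcm"
definition Gcd_gint :: "gint set \<Rightarrow> gint" where "Gcd_gint = Euclidean_Algorithm.Gcd"
definition Lcm_gint :: "gint set \<Rightarrow> gint" where "Lcm_gint = Euclidean_Algorithm.Lcm"

instance
  by standard (simp_all add: gcd_gint_def lcm_gint_def Gcd_gint_def Lcm_gint_def)

end

context gchar
begin

lemma mean_zero:
  assumes N: "N > 0" and per: "\<And>a b. \<xi> (a + of_nat N * b) = \<xi> a"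
    and cop: "coprime b (of_nat N)" and b: "\<xi> b \<noteq> 1"
  shows "(\<Sum>r\<in>gbox N. \<xi> r) = 0"
proof -
  define rep where "rep z = Gint (gre z mod int N) (gim z mod int N)" for z
  have rep: "z = rep z + of_nat N * Gint (gre z div int N) (gim z div int N)" for z
    by (simp add: rep_def gint_eq_iff)
  have \<xi>rep: "\<xi> (rep z) = \<xi> z" for z
    using per[of "rep z" "Gint (gre z div int N) (gim z div int N)"] rep[of z] by simp
  have rbox: "rep z \<in> gbox N" for z using N by (simp add: rep_def in_gbox_iff)
  let ?h = "\<lambda>r. rep (b * r)"
  have "inj_on ?h (gbox N)"
  proof (rule inj_onI)
    fix x y assume xy: "x \<in> gbox N" "y \<in> gbox N" "?h x = ?h y"
    have "b * x - b * y = (b * x - rep (b * x)) - (b * y - rep (b * y))" using xy(3) by simp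
    also have "of_nat N dvd \<dots>"
      by (rule dvd_diff; subst (1) rep; simp add: add.commute)
    finally have "of_nat N dvd b * (x - y)" by (simp add: right_diff_distrib)
    then have "of_nat N dvd x - y" using cop by (simp add: coprime_dvd_mult_right_iff coprime_commute)
    then have "int N dvd gre x - gre y" "int N dvd gim x - gim y"
      using of_int_dvd_gint_iff[of "int N" "x - y"] by simp_all
    then have "gre x mod int N = gre y mod int N" "gim x mod int N = gim y mod int N"
      by (simp_all add: mod_eq_dvd_iff)
    then show "x = y" using xy(1,2) by (simp add: in_gbox_iff gint_eq_iff)
  qed
  then have "bij_betw ?h (gbox N) (gbox N)"
    using rbox by (simp add: bij_betw_def endo_inj_surj image_subset_iff)
  then have "(\<Sum>r\<in>gbox N. \<xi> r) = (\<Sum>r\<in>gbox N. \<xi> (?h r))" by (rule sum.reindex_bij_betw[symmetric])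
  also have "\<dots> = \<xi> b * (\<Sum>r\<in>gbox N. \<xi> r)" by (simp add: \<xi>rep mult sum_distrib_left)
  finally have "(1 - \<xi> b) * (\<Sum>r\<in>gbox N. \<xi> r) = 0" by (simp add: algebra_simps)
  then show ?thesis using b by simp
qed

text \<open>To the right of 1, \<open>mser \<xi>\<close> is minus the logarithmic derivative of the
  continuation \<open>F\<close>, which is continuous at 1 because
  \<open>F 1 \<noteq> 0\<close>.\<close>

lemma mser_bounded:
  assumes N: "N > 0" and per: "\<And>a b. \<xi> (a + of_nat N * b) = \<xi> a"
    and cop: "coprime b (of_nat N)" and b: "\<xi> b \<noteq> 1"
  shows "\<exists>C. eventually (\<lambda>x. norm (mser \<xi> (of_real x)) \<le> C) (at_right 1)"
proof -
  have "\<exists>F. F holomorphic_on {s. Re s > 0} \<and> (\<forall>s. Re s > 1 \<longrightarrow> F s = gser \<xi> s)"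
  proof (rule gser_continuation[OF N per mean_zero[OF assms] norm_le])
    fix F assume "F holomorphic_on {s. Re s > 0}" "\<And>s. Re s > 1 \<Longrightarrow> F s = gser \<xi> s"
    then show ?thesis by (intro exI[of _ F]) simp
  qed
  then obtain F where F: "F holomorphic_on {s. Re s > 0}" and Feq: "\<And>s. Re s > 1 \<Longrightarrow> F s = gser \<xi> s" by blast
  have F1: "F 1 \<noteq> 0" by (rule nonzero_at_1[OF F Feq])
  have op: "open {s. Re s > 0}" by (rule open_halfspace_Re_gt)
  define g where "g s = deriv F s / F s" for s
  have "isCont (deriv F) 1"
    using holomorphic_deriv[OF F op] op by (auto intro!: continuous_on_interior[of "{s. Re s > 0}"] holomorphic_on_imp_continuous_on simp: interior_open)
  moreover have "isCont F 1"
    using F op by (auto intro!: continuous_on_interior[of "{s. Re s > 0}"] holomorphic_on_imp_continuous_on simp: interior_open)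
  ultimately have "isCont g 1" unfolding g_def[abs_def] using F1 by (intro continuous_intros)
  then have "(g \<longlongrightarrow> g 1) (nhds 1)" by (simp add: isCont_def tendsto_nhds_iff)
  then have "((\<lambda>x. g (of_real x)) \<longlongrightarrow> g 1) (at_right 1)"
    by (rule filterlim_compose) (auto intro!: tendsto_eq_intros)
  then have "eventually (\<lambda>x. dist (g (of_real x)) (g 1) < 1) (at_right 1)" by (rule tendstoD) simp
  moreover have "eventually (\<lambda>x::real. x > 1) (at_right 1)" by (rule eventually_at_right_less)
  ultimately have "eventually (\<lambda>x. norm (mser \<xi> (of_real x)) \<le> norm (g 1) + 1) (at_right 1)"
  proof eventually_elim
    case (elim x)
    have x: "Re (of_real x) > 1" using elim(2) by simp
    have "eventually (\<lambda>s. s \<in> {s. Re s > 1}) (nhds (of_real x))"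
      using x by (intro eventually_nhds_in_open open_halfspace_Re_gt) auto
    then have "eventually (\<lambda>s. F s = gser \<xi> s) (nhds (of_real x))"
      by (rule eventually_mono) (simp add: Feq)
    then have "deriv F (of_real x) = deriv (gser \<xi>) (of_real x)" by (rule deriv_cong_ev) simp
    also have "\<dots> = - (gser \<xi> (of_real x) * mser \<xi> (of_real x))" by (rule DERIV_imp_deriv[OF deriv[OF x]])
    finally have "g (of_real x) = - mser \<xi> (of_real x)"
      unfolding g_def Feq[OF x] using gser_nonzero[OF x] by simp
    then have "norm (mser \<xi> (of_real x)) = norm (g (of_real x))" by simp
    also have "\<dots> \<le> norm (g 1) + 1" using elim(1) norm_triangle_ineq2[of "g (of_real x)" "g 1"] by (simp add: dist_norm)
    finally show ?case .
  qed
  then show ?thesis by blast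
qed

lemma mser_Re_has_sum:
  assumes "x > 1"
  shows "((\<lambda>(p, k). Re (\<xi> p ^ k) * ln (gN p) * exp (- x * mlog (p, k))) has_sum Re (mser \<xi> (of_real x))) gpp"
proof -
  have "((\<lambda>j. (case j of (p, k) \<Rightarrow> \<xi> p ^ k * of_real (ln (gN p))) * exp (- of_real x * of_real (mlog j))) has_sum mser \<xi> (of_real x)) gpp"
    unfolding mser_def by (rule dser_has_sum[OF dm]) (use assms in simp)
  from has_sum_Re[OF this] show ?thesis
  proof (rule has_sum_cong[THEN iffD1, rotated])
    fix j :: "gint \<times> nat"
    obtain p k where j: "j = (p, k)" by (cases j)
    have "exp (- of_real x * of_real (mlog j)) = complex_of_real (exp (- x * mlog j))" by (simp flip: exp_of_real)
    then show "Re ((case j of (p, k) \<Rightarrow> \<xi> p ^ k * of_real (ln (gN p))) * exp (- of_real x * of_real (mlog j))) =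
        (case j of (p, k) \<Rightarrow> Re (\<xi> p ^ k) * ln (gN p) * exp (- x * mlog (p, k)))"
      by (simp add: j)
  qed
qed

end

section \<open>Dirichlet's theorem by orthogonality of characters\<close>

lemma has_sum_sum_finite:
  fixes f :: "'a \<Rightarrow> 'b \<Rightarrow> 'c :: topological_comm_monoid_add"
  assumes "finite E" "\<And>e. e \<in> E \<Longrightarrow> (f e has_sum S e) A"
  shows "((\<lambda>j. \<Sum>e\<in>E. f e j) has_sum (\<Sum>e\<in>E. S e)) A"
  using assms by (induction E rule: finite_induct) (auto intro!: has_sum_add)

text \<open>The exponents run from 1 to 4, not from 0 to 3, so that \<open>z = 0\<close> also gives
  0.\<close>

lemma sum_quartic_powers:
  fixes z :: complex
  assumes "z = 0 \<or> z ^ 4 = 1"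
  shows "(\<Sum>j\<in>{1..4::nat}. z ^ j) = (if z = 1 then 4 else 0)"
proof -
  have "{1..4::nat} = {1, 2, 3, 4}" by auto
  then have s: "(\<Sum>j\<in>{1..4::nat}. z ^ j) = z + z ^ 2 + z ^ 3 + z ^ 4" by simp
  show ?thesis
  proof (cases "z = 1")
    case False
    have "(z - 1) * (z + z ^ 2 + z ^ 3 + z ^ 4) = z * (z ^ 4 - 1)"
      by (simp add: power2_eq_square power3_eq_cube power4_eq_xxxx algebra_simps)
    then have "(z - 1) * (z + z ^ 2 + z ^ 3 + z ^ 4) = 0" using assms by auto
    then show ?thesis using False s by simp
  qed (simp add: s)
qed

lemma finite_bad_primes:
  assumes "N > 0"
  shows "finite {p :: gint. prime p \<and> \<not> coprime p (of_nat N)}"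
proof (rule finite_subset)
  show "{p :: gint. prime p \<and> \<not> coprime p (of_nat N)} \<subseteq> prime_factors (of_nat N)"
    using assms by (auto simp: in_prime_factors_iff prime_imp_coprime dest: prime_imp_coprime)
qed simp

lemma summable_higher_prime_powers:
  "(\<lambda>(p, k). ln (gN p) * exp (- mlog (p, k))) summable_on (SIGMA p:{p. prime p}. {2..})"
proof (rule summable_on_SigmaI)
  fix p :: gint assume "p \<in> {p. prime p}"
  then have 2: "gN p \<ge> 2" using gN_prime_ge_2 by simp
  have "((\<lambda>k. exp (- ln (gN p)) * exp (- 1 * (real k * ln (gN p)))) has_sum exp (- ln (gN p)) * (1 / (gN p powr 1 - 1))) {1..}"
    by (intro has_sum_cmult_right geometric_bound(1)) (use 2 in auto)
  then have "((\<lambda>k. ln (gN p) * (exp (- ln (gN p)) * exp (- 1 * (real k * ln (gN p))))) has_sum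
      ln (gN p) * (exp (- ln (gN p)) * (1 / (gN p powr 1 - 1)))) {1..}"
    by (rule has_sum_cmult_right)
  also have "?this \<longleftrightarrow> ((\<lambda>k. ln (gN p) * exp (- mlog (p, k))) has_sum
      ln (gN p) * (exp (- ln (gN p)) * (1 / (gN p powr 1 - 1)))) {2..}"
    by (rule has_sum_reindex_bij_witness[where i = "\<lambda>k. k - 1" and j = Suc])
      (auto simp: mlog_def exp_add [symmetric] algebra_simps)
  finally show "((\<lambda>k. case (p, k) of (p, k) \<Rightarrow> ln (gN p) * exp (- mlog (p, k))) has_sum
      ln (gN p) * (exp (- ln (gN p)) * (1 / (gN p powr 1 - 1)))) {2..}" by simp
next
  have "dser_abs 1 (- {0}) (\<lambda>a. complex_of_real (ln (gN a)) * 1) (\<lambda>a. ln (gN a))"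
    by (intro dser_abs_deriv dser_abs_gser[where B = 1]) auto
  then have "\<forall>\<sigma>>1. (\<lambda>a. norm (complex_of_real (ln (gN a)) * 1) * exp (- \<sigma> * ln (gN a))) summable_on (- {0})"
    unfolding dser_abs_def by blast
  then have "(\<lambda>a. norm (complex_of_real (ln (gN a)) * 1) * exp (- 2 * ln (gN a))) summable_on (- {0})" by (rule allE[of _ 2]) simp
  then have "(\<lambda>a. norm (complex_of_real (ln (gN a)) * 1) * exp (- 2 * ln (gN a))) summable_on {p. prime p}"
    by (rule summable_on_subset) auto
  then have "(\<lambda>a. 2 * (norm (complex_of_real (ln (gN a)) * 1) * exp (- 2 * ln (gN a)))) summable_on {p. prime p}"
    by (rule summable_on_cmult_right)
  then show "(\<lambda>p. ln (gN p) * (exp (- ln (gN p)) * (1 / (gN p powr 1 - 1)))) summable_on {p. prime p}"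
  proof (rule summable_on_comparison_test)
    fix p :: gint assume "p \<in> {p. prime p}"
    then have 2: "gN p \<ge> 2" using gN_prime_ge_2 by simp
    have e: "exp (- ln (gN p)) = 1 / gN p" using 2 by (simp add: exp_minus divide_inverse)
    have e2: "exp (- 2 * ln (gN p)) = 1 / gN p * (1 / gN p)" unfolding e[symmetric] by (simp add: exp_add [symmetric])
    have "1 / (gN p powr 1 - 1) \<le> 2 / gN p" by (rule geometric_bound(2)) (use 2 in auto)
    then have "ln (gN p) * (exp (- ln (gN p)) * (1 / (gN p powr 1 - 1))) \<le> ln (gN p) * (exp (- ln (gN p)) * (2 / gN p))"
      using 2 by (intro mult_left_mono) auto
    also have "\<dots> = 2 * (norm (complex_of_real (ln (gN p)) * 1) * exp (- 2 * ln (gN p)))"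
      unfolding e e2 using 2 by simp
    finally show "ln (gN p) * (exp (- ln (gN p)) * (1 / (gN p powr 1 - 1))) \<le>
        2 * (norm (complex_of_real (ln (gN p)) * 1) * exp (- 2 * ln (gN p)))" .
    show "0 \<le> ln (gN p) * (exp (- ln (gN p)) * (1 / (gN p powr 1 - 1)))" using 2 by simp
  qed
next
  fix p :: gint and k :: nat assume "p \<in> {p. prime p}"
  then show "0 \<le> (case (p, k) of (p, k) \<Rightarrow> ln (gN p) * exp (- mlog (p, k)))"
    using gN_prime_ge_2[of p] by simp
qed

text \<open>By orthogonality, \<open>G\<close> is a weighted sum over the prime powers with the same
  values as \<open>r\<close>. If no prime has these values, only exponents \<open>k \<ge> 2\<close>
  remain and \<open>G\<close> is bounded above. But in the expansion of \<open>G\<close> by the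
  products \<open>X e\<close> the principal character is unbounded near 1, while the others are
  bounded below. One-sided bounds permit several \<open>e\<close> to give the same
  character.\<close>

theorem dirichlet_gint:
  fixes \<xi> :: "'i \<Rightarrow> gint \<Rightarrow> complex"
  assumes I: "finite I" and N: "N > 0" and ch: "\<And>i. i \<in> I \<Longrightarrow> gchar (\<xi> i)"
    and per: "\<And>i a b. i \<in> I \<Longrightarrow> \<xi> i (a + of_nat N * b) = \<xi> i a"
    and cop: "\<And>a. (\<forall>i\<in>I. \<xi> i a \<noteq> 0) \<longleftrightarrow> coprime a (of_nat N)"
    and r: "coprime r (of_nat N)"
  shows "\<exists>p. prime p \<and> (\<forall>i\<in>I. \<xi> i p = \<xi> i r)"
proof (rule ccontr)
  assume no: "\<not> ?thesis"
  \<comment> \<open>With all exponents positive, each \<open>X e\<close> is nonzero exactly at the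
    elements coprime to \<open>N\<close>.\<close>
  define Ex where "Ex = PiE I (\<lambda>_. {1..4::nat})"
  have finEx: "finite Ex" unfolding Ex_def by (intro finite_PiE I) auto
  define X where "X e a = (\<Prod>i\<in>I. \<xi> i a ^ e i)" for e a
  have X0: "X e a \<noteq> 0 \<longleftrightarrow> coprime a (of_nat N)" if "e \<in> Ex" for e a
  proof -
    have "e i > 0" if "i \<in> I" for i using \<open>e \<in> Ex\<close> that unfolding Ex_def by (force simp: PiE_def Pi_def)
    then show ?thesis unfolding X_def cop[symmetric] using I by auto
  qed
  have X4: "X e a = 0 \<or> X e a ^ 4 = 1" if "e \<in> Ex" for e a
  proof (cases "X e a = 0")
    case False
    then have nz: "\<forall>i\<in>I. \<xi> i a \<noteq> 0" using X0[OF that] cop by blast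
    have "X e a ^ 4 = (\<Prod>i\<in>I. (\<xi> i a ^ 4) ^ e i)"
      unfolding X_def prod_power_distrib by (intro prod.cong refl) (simp only: power_mult[symmetric] mult.commute)
    also have "\<dots> = (\<Prod>i\<in>I. 1)"
      using gchar.quartic[OF ch] nz by (intro prod.cong refl) (metis power_one)
    finally show ?thesis by simp
  qed simp
  have gX: "gchar (X e)" if "e \<in> Ex" for e
  proof
    fix a b
    show "X e (a * b) = X e a * X e b"
      unfolding X_def prod.distrib[symmetric] by (intro prod.cong refl) (simp add: gchar.mult[OF ch] power_mult_distrib)
    show "X e 1 = 1" "X e gi = 1" unfolding X_def by (simp_all add: gchar.one[OF ch] gchar.unit[OF ch])
    show "X e a = 0 \<or> X e a ^ 4 = 1" by (rule X4[OF that])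
  qed
  have perX: "X e (a + of_nat N * b) = X e a" for e a b
    unfolding X_def by (intro prod.cong refl) (simp add: per)
  have powX: "X e (a ^ k) = X e a ^ k" if "e \<in> Ex" for e a k
    by (induction k) (simp_all add: gchar.one[OF gX[OF that]] gchar.mult[OF gX[OF that]])
  have orth: "(\<Sum>e\<in>Ex. cnj (X e r) * X e a) = (if \<forall>i\<in>I. \<xi> i a = \<xi> i r then 4 ^ card I else 0)" for a
  proof -
    have "(\<Sum>e\<in>Ex. cnj (X e r) * X e a) = (\<Sum>e\<in>Ex. \<Prod>i\<in>I. (cnj (\<xi> i r) * \<xi> i a) ^ e i)"
      by (simp add: X_def power_mult_distrib prod.distrib)
    also have "\<dots> = (\<Prod>i\<in>I. \<Sum>j\<in>{1..4}. (cnj (\<xi> i r) * \<xi> i a) ^ j)"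
      unfolding Ex_def by (rule prod_sum_PiE[symmetric]) (use I in auto)
    also have "\<dots> = (\<Prod>i\<in>I. if \<xi> i a = \<xi> i r then 4 else 0)"
    proof (intro prod.cong refl)
      fix i assume i: "i \<in> I"
      have r4: "\<xi> i r ^ 4 = 1" using gchar.quartic[OF ch[OF i], of r] cop r i by blast
      then have "norm (\<xi> i r) ^ 4 = 1 ^ 4" by (metis norm_one norm_power power_one)
      then have n1: "norm (\<xi> i r) = 1" by (rule power_eq_imp_eq_base) auto
      then have c: "\<xi> i r * cnj (\<xi> i r) = 1" by (simp flip: complex_norm_square)
      define z where "z = cnj (\<xi> i r) * \<xi> i a"
      have "\<xi> i r * z = \<xi> i a" unfolding z_def mult.assoc[symmetric] c by simp
      then have "z = 1 \<longleftrightarrow> \<xi> i a = \<xi> i r" using c unfolding z_def by (metis mult.commute mult.right_neutral)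
      moreover have "z = 0 \<or> z ^ 4 = 1"
        using gchar.quartic[OF ch[OF i], of a] r4 unfolding z_def
        by (auto simp: power_mult_distrib complex_cnj_power[symmetric] simp del: complex_cnj_power)
      ultimately show "(\<Sum>j\<in>{1..4}. (cnj (\<xi> i r) * \<xi> i a) ^ j) = (if \<xi> i a = \<xi> i r then 4 else 0)"
        unfolding z_def[symmetric] by (simp only: sum_quartic_powers)
    qed
    also have "\<dots> = (if \<forall>i\<in>I. \<xi> i a = \<xi> i r then 4 ^ card I else 0)"
      using I by (auto intro!: prod_zero)
    finally show ?thesis .
  qed
  define G where "G x = (\<Sum>e\<in>Ex. cnj (X e r) * mser (X e) (of_real x))" for x :: real
  \<comment> \<open>The contribution of \<open>k \<ge> 2\<close> taken at \<open>x = 1\<close>,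
    which dominates the one for every \<open>x > 1\<close>.\<close>
  define C1 where "C1 = (\<Sum>\<^sub>\<infinity>(p, k)\<in>(SIGMA p:{p. prime p}. {2..}). 4 ^ card I * (ln (gN p) * exp (- mlog (p, k))))"
  have upper: "Re (G x) \<le> C1" if x: "x > 1" for x
  proof -
    have "((\<lambda>j. \<Sum>e\<in>Ex. cnj (X e r) * ((case j of (p, k) \<Rightarrow> X e p ^ k * of_real (ln (gN p))) * exp (- of_real x * of_real (mlog j)))) has_sum G x) gpp"
      unfolding G_def mser_def
      by (intro has_sum_sum_finite has_sum_cmult_right dser_has_sum[OF gchar.dm[OF gX]] finEx) (use x in auto)
    from has_sum_Re[OF this]
    have "((\<lambda>(p, k). (if \<forall>i\<in>I. \<xi> i (p ^ k) = \<xi> i r then 4 ^ card I else 0) * (ln (gN p) * exp (- x * mlog (p, k)))) has_sum Re (G x)) gpp"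
    proof (rule has_sum_cong[THEN iffD1, rotated])
      fix j :: "gint \<times> nat"
      obtain p k where j: "j = (p, k)" by (cases j)
      have ex: "exp (- of_real x * of_real (mlog j)) = complex_of_real (exp (- x * mlog j))" by (simp flip: exp_of_real)
      have "(\<Sum>e\<in>Ex. cnj (X e r) * ((case j of (p, k) \<Rightarrow> X e p ^ k * of_real (ln (gN p))) * exp (- of_real x * of_real (mlog j))))
          = (\<Sum>e\<in>Ex. cnj (X e r) * X e (p ^ k)) * complex_of_real (ln (gN p) * exp (- x * mlog (p, k)))"
        unfolding ex sum_distrib_right by (intro sum.cong refl) (simp add: j powX)
      also have "\<dots> = complex_of_real ((if \<forall>i\<in>I. \<xi> i (p ^ k) = \<xi> i r then 4 ^ card I else 0) * (ln (gN p) * exp (- x * mlog (p, k))))"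
        unfolding orth by simp
      finally show "Re (\<Sum>e\<in>Ex. cnj (X e r) * ((case j of (p, k) \<Rightarrow> X e p ^ k * of_real (ln (gN p))) * exp (- of_real x * of_real (mlog j)))) =
         (case j of (p, k) \<Rightarrow> (if \<forall>i\<in>I. \<xi> i (p ^ k) = \<xi> i r then 4 ^ card I else 0) * (ln (gN p) * exp (- x * mlog (p, k))))"
        by (simp only: j prod.case Re_complex_of_real)
    qed
    moreover have "((\<lambda>(p, k). 4 ^ card I * (ln (gN p) * exp (- mlog (p, k)))) has_sum C1) (SIGMA p:{p. prime p}. {2..})"
      unfolding C1_def case_prod_unfold
      by (intro has_sum_infsum summable_on_cmult_right summable_higher_prime_powers[unfolded case_prod_unfold])
    ultimately show ?thesis
    proof (rule has_sum_mono_neutral)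
      fix j assume "j \<in> gpp \<inter> (SIGMA p:{p. prime p}. {2..})"
      then obtain p k where j: "j = (p, k)" "prime p" "k \<ge> 2" by auto
      have 2: "gN p \<ge> 2" by (rule gN_prime_ge_2[OF j(2)])
      have "mlog (p, k) \<ge> 0" using 2 by (simp add: mlog_def)
      then have "- x * mlog (p, k) \<le> - mlog (p, k)" using x mult_right_mono[of 1 x "mlog (p, k)"] by simp
      then have "ln (gN p) * exp (- x * mlog (p, k)) \<le> ln (gN p) * exp (- mlog (p, k))"
        using 2 by (intro mult_left_mono) auto
      moreover have "0 \<le> ln (gN p) * exp (- x * mlog (p, k))" using 2 by simp
      ultimately have "(if \<forall>i\<in>I. \<xi> i (p ^ k) = \<xi> i r then 4 ^ card I else 0) * (ln (gN p) * exp (- x * mlog (p, k)))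
         \<le> 4 ^ card I * (ln (gN p) * exp (- mlog (p, k)))"
        by - (rule mult_mono; (assumption | simp))
      then show "(case j of (p, k) \<Rightarrow> (if \<forall>i\<in>I. \<xi> i (p ^ k) = \<xi> i r then 4 ^ card I else 0) * (ln (gN p) * exp (- x * mlog (p, k))))
         \<le> (case j of (p, k) \<Rightarrow> 4 ^ card I * (ln (gN p) * exp (- mlog (p, k))))" by (simp only: j(1) prod.case)
    next
      fix j assume j: "j \<in> gpp - (SIGMA p:{p. prime p}. {2..})"
      then obtain p k where pk: "j = (p, k)" "prime p" "k \<ge> 1" "\<not> k \<ge> 2" by (auto simp: gpp_def)
      then have p: "j = (p, 1)" "prime p" by auto
      then have "\<not> (\<forall>i\<in>I. \<xi> i (p ^ 1) = \<xi> i r)" using no by auto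
      then show "(case j of (p, k) \<Rightarrow> (if \<forall>i\<in>I. \<xi> i (p ^ k) = \<xi> i r then 4 ^ card I else 0) * (ln (gN p) * exp (- x * mlog (p, k)))) \<le> 0"
        by (simp only: p(1) prod.case if_False mult_zero_left order_refl)
    next
      fix j assume "j \<in> (SIGMA p:{p. prime p}. {2..}) - gpp"
      then show "0 \<le> (case j of (p, k) \<Rightarrow> 4 ^ card I * (ln (gN p) * exp (- mlog (p, k))))" by (auto simp: gpp_def)
    qed
  qed
  \<comment> \<open>Bounds what the principal character loses against zeta, namely the powers of the
    finitely many primes not coprime to \<open>N\<close>.\<close>
  define C3 where "C3 = (\<Sum>p\<in>{p. prime p \<and> \<not> coprime p (of_nat N)}. ln (gN p) * (2 / gN p))"
  \<comment> \<open>All exponents equal to 4 give the principal character modulo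
    \<open>N\<close>.\<close>
  define e4 where "e4 = (\<lambda>i\<in>I. 4 :: nat)"
  have e4: "e4 \<in> Ex" by (auto simp: e4_def Ex_def)
  have Xe4: "X e4 a = (if coprime a (of_nat N) then 1 else 0)" for a
  proof (cases "coprime a (of_nat N)")
    case True
    then have "\<forall>i\<in>I. \<xi> i a ^ 4 = 1" using cop gchar.quartic[OF ch] by blast
    then show ?thesis using True by (simp add: X_def e4_def)
  qed (use X0[OF e4, of a] in simp)
  have low4: "Re (mser (X e4) (of_real x)) \<ge> Re (mser (\<lambda>_. 1) (of_real x)) - C3" if x: "x > 1" for x
  proof -
    let ?bad = "{p. prime p \<and> \<not> coprime p (of_nat N)}"
    have "((\<lambda>(p, k). Re (X e4 p ^ k) * ln (gN p) * exp (- x * mlog (p, k))) has_sum Re (mser (X e4) (of_real x))) gpp"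
      by (rule gchar.mser_Re_has_sum[OF gX[OF e4] x])
    then have "((\<lambda>j. (-1) * (case j of (p, k) \<Rightarrow> Re (X e4 p ^ k) * ln (gN p) * exp (- x * mlog (p, k)))) has_sum (-1) * Re (mser (X e4) (of_real x))) gpp"
      by (rule has_sum_cmult_right)
    then have "((\<lambda>j. (case j of (p, k) \<Rightarrow> ln (gN p) * exp (- x * mlog (p, k))) +
        (-1) * (case j of (p, k) \<Rightarrow> Re (X e4 p ^ k) * ln (gN p) * exp (- x * mlog (p, k)))) has_sum
        Re (mser (\<lambda>_. 1) (of_real x)) + (-1) * Re (mser (X e4) (of_real x))) gpp"
      by (rule has_sum_add[OF mser_1_real(1)[OF x]])
    then have "((\<lambda>(p, k). ln (gN p) * exp (- x * mlog (p, k))) has_sum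
        Re (mser (\<lambda>_. 1) (of_real x)) + (-1) * Re (mser (X e4) (of_real x))) (SIGMA p:?bad. {1..})"
      by (rule has_sum_cong_neutral[THEN iffD1, rotated -1]) (auto simp: gpp_def Xe4)
    then have "((\<lambda>p. ln (gN p) * (1 / (gN p powr x - 1))) has_sum
        Re (mser (\<lambda>_. 1) (of_real x)) + (-1) * Re (mser (X e4) (of_real x))) ?bad"
    proof (rule has_sum_SigmaD)
      fix p :: gint assume "p \<in> ?bad"
      then have "gN p \<ge> 2" using gN_prime_ge_2 by simp
      then show "((\<lambda>k. case (p, k) of (p, k) \<Rightarrow> ln (gN p) * exp (- x * mlog (p, k))) has_sum ln (gN p) * (1 / (gN p powr x - 1))) {1..}"
        using has_sum_cmult_right[OF geometric_bound(1)[of "gN p" x], of "ln (gN p)"] x by (simp add: mlog_def)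
    qed
    moreover have "((\<lambda>p. ln (gN p) * (1 / (gN p powr x - 1))) has_sum (\<Sum>p\<in>?bad. ln (gN p) * (1 / (gN p powr x - 1)))) ?bad"
      by (rule has_sum_finite[OF finite_bad_primes[OF N]])
    ultimately have "Re (mser (\<lambda>_. 1) (of_real x)) + (-1) * Re (mser (X e4) (of_real x)) = (\<Sum>p\<in>?bad. ln (gN p) * (1 / (gN p powr x - 1)))"
      by (rule has_sum_unique)
    also have "\<dots> \<le> C3" unfolding C3_def
    proof (rule sum_mono)
      fix p :: gint assume "p \<in> ?bad"
      then have 2: "gN p \<ge> 2" using gN_prime_ge_2 by simp
      then show "ln (gN p) * (1 / (gN p powr x - 1)) \<le> ln (gN p) * (2 / gN p)"
        using x by (intro mult_left_mono geometric_bound(2)) auto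
    qed
    finally show ?thesis by simp
  qed
  \<comment> \<open>Either \<open>X e\<close> has a value other than 1 at some element coprime to
    \<open>N\<close>, and nonvanishing at 1 bounds its series, or it is principal, and its series is
    nonnegative.\<close>
  have other: "\<exists>C. eventually (\<lambda>x. Re (cnj (X e r) * mser (X e) (of_real x)) \<ge> - C) (at_right 1)" if e: "e \<in> Ex" for e
  proof (cases "\<exists>b. coprime b (of_nat N) \<and> X e b \<noteq> 1")
    case True
    then obtain b where b: "coprime b (of_nat N)" "X e b \<noteq> 1" by blast
    then obtain C where "eventually (\<lambda>x. norm (mser (X e) (of_real x)) \<le> C) (at_right 1)"
      using gchar.mser_bounded[OF gX[OF e] N perX b] by blast
    then have "eventually (\<lambda>x. Re (cnj (X e r) * mser (X e) (of_real x)) \<ge> - C) (at_right 1)"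
    proof eventually_elim
      case (elim x)
      have "\<bar>Re (cnj (X e r) * mser (X e) (of_real x))\<bar> \<le> norm (X e r) * norm (mser (X e) (of_real x))"
        using abs_Re_le_cmod[of "cnj (X e r) * mser (X e) (of_real x)"] by (simp add: norm_mult)
      also have "\<dots> \<le> 1 * C"
        by (intro mult_mono elim gchar.norm_le[OF gX[OF e]]) auto
      finally show ?case by simp
    qed
    then show ?thesis by blast
  next
    case False
    then have X1: "X e a = (if coprime a (of_nat N) then 1 else 0)" for a using X0[OF e, of a] by auto
    have "eventually (\<lambda>x::real. x > 1) (at_right 1)" by (rule eventually_at_right_less)
    then have "eventually (\<lambda>x. Re (cnj (X e r) * mser (X e) (of_real x)) \<ge> - 0) (at_right 1)"
    proof eventually_elim
      case (elim x)
      have "0 \<le> Re (mser (X e) (of_real x))"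
        by (rule has_sum_nonneg[OF gchar.mser_Re_has_sum[OF gX[OF e] elim]])
          (auto simp: X1 gpp_def power_0_left dest!: gN_prime_ge_2)
      then show ?case using r by (simp add: X1)
    qed
    then show ?thesis by blast
  qed
  then obtain C where C: "\<And>e. e \<in> Ex \<Longrightarrow> eventually (\<lambda>x. Re (cnj (X e r) * mser (X e) (of_real x)) \<ge> - C e) (at_right 1)" by metis
  have "eventually (\<lambda>x. \<forall>e\<in>Ex. Re (cnj (X e r) * mser (X e) (of_real x)) \<ge> - C e) (at_right 1)"
    using finEx C by (intro eventually_ball_finite) auto
  moreover have "eventually (\<lambda>x::real. x > 1) (at_right 1)" by (rule eventually_at_right_less)
  ultimately have "eventually (\<lambda>x. Re (mser (\<lambda>_. 1) (of_real x)) \<le> C1 + C3 + (\<Sum>e\<in>Ex - {e4}. C e)) (at_right 1)"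
  proof eventually_elim
    case (elim x)
    have "Re (G x) = (\<Sum>e\<in>Ex. Re (cnj (X e r) * mser (X e) (of_real x)))"
      by (simp add: G_def Re_sum)
    also have "\<dots> = Re (cnj (X e4 r) * mser (X e4) (of_real x)) + (\<Sum>e\<in>Ex - {e4}. Re (cnj (X e r) * mser (X e) (of_real x)))"
      by (rule sum.remove[OF finEx e4])
    also have "Re (cnj (X e4 r) * mser (X e4) (of_real x)) = Re (mser (X e4) (of_real x))"
      using r by (simp add: Xe4)
    finally have "Re (G x) = Re (mser (X e4) (of_real x)) + (\<Sum>e\<in>Ex - {e4}. Re (cnj (X e r) * mser (X e) (of_real x)))" .
    moreover have "(\<Sum>e\<in>Ex - {e4}. Re (cnj (X e r) * mser (X e) (of_real x))) \<ge> (\<Sum>e\<in>Ex - {e4}. - C e)"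
      using elim by (intro sum_mono) auto
    ultimately show ?case using upper[OF elim(2)] low4[OF elim(2)] by (simp add: sum_negf)
  qed
  then obtain b where b: "b > 1" "\<And>x. 1 < x \<Longrightarrow> x < b \<Longrightarrow> Re (mser (\<lambda>_. 1) (of_real x)) \<le> C1 + C3 + (\<Sum>e\<in>Ex - {e4}. C e)"
    unfolding eventually_at_right_field by blast
  obtain x where x: "1 < x" "x < 1 + (b - 1)" "Re (mser (\<lambda>_. 1) (of_real x)) > C1 + C3 + (\<Sum>e\<in>Ex - {e4}. C e)"
    using mser_1_unbounded[of "b - 1"] b(1) by auto
  then show False using b(2)[of x] by simp
qed

section \<open>Gaussian primes with prescribed symbols\<close>

definition cx :: "gint \<Rightarrow> complex" where "cx a = Complex (of_int (gre a)) (of_int (gim a))"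

lemma cx_simps [simp]:
  "cx 0 = 0" "cx 1 = 1" "cx (a + b) = cx a + cx b" "cx (a - b) = cx a - cx b" "cx (- a) = - cx a"
  "cx (a * b) = cx a * cx b" "cx gi = \<i>" "cx (numeral k) = numeral k"
  by (simp_all add: cx_def complex_eq_iff)

lemma cx_power [simp]: "cx (a ^ n) = cx a ^ n"
  by (induction n) auto

lemma cx_eq_iff [simp]: "cx a = cx b \<longleftrightarrow> a = b"
  by (auto simp: cx_def gint_eq_iff)

lemma cx_eq_0_iff [simp]: "cx a = 0 \<longleftrightarrow> a = 0"
  using cx_eq_iff[of a 0] by (simp del: cx_eq_iff)

lemma guf_cong:
  assumes "4 dvd N" "godd a"
  shows "guf (a + of_nat N * b) = guf a"
proof -
  obtain k where "N = 4 * k" using assms(1) by (rule dvdE)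
  have *: "even (p + 4 * u) = even p" "odd (p + 4 * u + (q + 4 * v)) = odd (p + q)"
    "(p + 4 * u + (q + 4 * v)) mod 4 = (p + q) mod 4" "(p + 4 * u - (q + 4 * v)) mod 4 = (p - q) mod 4"
    for p q u v :: int
    using mod_mult_self2[of "p + q" 4 "u + v"] mod_mult_self2[of "p - q" 4 "u - v"]
    by (simp_all add: algebra_simps)
  define a' where "a' = a + of_nat N * b"
  obtain x y where r: "gre a' = gre a + 4 * x" and i: "gim a' = gim a + 4 * y"
    by (auto simp: a'_def \<open>N = 4 * k\<close> mult.assoc)
  have "even (gim a') = even (gim a)" "odd (gre a' + gim a') = odd (gre a + gim a)"
    "(gre a' + gim a') mod 4 = (gre a + gim a) mod 4" "(gim a' - gre a') mod 4 = (gim a - gre a) mod 4"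
    unfolding r i using * by auto
  then show ?thesis using assms(2) unfolding a'_def[symmetric] guf_def godd_def by simp
qed

lemma godd_cong: "4 dvd N \<Longrightarrow> godd (a + of_nat N * b) = godd a"
  by (auto simp: godd_def elim!: dvdE)

lemma normalize_cong:
  fixes a :: gint
  assumes "4 dvd N" "godd a"
  shows "of_nat N dvd normalize (a + of_nat N * b) - normalize a"
  unfolding normalize_gint_def guf_cong[OF assms] by (simp add: distrib_left)

lemma gtwisted_cong:
  assumes "of_nat N dvd a - b" "4 dvd N"
  shows "gtwisted a = gtwisted b"
proof -
  have "int N dvd gim a - gim b" using of_int_dvd_gint_iff[of "int N" "a - b"] assms(1) by simp
  moreover have "4 dvd int N" using assms(2) by presburger
  ultimately have "4 dvd gim a - gim b" by (rule dvd_trans[rotated])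
  then show ?thesis unfolding gtwisted_def by presburger
qed

text \<open>Precomposition with \<open>normalize\<close> makes the symbol invariant under units, as
  \<open>gchar\<close> requires, and changes nothing at 2-primary elements. Even elements get 0,
  because normalization is not multiplicative on them.\<close>

definition qchar :: "gint \<Rightarrow> gint \<Rightarrow> complex" where
  "qchar \<pi> a = (if godd a then cx (qsym (normalize a) \<pi>) else 0)"

text \<open>The character that separates the two classes of 2-primary elements modulo 4; by it
  Dirichlet's theorem also controls membership in the twisted set.\<close>

definition tchar :: "gint \<Rightarrow> complex" where
  "tchar a = (if godd a then if gtwisted (normalize a) then -1 else 1 else 0)"

lemma gchar_qchar:
  assumes "gprime \<pi>"
  shows "gchar (qchar \<pi>)"
proof
  show "qchar \<pi> (a * b) = qchar \<pi> a * qchar \<pi> b" for a b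
    by (auto simp: qchar_def godd_mult normalize_mult_godd qsym_mult[OF assms])
  show "qchar \<pi> 1 = 1" "qchar \<pi> gi = 1"
    using assms by (simp_all add: qchar_def is_unit_normalize gunit_iff)
  show "qchar \<pi> a = 0 \<or> qchar \<pi> a ^ 4 = 1" for a
    using qsym_cases[OF assms, of "normalize a"] by (auto simp: qchar_def)
qed

lemma gchar_tchar: "gchar tchar"
proof
  show "tchar (a * b) = tchar a * tchar b" for a b
    by (auto simp: tchar_def godd_mult normalize_mult_godd gtwisted_mult gprimary_normalize)
  show "tchar 1 = 1" "tchar gi = 1"
    by (simp_all add: tchar_def is_unit_normalize gunit_iff gtwisted_def)
  show "tchar a = 0 \<or> tchar a ^ 4 = 1" for a
    by (auto simp: tchar_def)
qed

lemma godd_iff_coprime_4: "godd a \<longleftrightarrow> coprime a 4"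
proof
  assume a: "godd a"
  show "coprime a 4"
  proof (rule coprimeI)
    fix d :: gint assume d: "d dvd a" "d dvd 4"
    have "gnorm d dvd gnorm a" "gnorm d dvd 2 ^ 4"
      using gnorm_dvd[OF d(1)] gnorm_dvd[OF d(2)] by (simp_all add: gnorm_def)
    moreover have "coprime (gnorm a) 2" using a by (simp add: gnorm_odd_iff)
    then have "coprime (gnorm a) (2 ^ 4)" by (simp only: coprime_power_right_iff) simp
    ultimately have "gnorm d dvd 1" by (meson coprime_common_divisor)
    then show "d dvd 1" using gnorm_nonneg[of d] by (simp add: zdvd1_eq flip: gnorm_eq_1_iff)
  qed
next
  assume c: "coprime a 4"
  show "godd a"
  proof (rule ccontr)
    assume "\<not> godd a"
    then have "1 + gi dvd a" by (simp add: not_godd_iff)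
    moreover have "(4 :: gint) = (1 + gi) * (2 * (1 - gi))" by (simp add: gint_eq_iff)
    then have "1 + gi dvd 4" by (metis dvd_triv_left)
    ultimately have "1 + gi dvd 1" using c by (meson coprime_common_divisor)
    then show False by (simp add: gnorm_def flip: gnorm_eq_1_iff)
  qed
qed

lemma gprime_coprime_iff: "gprime \<pi> \<Longrightarrow> coprime a \<pi> \<longleftrightarrow> \<not> \<pi> dvd a"
  using prime_elem_imp_coprime[OF gprime_prime_elem, of \<pi> a] gprime_not_dvd_unit[of \<pi> 1]
  by (auto simp: coprime_commute dest: coprime_common_divisor)

lemma coprime_prod_iff:
  fixes f :: "'b \<Rightarrow> 'a :: {semiring_gcd}"
  shows "finite A \<Longrightarrow> coprime a (\<Prod>x\<in>A. f x) \<longleftrightarrow> (\<forall>x\<in>A. coprime a (f x))"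
  by (induction A rule: finite_induct) (auto simp: coprime_mult_right_iff)

text \<open>Chinese remaindering by induction: adding a multiple of \<open>m = 4 * \<Prod>S\<close>
  preserves all earlier conditions, and \<open>m\<close> is invertible modulo the new prime.\<close>

lemma crt_primary:
  assumes "finite S" "\<And>\<pi>. \<pi> \<in> S \<Longrightarrow> gprime \<pi>" "\<And>\<pi>. \<pi> \<in> S \<Longrightarrow> t \<pi> dvd 1"
  shows "\<exists>r. gprimary r \<and> gtwisted r = \<tau> \<and> (\<forall>\<pi>\<in>S. qsym r \<pi> = t \<pi>)"
  using assms
proof (induction S rule: finite_induct)
  case empty
  \<comment> \<open>\<open>3 + 2 * gi\<close> and 1 represent the two classes of 2-primary elements
    modulo 4.\<close>
  have "gprimary (Gint 3 2)" "gtwisted (Gint 3 2)" "\<not> gtwisted 1"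
    by (simp_all add: gprimary_def gtwisted_def)
  then show ?case by (cases \<tau>) (auto intro: gprimary_1)
next
  case (insert \<pi> S)
  then obtain r where r: "gprimary r" "gtwisted r = \<tau>" "\<forall>\<pi>\<in>S. qsym r \<pi> = t \<pi>" by auto
  have \<pi>: "gprime \<pi>" using insert.prems by simp
  have S: "gprime \<rho>" "\<rho> \<noteq> \<pi>" if "\<rho> \<in> S" for \<rho> using that insert by auto
  define m where "m = 4 * \<Prod>S"
  have "\<not> \<pi> dvd 4"
    using \<pi> gprime_godd[OF \<pi>] gprime_coprime_iff[OF \<pi>] unfolding godd_iff_coprime_4 by (metis coprime_commute)
  moreover have "\<not> \<pi> dvd \<Prod>S"
    using insert.hyps(1) prime_dvd_prod_iff[OF _ gprime_prime[OF \<pi>], of S "\<lambda>x. x"] gprime_dvd_gprime[OF \<pi>] S by auto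
  ultimately have m: "\<not> \<pi> dvd m" unfolding m_def gprime_dvd_mult[OF \<pi>] by simp
  obtain a where a: "qsym a \<pi> = t \<pi>" using qsym_surj[OF \<pi>, of "t \<pi>"] insert.prems by auto
  define k where "k = nat (gnorm \<pi> - 1)"
  have k: "k > 0" using gnorm_gprime_gt_1[OF \<pi>] by (simp add: k_def)
  \<comment> \<open>By Fermat \<open>m ^ (k - 1)\<close> is an inverse of \<open>m\<close> modulo
    \<open>\<pi>\<close>, so \<open>r + m * y\<close> is congruent to \<open>a\<close>.\<close>
  define y where "y = m ^ (k - 1) * (a - r)"
  have "\<pi> dvd (m ^ k - 1) * (a - r)" using gprime_fermat[OF \<pi> m] by (simp add: k_def)
  also have "m ^ k = m * m ^ (k - 1)" using k by (simp flip: power_Suc)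
  also have "(m * m ^ (k - 1) - 1) * (a - r) = r + m * y - a" by (simp add: y_def algebra_simps)
  finally have "qsym (r + m * y) \<pi> = t \<pi>" using qsym_cong[OF \<pi>] a by metis
  moreover have "qsym (r + m * y) \<rho> = t \<rho>" if \<rho>: "\<rho> \<in> S" for \<rho>
  proof -
    have "\<rho> dvd \<Prod>S" using \<rho> insert.hyps(1) by (rule dvd_prodI[rotated, where f = "\<lambda>x. x", simplified])
    then have "\<rho> dvd (r + m * y) - r" by (simp add: m_def)
    then show ?thesis using qsym_cong[OF S(1)[OF \<rho>]] r(3) \<rho> by metis
  qed
  moreover have d4: "of_nat 4 dvd (r + m * y) - r" by (simp add: m_def)
  then have "gtwisted (r + m * y) = \<tau>" using gtwisted_cong[OF d4] r(2) by simp
  moreover have "gprimary (r + m * y)"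
  proof -
    have "2 * (1 + gi) dvd m * y + (r - 1)"
    proof (rule dvd_add)
      have "m = 2 * (1 + gi) * ((1 - gi) * \<Prod>S)" by (simp add: m_def gint_eq_iff algebra_simps)
      then show "2 * (1 + gi) dvd m * y" by (metis dvd_mult2 dvd_triv_left)
    qed (use r(1) gprimary_iff in blast)
    then show ?thesis unfolding gprimary_iff by (simp add: algebra_simps)
  qed
  ultimately show ?case by (intro exI[of _ "r + m * y"]) auto
qed

text \<open>The period in \<open>dirichlet_gint\<close> is a rational integer \<open>N\<close>, so
  \<open>S\<close> is first closed under conjugation, with value 1 at the added primes; then all
  characters together are nonzero exactly at the elements coprime to \<open>N\<close>. The new prime
  is not in \<open>S\<close>, as \<open>qsym p p = 0\<close> is not a unit.\<close>

lemma gprime_prescribed: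
  assumes S: "finite S" "\<And>\<pi>. \<pi> \<in> S \<Longrightarrow> gprime \<pi>" "\<And>\<pi>. \<pi> \<in> S \<Longrightarrow> t \<pi> dvd 1"
  obtains p where "gprime p" "p \<notin> S" "gtwisted p = \<tau>" "\<And>\<pi>. \<pi> \<in> S \<Longrightarrow> qsym p \<pi> = t \<pi>"
proof -
  define R where "R = S \<union> gcnj ` S"
  define t' where "t' \<pi> = (if \<pi> \<in> S then t \<pi> else 1)" for \<pi>
  have R: "finite R" "gprime \<pi>" "gcnj \<pi> \<in> R" "t' \<pi> dvd 1" if "\<pi> \<in> R" for \<pi>
    using that S unfolding R_def t'_def by force+
  have finR: "finite R" using S(1) by (simp add: R_def)
  define I where "I = insert None (Some ` R)"
  define \<xi> where "\<xi> i = (case i of None \<Rightarrow> tchar | Some \<pi> \<Rightarrow> qchar \<pi>)" for i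
  define N where "N = 4 * (\<Prod>\<pi>\<in>R. nat (gnorm \<pi>))"
  have N4: "4 dvd N" by (simp add: N_def)
  have Neq: "of_nat N = 4 * (\<Prod>\<pi>\<in>R. \<pi> * gcnj \<pi>)"
    by (simp add: N_def of_nat_prod mult_gcnj)
  obtain r where r: "gprimary r" "gtwisted r = \<tau>" "\<forall>\<pi>\<in>R. qsym r \<pi> = t' \<pi>"
    using crt_primary[OF finR, of t' \<tau>] R(2,4) by blast
  have "\<exists>p. prime p \<and> (\<forall>i\<in>I. \<xi> i p = \<xi> i r)"
  proof (rule dirichlet_gint)
    show "finite I" using finR by (simp add: I_def)
    show "N > 0" using R(2) finR gnorm_gprime_gt_1 by (force simp: N_def)
    show "gchar (\<xi> i)" if "i \<in> I" for i
      using that gchar_tchar gchar_qchar R(2) by (auto simp: I_def \<xi>_def)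
    show "\<xi> i (a + of_nat N * b) = \<xi> i a" if "i \<in> I" for i a b
    proof (cases i)
      case None
      then show ?thesis
        using gtwisted_cong[OF normalize_cong[OF N4, of a b] N4] by (auto simp: \<xi>_def tchar_def godd_cong[OF N4])
    next
      case (Some \<pi>)
      then have \<pi>: "\<pi> \<in> R" using that by (auto simp: I_def)
      have "\<pi> * gcnj \<pi> dvd (\<Prod>\<pi>\<in>R. \<pi> * gcnj \<pi>)" by (rule dvd_prodI[OF finR \<pi>])
      then have "\<pi> dvd of_nat N" unfolding Neq by (metis dvd_mult dvd_mult_left)
      then have "qsym (normalize (a + of_nat N * b)) \<pi> = qsym (normalize a) \<pi>" if "godd a"
        using normalize_cong[OF N4 that, of b] by (intro qsym_cong R(2) \<pi>) (rule dvd_trans)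
      then show ?thesis by (auto simp: Some \<xi>_def qchar_def godd_cong[OF N4])
    qed
    show cop: "(\<forall>i\<in>I. \<xi> i a \<noteq> 0) \<longleftrightarrow> coprime a (of_nat N)" for a
    proof -
      have "(\<forall>i\<in>I. \<xi> i a \<noteq> 0) \<longleftrightarrow> godd a \<and> (\<forall>\<pi>\<in>R. \<not> \<pi> dvd a)"
        using R(2) by (auto simp: I_def \<xi>_def tchar_def qchar_def)
      also have "\<dots> \<longleftrightarrow> coprime a 4 \<and> (\<forall>\<pi>\<in>R. coprime a \<pi> \<and> coprime a (gcnj \<pi>))"
        using R(2,3) by (auto simp: godd_iff_coprime_4 gprime_coprime_iff)
      also have "\<dots> \<longleftrightarrow> coprime a (of_nat N)"
        unfolding Neq using finR by (simp add: coprime_mult_right_iff coprime_prod_iff)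
      finally show ?thesis .
    qed
    show "coprime r (of_nat N)"
    proof (rule cop[THEN iffD1], rule ballI)
      fix i assume "i \<in> I"
      then show "\<xi> i r \<noteq> 0"
        using r gprimary_imp_godd[OF r(1)] R(4)
        by (force simp: I_def \<xi>_def tchar_def qchar_def normalize_gprimary)
    qed
  qed
  then obtain p where p: "prime p" "\<forall>i\<in>I. \<xi> i p = \<xi> i r" by blast
  have "tchar p = tchar r" using p(2) by (auto simp: I_def \<xi>_def)
  then have "godd p" and tw: "gtwisted (normalize p) = gtwisted (normalize r)"
    using gprimary_imp_godd[OF r(1)] by (auto simp: tchar_def split: if_splits)
  then have gp: "gprime p" using p(1) by (simp add: gprime_def)
  note nz = normalize_gprimary[OF gprime_gprimary[OF gp]] normalize_gprimary[OF r(1)]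
  have q: "qsym p \<pi> = t \<pi>" if "\<pi> \<in> S" for \<pi>
  proof -
    have "\<pi> \<in> R" using that by (simp add: R_def)
    then have "qchar \<pi> p = qchar \<pi> r" using p(2) by (auto simp: I_def \<xi>_def)
    then have "qsym p \<pi> = qsym r \<pi>" using \<open>godd p\<close> gprimary_imp_godd[OF r(1)] by (simp add: qchar_def nz)
    then show ?thesis using r(3) \<open>\<pi> \<in> R\<close> that by (simp add: t'_def)
  qed
  have "p \<notin> S"
  proof
    assume "p \<in> S"
    then have "qsym p p dvd 1" using q S(3) by simp
    then show False using gp by (simp add: qsym_def)
  qed
  then show thesis using that gp q tw r(2) by (simp add: nz)
qed

lemma gprime_sequence:
  fixes m :: "nat \<Rightarrow> nat \<Rightarrow> gint"
  assumes "\<And>j k. k < j \<Longrightarrow> j < n \<Longrightarrow> m j k dvd 1"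
  shows "\<exists>\<pi>. inj_on \<pi> {..<n} \<and> (\<forall>j<n. gprime (\<pi> j) \<and> (gtwisted (\<pi> j) \<longleftrightarrow> j \<in> T)) \<and>
    (\<forall>j<n. \<forall>k<j. qsym (\<pi> j) (\<pi> k) = m j k)"
  using assms
proof (induction n)
  case (Suc n)
  have "m j k dvd 1" if "k < j" "j < n" for j k using Suc.prems that by simp
  from Suc.IH[OF this] obtain \<pi> where \<pi>: "inj_on \<pi> {..<n}"
    "\<forall>j<n. gprime (\<pi> j) \<and> (gtwisted (\<pi> j) \<longleftrightarrow> j \<in> T)" "\<forall>j<n. \<forall>k<j. qsym (\<pi> j) (\<pi> k) = m j k"
    by blast
  define t where "t \<rho> = m n (inv_into {..<n} \<pi> \<rho>)" for \<rho>
  have t: "t (\<pi> k) = m n k" if "k < n" for k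
    using that by (simp add: t_def inv_into_f_f[OF \<pi>(1)])
  obtain p where p: "gprime p" "p \<notin> \<pi> ` {..<n}" "gtwisted p = (n \<in> T)"
    "\<And>\<rho>. \<rho> \<in> \<pi> ` {..<n} \<Longrightarrow> qsym p \<rho> = t \<rho>"
  proof (rule gprime_prescribed[of "\<pi> ` {..<n}" t "n \<in> T"])
    show "t \<rho> dvd 1" if "\<rho> \<in> \<pi> ` {..<n}" for \<rho> using that t Suc.prems by auto
  qed (use \<pi>(2) in auto)
  show ?case
  proof (intro exI[of _ "\<pi>(n := p)"] conjI allI impI)
    show "inj_on (\<pi>(n := p)) {..<Suc n}"
      using \<pi>(1) p(2) by (auto simp: inj_on_def less_Suc_eq)
    fix j assume j: "j < Suc n"
    show "gprime ((\<pi>(n := p)) j)" "gtwisted ((\<pi>(n := p)) j) \<longleftrightarrow> j \<in> T"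
      using j \<pi>(2) p by (auto simp: less_Suc_eq)
    show "qsym ((\<pi>(n := p)) j) ((\<pi>(n := p)) k) = m j k" if "k < j" for k
      using j that \<pi>(3) p(4) t by (auto simp: less_Suc_eq)
  qed
qed simp

section \<open>Prime ideals of the Gaussian integers\<close>

lemma gauss_int_ring_simps:
  "carrier gauss_int_ring = range cx" "x \<otimes>\<^bsub>gauss_int_ring\<^esub> y = x * y" "x \<oplus>\<^bsub>gauss_int_ring\<^esub> y = x + y"
  "\<zero>\<^bsub>gauss_int_ring\<^esub> = 0" "\<one>\<^bsub>gauss_int_ring\<^esub> = 1"
proof -
  have "z \<in> range cx" if z: "Re z \<in> \<int>" "Im z \<in> \<int>" for z
  proof -
    obtain a b where "Re z = of_int a" "Im z = of_int b" using z by (auto elim!: Ints_cases)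
    then have "z = cx (Gint a b)" by (simp add: cx_def complex_eq_iff)
    then show ?thesis by blast
  qed
  then show "carrier gauss_int_ring = range cx" by (auto simp: gauss_int_ring_def cx_def)
qed (simp_all add: gauss_int_ring_def)

lemma cx_in_image_iff [simp]: "cx a \<in> cx ` A \<longleftrightarrow> a \<in> A"
  by auto

lemma PIdl_cx: "PIdl\<^bsub>gauss_int_ring\<^esub> (cx a) = cx ` {b. a dvd b}"
proof -
  have "PIdl\<^bsub>gauss_int_ring\<^esub> (cx a) = {x * cx a | x. x \<in> range cx}"
    by (simp add: cgenideal_def gauss_int_ring_simps)
  also have "\<dots> = cx ` {b. a dvd b}"
  proof (intro Set.set_eqI iffI)
    fix z assume "z \<in> {x * cx a | x. x \<in> range cx}"
    then obtain y where "z = cx (y * a)" by auto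
    then show "z \<in> cx ` {b. a dvd b}" by (intro image_eqI[of _ _ "y * a"]) auto
  next
    fix z assume "z \<in> cx ` {b. a dvd b}"
    then obtain b where b: "z = cx b" "a dvd b" by auto
    then obtain y where "b = a * y" by (elim dvdE)
    then have "z = cx y * cx a" using b by simp
    then show "z \<in> {x * cx a | x. x \<in> range cx}" by blast
  qed
  finally show ?thesis .
qed

lemma PIdl_cx_eq_iff: "PIdl\<^bsub>gauss_int_ring\<^esub> (cx a) = PIdl\<^bsub>gauss_int_ring\<^esub> (cx b) \<longleftrightarrow> a dvd b \<and> b dvd a"
proof
  assume "PIdl\<^bsub>gauss_int_ring\<^esub> (cx a) = PIdl\<^bsub>gauss_int_ring\<^esub> (cx b)"
  then have "cx ` {c. a dvd c} = cx ` {c. b dvd c}" by (simp only: PIdl_cx)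
  then have "cx c \<in> cx ` {c. a dvd c} \<longleftrightarrow> cx c \<in> cx ` {c. b dvd c}" for c by blast
  then have *: "a dvd c \<longleftrightarrow> b dvd c" for c unfolding cx_in_image_iff by simp
  show "a dvd b \<and> b dvd a" using *[of a] *[of b] by simp
next
  assume "a dvd b \<and> b dvd a"
  then have "{c. a dvd c} = {c. b dvd c}" by (auto intro: dvd_trans[of a b] dvd_trans[of b a])
  then show "PIdl\<^bsub>gauss_int_ring\<^esub> (cx a) = PIdl\<^bsub>gauss_int_ring\<^esub> (cx b)" by (simp only: PIdl_cx)
qed

lemma ideal_PIdl_cx: "ideal (PIdl\<^bsub>gauss_int_ring\<^esub> (cx a)) gauss_int_ring"
  by (rule cring.cgenideal_ideal[OF cring_gauss_int_ring]) (simp add: gauss_int_ring_simps)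

lemma gauss_cong_cx: "gauss_cong (cx a) (cx b) (cx c) \<longleftrightarrow> c dvd a - b"
  unfolding gauss_cong_def PIdl_cx cx_simps(4)[symmetric] cx_in_image_iff by simp

lemma ideal_gauss_principal:
  assumes "ideal I gauss_int_ring"
  obtains a where "I = PIdl\<^bsub>gauss_int_ring\<^esub> (cx a)"
proof -
  interpret I: ideal I gauss_int_ring by (rule assms)
  define J where "J = {a. cx a \<in> I}"
  have IJ: "I = cx ` J"
    using I.a_subset by (auto simp: J_def gauss_int_ring_simps)
  have zero: "0 \<in> J" using additive_subgroup.zero_closed[OF ideal.axioms(1)[OF assms]] by (simp add: J_def gauss_int_ring_simps)
  have add: "a + b \<in> J" if "a \<in> J" "b \<in> J" for a b
    using additive_subgroup.a_closed[OF ideal.axioms(1)[OF assms], of "cx a" "cx b"] that by (simp add: J_def gauss_int_ring_simps)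
  have mul: "b * a \<in> J" if "a \<in> J" for a b
    using I.I_l_closed[of "cx a" "cx b"] that by (simp add: J_def gauss_int_ring_simps)
  have "\<exists>a. J = {b. a dvd b}"
  proof (cases "J = {0}")
    case True
    then show ?thesis by (intro exI[of _ 0]) auto
  next
    case False
    then obtain c where "c \<in> J \<and> c \<noteq> 0" using zero by auto
    then obtain a where a: "a \<in> J" "a \<noteq> 0"
      and min: "\<And>b. b \<in> J \<Longrightarrow> b \<noteq> 0 \<Longrightarrow> euclidean_size a \<le> euclidean_size b"
      using exists_least_iff[of "\<lambda>n. \<exists>b. b \<in> J \<and> b \<noteq> 0 \<and> euclidean_size b = n"]
      by (metis (no_types, lifting) not_le)
    have "a dvd b" if b: "b \<in> J" for b
    proof -
      have "b + (- (b div a)) * a \<in> J" by (intro add mul a b)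
      then have "b mod a \<in> J" by (simp add: minus_mult_div_eq_mod[symmetric] mult.commute)
      then have "b mod a = 0" using min[of "b mod a"] mod_size_less[OF a(2), of b] by fastforce
      then show ?thesis by blast
    qed
    moreover have "b \<in> J" if "a dvd b" for b using that mul[OF a(1)] by (auto elim!: dvdE simp: mult.commute)
    ultimately show ?thesis by blast
  qed
  then show thesis using that IJ PIdl_cx by metis
qed

lemma gauss_prime_ideal_PIdl_cx:
  "gauss_prime_ideal (PIdl\<^bsub>gauss_int_ring\<^esub> (cx a)) \<longleftrightarrow> prime_elem a"
proof
  assume "gauss_prime_ideal (PIdl\<^bsub>gauss_int_ring\<^esub> (cx a))"
  then have P: "primeideal (cx ` {b. a dvd b}) gauss_int_ring" and nz: "cx ` {b. a dvd b} \<noteq> {0}"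
    by (simp_all add: gauss_prime_ideal_def PIdl_cx)
  interpret P: primeideal "cx ` {b. a dvd b}" gauss_int_ring by (rule P)
  show "prime_elem a"
  proof (rule prime_elemI)
    show "a \<noteq> 0" using nz by auto
    show "\<not> a dvd 1"
    proof
      assume "a dvd 1"
      then have "{b. a dvd b} = UNIV" by (auto intro: dvd_trans)
      then show False using P.I_notcarr by (simp add: gauss_int_ring_simps)
    qed
    fix b c assume "a dvd b * c"
    then have "cx b \<otimes>\<^bsub>gauss_int_ring\<^esub> cx c \<in> cx ` {b. a dvd b}"
      by (simp add: gauss_int_ring_simps flip: cx_simps(6))
    from P.I_prime[OF _ _ this] show "a dvd b \<or> a dvd c" by (auto simp: gauss_int_ring_simps)
  qed
next
  assume a: "prime_elem a"
  show "gauss_prime_ideal (PIdl\<^bsub>gauss_int_ring\<^esub> (cx a))"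
    unfolding gauss_prime_ideal_def
  proof
    show "primeideal (PIdl\<^bsub>gauss_int_ring\<^esub> (cx a)) gauss_int_ring"
    proof (rule primeidealI[OF ideal_PIdl_cx cring_gauss_int_ring])
      have "cx 1 \<notin> cx ` {b. a dvd b}" using a unfolding cx_in_image_iff by auto
      then show "carrier gauss_int_ring \<noteq> PIdl\<^bsub>gauss_int_ring\<^esub> (cx a)"
        unfolding PIdl_cx gauss_int_ring_simps by blast
      fix x y assume xy: "x \<in> carrier gauss_int_ring" "y \<in> carrier gauss_int_ring"
        "x \<otimes>\<^bsub>gauss_int_ring\<^esub> y \<in> PIdl\<^bsub>gauss_int_ring\<^esub> (cx a)"
      obtain b c where bc: "x = cx b" "y = cx c" using xy(1,2) by (auto simp: gauss_int_ring_simps)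
      have "a dvd b * c"
        using xy(3) unfolding bc PIdl_cx gauss_int_ring_simps cx_simps(6)[symmetric] cx_in_image_iff by simp
      then show "x \<in> PIdl\<^bsub>gauss_int_ring\<^esub> (cx a) \<or> y \<in> PIdl\<^bsub>gauss_int_ring\<^esub> (cx a)"
        using a by (simp add: bc PIdl_cx prime_elem_dvd_mult_iff)
    qed
    have "cx a \<in> PIdl\<^bsub>gauss_int_ring\<^esub> (cx a)" by (simp add: PIdl_cx)
    moreover have "cx a \<noteq> 0" using a by auto
    ultimately show "PIdl\<^bsub>gauss_int_ring\<^esub> (cx a) \<noteq> {0}" by blast
  qed
qed

lemma ideal_divides_PIdl_cx:
  "ideal_divides (PIdl\<^bsub>gauss_int_ring\<^esub> (cx a)) (PIdl\<^bsub>gauss_int_ring\<^esub> (cx b)) \<longleftrightarrow> a dvd b"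
proof
  assume "ideal_divides (PIdl\<^bsub>gauss_int_ring\<^esub> (cx a)) (PIdl\<^bsub>gauss_int_ring\<^esub> (cx b))"
  then obtain K where K: "ideal K gauss_int_ring"
    "PIdl\<^bsub>gauss_int_ring\<^esub> (cx b) = ideal_prod gauss_int_ring (PIdl\<^bsub>gauss_int_ring\<^esub> (cx a)) K"
    by (auto simp: ideal_divides_def)
  have "PIdl\<^bsub>gauss_int_ring\<^esub> (cx b) \<subseteq> PIdl\<^bsub>gauss_int_ring\<^esub> (cx a)"
    using ring.ideal_prod_inter[OF cring.axioms(1)[OF cring_gauss_int_ring] ideal_PIdl_cx K(1)] K(2) by blast
  then show "a dvd b" unfolding PIdl_cx by (auto simp: image_subset_iff)
next
  assume "a dvd b"
  then obtain c where c: "b = a * c" by (rule dvdE)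
  have "PIdl\<^bsub>gauss_int_ring\<^esub> (cx b) =
      ideal_prod gauss_int_ring (PIdl\<^bsub>gauss_int_ring\<^esub> (cx a)) (PIdl\<^bsub>gauss_int_ring\<^esub> (cx c))"
  proof (intro equalityI subsetI)
    fix z assume "z \<in> PIdl\<^bsub>gauss_int_ring\<^esub> (cx b)"
    then obtain w where w: "z = cx w" "b dvd w" by (auto simp: PIdl_cx)
    then obtain y where "w = b * y" by (elim dvdE)
    then have "z = cx (a * y) * cx c" using w c by simp
    moreover have "cx (a * y) \<otimes>\<^bsub>gauss_int_ring\<^esub> cx c
        \<in> ideal_prod gauss_int_ring (PIdl\<^bsub>gauss_int_ring\<^esub> (cx a)) (PIdl\<^bsub>gauss_int_ring\<^esub> (cx c))"
      by (rule ideal_prod.prod) (simp_all add: PIdl_cx del: cx_simps)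
    ultimately show "z \<in> ideal_prod gauss_int_ring (PIdl\<^bsub>gauss_int_ring\<^esub> (cx a)) (PIdl\<^bsub>gauss_int_ring\<^esub> (cx c))"
      by (simp add: gauss_int_ring_simps)
  next
    fix z assume "z \<in> ideal_prod gauss_int_ring (PIdl\<^bsub>gauss_int_ring\<^esub> (cx a)) (PIdl\<^bsub>gauss_int_ring\<^esub> (cx c))"
    then show "z \<in> PIdl\<^bsub>gauss_int_ring\<^esub> (cx b)"
    proof induction
      case (prod i j)
      then obtain x y where "i = cx x" "a dvd x" "j = cx y" "c dvd y" by (auto simp: PIdl_cx)
      then have "i * j = cx (x * y)" "b dvd x * y" by (auto simp: c mult_dvd_mono)
      then show ?case by (simp only: PIdl_cx gauss_int_ring_simps cx_in_image_iff mem_Collect_eq)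
    next
      case (sum s1 s2)
      then obtain x y where "s1 = cx x" "b dvd x" "s2 = cx y" "b dvd y" by (auto simp: PIdl_cx)
      then have "s1 + s2 = cx (x + y)" "b dvd x + y" by auto
      then show ?case by (simp only: PIdl_cx gauss_int_ring_simps cx_in_image_iff mem_Collect_eq)
    qed
  qed
  then show "ideal_divides (PIdl\<^bsub>gauss_int_ring\<^esub> (cx a)) (PIdl\<^bsub>gauss_int_ring\<^esub> (cx b))"
    unfolding ideal_divides_def using ideal_PIdl_cx by blast
qed

lemma odd_prime_ideal_iff:
  "odd_prime_ideal \<pp> \<longleftrightarrow> (\<exists>\<pi>. gprime \<pi> \<and> \<pp> = PIdl\<^bsub>gauss_int_ring\<^esub> (cx \<pi>))"
proof -
  \<comment> \<open>\<open>godd\<close> is known as coprimality to 4, and a prime divides 4 exactly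
    if it divides 2.\<close>
  have 2: "(4 :: gint) = 2 * 2" by simp
  have four: "\<not> \<pi> dvd 2 \<longleftrightarrow> godd \<pi>" if "prime_elem \<pi>" for \<pi> :: gint
  proof -
    have "\<pi> dvd 2 \<longleftrightarrow> \<pi> dvd 4" unfolding 2 using that by (simp only: prime_elem_dvd_mult_iff disj_absorb)
    moreover have "coprime \<pi> 4 \<longleftrightarrow> \<not> \<pi> dvd 4"
      using prime_elem_imp_coprime[OF that, of 4] that
      by (auto dest: coprime_common_divisor[of \<pi> 4 \<pi>])
    ultimately show ?thesis using godd_iff_coprime_4 by blast
  qed
  have odd: "odd_prime_ideal (PIdl\<^bsub>gauss_int_ring\<^esub> (cx \<pi>)) \<longleftrightarrow> prime_elem \<pi> \<and> godd \<pi>" for \<pi>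
    using ideal_divides_PIdl_cx[of \<pi> 2] four[of \<pi>]
    by (auto simp: odd_prime_ideal_def gauss_prime_ideal_PIdl_cx)
  show ?thesis
  proof
    assume p: "odd_prime_ideal \<pp>"
    then have "ideal \<pp> gauss_int_ring"
      by (simp add: odd_prime_ideal_def gauss_prime_ideal_def primeideal.axioms(1))
    then obtain a where a: "\<pp> = PIdl\<^bsub>gauss_int_ring\<^esub> (cx a)" by (rule ideal_gauss_principal)
    then have "prime_elem a" "godd a" using p odd by auto
    then have "gprime (normalize a)" by (simp add: gprime_iff gprimary_normalize)
    moreover have "\<pp> = PIdl\<^bsub>gauss_int_ring\<^esub> (cx (normalize a))" unfolding a PIdl_cx_eq_iff by simp
    ultimately show "\<exists>\<pi>. gprime \<pi> \<and> \<pp> = PIdl\<^bsub>gauss_int_ring\<^esub> (cx \<pi>)" by blast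
  next
    assume "\<exists>\<pi>. gprime \<pi> \<and> \<pp> = PIdl\<^bsub>gauss_int_ring\<^esub> (cx \<pi>)"
    then show "odd_prime_ideal \<pp>" using odd gprime_prime_elem gprime_godd by blast
  qed
qed

lemma primary_generator_PIdl_cx:
  assumes "gprime \<pi>"
  shows "primary_generator (PIdl\<^bsub>gauss_int_ring\<^esub> (cx \<pi>)) = cx \<pi>"
proof -
  have prim: "gauss_cong (cx b) 1 (2 * (1 + \<i>)) \<longleftrightarrow> gprimary b" for b
    using gauss_cong_cx[of b 1 "2 * (1 + gi)"] by (simp add: gprimary_iff)
  show ?thesis
    unfolding primary_generator_def
  proof (rule the_equality)
    show "cx \<pi> \<in> carrier gauss_int_ring \<and> PIdl\<^bsub>gauss_int_ring\<^esub> (cx \<pi>) = PIdl\<^bsub>gauss_int_ring\<^esub> (cx \<pi>) \<and>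
        gauss_cong (cx \<pi>) 1 (2 * (1 + \<i>))"
      using gprime_gprimary[OF assms] by (simp add: prim gauss_int_ring_simps del: distrib_left_numeral)
    fix x assume x: "x \<in> carrier gauss_int_ring \<and> PIdl\<^bsub>gauss_int_ring\<^esub> x = PIdl\<^bsub>gauss_int_ring\<^esub> (cx \<pi>) \<and>
        gauss_cong x 1 (2 * (1 + \<i>))"
    then obtain b where b: "x = cx b" by (auto simp: gauss_int_ring_simps)
    have "gprimary b" "b dvd \<pi>" "\<pi> dvd b" using x by (simp_all add: b prim PIdl_cx_eq_iff del: distrib_left_numeral)
    then have "normalize b = normalize \<pi>" "normalize b = b" "normalize \<pi> = \<pi>"
      using gprime_gprimary[OF assms] by (auto intro: associatedI normalize_gprimary)
    then show "x = cx \<pi>" by (simp add: b)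
  qed
qed

lemma gauss_norm_cx: "gauss_norm (cx a) = nat (gnorm a)"
proof -
  have "Re (cx a * cnj (cx a)) = of_int (gnorm a)"
    by (simp add: cx_def gnorm_def power2_eq_square)
  then show ?thesis by (simp add: gauss_norm_def)
qed

lemma fourth_roots_cx: "fourth_roots = cx ` {u. u dvd 1}"
proof -
  have "{u :: gint. u dvd 1} = {1, -1, gi, -gi}" by (auto simp: gunit_iff)
  then show ?thesis by (simp add: fourth_roots_def)
qed

lemma quartic_symbol_cx:
  assumes "gprime \<pi>" "gprime \<theta>"
  shows "quartic_symbol (cx \<pi>) (cx \<theta>) = cx (qsym \<pi> \<theta>)"
proof (cases "\<pi> = \<theta>")
  case True
  then show ?thesis using assms by (simp add: quartic_symbol_def)
next
  case False
  then have nd: "\<not> \<theta> dvd \<pi>" using assms gprime_dvd_gprime by auto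
  have e: "(gauss_norm (cx \<theta>) - 1) div 4 = qexp \<theta>"
    using gnorm_gprime_gt_1[OF assms(2)] by (simp add: gauss_norm_cx qexp_def nat_diff_distrib)
  have c: "gauss_cong (cx u) (cx \<pi> ^ qexp \<theta>) (cx \<theta>) \<longleftrightarrow> \<theta> dvd u - \<pi> ^ qexp \<theta>" for u
    using gauss_cong_cx[of u "\<pi> ^ qexp \<theta>" \<theta>] by simp
  have "(THE \<zeta>. \<zeta> \<in> fourth_roots \<and> gauss_cong \<zeta> (cx \<pi> ^ qexp \<theta>) (cx \<theta>)) = cx (qsym \<pi> \<theta>)"
  proof (rule the_equality)
    show "cx (qsym \<pi> \<theta>) \<in> fourth_roots \<and> gauss_cong (cx (qsym \<pi> \<theta>)) (cx \<pi> ^ qexp \<theta>) (cx \<theta>)"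
      using qsym_unit[OF assms(2) nd] qsym_cong_power[OF assms(2)] by (simp add: fourth_roots_cx c)
    fix z assume z: "z \<in> fourth_roots \<and> gauss_cong z (cx \<pi> ^ qexp \<theta>) (cx \<theta>)"
    then obtain u where u: "z = cx u" "u dvd 1" by (auto simp: fourth_roots_cx)
    then have "\<theta> dvd u - \<pi> ^ qexp \<theta>" using z c by simp
    then show "z = cx (qsym \<pi> \<theta>)" using qsym_eqI[OF assms(2) u(2)] u(1) by simp
  qed
  then show ?thesis unfolding quartic_symbol_def e using False by simp
qed

lemma is_quartic_residue_mat_iff:
  "is_quartic_residue_mat n M \<longleftrightarrow>
    (\<exists>\<pi>. inj_on \<pi> {..<n} \<and> (\<forall>j<n. gprime (\<pi> j)) \<and> M = Matrix.mat n n (\<lambda>(j, k). cx (qsym (\<pi> j) (\<pi> k))))"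
    (is "_ \<longleftrightarrow> ?R")
proof -
  have eq: "quartic_residue_mat n (\<lambda>j. PIdl\<^bsub>gauss_int_ring\<^esub> (cx (\<pi> j))) = Matrix.mat n n (\<lambda>(j, k). cx (qsym (\<pi> j) (\<pi> k)))"
    if "\<forall>j<n. gprime (\<pi> j)" for \<pi>
    using that unfolding quartic_residue_mat_def
    by (intro eq_matI) (simp_all add: primary_generator_PIdl_cx quartic_symbol_cx)
  have inj: "inj_on (\<lambda>j. PIdl\<^bsub>gauss_int_ring\<^esub> (cx (\<pi> j))) {..<n} \<longleftrightarrow> inj_on \<pi> {..<n}"
    if "\<forall>j<n. gprime (\<pi> j)" for \<pi>
    using that unfolding inj_on_def PIdl_cx_eq_iff by (auto simp: gprime_dvd_gprime)
  show ?thesis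
  proof
    assume "is_quartic_residue_mat n M"
    then obtain \<pp> where p: "inj_on \<pp> {..<n}" "\<forall>j<n. odd_prime_ideal (\<pp> j)" "M = quartic_residue_mat n \<pp>"
      by (auto simp: is_quartic_residue_mat_def)
    from p(2) have "\<forall>j. \<exists>\<pi>. j < n \<longrightarrow> gprime \<pi> \<and> \<pp> j = PIdl\<^bsub>gauss_int_ring\<^esub> (cx \<pi>)"
      by (auto simp: odd_prime_ideal_iff)
    then obtain \<pi> where \<pi>: "\<forall>j<n. gprime (\<pi> j)" "\<And>j. j < n \<Longrightarrow> \<pp> j = PIdl\<^bsub>gauss_int_ring\<^esub> (cx (\<pi> j))"
      by metis
    have "quartic_residue_mat n \<pp> = quartic_residue_mat n (\<lambda>j. PIdl\<^bsub>gauss_int_ring\<^esub> (cx (\<pi> j)))"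
      unfolding quartic_residue_mat_def by (intro eq_matI) (simp_all add: \<pi>(2))
    moreover have "inj_on (\<lambda>j. PIdl\<^bsub>gauss_int_ring\<^esub> (cx (\<pi> j))) {..<n}"
      using p(1) \<pi>(2) inj_on_cong[of "{..<n}" \<pp> "\<lambda>j. PIdl\<^bsub>gauss_int_ring\<^esub> (cx (\<pi> j))"] by simp
    ultimately show ?R using \<pi>(1) p(3) eq inj by (intro exI[of _ \<pi>]) simp
  next
    assume ?R
    then obtain \<pi> where \<pi>: "inj_on \<pi> {..<n}" "\<forall>j<n. gprime (\<pi> j)" "M = Matrix.mat n n (\<lambda>(j, k). cx (qsym (\<pi> j) (\<pi> k)))"
      by blast
    then show "is_quartic_residue_mat n M"
      unfolding is_quartic_residue_mat_def
      by (intro exI[of _ "\<lambda>j. PIdl\<^bsub>gauss_int_ring\<^esub> (cx (\<pi> j))"]) (auto simp: eq inj odd_prime_ideal_iff)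
  qed
qed

text \<open>Only the part of \<open>T\<close> below \<open>n\<close> matters, and the diagonal is
  exempt. An empty \<open>T\<close> therefore imposes the same conditions as a singleton, which
  \<open>skew_on_nonempty\<close> uses to obtain \<open>s \<ge> 1\<close>.\<close>

definition skew_on :: "nat \<Rightarrow> nat set \<Rightarrow> complex mat \<Rightarrow> bool" where
  "skew_on n T M \<longleftrightarrow> (\<forall>j<n. \<forall>k<n. j \<noteq> k \<longrightarrow>
     M $$ (j, k) = (if j \<in> T \<and> k \<in> T then - M $$ (k, j) else M $$ (k, j)))"

theorem is_quartic_residue_mat_iff_skew_on:
  assumes "quartic_sign_mat n M"
  shows "is_quartic_residue_mat n M \<longleftrightarrow> (\<exists>T. skew_on n T M)"
proof
  assume "is_quartic_residue_mat n M"
  then obtain \<pi> where \<pi>: "inj_on \<pi> {..<n}" "\<forall>j<n. gprime (\<pi> j)" "M = Matrix.mat n n (\<lambda>(j, k). cx (qsym (\<pi> j) (\<pi> k)))"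
    unfolding is_quartic_residue_mat_iff by blast
  have "skew_on n {j. gtwisted (\<pi> j)} M"
    unfolding skew_on_def
  proof (intro allI impI)
    fix j k assume jk: "j < n" "k < n" "j \<noteq> k"
    then have "\<pi> j \<noteq> \<pi> k" using \<pi>(1) by (auto simp: inj_on_def)
    then show "M $$ (j, k) = (if j \<in> {j. gtwisted (\<pi> j)} \<and> k \<in> {j. gtwisted (\<pi> j)} then - M $$ (k, j) else M $$ (k, j))"
      using quartic_reciprocity[of "\<pi> j" "\<pi> k"] \<pi>(2) jk by (simp add: \<pi>(3))
  qed
  then show "\<exists>T. skew_on n T M" by blast
next
  assume "\<exists>T. skew_on n T M"
  then obtain T where T: "skew_on n T M" by blast
  have M: "M \<in> carrier_mat n n" "\<And>j. j < n \<Longrightarrow> M $$ (j, j) = 0"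
    "\<And>j k. j < n \<Longrightarrow> k < n \<Longrightarrow> j \<noteq> k \<Longrightarrow> M $$ (j, k) \<in> cx ` {u. u dvd 1}"
    using assms by (auto simp: quartic_sign_mat_def fourth_roots_cx)
  define m where "m j k = inv_into UNIV cx (M $$ (j, k))" for j k
  have m: "cx (m j k) = M $$ (j, k)" "m j k dvd 1" if "j < n" "k < n" "j \<noteq> k" for j k
  proof -
    have "inj cx" by (simp add: inj_def)
    then show "cx (m j k) = M $$ (j, k)" "m j k dvd 1" using M(3)[OF that] by (auto simp: m_def)
  qed
  have "\<exists>\<pi>. inj_on \<pi> {..<n} \<and> (\<forall>j<n. gprime (\<pi> j) \<and> (gtwisted (\<pi> j) \<longleftrightarrow> j \<in> T)) \<and>
    (\<forall>j<n. \<forall>k<j. qsym (\<pi> j) (\<pi> k) = m j k)"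
    by (rule gprime_sequence) (simp add: m(2))
  then obtain \<pi> where \<pi>: "inj_on \<pi> {..<n}" "\<forall>j<n. gprime (\<pi> j) \<and> (gtwisted (\<pi> j) \<longleftrightarrow> j \<in> T)"
    "\<forall>j<n. \<forall>k<j. qsym (\<pi> j) (\<pi> k) = m j k"
    by blast
  have "cx (qsym (\<pi> j) (\<pi> k)) = M $$ (j, k)" if jk: "j < n" "k < n" for j k
  proof (cases j k rule: linorder_cases)
    case less
    then have "\<pi> j \<noteq> \<pi> k" using \<pi>(1) jk by (auto simp: inj_on_def)
    then have "qsym (\<pi> j) (\<pi> k) = (if j \<in> T \<and> k \<in> T then - m k j else m k j)"
      using quartic_reciprocity[of "\<pi> j" "\<pi> k"] \<pi>(2,3) jk less by simp
    moreover have "M $$ (j, k) = (if j \<in> T \<and> k \<in> T then - M $$ (k, j) else M $$ (k, j))"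
      using T jk less unfolding skew_on_def by blast
    ultimately show ?thesis using m(1)[of k j] jk less by simp
  next
    case equal
    then show ?thesis using \<pi>(2) M(2) jk by simp
  next
    case greater
    then show ?thesis using \<pi>(3) m(1) jk by simp
  qed
  then have "M = Matrix.mat n n (\<lambda>(j, k). cx (qsym (\<pi> j) (\<pi> k)))"
    using M(1) by (intro eq_matI) auto
  then show "is_quartic_residue_mat n M" unfolding is_quartic_residue_mat_iff using \<pi> by blast
qed

section \<open>Permutation conjugation and diagonals\<close>

lemma permutation_mat_mult:
  fixes M :: "complex mat"
  assumes "\<sigma> permutes {..<n}" "M \<in> carrier_mat n n" "j < n" "k < n"
  defines "P \<equiv> Matrix.mat n n (\<lambda>(j, k). if k = \<sigma> j then 1 else 0)"
  shows "(P * M) $$ (j, k) = M $$ (\<sigma> j, k)" "(M * P) $$ (j, \<sigma> k) = M $$ (j, k)"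
proof -
  have \<sigma>: "\<sigma> j < n" "\<sigma> k < n" using permutes_in_image[OF assms(1)] assms(3,4) by auto
  have inj: "\<sigma> k = \<sigma> l \<longleftrightarrow> l = k" for l using permutes_inj[OF assms(1)] by (auto simp: inj_def)
  have "(P * M) $$ (j, k) = (\<Sum>l\<in>{0..<n}. (if l = \<sigma> j then 1 else 0) * M $$ (l, k))"
    using assms(2-4) by (simp add: P_def scalar_prod_def)
  also have "\<dots> = (\<Sum>l\<in>{0..<n}. if l = \<sigma> j then M $$ (l, k) else 0)"
    by (intro sum.cong) auto
  finally show "(P * M) $$ (j, k) = M $$ (\<sigma> j, k)" using \<sigma> by simp
  have "(M * P) $$ (j, \<sigma> k) = (\<Sum>l\<in>{0..<n}. M $$ (j, l) * (if \<sigma> k = \<sigma> l then 1 else 0))"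
    using assms(2-4) \<sigma> by (simp add: P_def scalar_prod_def)
  also have "\<dots> = (\<Sum>l\<in>{0..<n}. if l = k then M $$ (j, l) else 0)"
    unfolding inj by (intro sum.cong) auto
  finally show "(M * P) $$ (j, \<sigma> k) = M $$ (j, k)" using assms(4) by simp
qed

text \<open>From \<open>N = P * M * Q\<close> and \<open>Q * P = 1\<close> follows
  \<open>N * P = P * M\<close>, where both sides merely permute entries. Conversely,
  \<open>Q\<close> is taken as the matrix of the inverse permutation.\<close>

lemma perm_conjugate_iff:
  assumes M: "M \<in> carrier_mat n n"
  shows "perm_conjugate n M N \<longleftrightarrow>
    (\<exists>\<sigma>. \<sigma> permutes {..<n} \<and> N = Matrix.mat n n (\<lambda>(j, k). M $$ (\<sigma> j, \<sigma> k)))"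
proof
  assume "perm_conjugate n M N"
  then obtain \<sigma> P Q where \<sigma>: "\<sigma> permutes {..<n}" and P: "P = Matrix.mat n n (\<lambda>(j, k). if k = \<sigma> j then 1 else 0)"
    and s: "similar_mat_wit N M P Q"
    by (auto simp: perm_conjugate_def permutation_mat_def)
  have c: "N \<in> carrier_mat n n" "P \<in> carrier_mat n n" "Q \<in> carrier_mat n n" "Q * P = 1\<^sub>m n" "N = P * M * Q"
  proof -
    note w = s[unfolded similar_mat_wit_def Let_def insert_subset]
    have "M \<in> carrier_mat (dim_row N) (dim_row N)" using w by blast
    then have "dim_row N = n" using M by (metis carrier_matD(1))
    note w[unfolded this]
    then show "N \<in> carrier_mat n n" "P \<in> carrier_mat n n" "Q \<in> carrier_mat n n" "Q * P = 1\<^sub>m n" "N = P * M * Q"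
      by blast+
  qed
  have "N * P = P * M * (Q * P)"
    unfolding c(5) using c(2,3) M by (intro assoc_mult_mat) auto
  then have NP: "N * P = P * M" using c(2,4) M by simp
  have "N $$ (j, k) = M $$ (\<sigma> j, \<sigma> k)" if jk: "j < n" "k < n" for j k
  proof -
    have \<sigma>k: "\<sigma> k < n" using permutes_in_image[OF \<sigma>] jk by auto
    have "N $$ (j, k) = (N * P) $$ (j, \<sigma> k)"
      unfolding P by (rule permutation_mat_mult(2)[OF \<sigma> c(1) jk, symmetric])
    also have "\<dots> = M $$ (\<sigma> j, \<sigma> k)"
      unfolding NP unfolding P by (rule permutation_mat_mult(1)[OF \<sigma> M jk(1) \<sigma>k])
    finally show ?thesis .
  qed
  then have "N = Matrix.mat n n (\<lambda>(j, k). M $$ (\<sigma> j, \<sigma> k))" using c(1) by (intro eq_matI) auto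
  then show "\<exists>\<sigma>. \<sigma> permutes {..<n} \<and> N = Matrix.mat n n (\<lambda>(j, k). M $$ (\<sigma> j, \<sigma> k))"
    using \<sigma> by blast
next
  assume "\<exists>\<sigma>. \<sigma> permutes {..<n} \<and> N = Matrix.mat n n (\<lambda>(j, k). M $$ (\<sigma> j, \<sigma> k))"
  then obtain \<sigma> where \<sigma>: "\<sigma> permutes {..<n}" and N: "N = Matrix.mat n n (\<lambda>(j, k). M $$ (\<sigma> j, \<sigma> k))"
    by blast
  define P :: "complex mat" where "P = Matrix.mat n n (\<lambda>(j, k). if k = \<sigma> j then 1 else 0)"
  define \<tau> where "\<tau> = inv_into UNIV \<sigma>"
  have \<tau>: "\<tau> permutes {..<n}" unfolding \<tau>_def by (rule permutes_inv[OF \<sigma>])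
  have st: "\<sigma> (\<tau> j) = j" "\<tau> (\<sigma> j) = j" for j
    unfolding \<tau>_def using permutes_inverses[OF \<sigma>] by auto
  define Q :: "complex mat" where "Q = Matrix.mat n n (\<lambda>(j, k). if k = \<tau> j then 1 else 0)"
  have PQ: "P \<in> carrier_mat n n" "Q \<in> carrier_mat n n" by (simp_all add: P_def Q_def)
  have lt: "\<sigma> j < n" "\<tau> j < n" if "j < n" for j
    using permutes_in_image[OF \<sigma>] permutes_in_image[OF \<tau>] that by auto
  have "P * Q = 1\<^sub>m n"
  proof (rule eq_matI)
    fix j k assume "j < dim_row (1\<^sub>m n)" "k < dim_col (1\<^sub>m n)"
    then have jk: "j < n" "k < n" by auto
    have "(P * Q) $$ (j, k) = Q $$ (\<sigma> j, k)"
      unfolding P_def by (rule permutation_mat_mult(1)[OF \<sigma> PQ(2) jk])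
    then show "(P * Q) $$ (j, k) = 1\<^sub>m n $$ (j, k)" using jk lt by (auto simp: Q_def st)
  qed (use PQ in auto)
  moreover have "Q * P = 1\<^sub>m n"
  proof (rule eq_matI)
    fix j k assume "j < dim_row (1\<^sub>m n)" "k < dim_col (1\<^sub>m n)"
    then have jk: "j < n" "k < n" by auto
    have "(Q * P) $$ (j, k) = P $$ (\<tau> j, k)"
      unfolding Q_def by (rule permutation_mat_mult(1)[OF \<tau> PQ(1) jk])
    then show "(Q * P) $$ (j, k) = 1\<^sub>m n $$ (j, k)" using jk lt by (auto simp: P_def st)
  qed (use PQ in auto)
  moreover have "N = P * M * Q"
  proof (rule eq_matI)
    fix j k assume "j < dim_row (P * M * Q)" "k < dim_col (P * M * Q)"
    then have jk: "j < n" "k < n" using PQ by auto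
    have PM: "P * M \<in> carrier_mat n n" using PQ M by auto
    have "(P * M * Q) $$ (j, \<tau> (\<sigma> k)) = (P * M) $$ (j, \<sigma> k)"
      unfolding Q_def by (rule permutation_mat_mult(2)[OF \<tau> PM jk(1)]) (use lt jk in auto)
    also have "\<dots> = M $$ (\<sigma> j, \<sigma> k)"
      unfolding P_def by (rule permutation_mat_mult(1)[OF \<sigma> M]) (use lt jk in auto)
    finally show "N $$ (j, k) = (P * M * Q) $$ (j, k)" using jk by (simp add: st N)
  qed (use PQ N in auto)
  ultimately have "similar_mat_wit N M P Q"
    using PQ M N by (intro similar_mat_witI[of P Q n]) auto
  then show "perm_conjugate n M N"
    unfolding perm_conjugate_def permutation_mat_def P_def using \<sigma> by blast
qed

lemma permutes_image_initial:
  assumes "T \<subseteq> {..<n}"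
  obtains \<sigma> where "\<sigma> permutes {..<n}" "\<sigma> ` {..<card T} = T"
proof -
  define s where "s = card T"
  have fin: "finite T" using assms finite_subset by blast
  have sn: "s \<le> n" using card_mono[OF _ assms] by (simp add: s_def)
  obtain f where f: "bij_betw f {..<s} T"
    using finite_same_card_bij[of "{..<s}" T] fin by (auto simp: s_def)
  obtain g where g: "bij_betw g {s..<n} ({..<n} - T)"
    using finite_same_card_bij[of "{s..<n}" "{..<n} - T"] card_Diff_subset[OF fin assms] by (auto simp: s_def)
  define \<sigma> where "\<sigma> x = (if x < s then f x else if x < n then g x else x)" for x
  have 1: "bij_betw \<sigma> {..<s} T" using f by (rule bij_betw_cong[THEN iffD1, rotated]) (simp add: \<sigma>_def)
  have 2: "bij_betw \<sigma> {s..<n} ({..<n} - T)" using g by (rule bij_betw_cong[THEN iffD1, rotated]) (simp add: \<sigma>_def)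
  have "bij_betw \<sigma> ({..<s} \<union> {s..<n}) (T \<union> ({..<n} - T))" by (rule bij_betw_combine[OF 1 2]) auto
  also have "{..<s} \<union> {s..<n} = {..<n}" using sn by auto
  also have "T \<union> ({..<n} - T) = {..<n}" using assms by auto
  finally have "\<sigma> permutes {..<n}" by (rule bij_imp_permutes) (use sn in \<open>auto simp: \<sigma>_def\<close>)
  moreover have "\<sigma> ` {..<card T} = T" using 1 by (simp add: bij_betw_def s_def)
  ultimately show thesis by (rule that)
qed

lemma skew_on_nonempty:
  assumes "skew_on n T M" "n > 0"
  obtains U where "skew_on n U M" "U \<subseteq> {..<n}" "U \<noteq> {}"
proof (cases "T \<inter> {..<n} = {}")
  case True
  have "skew_on n {0} M"
    unfolding skew_on_def
  proof (intro allI impI)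
    fix j k assume jk: "j < n" "k < n" "j \<noteq> k"
    have "j \<notin> T" using True jk(1) by blast
    then have "M $$ (j, k) = M $$ (k, j)" using assms(1) jk unfolding skew_on_def by metis
    moreover have "\<not> (j \<in> {0} \<and> k \<in> {0})" using jk(3) by blast
    ultimately show "M $$ (j, k) = (if j \<in> {0} \<and> k \<in> {0} then - M $$ (k, j) else M $$ (k, j))"
      by (simp only: if_False)
  qed
  then show thesis using that[of "{0}"] assms(2) by auto
next
  case False
  have "skew_on n (T \<inter> {..<n}) M" using assms unfolding skew_on_def by simp
  then show thesis using that[of "T \<inter> {..<n}"] False by auto
qed

theorem skew_symmetric_block_form_iff_skew_on:
  assumes M: "quartic_sign_mat n M" and n: "n > 0"
  shows "skew_symmetric_block_form n M \<longleftrightarrow> (\<exists>T. skew_on n T M)"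
proof
  have Mc: "M \<in> carrier_mat n n" using M by (simp add: quartic_sign_mat_def)
  {
    assume "skew_symmetric_block_form n M"
    then obtain s A B S where s: "s \<le> n" and A: "quartic_sign_mat s A" "skew_symmetric_mat A"
      and S: "quartic_sign_mat (n - s) S" "symmetric_mat S" and B: "B \<in> carrier_mat s (n - s)"
      and pc: "perm_conjugate n M (four_block_mat A B (transpose_mat B) S)"
      by (auto simp: skew_symmetric_block_form_def)
    obtain \<sigma> where \<sigma>: "\<sigma> permutes {..<n}"
      and N: "four_block_mat A B (transpose_mat B) S = Matrix.mat n n (\<lambda>(j, k). M $$ (\<sigma> j, \<sigma> k))"
      using pc unfolding perm_conjugate_iff[OF Mc] by blast
    have Ac: "A \<in> carrier_mat s s" and Sc: "S \<in> carrier_mat (n - s) (n - s)"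
      using A S by (simp_all add: quartic_sign_mat_def)
    have Aeq: "A $$ (j, k) = - A $$ (k, j)" if "j < s" "k < s" for j k
    proof -
      have "transpose_mat A $$ (k, j) = (- A) $$ (k, j)" using A(2) by (simp add: skew_symmetric_mat_def)
      then show ?thesis using that Ac by simp
    qed
    have Seq: "S $$ (j, k) = S $$ (k, j)" if "j < n - s" "k < n - s" for j k
    proof -
      have "transpose_mat S $$ (k, j) = S $$ (k, j)" using S(2) by (simp add: symmetric_mat_def)
      then show ?thesis using that Sc by simp
    qed
    have Meq: "M $$ (\<sigma> j, \<sigma> k) = (if j < s then if k < s then A $$ (j, k) else B $$ (j, k - s)
        else if k < s then B $$ (k, j - s) else S $$ (j - s, k - s))" if jk: "j < n" "k < n" for j k
    proof -
      have "M $$ (\<sigma> j, \<sigma> k) = four_block_mat A B (transpose_mat B) S $$ (j, k)" using jk N by simp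
      then show ?thesis using Ac Sc B s jk by auto
    qed
    have "skew_on n (\<sigma> ` {..<s}) M"
      unfolding skew_on_def
    proof (intro allI impI)
      fix j k assume jk: "j < n" "k < n" "j \<noteq> k"
      have "\<exists>i<n. \<sigma> i = j" if "j < n" for j using permutes_image[OF \<sigma>] that by (metis imageE lessThan_iff)
      then obtain j' k' where jk': "j' < n" "k' < n" "j = \<sigma> j'" "k = \<sigma> k'" using jk by metis
      have mem: "\<sigma> i \<in> \<sigma> ` {..<s} \<longleftrightarrow> i < s" for i
        using inj_image_mem_iff[OF permutes_inj[OF \<sigma>], of i "{..<s}"] by simp
      show "M $$ (j, k) = (if j \<in> \<sigma> ` {..<s} \<and> k \<in> \<sigma> ` {..<s} then - M $$ (k, j) else M $$ (k, j))"
        unfolding jk'(3,4) mem Meq[OF jk'(1,2)] Meq[OF jk'(2,1)]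
        using Aeq[of j' k'] Seq[of "j' - s" "k' - s"] jk'(1,2) by auto
    qed
    then show "\<exists>T. skew_on n T M" by blast
  next
    assume "\<exists>T. skew_on n T M"
    then obtain T where T: "skew_on n T M" "T \<subseteq> {..<n}" "T \<noteq> {}" using skew_on_nonempty[OF _ n] by metis
    obtain \<sigma> where \<sigma>: "\<sigma> permutes {..<n}" "\<sigma> ` {..<card T} = T" using permutes_image_initial[OF T(2)] by blast
    define s where "s = card T"
    have fin: "finite T" using T(2) finite_subset by blast
    have s: "1 \<le> s" "s \<le> n" using T fin card_mono[OF _ T(2)] by (auto simp: s_def Suc_le_eq card_gt_0_iff)
    have lt: "\<sigma> j < n" if "j < n" for j using permutes_in_image[OF \<sigma>(1)] that by auto
    have inj: "\<sigma> j = \<sigma> k \<longleftrightarrow> j = k" for j k using permutes_inj[OF \<sigma>(1)] by (auto simp: inj_def)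
    have mem: "\<sigma> j \<in> T \<longleftrightarrow> j < s" for j
      using inj_image_mem_iff[OF permutes_inj[OF \<sigma>(1)], of j "{..<card T}"] by (simp add: \<sigma>(2) s_def)
    define N where "N j k = M $$ (\<sigma> j, \<sigma> k)" for j k
    have N0: "N j j = 0" if "j < n" for j using M lt that by (simp add: N_def quartic_sign_mat_def)
    have N4: "N j k \<in> fourth_roots" if "j < n" "k < n" "j \<noteq> k" for j k
      using M lt that inj by (simp add: N_def quartic_sign_mat_def)
    have Nsk: "N j k = (if j < s \<and> k < s then - N k j else N k j)" if "j < n" "k < n" "j \<noteq> k" for j k
      using T(1)[unfolded skew_on_def, rule_format, of "\<sigma> j" "\<sigma> k"] lt that inj unfolding N_def mem by simp
    define A where "A = Matrix.mat s s (\<lambda>(j, k). N j k)"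
    define B where "B = Matrix.mat s (n - s) (\<lambda>(j, k). N j (k + s))"
    define S where "S = Matrix.mat (n - s) (n - s) (\<lambda>(j, k). N (j + s) (k + s))"
    have "quartic_sign_mat s A" using N0 N4 s by (auto simp: quartic_sign_mat_def A_def)
    moreover have "skew_symmetric_mat A"
      unfolding skew_symmetric_mat_def
    proof (rule eq_matI)
      fix j k assume "j < dim_row (- A)" "k < dim_col (- A)"
      then have jk: "j < s" "k < s" by (auto simp: A_def)
      then have "N k j = - N j k" using Nsk[of k j] N0[of j] s by (cases "k = j") auto
      then show "transpose_mat A $$ (j, k) = (- A) $$ (j, k)" using jk by (simp add: A_def)
    qed (auto simp: A_def)
    moreover have "quartic_sign_mat (n - s) S" using N0 N4 by (auto simp: quartic_sign_mat_def S_def)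
    moreover have "symmetric_mat S"
      unfolding symmetric_mat_def
    proof (rule eq_matI)
      fix j k assume "j < dim_row S" "k < dim_col S"
      then have jk: "j < n - s" "k < n - s" by (auto simp: S_def)
      then have "N (k + s) (j + s) = N (j + s) (k + s)" using Nsk[of "k + s" "j + s"] by (cases "k = j") auto
      then show "transpose_mat S $$ (j, k) = S $$ (j, k)" using jk by (simp add: S_def)
    qed (auto simp: S_def)
    moreover have "B \<in> carrier_mat s (n - s)" by (simp add: B_def)
    moreover have "elements_mat B \<subseteq> fourth_roots" using N4 s by (auto simp: elements_mat_def B_def)
    moreover have "four_block_mat A B (transpose_mat B) S = Matrix.mat n n (\<lambda>(j, k). M $$ (\<sigma> j, \<sigma> k))"
    proof (rule eq_matI)
      fix j k assume "j < dim_row (Matrix.mat n n (\<lambda>(j, k). M $$ (\<sigma> j, \<sigma> k)))"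
        "k < dim_col (Matrix.mat n n (\<lambda>(j, k). M $$ (\<sigma> j, \<sigma> k)))"
      then have jk: "j < n" "k < n" by auto
      have "N k j = N j k" if "\<not> j < s" "k < s" using Nsk[of j k] jk that by auto
      then have "four_block_mat A B (transpose_mat B) S $$ (j, k) = N j k"
        using jk s by (auto simp: A_def B_def S_def)
      then show "four_block_mat A B (transpose_mat B) S $$ (j, k) = Matrix.mat n n (\<lambda>(j, k). M $$ (\<sigma> j, \<sigma> k)) $$ (j, k)"
        using jk by (simp add: N_def)
    qed (use s in \<open>auto simp: A_def S_def\<close>)
    then have "perm_conjugate n M (four_block_mat A B (transpose_mat B) S)"
      unfolding perm_conjugate_iff[OF Mc] using \<sigma>(1) by blast
    ultimately show "skew_symmetric_block_form n M"
      unfolding skew_symmetric_block_form_def using s by blast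
  }
qed

text \<open>Neighbours of \<open>j\<close> in the graph that joins two indices if \<open>M\<close>
  is not symmetric at this pair.\<close>

definition skew_nbrs :: "nat \<Rightarrow> complex mat \<Rightarrow> nat \<Rightarrow> nat set" where
  "skew_nbrs n M j = {k. k < n \<and> M $$ (j, k) \<noteq> M $$ (k, j)}"

lemma diag_mult_cnj:
  assumes M: "quartic_sign_mat n M" and j: "j < n"
    and pm: "\<And>k. k < n \<Longrightarrow> M $$ (j, k) = M $$ (k, j) \<or> M $$ (j, k) = - M $$ (k, j)"
  shows "(M * map_mat cnj M) $$ (j, j) = of_int (int n - 1 - 2 * int (card (skew_nbrs n M j)))"
proof -
  have Mc: "M \<in> carrier_mat n n" using M by (simp add: quartic_sign_mat_def)
  let ?K = "skew_nbrs n M j"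
  have fin: "finite ?K" and sub: "?K \<subseteq> {0..<n} - {j}" by (auto simp: skew_nbrs_def)
  have "(M * map_mat cnj M) $$ (j, j) = (\<Sum>k\<in>{0..<n}. M $$ (j, k) * cnj (M $$ (k, j)))"
    using Mc j by (simp add: scalar_prod_def)
  also have "\<dots> = (\<Sum>k\<in>{0..<n} - {j}. M $$ (j, k) * cnj (M $$ (k, j)))"
    using j M by (subst sum.remove[of _ j]) (auto simp: quartic_sign_mat_def)
  also have "\<dots> = (\<Sum>k\<in>{0..<n} - {j}. 1 - (if k \<in> ?K then 2 else 0))"
  proof (intro sum.cong refl)
    fix k assume "k \<in> {0..<n} - {j}"
    then have k: "k < n" "k \<noteq> j" by auto
    then have "M $$ (k, j) \<in> fourth_roots" using M j by (simp add: quartic_sign_mat_def)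
    \<comment> \<open>A root of unity differs from its negative, so no pair is symmetric and skew at
      once, and the product is 1 or -1 accordingly.\<close>
    then have "M $$ (k, j) * cnj (M $$ (k, j)) = 1" "M $$ (k, j) \<noteq> - M $$ (k, j)"
      by (auto simp: fourth_roots_def complex_eq_iff)
    then show "M $$ (j, k) * cnj (M $$ (k, j)) = 1 - (if k \<in> ?K then 2 else 0)"
      using pm[OF k(1)] k by (auto simp: skew_nbrs_def)
  qed
  also have "\<dots> = of_nat (card ({0..<n} - {j})) - (\<Sum>k\<in>{0..<n} - {j}. if k \<in> ?K then 2 else 0)"
    by (simp add: sum_subtractf)
  also have "(\<Sum>k\<in>{0..<n} - {j}. if k \<in> ?K then 2 else 0) = (\<Sum>k\<in>?K. (2 :: complex))"
    using sub by (intro sum.mono_neutral_cong_right) auto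
  finally show ?thesis using j by (simp add: of_nat_diff)
qed

lemma count_image_mset_set:
  "finite A \<Longrightarrow> count (image_mset f (mset_set A)) c = card {x \<in> A. f x = c}"
proof (induction A rule: finite_induct)
  case (insert x A)
  have "{y \<in> insert x A. f y = c} = (if f x = c then insert x {y \<in> A. f y = c} else {y \<in> A. f y = c})" by auto
  then show ?case using insert by auto
qed simp

theorem diagonal_condition_iff_skew_on:
  assumes M: "quartic_sign_mat n M" and n: "n > 0"
  shows "diagonal_condition n M \<longleftrightarrow> (\<exists>T. skew_on n T M)"
proof
  have Mc: "M \<in> carrier_mat n n" using M by (simp add: quartic_sign_mat_def)
  have dg: "mset (diag_mat (M * map_mat cnj M)) = image_mset (\<lambda>j. (M * map_mat cnj M) $$ (j, j)) (mset_set {..<n})"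
    using Mc by (simp add: diag_mat_def atLeast0LessThan)
  define F where "F j = int n - 1 - 2 * int (card (skew_nbrs n M j))" for j
  have fin: "finite (skew_nbrs n M j)" for j by (simp add: skew_nbrs_def)
  {
    assume "diagonal_condition n M"
    then obtain s where pm: "\<And>j k. j < n \<Longrightarrow> k < n \<Longrightarrow> M $$ (j, k) = M $$ (k, j) \<or> M $$ (j, k) = - M $$ (k, j)"
      and s: "1 \<le> s" "s \<le> n"
      and ms: "mset (diag_mat (M * map_mat cnj M)) =
        replicate_mset s (of_int (int n + 1 - 2 * int s)) + replicate_mset (n - s) (of_int (int n - 1))"
      unfolding diagonal_condition_def by blast
    have dF: "(M * map_mat cnj M) $$ (j, j) = of_int (F j)" if "j < n" for j
      unfolding F_def by (rule diag_mult_cnj[OF M that pm[OF that]])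
    have "image_mset (\<lambda>j. (M * map_mat cnj M) $$ (j, j)) (mset_set {..<n}) = image_mset (\<lambda>j. of_int (F j)) (mset_set {..<n})"
      by (intro image_mset_cong) (simp add: dF)
    then have im: "image_mset (\<lambda>j. of_int (F j) :: complex) (mset_set {..<n}) =
        replicate_mset s (of_int (int n + 1 - 2 * int s)) + replicate_mset (n - s) (of_int (int n - 1))"
      using ms dg by simp
    have vals: "card (skew_nbrs n M j) = s - 1 \<or> card (skew_nbrs n M j) = 0" if "j < n" for j
    proof -
      have "(of_int (F j) :: complex) \<in># image_mset (\<lambda>j. of_int (F j)) (mset_set {..<n})" using that by auto
      then have "(of_int (F j) :: complex) = of_int (int n + 1 - 2 * int s) \<or> (of_int (F j) :: complex) = of_int (int n - 1)"
        unfolding im by (auto simp del: of_int_diff of_int_add of_int_mult split: if_splits)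
      then show ?thesis using s unfolding of_int_eq_iff F_def by linarith
    qed
    define T where "T = {j. j < n \<and> card (skew_nbrs n M j) \<noteq> 0}"
    have sym: "k \<in> skew_nbrs n M j \<Longrightarrow> j < n \<Longrightarrow> j \<in> skew_nbrs n M k" for j k by (auto simp: skew_nbrs_def)
    \<comment> \<open>A neighbour of \<open>j\<close> has \<open>j\<close> as a neighbour and so
      lies in \<open>T\<close>; as the degree of \<open>j\<close> is
      \<open>s - 1 = card T - 1\<close>, all of \<open>T\<close> is adjacent to
      \<open>j\<close>.\<close>
    have full: "skew_nbrs n M j = T - {j}" if j: "j \<in> T" for j
    proof (rule card_subset_eq)
      show "finite (T - {j})" by (simp add: T_def)
      show "skew_nbrs n M j \<subseteq> T - {j}"
        using sym j fin by (auto simp: T_def skew_nbrs_def)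
      \<comment> \<open>A vertex with a neighbour rules out \<open>s = 1\<close>. Hence the two
        prescribed values differ, and the multiplicity of the first one in the multiset gives
        \<open>card T = s\<close>.\<close>
      have c: "card (skew_nbrs n M j) = s - 1" "s \<noteq> 1" using vals[of j] j by (auto simp: T_def)
      have "T = {i \<in> {..<n}. (of_int (F i) :: complex) = of_int (int n + 1 - 2 * int s)}"
        unfolding of_int_eq_iff F_def T_def using vals c(2) s by force
      then have "card T = count (image_mset (\<lambda>j. of_int (F j) :: complex) (mset_set {..<n})) (of_int (int n + 1 - 2 * int s))"
        by (simp only: count_image_mset_set[OF finite_lessThan])
      also have "\<dots> = s" unfolding im using c(2)
        by (simp del: of_int_diff of_int_add of_int_mult)
      finally show "card (skew_nbrs n M j) = card (T - {j})" using j c(1) by (simp add: T_def)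
    qed
    have "skew_on n T M"
      unfolding skew_on_def
    proof (intro allI impI)
      fix j k assume jk: "j < n" "k < n" "j \<noteq> k"
      show "M $$ (j, k) = (if j \<in> T \<and> k \<in> T then - M $$ (k, j) else M $$ (k, j))"
      proof (cases "j \<in> T \<and> k \<in> T")
        case True
        then have "k \<in> skew_nbrs n M j" using full jk by auto
        then show ?thesis using True pm[OF jk(1,2)] by (simp add: skew_nbrs_def)
      next
        case False
        then have "skew_nbrs n M j = {} \<or> skew_nbrs n M k = {}" using jk fin by (auto simp: T_def)
        then show ?thesis unfolding if_not_P[OF False] using jk by (auto simp: skew_nbrs_def)
      qed
    qed
    then show "\<exists>T. skew_on n T M" by blast
  next
    assume "\<exists>T. skew_on n T M"
    then obtain T where T: "skew_on n T M" "T \<subseteq> {..<n}" "T \<noteq> {}" using skew_on_nonempty[OF _ n] by metis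
    define s where "s = card T"
    have finT: "finite T" using T(2) finite_subset by blast
    have s: "1 \<le> s" "s \<le> n" using T finT card_mono[OF _ T(2)] by (auto simp: s_def Suc_le_eq card_gt_0_iff)
    have sk: "M $$ (j, k) = (if j \<in> T \<and> k \<in> T then - M $$ (k, j) else M $$ (k, j))" if "j < n" "k < n" "j \<noteq> k" for j k
      using T(1) that unfolding skew_on_def by blast
    have pm: "M $$ (j, k) = M $$ (k, j) \<or> M $$ (j, k) = - M $$ (k, j)" if "j < n" "k < n" for j k
      using sk[OF that] by (cases "j = k") (auto split: if_splits)
    have nz: "M $$ (k, j) \<noteq> - M $$ (k, j)" if "j < n" "k < n" "j \<noteq> k" for j k
    proof -
      have "M $$ (k, j) \<in> fourth_roots" using M that by (simp add: quartic_sign_mat_def)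
      then show ?thesis by (auto simp: fourth_roots_def complex_eq_iff)
    qed
    have nb: "skew_nbrs n M j = (if j \<in> T then T - {j} else {})" if j: "j < n" for j
    proof (intro Set.set_eqI)
      fix k
      show "k \<in> skew_nbrs n M j \<longleftrightarrow> k \<in> (if j \<in> T then T - {j} else {})"
      proof (cases "k < n \<and> j \<noteq> k")
        case True
        then show ?thesis using sk[of j k] nz[of j k] j by (auto simp: skew_nbrs_def)
      next
        case False
        then show ?thesis using T(2) by (auto simp: skew_nbrs_def)
      qed
    qed
    have dF: "(M * map_mat cnj M) $$ (j, j) = (if j \<in> T then of_int (int n + 1 - 2 * int s) else of_int (int n - 1))"
      if j: "j < n" for j
    proof -
      have "(M * map_mat cnj M) $$ (j, j) = of_int (F j)"
        unfolding F_def by (rule diag_mult_cnj[OF M j pm[OF j]])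
      also have "F j = (if j \<in> T then int n + 1 - 2 * int s else int n - 1)"
        using s finT by (auto simp: F_def nb[OF j] s_def of_nat_diff)
      finally show ?thesis by simp
    qed
    have "mset_set {..<n} = mset_set (T \<union> ({..<n} - T))" using T(2) by (intro arg_cong[of _ _ mset_set]) auto
    also have "\<dots> = mset_set T + mset_set ({..<n} - T)" using finT by (intro mset_set_Union) auto
    finally have "image_mset (\<lambda>j. (M * map_mat cnj M) $$ (j, j)) (mset_set {..<n}) =
        image_mset (\<lambda>j. (M * map_mat cnj M) $$ (j, j)) (mset_set T) +
        image_mset (\<lambda>j. (M * map_mat cnj M) $$ (j, j)) (mset_set ({..<n} - T))" by simp
    also have "image_mset (\<lambda>j. (M * map_mat cnj M) $$ (j, j)) (mset_set T) =
        image_mset (\<lambda>j. of_int (int n + 1 - 2 * int s)) (mset_set T)"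
      using T(2) finT by (intro image_mset_cong) (auto simp: dF subset_eq)
    also have "image_mset (\<lambda>j. (M * map_mat cnj M) $$ (j, j)) (mset_set ({..<n} - T)) =
        image_mset (\<lambda>j. of_int (int n - 1)) (mset_set ({..<n} - T))"
      by (intro image_mset_cong) (auto simp: dF)
    finally have "mset (diag_mat (M * map_mat cnj M)) =
          replicate_mset s (of_int (int n + 1 - 2 * int s)) + replicate_mset (n - s) (of_int (int n - 1))"
      unfolding dg image_mset_const_eq using card_Diff_subset[OF finT T(2)] by (simp add: s_def)
    then show "diagonal_condition n M" unfolding diagonal_condition_def using pm s by blast
  }
qed

theorem theorem3:
  fixes n :: nat and M :: "complex mat"
  assumes "n > 1" and "quartic_sign_mat n M"
  shows "(skew_symmetric_block_form n M \<longleftrightarrow> is_quartic_residue_mat n M) \<and>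
         (is_quartic_residue_mat n M \<longleftrightarrow> diagonal_condition n M)"
  using assms skew_symmetric_block_form_iff_skew_on[of n M] diagonal_condition_iff_skew_on[of n M]
    is_quartic_residue_mat_iff_skew_on[of n M] by simp

end
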